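(* Let $\lambda>0$, $0<\sigma<1$ and $u\in L_\sigma$. Define the kernel $$K_\sigma^\lambda(x,y)=\frac{1}{-\Gamma(-\sigma)}\int_0^\infty W_t^\lambda(x,y)\,\frac{dt}{t^{1+\sigma}},\quad x,y\in\mathbb{R}_+,\ x\neq y,$$ and the function $$B_\sigma^\lambda(x)=\frac{1}{\Gamma(-\sigma)}\int_0^\infty\big(W_t^\lambda1(x)-1\big)\frac{dt}{t^{1+\sigma}},\quad x\in\mathbb{R}_+.$$ Then both integrals are absolutely convergent, and there is a constant $C$ such that $$0\le K_\sigma^\lambda(x,y)\le\frac{C}{|x-y|^{1+2\sigma}},\ x\ne y,\qquad |B_\sigma^\lambda(x)|\le\frac{C}{x^{2\sigma}},\quad x,y\in\mathbb{R}_+.$$ Moreover: (1) Let $0<\sigma<1/2$ and $\lambda\ge1$. If $u\in C^\alpha_+$ with $0<2\sigma<\alpha<1$, or $u\in\mathrm{Lip}_+$ when $\alpha=1$, then $\Delta_\lambda^\sigma u$ is a continuous function on $\mathbb{R}_+$ given by $$\Delta_\lambda^\sigma u(x)=\int_0^\infty(u(x)-u(y))K_\sigma^\lambda(x,y)\,dy+u(x)B_\sigma^\lambda(x),\quad x\in\mathbb{R}_+,$$ where the integral is absolutely convergent. (2) Let $1/2\le\sigma<1$ and $\lambda\ge2$. If $u$ is continuous on $[0,\infty)$ and has a derivative $u'\in C^\alpha_+$ with $0\le2\sigma-1<\alpha<1$, or $u'\in\mathrm{Lip}_+$ when $\alpha=1$, then $\Delta_\lambda^\sigma u$ is a continuous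 function on $\mathbb{R}_+$ given by $$\Delta_\lambda^\sigma u(x)=\lim_{\varepsilon\to0^+}\int_{y\in(0,\infty),\,|x-y|>\varepsilon}(u(x)-u(y))K_\sigma^\lambda(x,y)\,dy+u(x)B_\sigma^\lambda(x),\quad x\in\mathbb{R}_+.$$
   Context: $\mathbb{R}_+=(0,\infty)$. For $0<\alpha<1$, $C^\alpha_+$ is the space of continuous functions $f$ on $\mathbb{R}_+$ with $\|f\|_{C^\alpha_+}=\sup_{x\ne y}\frac{|f(x)-f(y)|}{|x-y|^\alpha}+\sup_{x>0}x^{-\alpha}|f(x)|<\infty$; $\mathrm{Lip}_+$ is the space defined in the same way with $\alpha=1$. For $\rho>0$, $L_\rho=\{f:\mathbb{R}_+\to\mathbb{R}:\ \int_0^\infty|f(x)|(1+x)^{-1-2\rho}\,dx<\infty\}$. Bessel heat kernel: $W_t^\lambda(x,y)=\frac{\sqrt{xy}}{2t}I_{\lambda-1/2}(\frac{xy}{2t})e^{-(x^2+y^2)/(4t)}$, $x,y,t>0$, with $I_\nu$ the modified Bessel function of the first kind; $W_t^\lambda1(x)=\int_0^\infty W_t^\lambda(x,y)\,dy$. Fractional Bessel operator ($\Delta_\lambda=-\frac{d^2}{dx^2}+\frac{\lambda(\lambda-1)}{x^2}$): the Hankel transform is $h_\lambda \phi(x)=\int_0^\infty\sqrt{xy}\,J_{\lambda-1/2}(xy)\phi(y)\,dy$, with $J_\nu$ the Bessel function. $\mathcal{S}_\lambda$ is the Fréchet space of smooth functions $\phi$ on $\mathbb{R}_+$ with $\sup_{x>0}(1+x)^m|(\frac1x\frac{d}{dx})^k(x^{-\lambda}\phi(x))|<\infty$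 for all integers $m,k\ge0$; $\mathcal{S}_\lambda'$ is its dual. For $\phi\in\mathcal{S}_\lambda$, $\Delta_\lambda^\sigma\phi=h_\lambda(y^{2\sigma}h_\lambda\phi)$. For $u\in L_\sigma$ (with $\lambda\ge1$ if $\sigma<1/2$, $\lambda\ge2$ if $\sigma\ge1/2$), $\Delta_\lambda^\sigma u\in\mathcal{S}_\lambda'$ is defined by transposition, $(\Delta_\lambda^\sigma u)(\phi)=\int_0^\infty u\,\Delta_\lambda^\sigma\phi\,dx$; it is identified with a function $g$ when $(\Delta_\lambda^\sigma u)(\phi)=\int_0^\infty g\phi\,dx$ for all $\phi\in\mathcal{S}_\lambda$. *)

theory Defs
  imports "HOL-Analysis.Analysis"
begin

text \<open>
  Functions on \<open>(0,\<infinity>)\<close> are total functions on the reals; only their values on \<open>{0<..}\<close> are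
  ever used. The parameter \<open>lam\<close> is the \<open>\<lambda>\<close> of the Bessel operator
  \<open>- d\<^sup>2/dx\<^sup>2 + \<lambda>(\<lambda> - 1)/x\<^sup>2\<close>.
\<close>

subsection \<open>Function spaces\<close>

text \<open>\<open>holder_plus \<alpha>\<close> is \<open>C\<^sup>\<alpha>\<close> on the half-line for \<open>0 < \<alpha> < 1\<close>, and the space of Lipschitz
  functions \<open>Lip\<close> for \<open>\<alpha> = 1\<close>; the norm is finite iff both suprema are.\<close>

definition holder_plus :: "real \<Rightarrow> (real \<Rightarrow> real) set" where
  "holder_plus \<alpha> = {f. continuous_on {0<..} f
     \<and> bdd_above {\<bar>f x - f y\<bar> / \<bar>x - y\<bar> powr \<alpha> | x y. 0 < x \<and> 0 < y \<and> x \<noteq> y}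
     \<and> bdd_above {x powr (- \<alpha>) * \<bar>f x\<bar> | x. 0 < x}}"

definition L_space :: "real \<Rightarrow> (real \<Rightarrow> real) set" where
  "L_space \<rho> = {f. f \<in> borel_measurable (lebesgue_on {0<..})
     \<and> set_integrable lebesgue {0<..} (\<lambda>x. \<bar>f x\<bar> * (1 + x) powr (- 1 - 2 * \<rho>))}"

subsection \<open>Bessel functions and the Bessel heat kernel\<close>

text \<open>For arguments \<open>z > 0\<close> and orders \<open>\<nu> > - 1\<close>.\<close>

definition bessel_J :: "real \<Rightarrow> real \<Rightarrow> real" where
  "bessel_J \<nu> z = (\<Sum>k. (- 1) ^ k / (fact k * Gamma (real k + \<nu> + 1)) * (z / 2) powr (2 * real k + \<nu>))"

definition bessel_I :: "real \<Rightarrow> real \<Rightarrow> real" where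
  "bessel_I \<nu> z = (\<Sum>k. 1 / (fact k * Gamma (real k + \<nu> + 1)) * (z / 2) powr (2 * real k + \<nu>))"

definition heat_kernel :: "real \<Rightarrow> real \<Rightarrow> real \<Rightarrow> real \<Rightarrow> real" where
  "heat_kernel lam t x y =
     sqrt (x * y) / (2 * t) * bessel_I (lam - 1/2) (x * y / (2 * t)) * exp (- (x\<^sup>2 + y\<^sup>2) / (4 * t))"

definition heat_one :: "real \<Rightarrow> real \<Rightarrow> real \<Rightarrow> real" where
  "heat_one lam t x = (LINT y:{0<..}|lebesgue. heat_kernel lam t x y)"

definition K_integrand :: "real \<Rightarrow> real \<Rightarrow> real \<Rightarrow> real \<Rightarrow> real \<Rightarrow> real" where
  "K_integrand lam \<sigma> x y t = heat_kernel lam t x y / t powr (1 + \<sigma>)"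

definition K_kernel :: "real \<Rightarrow> real \<Rightarrow> real \<Rightarrow> real \<Rightarrow> real" where
  "K_kernel lam \<sigma> x y = 1 / (- Gamma (- \<sigma>)) * (LINT t:{0<..}|lebesgue. K_integrand lam \<sigma> x y t)"

definition B_integrand :: "real \<Rightarrow> real \<Rightarrow> real \<Rightarrow> real \<Rightarrow> real" where
  "B_integrand lam \<sigma> x t = (heat_one lam t x - 1) / t powr (1 + \<sigma>)"

definition B_fun :: "real \<Rightarrow> real \<Rightarrow> real \<Rightarrow> real" where
  "B_fun lam \<sigma> x = 1 / Gamma (- \<sigma>) * (LINT t:{0<..}|lebesgue. B_integrand lam \<sigma> x t)"

subsection \<open>The test space and its dual\<close>

definition smooth_plus :: "(real \<Rightarrow> real) \<Rightarrow> bool" where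
  "smooth_plus \<phi> \<longleftrightarrow> (\<forall>k. \<forall>x>0. ((deriv ^^ k) \<phi>) field_differentiable (at x))"

definition test_weight :: "real \<Rightarrow> nat \<Rightarrow> nat \<Rightarrow> (real \<Rightarrow> real) \<Rightarrow> real \<Rightarrow> real" where
  "test_weight lam m k \<phi> x =
     (1 + x) ^ m * \<bar>((\<lambda>f z. 1 / z * deriv f z) ^^ k) (\<lambda>z. z powr (- lam) * \<phi> z) x\<bar>"

definition test_space :: "real \<Rightarrow> (real \<Rightarrow> real) set" where
  "test_space lam = {\<phi>. smooth_plus \<phi> \<and> (\<forall>m k. bdd_above (test_weight lam m k \<phi> ` {0<..}))}"

definition test_seminorm :: "real \<Rightarrow> nat \<Rightarrow> nat \<Rightarrow> (real \<Rightarrow> real) \<Rightarrow> real" where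
  "test_seminorm lam m k \<phi> = (SUP x\<in>{0<..}. test_weight lam m k \<phi> x)"

text \<open>Continuity of a linear functional for the topology generated by the seminorms, i.e. domination
  by finitely many of them.\<close>

definition test_dual :: "real \<Rightarrow> ((real \<Rightarrow> real) \<Rightarrow> real) set" where
  "test_dual lam = {T.
     (\<forall>\<phi>\<in>test_space lam. \<forall>\<psi>\<in>test_space lam. \<forall>a b.
        T (\<lambda>x. a * \<phi> x + b * \<psi> x) = a * T \<phi> + b * T \<psi>)
     \<and> (\<exists>C M. \<forall>\<phi>\<in>test_space lam. \<bar>T \<phi>\<bar> \<le> C * (\<Sum>m\<le>M. \<Sum>k\<le>M. test_seminorm lam m k \<phi>))}"

text \<open>Identification of an element of the dual with a function.\<close>

definition dual_is_function :: "real \<Rightarrow> ((real \<Rightarrow> real) \<Rightarrow> real) \<Rightarrow> (real \<Rightarrow> real) \<Rightarrow> bool" where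
  "dual_is_function lam T g \<longleftrightarrow> T \<in> test_dual lam \<and>
     (\<forall>\<phi>\<in>test_space lam. set_integrable lebesgue {0<..} (\<lambda>x. g x * \<phi> x)
        \<and> T \<phi> = (LINT x:{0<..}|lebesgue. g x * \<phi> x))"

subsection \<open>The fractional Bessel operator\<close>

definition hankel :: "real \<Rightarrow> (real \<Rightarrow> real) \<Rightarrow> real \<Rightarrow> real" where
  "hankel lam \<phi> x = (LINT y:{0<..}|lebesgue. sqrt (x * y) * bessel_J (lam - 1/2) (x * y) * \<phi> y)"

definition frac_bessel_test :: "real \<Rightarrow> real \<Rightarrow> (real \<Rightarrow> real) \<Rightarrow> real \<Rightarrow> real" where
  "frac_bessel_test lam \<sigma> \<phi> = hankel lam (\<lambda>y. y powr (2 * \<sigma>) * hankel lam \<phi> y)"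

definition frac_bessel :: "real \<Rightarrow> real \<Rightarrow> (real \<Rightarrow> real) \<Rightarrow> (real \<Rightarrow> real) \<Rightarrow> real" where
  "frac_bessel lam \<sigma> u \<phi> = (LINT x:{0<..}|lebesgue. u x * frac_bessel_test lam \<sigma> \<phi> x)"

text \<open>\<open>g\<close> is the function with which the transposed operator applied to \<open>u\<close> is identified. The
  integrability clause says that the integral in \<open>frac_bessel\<close> is a genuine one, not the
  default value \<open>0\<close> of a divergent Lebesgue integral.\<close>

definition frac_bessel_is_function :: "real \<Rightarrow> real \<Rightarrow> (real \<Rightarrow> real) \<Rightarrow> (real \<Rightarrow> real) \<Rightarrow> bool" where
  "frac_bessel_is_function lam \<sigma> u g \<longleftrightarrow>
     (\<forall>\<phi>\<in>test_space lam.
        set_integrable lebesgue {0<..} (\<lambda>x. u x * frac_bessel_test lam \<sigma> \<phi> x))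
     \<and> dual_is_function lam (frac_bessel lam \<sigma> u) g"

end

theory Submission
  imports Defs "HOL-Probability.Distributions"
begin

text \<open>
  The Bessel heat kernel is bounded by a constant times an algebraic majorant of the Gaussian kernel
  \<open>G\<close>, and deviates from it by at most a multiple of \<open>(t + \<bar>x - y\<bar>\<^sup>2) / x\<^sup>2\<close> times that majorant; integrating
  in \<open>t\<close> gives the bounds on \<open>K\<close> and \<open>B\<close>. By Weber's second exponential integral, the heat
  semigroup \<open>W\<^sub>t\<close> acts on the Hankel side as multiplication by \<open>exp (- t y\<^sup>2)\<close>, so subordination,
  \<open>y powr (2 * \<sigma>) = 1 / Gamma (- \<sigma>) * \<integral> (exp (- t y\<^sup>2) - 1) / t powr (1 + \<sigma>) dt\<close>, expresses
  \<open>\<Delta>\<^sup>\<sigma>\<close> on test functions through \<open>W\<^sub>t \<phi> - \<phi>\<close>. The kernel is symmetric, so by Fubini \<open>\<Delta>\<^sup>\<sigma> u\<close> is the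
  function \<open>1 / Gamma (- \<sigma>) * \<integral> (W\<^sub>t u - u) / t powr (1 + \<sigma>) dt\<close> as soon as \<open>W\<^sub>t u - u\<close> is
  \<open>O(t powr \<beta>)\<close> for small \<open>t\<close> with some \<open>\<beta> > \<sigma>\<close>. Hoelder regularity of \<open>u\<close> gives \<open>\<beta> = \<alpha> / 2\<close>; for
  \<open>u'\<close> it gives \<open>\<beta> = (1 + \<alpha>) / 2\<close>, because the first-order Taylor term meets only the deviation of the
  kernel from \<open>G\<close>, even after truncation to \<open>\<bar>x - y\<bar> > \<epsilon>\<close>. Splitting
  \<open>W\<^sub>t u(x) - u(x) = W\<^sub>t (u - u(x))(x) + u(x) (W\<^sub>t 1(x) - 1)\<close> and exchanging the integrals yields the formulas.
\<close>

subsection \<open>Lebesgue measure on the half-line\<close>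

text \<open>Hankel inversion is not proved separately: it is the limit t -> 0 of Weber's identity,
  where the kernel side tends to the identity and the spectral side converges by domination. That
  limit uses test functions that are Lipschitz up to the origin, which is where \<lambda> >= 1
  enters; \<lambda> >= 2 enters in absorbing a singularity x^(-(1+\<alpha>)) at the origin by test
  functions of size x^\<lambda>.

  Two obstacles shape the estimates. A function of L_\<sigma> offers only integrability against
  (1+x)^(-1-2\<sigma>), so for a test function the time integral of its semigroup difference must be
  bounded by this very weight times finitely many seminorms. And the kernel bounds must survive
  translation, truncation and integration in t; for the algebraic majorant, of order h^(-6) at
  infinity, each of these is an elementary inequality between powers.

  For \<sigma> >= 1/2 the double integral in y and t need not converge absolutely. The order is
  therefore exchanged only for |x-y| > \<epsilon>, and \<epsilon> -> 0 is taken inside the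
  t-integral, with a bound on the signed y-integral that is uniform in \<epsilon>.\<close>

definition halfline :: "real measure" where
  "halfline = restrict_space lborel {0<..}"

lemma space_halfline [simp]: "space halfline = {0<..}"
  by (simp add: halfline_def space_restrict_space)

lemma measurable_halfline_ident [measurable (raw)]: "(\<lambda>x. x) \<in> borel_measurable halfline"
  unfolding halfline_def by (rule measurable_restrict_space1) simp

lemma measurable_halfline_fst [measurable (raw)]: "fst \<in> borel_measurable (halfline \<Otimes>\<^sub>M N)"
  by (rule measurable_compose[OF measurable_fst measurable_halfline_ident])

lemma measurable_halfline_snd [measurable (raw)]: "snd \<in> borel_measurable (N \<Otimes>\<^sub>M halfline)"
  by (rule measurable_compose[OF measurable_snd measurable_halfline_ident])

lemma borel_measurable_halflineI: "f \<in> borel_measurable borel \<Longrightarrow> f \<in> borel_measurable halfline"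
  unfolding halfline_def by (rule measurable_restrict_space1) simp

lemma continuous_on_imp_measurable_halfline:
  "continuous_on {0<..} f \<Longrightarrow> f \<in> borel_measurable halfline"
  for f :: "real \<Rightarrow> real"
  unfolding halfline_def
  by (subst measurable_cong_sets[OF sets_restrict_space_cong[OF sets_lborel] refl])
    (rule borel_measurable_continuous_on_restrict)

interpretation halfline: sigma_finite_measure halfline
  unfolding halfline_def
  by (rule sigma_finite_measure_restrict_space) (auto intro: sigma_finite_lborel)

interpretation halfline_pair: pair_sigma_finite halfline halfline ..

interpretation halfline_lborel: pair_sigma_finite halfline lborel ..

lemma nn_integral_halfline:
  "(\<integral>\<^sup>+x. f x \<partial>halfline) = (\<integral>\<^sup>+x. f x * indicator {0<..} x \<partial>lborel)"
  unfolding halfline_def by (rule nn_integral_restrict_space) simp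

lemma borel_measurable_halfline_iff:
  "f \<in> borel_measurable halfline \<longleftrightarrow> (\<lambda>x. indicator {0<..} x *\<^sub>R f x) \<in> borel_measurable borel"
  for f :: "real \<Rightarrow> real"
  unfolding halfline_def by (subst borel_measurable_restrict_space_iff) simp_all

text \<open>The definitions integrate over completed Lebesgue measure, whereas products and Fubini
  are carried out with a Borel measure on the half-line. Borel measurability, checked for each
  integrand below, lets statements pass between the two.\<close>

lemma set_integrable_halfline:
  fixes f :: "real \<Rightarrow> real"
  assumes "f \<in> borel_measurable halfline"
  shows "set_integrable lebesgue {0<..} f \<longleftrightarrow> integrable halfline f"
proof -
  have "integrable halfline f \<longleftrightarrow> integrable lborel (\<lambda>x. indicator {0<..} x *\<^sub>R f x)"
    unfolding halfline_def by (rule integrable_restrict_space) simp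
  also have "\<dots> \<longleftrightarrow> set_integrable lebesgue {0<..} f"
    unfolding set_integrable_def
    using assms by (subst integrable_completion) (auto simp: borel_measurable_halfline_iff)
  finally show ?thesis ..
qed

lemma set_lebesgue_integral_halfline:
  fixes f :: "real \<Rightarrow> real"
  assumes "f \<in> borel_measurable halfline"
  shows "(LINT x:{0<..}|lebesgue. f x) = integral\<^sup>L halfline f"
proof -
  have "integral\<^sup>L halfline f = integral\<^sup>L lborel (\<lambda>x. indicator {0<..} x *\<^sub>R f x)"
    unfolding halfline_def by (rule integral_restrict_space) simp
  also have "\<dots> = (LINT x:{0<..}|lebesgue. f x)"
    unfolding set_lebesgue_integral_def
    using assms by (subst integral_completion) (auto simp: borel_measurable_halfline_iff)
  finally show ?thesis ..
qed

text \<open>Tonelli bounds the double integral of the modulus by the integral of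
  \<open>\<bar>b\<bar>\<close>, so a single pointwise majorant of the inner integral delivers joint
  integrability, both iterated integrals and their equality at once. Every exchange of two Bochner
  integrals below goes through this lemma.\<close>

lemma (in pair_sigma_finite) Fubini_bounded:
  fixes F :: "'a \<Rightarrow> 'b \<Rightarrow> real"
  assumes [measurable]: "case_prod F \<in> borel_measurable (M1 \<Otimes>\<^sub>M M2)"
    and bound: "\<And>x. x \<in> space M1 \<Longrightarrow> (\<integral>\<^sup>+y. ennreal \<bar>F x y\<bar> \<partial>M2) \<le> ennreal (b x)"
    and b: "integrable M1 b"
  shows "integrable (M1 \<Otimes>\<^sub>M M2) (case_prod F)"
    and "integrable M1 (\<lambda>x. \<integral>y. F x y \<partial>M2)"
    and "integrable M2 (\<lambda>y. \<integral>x. F x y \<partial>M1)"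
    and "(\<integral>x. \<integral>y. F x y \<partial>M2 \<partial>M1) = (\<integral>y. \<integral>x. F x y \<partial>M1 \<partial>M2)"
proof -
  have "(\<integral>\<^sup>+z. ennreal (norm (case_prod F z)) \<partial>(M1 \<Otimes>\<^sub>M M2)) = (\<integral>\<^sup>+x. \<integral>\<^sup>+y. ennreal \<bar>F x y\<bar> \<partial>M2 \<partial>M1)"
    by (subst M2.nn_integral_fst[symmetric]) auto
  also have "\<dots> \<le> (\<integral>\<^sup>+x. ennreal \<bar>b x\<bar> \<partial>M1)"
    by (intro nn_integral_mono order_trans[OF bound]) (auto intro: ennreal_leI)
  also have "\<dots> < \<infinity>"
    using b by (simp add: integrable_iff_bounded)
  finally show int: "integrable (M1 \<Otimes>\<^sub>M M2) (case_prod F)"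
    by (intro integrableI_bounded) simp_all
  show "integrable M1 (\<lambda>x. \<integral>y. F x y \<partial>M2)" by (rule integrable_fst[OF int])
  show "integrable M2 (\<lambda>y. \<integral>x. F x y \<partial>M1)" by (rule integrable_snd[OF int])
  show "(\<integral>x. \<integral>y. F x y \<partial>M2 \<partial>M1) = (\<integral>y. \<integral>x. F x y \<partial>M1 \<partial>M2)"
    by (rule Fubini_integral[OF int, symmetric])
qed

section \<open>Integrals of powers over the half-line\<close>

lemma nn_integral_halfline_powr_0:
  assumes "p > -1" "d > 0"
  shows "(\<integral>\<^sup>+t. ennreal (t powr p) * indicator {..d} t \<partial>halfline) = ennreal (d powr (p + 1) / (p + 1))"
proof -
  have "(\<integral>\<^sup>+t. ennreal (t powr p) * indicator {..d} t \<partial>halfline)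
      = (\<integral>\<^sup>+t. ennreal (indicator {0..d} t * t powr p) \<partial>lborel)"
    unfolding nn_integral_halfline
    by (intro nn_integral_cong) (auto simp: indicator_def)
  also have "\<dots> = ennreal (d powr (p + 1) / (p + 1))"
    using has_integral_powr_from_0[of p d] assms
    by (intro nn_integral_has_integral_lebesgue) auto
  finally show ?thesis .
qed

lemma nn_integral_halfline_powr_inf:
  assumes "p < -1" "d > 0"
  shows "(\<integral>\<^sup>+t. ennreal (t powr p) * indicator {d<..} t \<partial>halfline) = ennreal (- (d powr (p + 1)) / (p + 1))"
proof -
  have "(\<integral>\<^sup>+t. ennreal (t powr p) * indicator {d<..} t \<partial>halfline)
      = (\<integral>\<^sup>+t. ennreal (indicator {d..} t * t powr p) \<partial>lborel)"
    unfolding nn_integral_halfline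
  proof (rule nn_integral_cong_AE)
    show "AE x in lborel. ennreal (x powr p) * indicator {d<..} x * indicator {0<..} x
        = ennreal (indicator {d..} x * x powr p)"
      using AE_lborel_singleton[of d]
    proof eventually_elim
      case (elim x)
      then show ?case using assms(2) by (auto simp: indicator_def)
    qed
  qed
  also have "\<dots> = ennreal (- (d powr (p + 1)) / (p + 1))"
    using has_integral_powr_to_inf[of p d] assms
    by (intro nn_integral_has_integral_lebesgue) auto
  finally show ?thesis .
qed

text \<open>The common shape of the majorants below: a power integrable at zero up to
  \<open>d\<close>, a power integrable at infinity beyond it. In scale-invariant estimates
  \<open>d\<close> is the point where two bounds balance, so that both pieces contribute the same
  power of the scale.\<close>

lemma nn_integral_halfline_two_powers:
  assumes "p > -1" "q > 1" "d > 0" "0 \<le> A" "0 \<le> B"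
  shows "(\<integral>\<^sup>+t. ennreal (if t \<le> d then A * t powr p else B * t powr (- q)) \<partial>halfline)
       = ennreal (A * d powr (p + 1) / (p + 1) + B * d powr (1 - q) / (q - 1))"
proof -
  have "(\<integral>\<^sup>+t. ennreal (if t \<le> d then A * t powr p else B * t powr (- q)) \<partial>halfline)
    = (\<integral>\<^sup>+t. ennreal A * (ennreal (t powr p) * indicator {..d} t)
        + ennreal B * (ennreal (t powr (- q)) * indicator {d<..} t) \<partial>halfline)"
    using assms by (intro nn_integral_cong) (auto simp: ennreal_mult)
  also have "\<dots> = ennreal A * ennreal (d powr (p + 1) / (p + 1))
      + ennreal B * ennreal (- (d powr (- q + 1)) / (- q + 1))"
    using assms nn_integral_halfline_powr_inf[of "-q" d] nn_integral_halfline_powr_0[of p d]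
    by (simp add: nn_integral_add nn_integral_cmult)
  also have "- (d powr (- q + 1)) / (- q + 1) = d powr (1 - q) / (q - 1)"
    using assms by (simp add: field_simps)
  also have "ennreal A * ennreal (d powr (p + 1) / (p + 1)) + ennreal B * ennreal (d powr (1 - q) / (q - 1))
    = ennreal (A * d powr (p + 1) / (p + 1) + B * d powr (1 - q) / (q - 1))"
    using assms by (simp add: ennreal_mult[symmetric] ennreal_plus[symmetric] del: ennreal_plus)
  finally show ?thesis .
qed

lemma integrable_halfline_two_powers:
  assumes "p > -1" "q > 1" "d > 0"
  shows "integrable halfline (\<lambda>t. if t \<le> d then A * t powr p else B * t powr (- q))"
proof (rule Bochner_Integration.integrable_bound)
  show "integrable halfline (\<lambda>t. if t \<le> d then \<bar>A\<bar> * t powr p else \<bar>B\<bar> * t powr (- q))"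
  proof (rule integrableI_bounded)
    have "(\<integral>\<^sup>+t. ennreal (norm (if t \<le> d then \<bar>A\<bar> * t powr p else \<bar>B\<bar> * t powr (- q))) \<partial>halfline)
      = (\<integral>\<^sup>+t. ennreal (if t \<le> d then \<bar>A\<bar> * t powr p else \<bar>B\<bar> * t powr (- q)) \<partial>halfline)"
      by (intro nn_integral_cong) auto
    then show "(\<integral>\<^sup>+t. ennreal (norm (if t \<le> d then \<bar>A\<bar> * t powr p else \<bar>B\<bar> * t powr (- q))) \<partial>halfline) < \<infinity>"
      using nn_integral_halfline_two_powers[of p q d "\<bar>A\<bar>" "\<bar>B\<bar>"] assms by simp
  qed measurable
qed (auto simp: abs_mult)

subsection \<open>Bessel functions\<close>

text \<open>This is the hypergeometric limit function 0F1(; \<mu>; v) / Gamma(\<mu>), entire in v.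
  It is the common part of both Bessel functions of order \<mu> - 1: once the factor (z/2)^(\<mu>-1)
  is removed, I is its value at z^2/4 and J its value at -z^2/4.\<close>

definition bes :: "real \<Rightarrow> real \<Rightarrow> real" where
  "bes \<mu> v = (\<Sum>k. inverse (fact k * Gamma (real k + \<mu>)) * v ^ k)"

text \<open>In the Pochhammer product relating the two Gamma values only the first factor can lie
  below one, and it is at least 1/2; hence the factor 2.\<close>

lemma inverse_Gamma_le:
  assumes "\<mu> \<ge> 1/2"
  shows "inverse (Gamma (real k + \<mu>)) \<le> 2 / Gamma \<mu>"
proof -
  have G: "Gamma \<mu> > 0" using assms by simp
  have "pochhammer \<mu> k \<ge> 1/2"
  proof (cases k)
    case (Suc n)
    have "1 \<le> (\<Prod>i<n. \<mu> + real (Suc i))"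
      using assms by (intro prod_ge_1) auto
    then have "1/2 * 1 \<le> \<mu> * (\<Prod>i<n. \<mu> + real (Suc i))"
      using assms by (intro mult_mono) auto
    then show ?thesis
      unfolding Suc pochhammer_prod atLeast0LessThan prod.lessThan_Suc_shift by simp
  qed simp
  moreover have "Gamma (real k + \<mu>) = Gamma \<mu> * pochhammer \<mu> k"
  proof -
    have "\<mu> \<notin> \<int>\<^sub>\<le>\<^sub>0" using assms nonpos_Ints_nonpos[of \<mu>] by fastforce
    then show ?thesis using pochhammer_Gamma[of \<mu> k] G by (simp add: add.commute)
  qed
  ultimately have "Gamma \<mu> * (1/2) \<le> Gamma (real k + \<mu>)"
    using G by (simp add: mult_left_mono)
  then have "inverse (Gamma (real k + \<mu>)) \<le> inverse (Gamma \<mu> * (1/2))"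
    using G by (intro le_imp_inverse_le) auto
  then show ?thesis by (simp add: field_simps)
qed

lemma Gamma_shift_pos: "\<mu> > 0 \<Longrightarrow> Gamma (real k + \<mu>) > 0"
  by (intro Gamma_real_pos) simp

lemma summable_bes:
  assumes "\<mu> \<ge> 1/2"
  shows "summable (\<lambda>k. inverse (fact k * Gamma (real k + \<mu>)) * (v::real) ^ k)"
proof (rule summable_comparison_test)
  show "summable (\<lambda>k. 2 / Gamma \<mu> * (inverse (fact k) * \<bar>v\<bar> ^ k))"
    by (intro summable_mult summable_exp)
  have "norm (inverse (fact k * Gamma (real k + \<mu>)) * v ^ k) \<le> 2 / Gamma \<mu> * (inverse (fact k) * \<bar>v\<bar> ^ k)" for k
  proof -
    have "norm (inverse (fact k * Gamma (real k + \<mu>)) * v ^ k)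
        = inverse (Gamma (real k + \<mu>)) * (inverse (fact k) * \<bar>v\<bar> ^ k)"
      using Gamma_shift_pos[of \<mu> k] assms by (simp add: abs_mult power_abs)
    also have "\<dots> \<le> 2 / Gamma \<mu> * (inverse (fact k) * \<bar>v\<bar> ^ k)"
      by (intro mult_right_mono inverse_Gamma_le assms) auto
    finally show ?thesis .
  qed
  then show "\<exists>N. \<forall>n\<ge>N. norm (inverse (fact n * Gamma (real n + \<mu>)) * v ^ n)
      \<le> 2 / Gamma \<mu> * (inverse (fact n) * \<bar>v\<bar> ^ n)" by blast
qed

lemma bes_sums:
  "\<mu> \<ge> 1/2 \<Longrightarrow> (\<lambda>k. inverse (fact k * Gamma (real k + \<mu>)) * v ^ k) sums bes \<mu> v"
  unfolding bes_def by (intro summable_sums summable_bes)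

lemma bes_0: "bes \<mu> 0 = inverse (Gamma \<mu>)"
  unfolding bes_def by (subst powser_zero) simp

lemma bes_has_derivative:
  assumes "\<mu> \<ge> 1/2"
  shows "(bes \<mu> has_real_derivative bes (\<mu> + 1) v) (at v)"
proof -
  define c where "c k = inverse (fact k * Gamma (real k + \<mu>))" for k
  have "((\<lambda>x. \<Sum>n. c n * x ^ n) has_field_derivative (\<Sum>n. diffs c n * v ^ n)) (at v)"
    unfolding c_def by (intro termdiffs_strong_converges_everywhere summable_bes assms)
  moreover have "diffs c n = inverse (fact n * Gamma (real n + (\<mu> + 1)))" for n
  proof -
    have eq: "real (Suc n) + \<mu> = real n + (\<mu> + 1)" by simp
    show ?thesis
      unfolding diffs_def c_def eq by (simp del: of_nat_Suc)
  qed
  ultimately show ?thesis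
    unfolding bes_def[abs_def] c_def by simp
qed

lemma continuous_bes: "\<mu> \<ge> 1/2 \<Longrightarrow> continuous_on A (bes \<mu>)"
  by (intro continuous_at_imp_continuous_on ballI DERIV_isCont[OF bes_has_derivative])

lemma bes_measurable [measurable]: "bes \<mu> \<in> borel_measurable borel"
  unfolding bes_def[abs_def] by measurable

text \<open>The k-th coefficient of \<open>bes \<mu>\<close> is k + \<mu> times that of
  \<open>bes (\<mu> + 1)\<close>. The part \<mu> gives the first summand, and the part k, after an
  index shift, the second. As differentiation raises the order by one, this is the Bessel equation b
  = \<mu> b' + v b''.\<close>

lemma bes_recurrence:
  assumes "\<mu> \<ge> 1/2"
  shows "bes \<mu> v = \<mu> * bes (\<mu> + 1) v + v * bes (\<mu> + 2) v"
proof -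
  define f where "f k = inverse (fact k * Gamma (real k + (\<mu> + 2))) * v ^ k" for k
  define g where "g k = real k * (inverse (fact k * Gamma (real k + (\<mu> + 1))) * v ^ k)" for k
  have "f sums bes (\<mu> + 2) v"
    unfolding f_def using assms by (intro bes_sums) auto
  then have "(\<lambda>k. v * f k) sums (v * bes (\<mu> + 2) v)"
    by (rule sums_mult)
  moreover have "v * f k = g (Suc k)" for k
  proof -
    have eq: "real (Suc k) + (\<mu> + 1) = real k + (\<mu> + 2)" by simp
    show ?thesis
      unfolding f_def g_def eq by (simp del: of_nat_Suc)
  qed
  ultimately have "(\<lambda>k. g (Suc k)) sums (v * bes (\<mu> + 2) v)" by simp
  then have "g sums (v * bes (\<mu> + 2) v)"
    by (subst (asm) sums_Suc_iff) (simp add: g_def)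
  then have "(\<lambda>k. \<mu> * (inverse (fact k * Gamma (real k + (\<mu> + 1))) * v ^ k) + g k)
      sums (\<mu> * bes (\<mu> + 1) v + v * bes (\<mu> + 2) v)"
    using assms by (intro sums_add sums_mult bes_sums) auto
  moreover have "\<mu> * (inverse (fact k * Gamma (real k + (\<mu> + 1))) * v ^ k) + g k
      = inverse (fact k * Gamma (real k + \<mu>)) * v ^ k" for k
  proof -
    define X G f w where "X = real k + \<mu>" and "G = Gamma (real k + \<mu>)" and "f = (fact k :: real)" and "w = v ^ k"
    have pos: "X > 0" "G > 0" "f > 0"
      using assms by (auto simp: X_def G_def f_def intro!: Gamma_shift_pos)
    have "X \<notin> \<int>\<^sub>\<le>\<^sub>0"
      using pos(1) by (intro notI) (drule nonpos_Ints_nonpos, simp)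
    from Gamma_plus1[OF this] have "Gamma (real k + (\<mu> + 1)) = X * G"
      by (simp add: X_def G_def add.assoc)
    then have "\<mu> * (inverse (fact k * Gamma (real k + (\<mu> + 1))) * v ^ k) + g k = X * (inverse (f * (X * G)) * w)"
      unfolding g_def f_def w_def X_def by (simp only: distrib_right add.commute)
    also have "\<dots> = inverse (f * G) * w"
      using pos by simp
    finally show ?thesis
      by (simp only: f_def G_def w_def)
  qed
  ultimately show ?thesis
    using bes_sums[OF assms, of v] by (simp add: sums_unique2)
qed

text \<open>The energy \<open>b\<^sub>0\<^sup>2 + v b\<^sub>1\<^sup>2\<close> with \<open>b\<^sub>i = bes (\<mu> + i) (- v)\<close> is nonincreasing.\<close>

lemma abs_bes_le:
  assumes "\<mu> \<ge> 1/2" "v \<ge> 0"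
  shows "\<bar>bes \<mu> (- v)\<bar> \<le> inverse (Gamma \<mu>)"
proof -
  define E where "E v = (bes \<mu> (- v))\<^sup>2 + v * (bes (\<mu> + 1) (- v))\<^sup>2" for v
  have d: "((\<lambda>v. bes \<mu> (- v)) has_real_derivative - bes (\<mu> + 1) (- v)) (at v)"
    if "\<mu> \<ge> 1/2" for \<mu> v
    using DERIV_chain2[OF bes_has_derivative[OF that] DERIV_minus[OF DERIV_ident]] by simp
  \<comment> \<open>The recurrence cancels the mixed terms, and the remaining square carries the
    sign of 1 - 2 \<mu>. This is where \<mu> >= 1/2 decides the monotonicity.\<close>
  have dE: "(E has_real_derivative (1 - 2 * \<mu>) * (bes (\<mu> + 1) (- v))\<^sup>2) (at v)" for v
  proof -
    have d0: "((\<lambda>v. bes \<mu> (- v)) has_real_derivative - bes (\<mu> + 1) (- v)) (at v)"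
      and d1: "((\<lambda>v. bes (\<mu> + 1) (- v)) has_real_derivative - bes (\<mu> + 1 + 1) (- v)) (at v)"
      by (rule d, use assms in simp)+
    have r: "bes \<mu> (- v) = \<mu> * bes (\<mu> + 1) (- v) - v * bes (\<mu> + 1 + 1) (- v)"
      using bes_recurrence[OF assms(1), of "- v"] by (simp add: add.assoc)
    show ?thesis
      unfolding E_def
      by (rule DERIV_cong[OF DERIV_add[OF DERIV_power[OF d0, of 2]
            DERIV_mult[OF DERIV_ident DERIV_power[OF d1, of 2]]]])
        (simp add: r algebra_simps power2_eq_square)
  qed
  have "E v \<le> E 0"
  proof (rule DERIV_nonpos_imp_nonincreasing[OF assms(2)])
    fix x
    show "\<exists>y. (E has_real_derivative y) (at x) \<and> y \<le> 0"
      using dE[of x] assms by (intro exI conjI) (auto simp: mult_nonpos_nonneg)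
  qed
  moreover have "(bes \<mu> (- v))\<^sup>2 \<le> E v"
    using assms by (simp add: E_def)
  ultimately have "\<bar>bes \<mu> (- v)\<bar>\<^sup>2 \<le> (inverse (Gamma \<mu>))\<^sup>2"
    by (simp add: E_def bes_0)
  then show ?thesis
    using assms by (elim power2_le_imp_le) simp
qed

section \<open>The functions I and J through the entire series, and Poisson's integral for I\<close>

lemma half_powr_even_add:
  assumes "z > 0"
  shows "(z / 2) powr (2 * real k + a) = (z\<^sup>2 / 4) ^ k * (z / 2) powr a"
proof -
  have "(z / 2) powr (2 * real k) = (z / 2) ^ (2 * k)"
    using powr_realpow[of "z / 2" "2 * k"] assms by simp
  also have "\<dots> = (z\<^sup>2 / 4) ^ k"
    unfolding power_mult by (simp add: power_divide)
  finally show ?thesis by (simp only: powr_add)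
qed

lemma bessel_I_eq:
  assumes "lam > 0" "z > 0"
  shows "bessel_I (lam - 1/2) z = (z / 2) powr (lam - 1/2) * bes (lam + 1/2) (z\<^sup>2 / 4)"
proof -
  have "bes (lam + 1/2) (z\<^sup>2 / 4) * (z / 2) powr (lam - 1/2)
      = (\<Sum>k. inverse (fact k * Gamma (real k + (lam + 1/2))) * (z\<^sup>2 / 4) ^ k * (z / 2) powr (lam - 1/2))"
    unfolding bes_def using assms by (intro suminf_mult2 summable_bes) auto
  also have "\<dots> = bessel_I (lam - 1/2) z"
    unfolding bessel_I_def
  proof (intro suminf_cong)
    fix k
    have eq1: "(z / 2) powr (2 * real k + (lam - 1/2)) = (z\<^sup>2 / 4) ^ k * (z / 2) powr (lam - 1/2)"
      by (rule half_powr_even_add) fact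
    have eq2: "real k + (lam - 1/2) + 1 = real k + (lam + 1/2)" by simp
    show "inverse (fact k * Gamma (real k + (lam + 1/2))) * (z\<^sup>2 / 4) ^ k * (z / 2) powr (lam - 1/2)
      = 1 / (fact k * Gamma (real k + (lam - 1/2) + 1)) * (z / 2) powr (2 * real k + (lam - 1/2))"
      unfolding eq1 eq2 by (simp only: divide_inverse mult_1_left mult.assoc)
  qed
  finally show ?thesis by (metis mult.commute)
qed

lemma bessel_J_eq:
  assumes "lam > 0" "z > 0"
  shows "bessel_J (lam - 1/2) z = (z / 2) powr (lam - 1/2) * bes (lam + 1/2) (- (z\<^sup>2 / 4))"
proof -
  have "bes (lam + 1/2) (- (z\<^sup>2 / 4)) * (z / 2) powr (lam - 1/2)
      = (\<Sum>k. inverse (fact k * Gamma (real k + (lam + 1/2))) * (- (z\<^sup>2 / 4)) ^ k * (z / 2) powr (lam - 1/2))"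
    unfolding bes_def using assms by (intro suminf_mult2 summable_bes) auto
  also have "\<dots> = bessel_J (lam - 1/2) z"
    unfolding bessel_J_def
  proof (intro suminf_cong)
    fix k
    have eq1: "(z / 2) powr (2 * real k + (lam - 1/2)) = (z\<^sup>2 / 4) ^ k * (z / 2) powr (lam - 1/2)"
      by (rule half_powr_even_add) fact
    have eq2: "real k + (lam - 1/2) + 1 = real k + (lam + 1/2)" by simp
    show "inverse (fact k * Gamma (real k + (lam + 1/2))) * (- (z\<^sup>2 / 4)) ^ k * (z / 2) powr (lam - 1/2)
      = (-1)^k / (fact k * Gamma (real k + (lam - 1/2) + 1)) * (z / 2) powr (2 * real k + (lam - 1/2))"
      unfolding eq1 eq2 by (subst power_minus) (simp only: divide_inverse mult_ac)
  qed
  finally show ?thesis by (metis mult.commute)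
qed

text \<open>Even moments of Poisson's weight: the substitution \<open>r = q\<^sup>2\<close> carries
  them to Beta integrals. Nonnegative integrals are convenient because the weight is unbounded at q
  = 1 when \<open>lam < 1\<close>; the endpoints, where open and closed interval differ, form a null
  set.\<close>

lemma nn_integral_even_Beta:
  assumes "lam > 0"
  shows "(\<integral>\<^sup>+q. ennreal ((1 - q\<^sup>2) powr (lam - 1) * q ^ (2 * k)) * indicator {0<..<1} q \<partial>lborel)
    = ennreal (Beta (real k + 1/2) lam / 2)"
proof -
  define f :: "real \<Rightarrow> real" where "f r = r powr (real k + 1/2 - 1) * (1 - r) powr (lam - 1)" for r
  have [measurable]: "f \<in> borel_measurable borel" unfolding f_def by measurable
  have "ennreal (Beta (real k + 1/2) lam) = (\<integral>\<^sup>+r. ennreal (f r) * indicator {0..1} r \<partial>lborel)"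
    unfolding f_def using assms
    by (intro nn_integral_has_integral_lebesgue'[symmetric] has_integral_Beta_real) auto
  also have "\<dots> = (\<integral>\<^sup>+r. ennreal (f r) * indicator {0\<^sup>2..1\<^sup>2} r \<partial>lborel)"
    by simp
  also have "\<dots> = (\<integral>\<^sup>+q. ennreal (f (q\<^sup>2) * (2 * q)) * indicator {0..1} q \<partial>lborel)"
  proof -
    have "((\<lambda>q. q\<^sup>2) has_real_derivative 2 * q) (at q)" for q :: real
      by (auto intro!: derivative_eq_intros)
    then show ?thesis
      using nn_integral_substitution[of "\<lambda>q. q\<^sup>2" 0 1 f "\<lambda>q. 2 * q"]
      by (simp add: nn_integral_set_ennreal set_borel_measurable_def continuous_on_mult_left mult.assoc)
  qed
  also have "\<dots> = (\<integral>\<^sup>+q. 2 * (ennreal ((1 - q\<^sup>2) powr (lam - 1) * q ^ (2 * k)) * indicator {0<..<1} q) \<partial>lborel)"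
  proof (rule nn_integral_cong_AE)
    show "AE q in lborel. ennreal (f (q\<^sup>2) * (2 * q)) * indicator {0..1} q
        = 2 * (ennreal ((1 - q\<^sup>2) powr (lam - 1) * q ^ (2 * k)) * indicator {0<..<1} q)"
      using AE_lborel_singleton[of 0] AE_lborel_singleton[of 1]
    proof eventually_elim
      case (elim q)
      show ?case
      proof (cases "0 < q \<and> q < 1")
        case True
        have "(q\<^sup>2) powr (real k + 1/2 - 1) * q = q powr (2 * (real k + 1/2 - 1)) * q powr 1"
          using True by (simp add: powr_powr flip: powr_numeral)
        also have "\<dots> = q powr real (2 * k)"
          unfolding powr_add[symmetric] by (simp add: algebra_simps)
        also have "\<dots> = q ^ (2 * k)"
          using True by (intro powr_realpow) simp
        finally have "(q\<^sup>2) powr (real k + 1/2 - 1) * q = q ^ (2 * k)" .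
        moreover have "f (q\<^sup>2) * (2 * q) = 2 * ((1 - q\<^sup>2) powr (lam - 1) * ((q\<^sup>2) powr (real k + 1/2 - 1) * q))"
          unfolding f_def by (simp only: mult_ac)
        ultimately have "f (q\<^sup>2) * (2 * q) = 2 * ((1 - q\<^sup>2) powr (lam - 1) * q ^ (2 * k))"
          by simp
        moreover have "0 \<le> (1 - q\<^sup>2) powr (lam - 1) * q ^ (2 * k)" using True by simp
        ultimately have "ennreal (f (q\<^sup>2) * (2 * q)) = ennreal 2 * ennreal ((1 - q\<^sup>2) powr (lam - 1) * q ^ (2 * k))"
          by (simp only: ennreal_mult zero_le_numeral)
        then show ?thesis using True by simp
      next
        case False
        then show ?thesis using elim by (auto simp: indicator_def)
      qed
    qed
  qed
  also have "\<dots> = 2 * (\<integral>\<^sup>+q. ennreal ((1 - q\<^sup>2) powr (lam - 1) * q ^ (2 * k)) * indicator {0<..<1} q \<partial>lborel)"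
    by (rule nn_integral_cmult) measurable
  finally have "ennreal (Beta (real k + 1/2) lam)
    = 2 * (\<integral>\<^sup>+q. ennreal ((1 - q\<^sup>2) powr (lam - 1) * q ^ (2 * k)) * indicator {0<..<1} q \<partial>lborel)" .
  then have eq: "ennreal (Beta (real k + 1/2) lam)
    = ennreal 2 * (\<integral>\<^sup>+q. ennreal ((1 - q\<^sup>2) powr (lam - 1) * q ^ (2 * k)) * indicator {0<..<1} q \<partial>lborel)"
    (is "_ = _ * ?Y") by simp
  have "ennreal (Beta (real k + 1/2) lam / 2) = ennreal (1/2) * ennreal (Beta (real k + 1/2) lam)"
    by (subst ennreal_mult'[symmetric]) auto
  also have "\<dots> = (ennreal (1/2) * ennreal 2) * ?Y"
    unfolding eq mult.assoc ..
  also have "ennreal (1/2) * ennreal 2 = 1"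
    by (subst ennreal_mult'[symmetric]) auto
  finally show ?thesis by (simp only: mult_1_left)
qed

lemma cosh_sums_even: "(\<lambda>k. (x::real) ^ (2 * k) / fact (2 * k)) sums cosh x"
proof -
  have "(\<lambda>k. (\<lambda>n. if even n then x ^ n /\<^sub>R fact n else 0) (2 * k)) sums cosh x"
    using cosh_converges[of x]
    by (subst sums_mono_reindex) (auto simp: strict_mono_def elim!: evenE)
  then show ?thesis by (simp add: divide_inverse mult.commute)
qed

lemma Gamma_half_shift: "Gamma (real k + 1/2) = sqrt pi * fact (2 * k) / (4 ^ k * fact k)"
proof -
  have "(1/2::real) \<notin> \<int>\<^sub>\<le>\<^sub>0" by (intro notI) (drule nonpos_Ints_nonpos, simp)
  from pochhammer_Gamma[OF this, of k]
  have "Gamma (real k + 1/2) = sqrt pi * pochhammer (1/2) k"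
    by (simp add: Gamma_one_half_real add.commute)
  moreover have "fact (2 * k) = (4 ^ k * pochhammer (1/2) k * fact k :: real)"
    by (simp add: fact_double power_mult)
  ultimately show ?thesis by simp
qed

text \<open>Poisson's integral for I. The hyperbolic cosine is expanded in even powers and
  integrated term by term, which is Tonelli because all terms are nonnegative; the Beta values,
  rewritten through \<open>Gamma_half_shift\<close>, become the coefficients of the series.\<close>

lemma bes_integral:
  assumes "lam > 0"
  shows "ennreal (bes (lam + 1/2) (z\<^sup>2 / 4))
    = (\<integral>\<^sup>+q. ennreal (2 / (sqrt pi * Gamma lam) * ((1 - q\<^sup>2) powr (lam - 1) * cosh (z * q))) * indicator {0<..<1} q \<partial>lborel)"
proof -
  define c where "c = 2 / (sqrt pi * Gamma lam)"
  define t where "t k q = c * (z ^ (2 * k) / fact (2 * k)) * ((1 - q\<^sup>2) powr (lam - 1) * q ^ (2 * k))" for k and q :: real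
  have c: "c > 0" using assms by (simp add: c_def)
  have "(\<integral>\<^sup>+q. ennreal (c * ((1 - q\<^sup>2) powr (lam - 1) * cosh (z * q))) * indicator {0<..<1} q \<partial>lborel)
     = (\<integral>\<^sup>+q. (\<Sum>k. ennreal (t k q) * indicator {0<..<1} q) \<partial>lborel)"
  proof (intro nn_integral_cong)
    fix q :: real
    have "(\<lambda>k. c * (1 - q\<^sup>2) powr (lam - 1) * ((z * q) ^ (2 * k) / fact (2 * k)))
        sums (c * (1 - q\<^sup>2) powr (lam - 1) * cosh (z * q))"
      by (intro sums_mult cosh_sums_even)
    then have "t k q \<ge> 0" "(\<lambda>k. t k q) sums (c * ((1 - q\<^sup>2) powr (lam - 1) * cosh (z * q)))" for k
      using c by (auto simp: t_def power_mult_distrib mult_ac zero_le_even_power)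
    then have "(\<Sum>k. ennreal (t k q)) = ennreal (c * ((1 - q\<^sup>2) powr (lam - 1) * cosh (z * q)))"
      by (intro suminf_ennreal_eq)
    then show "ennreal (c * ((1 - q\<^sup>2) powr (lam - 1) * cosh (z * q))) * indicator {0<..<1} q
        = (\<Sum>k. ennreal (t k q) * indicator {0<..<1} q)"
      by (cases "0 < q \<and> q < 1") auto
  qed
  also have "\<dots> = (\<Sum>k. \<integral>\<^sup>+q. ennreal (t k q) * indicator {0<..<1} q \<partial>lborel)"
    unfolding t_def by (rule nn_integral_suminf) measurable
  also have "\<dots> = (\<Sum>k. ennreal (inverse (fact k * Gamma (real k + (lam + 1/2))) * (z\<^sup>2 / 4) ^ k))"
  proof (intro suminf_cong)
    fix k
    define a where "a = c * (z ^ (2 * k) / fact (2 * k))"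
    have a: "a \<ge> 0" using c by (simp add: a_def zero_le_even_power)
    have "(\<integral>\<^sup>+q. ennreal (t k q) * indicator {0<..<1} q \<partial>lborel)
      = (\<integral>\<^sup>+q. ennreal a * (ennreal ((1 - q\<^sup>2) powr (lam - 1) * q ^ (2 * k)) * indicator {0<..<1} q) \<partial>lborel)"
      unfolding t_def a_def[symmetric] ennreal_mult'[OF a] mult.assoc ..
    also have "\<dots> = ennreal a * ennreal (Beta (real k + 1/2) lam / 2)"
      by (subst nn_integral_cmult) (simp_all add: nn_integral_even_Beta assms)
    also have "\<dots> = ennreal (a * (Beta (real k + 1/2) lam / 2))"
      by (simp only: ennreal_mult'[OF a])
    also have "a * (Beta (real k + 1/2) lam / 2) = inverse (fact k * Gamma (real k + (lam + 1/2))) * (z\<^sup>2 / 4) ^ k"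
    proof -
      have cancel: "(2 / (p * G) * (w / F)) * ((p * F / (q * f) * G / g) / 2) = inverse (f * g) * (w / q)"
        if "p > 0" "G > 0" "F > 0" for p G F f g q w :: real
        using that by (simp add: field_simps)
      have e: "real k + 1/2 + lam = real k + (lam + 1/2)" by simp
      have w: "(z\<^sup>2 / 4) ^ k = z ^ (2 * k) / 4 ^ k" by (simp add: power_divide power_mult)
      show ?thesis
        unfolding a_def c_def Beta_def e Gamma_half_shift w
        by (rule cancel) (use assms in auto)
    qed
    finally show "(\<integral>\<^sup>+q. ennreal (t k q) * indicator {0<..<1} q \<partial>lborel)
      = ennreal (inverse (fact k * Gamma (real k + (lam + 1/2))) * (z\<^sup>2 / 4) ^ k)" .
  qed
  also have "\<dots> = ennreal (bes (lam + 1/2) (z\<^sup>2 / 4))"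
  proof (rule suminf_ennreal_eq)
    show "0 \<le> inverse (fact k * Gamma (real k + (lam + 1/2))) * (z\<^sup>2 / 4) ^ k" for k
      using Gamma_shift_pos[of "lam + 1/2" k] assms by simp
    show "(\<lambda>k. inverse (fact k * Gamma (real k + (lam + 1/2))) * (z\<^sup>2 / 4) ^ k) sums bes (lam + 1/2) (z\<^sup>2 / 4)"
      using assms by (intro bes_sums) simp
  qed
  finally show ?thesis unfolding c_def ..
qed

lemma bes_pos:
  assumes "\<mu> \<ge> 1/2" "v \<ge> 0"
  shows "bes \<mu> v > 0"
proof -
  have t: "0 \<le> inverse (fact k * Gamma (real k + \<mu>)) * v ^ k" for k
    using Gamma_shift_pos[of \<mu> k] assms by simp
  have "0 < Gamma \<mu>" using assms by simp
  then show ?thesis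
    unfolding bes_def using assms(1) t by (intro suminf_pos2[of _ 0] summable_bes) auto
qed

section \<open>Comparison of I with its exponential asymptotics\<close>

lemma has_bochner_integral_Gamma:
  assumes "p > 0" "z > 0"
  shows "has_bochner_integral halfline (\<lambda>s. s powr (p - 1) * exp (- (z * s))) (Gamma p / z powr p)"
proof (rule has_bochner_integral_nn_integral)
  have "ennreal (Gamma p) = (\<integral>\<^sup>+t. ennreal (indicator {0..} t * t powr (p - 1) / exp t) \<partial>lborel)"
    by (rule Gamma_conv_nn_integral_real) fact
  also have "\<dots> = z * (\<integral>\<^sup>+s. ennreal (indicator {0..} (0 + z * s) * (0 + z * s) powr (p - 1) / exp (0 + z * s)) \<partial>lborel)"
    using assms by (subst nn_integral_real_affine[where c = z and t = 0]) auto
  also have "\<dots> = z * (\<integral>\<^sup>+s. ennreal (z powr (p - 1)) * (ennreal (s powr (p - 1) * exp (- (z * s))) * indicator {0<..} s) \<partial>lborel)"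
  proof (intro arg_cong2[where f = "(*)"] refl nn_integral_cong)
    fix s :: real
    show "ennreal (indicator {0..} (0 + z * s) * (0 + z * s) powr (p - 1) / exp (0 + z * s))
      = ennreal (z powr (p - 1)) * (ennreal (s powr (p - 1) * exp (- (z * s))) * indicator {0<..} s)"
    proof (cases "s > 0")
      case True
      then show ?thesis using assms
        by (simp add: powr_mult exp_minus field_simps flip: ennreal_mult)
    next
      case False
      then show ?thesis using assms by (cases "s = 0") (auto simp: indicator_def zero_le_mult_iff)
    qed
  qed
  also have "\<dots> = ennreal z * (ennreal (z powr (p - 1)) * (\<integral>\<^sup>+s. ennreal (s powr (p - 1) * exp (- (z * s))) \<partial>halfline))"
    unfolding nn_integral_halfline by (subst nn_integral_cmult) auto
  also have "\<dots> = ennreal (z powr p) * (\<integral>\<^sup>+s. ennreal (s powr (p - 1) * exp (- (z * s))) \<partial>halfline)"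
    using assms by (simp add: powr_diff flip: mult.assoc ennreal_mult)
  finally have eq: "ennreal (Gamma p) = ennreal (z powr p) * (\<integral>\<^sup>+s. ennreal (s powr (p - 1) * exp (- (z * s))) \<partial>halfline)" .
  have "ennreal (Gamma p / z powr p) = ennreal (1 / z powr p) * ennreal (Gamma p)"
    using assms by (simp flip: ennreal_mult)
  also have "\<dots> = (\<integral>\<^sup>+s. ennreal (s powr (p - 1) * exp (- (z * s))) \<partial>halfline)"
    unfolding eq using assms by (simp flip: mult.assoc ennreal_mult)
  finally show "(\<integral>\<^sup>+s. ennreal (s powr (p - 1) * exp (- (z * s))) \<partial>halfline) = ennreal (Gamma p / z powr p)" ..
qed (use assms in auto)

text \<open>The inequality w <= exp w at w = z / p, raised to the power p.\<close>

lemma powr_exp_le: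
  fixes z p :: real
  assumes "p > 0" "z > 0"
  shows "z powr p * exp (- z) \<le> p powr p"
proof -
  have "z / p \<le> exp (z / p)"
    using exp_ge_add_one_self[of "z / p"] by linarith
  then have "(z / p) powr p \<le> exp (z / p) powr p"
    using assms by (intro powr_mono2) auto
  also have "\<dots> = exp z"
    using assms by (simp add: powr_def)
  finally have "z powr p / p powr p \<le> exp z"
    using assms by (simp add: powr_divide)
  then show ?thesis
    using assms by (simp add: exp_minus field_simps)
qed

text \<open>For s in [0,1] the base stays in [1/2,1], where the derivative of the power is bounded
  for exponents of either sign. The exponent needed is \<open>lam - 1\<close>, which is negative for
  \<open>lam < 1\<close>.\<close>

lemma powr_near_one:
  fixes p :: real
  obtains L where "L \<ge> 0" and "\<And>s. 0 \<le> s \<Longrightarrow> s \<le> 1 \<Longrightarrow> \<bar>(1 - s / 2) powr p - 1\<bar> \<le> L * s"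
proof
  define B where "B = \<bar>p\<bar> * 2 powr \<bar>p - 1\<bar>"
  show "B / 2 \<ge> 0" by (simp add: B_def)
  fix s :: real assume s: "0 \<le> s" "s \<le> 1"
  have "norm ((1 - s / 2) powr p - 1 powr p) \<le> B * norm ((1 - s / 2) - 1)"
  proof (rule field_differentiable_bound[of "{1/2..1}" "\<lambda>w. w powr p" "\<lambda>w. p * w powr (p - 1)"])
    fix w :: real assume w: "w \<in> {1/2..1}"
    show "((\<lambda>w. w powr p) has_real_derivative p * w powr (p - 1)) (at w within {1/2..1})"
      using w by (auto intro!: derivative_eq_intros DERIV_subset[OF has_real_derivative_powr])
    have "w powr (p - 1) \<le> 2 powr \<bar>p - 1\<bar>"
    proof (cases "p \<ge> 1")
      case True
      then have "w powr (p - 1) \<le> 2 powr (p - 1)" using w by (intro powr_mono2) auto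
      then show ?thesis using True by simp
    next
      case False
      have "w powr (p - 1) = (1 / w) powr (1 - p)"
        using w by (simp add: powr_divide powr_minus_divide[symmetric])
      also have "\<dots> \<le> 2 powr (1 - p)" using w False by (intro powr_mono2) (auto simp: field_simps)
      finally show ?thesis using False by simp
    qed
    then show "norm (p * w powr (p - 1)) \<le> B"
      unfolding B_def by (simp add: abs_mult mult_left_mono)
  qed (use s in auto)
  then show "\<bar>(1 - s / 2) powr p - 1\<bar> \<le> B / 2 * s"
    using s by simp
qed

lemma has_bochner_integral_mono:
  fixes a b :: real
  assumes "has_bochner_integral M f a" "has_bochner_integral M g b" "\<And>x. x \<in> space M \<Longrightarrow> f x \<le> g x"
  shows "a \<le> b"
  using assms by (auto simp: has_bochner_integral_iff intro!: integral_mono)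

lemma has_bochner_integral_abs_le:
  fixes a b :: real
  assumes f: "has_bochner_integral M f a" and g: "has_bochner_integral M g b"
    and le: "\<And>x. x \<in> space M \<Longrightarrow> \<bar>f x\<bar> \<le> g x"
  shows "\<bar>a\<bar> \<le> b"
proof -
  have "a \<le> b" using le by (intro has_bochner_integral_mono[OF f g]) (auto simp: abs_le_iff)
  moreover have "- a \<le> b"
    using le by (intro has_bochner_integral_mono[OF has_bochner_integral_minus[OF f] g]) (auto simp: abs_le_iff)
  ultimately show ?thesis by simp
qed

text \<open>\<open>sqrt (2 * pi * z) * exp (- z) * bessel_I (lam - 1/2) z\<close>, the ratio of the Bessel heat
  kernel to the Gaussian one.\<close>

definition bessel_ratio :: "real \<Rightarrow> real \<Rightarrow> real" where
  "bessel_ratio lam z = 2 * sqrt pi * (z / 2) powr lam * exp (- z) * bes (lam + 1/2) (z\<^sup>2 / 4)"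

lemma bessel_ratio_nonneg: "lam > 0 \<Longrightarrow> 0 \<le> bessel_ratio lam z"
  unfolding bessel_ratio_def using bes_pos[of "lam + 1/2" "z\<^sup>2 / 4"] by simp

lemma nn_integral_lborel_reflect:
  "(\<integral>\<^sup>+q. ennreal (f q) * indicator {0<..<1} q \<partial>lborel) = (\<integral>\<^sup>+s. ennreal (f (1 - s)) * indicator {..<1} s \<partial>halfline)"
  if [measurable]: "f \<in> borel_measurable borel"
proof -
  have "(\<integral>\<^sup>+q. ennreal (f q) * indicator {0<..<1} q \<partial>lborel)
    = ennreal \<bar>- 1\<bar> * (\<integral>\<^sup>+s. ennreal (f (1 + (- 1) * s)) * indicator {0<..<1} (1 + (- 1) * s) \<partial>lborel)"
    by (subst nn_integral_real_affine[where c = "- 1" and t = 1]) auto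
  also have "\<dots> = (\<integral>\<^sup>+s. ennreal (f (1 - s)) * indicator {..<1} s * indicator {0<..} s \<partial>lborel)"
    by (auto intro!: nn_integral_cong simp: indicator_def)
  finally show ?thesis unfolding nn_integral_halfline .
qed

text \<open>Poisson's integral for \<open>I\<close> after the substitution \<open>q = 1 - s\<close>: the mass concentrates at \<open>s = 0\<close>.\<close>

lemma bessel_ratio_integral:
  assumes "lam > 0" "z > 0"
  shows "has_bochner_integral halfline
    (\<lambda>s. if s < 1 then s powr (lam - 1) * (1 - s / 2) powr (lam - 1) * (exp (- (z * s)) + exp (- (z * (2 - s)))) else 0)
    (bessel_ratio lam z * Gamma lam / z powr lam)"
proof (rule has_bochner_integral_nn_integral)
  define a where "a = Gamma lam * 2 * sqrt pi * 2 powr (- lam) * exp (- z)"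
  have a: "a > 0" using assms by (simp add: a_def)
  define F where "F q = 2 / (sqrt pi * Gamma lam) * ((1 - q\<^sup>2) powr (lam - 1) * cosh (z * q))" for q
  have [measurable]: "F \<in> borel_measurable borel" unfolding F_def cosh_def by measurable
  have "bessel_ratio lam z * Gamma lam / z powr lam = a * bes (lam + 1/2) (z\<^sup>2 / 4)"
    using assms by (simp add: bessel_ratio_def a_def powr_divide powr_minus field_simps)
  then have "ennreal (bessel_ratio lam z * Gamma lam / z powr lam)
     = ennreal a * ennreal (bes (lam + 1/2) (z\<^sup>2 / 4))"
    using a by (simp add: ennreal_mult')
  also have "\<dots> = ennreal a * (\<integral>\<^sup>+s. ennreal (F (1 - s)) * indicator {..<1} s \<partial>halfline)"
    unfolding bes_integral[OF assms(1)] F_def[symmetric]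
    by (subst nn_integral_lborel_reflect) simp_all
  also have "\<dots> = (\<integral>\<^sup>+s. ennreal a * (ennreal (F (1 - s)) * indicator {..<1} s) \<partial>halfline)"
    by (intro nn_integral_cmult[symmetric]) measurable
  also have "\<dots> = (\<integral>\<^sup>+s. ennreal (if s < 1 then s powr (lam - 1) * (1 - s / 2) powr (lam - 1)
      * (exp (- (z * s)) + exp (- (z * (2 - s)))) else 0) \<partial>halfline)"
  proof (intro nn_integral_cong)
    fix s assume "s \<in> space halfline"
    then have s: "s > 0" by simp
    show "ennreal a * (ennreal (F (1 - s)) * indicator {..<1} s)
      = ennreal (if s < 1 then s powr (lam - 1) * (1 - s / 2) powr (lam - 1)
          * (exp (- (z * s)) + exp (- (z * (2 - s)))) else 0)"
    proof (cases "s < 1")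
      case True
      have "1 - (1 - s)\<^sup>2 = s * (2 * (1 - s / 2))" by (simp add: power2_eq_square algebra_simps)
      then have "(1 - (1 - s)\<^sup>2) powr (lam - 1) = s powr (lam - 1) * (2 powr (lam - 1) * (1 - s / 2) powr (lam - 1))"
        using s True by (simp only: powr_mult)
      moreover have "exp (- z) * (2 * cosh (z * (1 - s))) = exp (- (z * s)) + exp (- (z * (2 - s)))"
        by (simp add: cosh_def algebra_simps flip: exp_add)
      moreover have "2 powr (- lam) * 2 powr (lam - 1) * 2 = (1::real)"
        by (simp add: powr_minus powr_diff)
      moreover have "Gamma lam > 0" using assms by simp
      ultimately have "a * F (1 - s) = s powr (lam - 1) * (1 - s / 2) powr (lam - 1)
          * (exp (- (z * s)) + exp (- (z * (2 - s))))"
        by (simp add: a_def F_def flip: \<open>exp (- z) * (2 * cosh (z * (1 - s))) = exp (- (z * s)) + exp (- (z * (2 - s)))\<close>)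
      then show ?thesis using True a by (simp flip: ennreal_mult')
    qed simp
  qed
  finally show "(\<integral>\<^sup>+s. ennreal (if s < 1 then s powr (lam - 1) * (1 - s / 2) powr (lam - 1)
      * (exp (- (z * s)) + exp (- (z * (2 - s)))) else 0) \<partial>halfline) = ennreal (bessel_ratio lam z * Gamma lam / z powr lam)" ..
  show "0 \<le> bessel_ratio lam z * Gamma lam / z powr lam"
    using assms bessel_ratio_nonneg[of lam z] by (simp add: Gamma_real_nonneg)
qed auto

text \<open>In Poisson's integral the mass sits at s of order 1/z, where the integrand is nearly
  that of Gamma(lam) / z^lam. Replacing (1 - s/2)^(lam-1) by one costs O(s), that is a factor 1/z
  after integration; the reflected exponential is at most exp(-z), and the tail s > 1 is of the same
  order as the first error. For small z the crude bound of the integrand by a multiple of s^(lam-1)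
  already gives O(z^lam).\<close>

lemma bessel_ratio_bounds:
  assumes "lam > 0"
  obtains C where "C > 0" and "\<And>z. z > 0 \<Longrightarrow> bessel_ratio lam z \<le> C"
    and "\<And>z. z > 0 \<Longrightarrow> \<bar>bessel_ratio lam z - 1\<bar> \<le> C / z"
proof -
  obtain L where L: "L \<ge> 0" "\<And>s. 0 \<le> s \<Longrightarrow> s \<le> 1 \<Longrightarrow> \<bar>(1 - s / 2) powr (lam - 1) - 1\<bar> \<le> L * s"
    using powr_near_one[of "lam - 1"] by blast
  have Gp: "Gamma lam > 0" using assms by simp
  define D where "D = (1 + L) / lam"
  have D: "D \<ge> 0" using assms L by (simp add: D_def)
  define a where "a s = (1 - s / 2) powr (lam - 1)" for s :: real
  define H where "H z s = (if s < 1 then s powr (lam - 1) * a s * (exp (- (z * s)) + exp (- (z * (2 - s)))) else 0)" for z s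
  have H: "has_bochner_integral halfline (H z) (bessel_ratio lam z * Gamma lam / z powr lam)" if "z > 0" for z
    using bessel_ratio_integral[OF assms that] unfolding H_def a_def .
  have a_le: "a s \<le> 1 + L" "0 \<le> a s" if "0 < s" "s < 1" for s
    using L(2)[of s] that mult_left_mono[of s 1 L] L(1) by (auto simp: a_def)
  have unit: "has_bochner_integral halfline (\<lambda>s. if s \<le> 1 then E * s powr (lam - 1) else 0) (E / lam)" if "E \<ge> 0" for E
    using nn_integral_halfline_two_powers[of "lam - 1" 2 1 E 0] assms that
    by (intro has_bochner_integral_nn_integral) (auto cong: if_cong)
  have small: "bessel_ratio lam z * Gamma lam / z powr lam \<le> 2 * D" if z: "z > 0" for z
  proof -
    have "bessel_ratio lam z * Gamma lam / z powr lam \<le> (2 * (1 + L)) / lam"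
    proof (rule has_bochner_integral_mono[OF H[OF z] unit])
      fix s assume "s \<in> space halfline"
      then have s: "s > 0" by simp
      show "H z s \<le> (if s \<le> 1 then 2 * (1 + L) * s powr (lam - 1) else 0)"
      proof (cases "s < 1")
        case True
        have "exp (- (z * s)) \<le> 1" "exp (- (z * (2 - s))) \<le> 1" using z s True by auto
        then have "exp (- (z * s)) + exp (- (z * (2 - s))) \<le> 2" by linarith
        then have "s powr (lam - 1) * a s * (exp (- (z * s)) + exp (- (z * (2 - s))))
           \<le> s powr (lam - 1) * (1 + L) * 2"
          using a_le[OF s True] by (intro mult_mono) auto
        then show ?thesis using True by (simp add: H_def algebra_simps)
      qed (use L in \<open>auto simp: H_def\<close>)
    qed (use L in auto)
    then show ?thesis by (simp add: D_def)
  qed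
  have main: "\<bar>bessel_ratio lam z * Gamma lam / z powr lam - Gamma lam / z powr lam\<bar>
      \<le> (L + 1) * (Gamma (lam + 1) / z powr (lam + 1)) + exp (- z) * D" if z: "z > 0" for z
  proof -
    have m1: "has_bochner_integral halfline (\<lambda>s. H z s - s powr (lam - 1) * exp (- (z * s)))
        (bessel_ratio lam z * Gamma lam / z powr lam - Gamma lam / z powr lam)"
      by (intro has_bochner_integral_diff H z has_bochner_integral_Gamma assms)
    \<comment> \<open>The exponent is spelled \<open>lam + 1 - 1\<close> so that the first summand
      is literally the Gamma integral of order \<open>lam + 1\<close>, whose value has one more
      power of z in the denominator. The second summand collects the reflected exponential, at most
      exp(-z) for s < 1.\<close>
    have m2: "has_bochner_integral halfline
        (\<lambda>s. (L + 1) * (s powr (lam + 1 - 1) * exp (- (z * s))) + (if s \<le> 1 then (exp (- z) * (1 + L)) * s powr (lam - 1) else 0))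
        ((L + 1) * (Gamma (lam + 1) / z powr (lam + 1)) + exp (- z) * (1 + L) / lam)"
      using assms z L by (intro has_bochner_integral_add has_bochner_integral_mult_right has_bochner_integral_Gamma unit) auto
    have m3: "\<bar>H z s - s powr (lam - 1) * exp (- (z * s))\<bar>
      \<le> (L + 1) * (s powr (lam + 1 - 1) * exp (- (z * s))) + (if s \<le> 1 then (exp (- z) * (1 + L)) * s powr (lam - 1) else 0)"
      if "s > 0" for s
    proof (cases "s < 1")
      case True
      have e: "s powr lam = s powr (lam - 1) * s"
        using \<open>s > 0\<close> powr_add[of s "lam - 1" 1] by simp
      have "H z s - s powr (lam - 1) * exp (- (z * s))
        = s powr (lam - 1) * exp (- (z * s)) * (a s - 1) + s powr (lam - 1) * a s * exp (- (z * (2 - s)))"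
        using True by (simp add: H_def algebra_simps)
      also have "\<bar>\<dots>\<bar> \<le> s powr (lam - 1) * exp (- (z * s)) * \<bar>a s - 1\<bar> + s powr (lam - 1) * a s * exp (- (z * (2 - s)))"
        using a_le[OF \<open>s > 0\<close> True]
        by (intro order_trans[OF abs_triangle_ineq]) (simp add: abs_mult)
      also have "\<dots> \<le> s powr (lam - 1) * exp (- (z * s)) * ((L + 1) * s) + s powr (lam - 1) * (1 + L) * exp (- z)"
      proof (intro add_mono mult_mono)
        show "\<bar>a s - 1\<bar> \<le> (L + 1) * s"
          using L(2)[of s] True \<open>s > 0\<close> by (simp add: a_def algebra_simps)
      next
        show "exp (- (z * (2 - s))) \<le> exp (- z)"
          using mult_left_mono[of 1 "2 - s" z] True z by simp
      qed (use a_le[OF \<open>s > 0\<close> True] L in auto)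
      finally show ?thesis using True e by (simp add: mult_ac)
    next
      \<comment> \<open>Beyond s = 1 the Poisson integrand has ended; the tail of the Gamma integral
        that it misses is paid for by the extra power of s.\<close>
      case False
      then have "s powr (lam - 1) * 1 \<le> s powr (lam - 1) * s"
        by (intro mult_left_mono) auto
      also have "\<dots> = s powr lam" using \<open>s > 0\<close> powr_add[of s "lam - 1" 1] by simp
      finally have "s powr (lam - 1) \<le> s powr lam" by simp
      then have "s powr (lam - 1) * exp (- (z * s)) \<le> 1 * (s powr lam * exp (- (z * s)))"
        by simp
      also have "\<dots> \<le> (L + 1) * (s powr lam * exp (- (z * s)))"
        using L by (intro mult_right_mono) auto
      finally have "s powr (lam - 1) * exp (- (z * s)) \<le> (L + 1) * (s powr lam * exp (- (z * s)))" .
      moreover have "0 \<le> (if s \<le> 1 then (exp (- z) * (1 + L)) * s powr (lam - 1) else 0)" using L by auto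
      moreover have "H z s = 0" using False by (simp add: H_def)
      moreover have "0 \<le> s powr (lam - 1) * exp (- (z * s))" by simp
      moreover have "lam + 1 - 1 = lam" by simp
      ultimately show ?thesis by (simp only: abs_le_iff) linarith
    qed
    have "\<bar>bessel_ratio lam z * Gamma lam / z powr lam - Gamma lam / z powr lam\<bar>
        \<le> (L + 1) * (Gamma (lam + 1) / z powr (lam + 1)) + exp (- z) * (1 + L) / lam"
      using m3 by (intro has_bochner_integral_abs_le[OF m1 m2]) simp
    then show ?thesis by (simp add: D_def)
  qed
  \<comment> \<open>The factor \<open>lam\<close> is Gamma(lam + 1) / Gamma(lam), and
    \<open>(lam + 1) powr (lam + 1)\<close> comes from \<open>powr_exp_le\<close>, which trades
    exp(-z) for z^(-(lam+1)).\<close>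
  define C1 where "C1 = (L + 1) * lam + D / Gamma lam * (lam + 1) powr (lam + 1)"
  have C1: "C1 \<ge> 0" using assms L D Gp by (simp add: C1_def)
  have near: "\<bar>bessel_ratio lam z - 1\<bar> \<le> C1 / z" if z: "z > 0" for z
  proof -
    have Gl: "Gamma (lam + 1) = lam * Gamma lam"
      using assms by (intro Gamma_plus1) (auto dest: nonpos_Ints_nonpos)
    have "\<bar>bessel_ratio lam z - 1\<bar> * (Gamma lam / z powr lam) = \<bar>(bessel_ratio lam z - 1) * (Gamma lam / z powr lam)\<bar>"
      using Gp by (intro abs_mult_pos) auto
    also have "\<dots> = \<bar>bessel_ratio lam z * Gamma lam / z powr lam - Gamma lam / z powr lam\<bar>"
      by (simp add: left_diff_distrib diff_divide_distrib)
    also have "\<dots> \<le> (L + 1) * (lam * Gamma lam / z powr (lam + 1)) + exp (- z) * D"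
      using main[OF z] by (simp add: Gl)
    also have "\<dots> \<le> (L + 1) * (lam * Gamma lam / z powr (lam + 1)) + ((lam + 1) powr (lam + 1) / z powr (lam + 1)) * D"
      using powr_exp_le[of "lam + 1" z] assms z D
      by (intro add_left_mono mult_right_mono) (auto simp: field_simps)
    also have "\<dots> = C1 / z * (Gamma lam / z powr lam)"
      using z Gp by (simp add: C1_def powr_add field_simps)
    finally show ?thesis
      by (rule mult_right_le_imp_le) (use Gp z in auto)
  qed
  define C where "C = 1 + C1 + 2 * D / Gamma lam"
  show ?thesis
  proof
    show "C > 0" using C1 D Gp by (simp add: C_def add_pos_nonneg)
    fix z :: real assume z: "z > 0"
    have "C1 \<le> C" using D Gp by (simp add: C_def)
    then have "C1 / z \<le> C / z" using z by (simp add: divide_right_mono)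
    then show "\<bar>bessel_ratio lam z - 1\<bar> \<le> C / z" using near[OF z] by linarith
    show "bessel_ratio lam z \<le> C"
    proof (cases "z \<le> 1")
      case True
      have "bessel_ratio lam z = (bessel_ratio lam z * Gamma lam / z powr lam) * (z powr lam / Gamma lam)"
        using z Gp by simp
      also have "\<dots> \<le> 2 * D * (1 / Gamma lam)"
        using small[OF z] z True Gp D assms powr_mono2[of lam z 1]
        by (intro mult_mono) (auto simp: divide_right_mono)
      finally show ?thesis using C1 by (simp add: C_def)
    next
      case False
      then have "C1 / z \<le> C1" using C1 z by (simp add: divide_le_eq mult_le_cancel_left1)
      then have "bessel_ratio lam z \<le> 1 + C1" using near[OF z] by linarith
      also have "\<dots> \<le> C" using D Gp by (simp add: C_def)
      finally show ?thesis .
    qed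
  qed
qed

subsection \<open>Bounds for the Bessel heat kernel\<close>

definition gauss :: "real \<Rightarrow> real \<Rightarrow> real" where
  "gauss t h = exp (- (h\<^sup>2 / (4 * t))) / sqrt (4 * pi * t)"

text \<open>This is pi times the Poisson kernel of the half-plane at height sqrt t. Its mass pi does
  not depend on t, so an integral over the half-line is estimated by comparing the integrand with a
  multiple of it pointwise.\<close>

definition cauchy :: "real \<Rightarrow> real \<Rightarrow> real" where
  "cauchy t h = sqrt t / (t + h\<^sup>2)"

text \<open>An algebraic majorant of the Gaussian kernel, still integrable against \<open>h\<^sup>4\<close>.\<close>

definition rk :: "real \<Rightarrow> real \<Rightarrow> real" where
  "rk t h = t powr (5/2) / (t + h\<^sup>2) ^ 3"

lemma gauss_measurable [measurable]: "(\<lambda>p. gauss (fst p) (snd p)) \<in> borel_measurable (borel \<Otimes>\<^sub>M borel)"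
  "gauss t \<in> borel_measurable borel"
  unfolding gauss_def[abs_def] by measurable

lemma rk_measurable [measurable]: "(\<lambda>p. rk (fst p) (snd p)) \<in> borel_measurable (borel \<Otimes>\<^sub>M borel)"
  "rk t \<in> borel_measurable borel"
  unfolding rk_def[abs_def] by measurable

lemma cauchy_measurable [measurable]: "cauchy t \<in> borel_measurable borel"
  unfolding cauchy_def[abs_def] by measurable

lemma bessel_I_measurable [measurable]: "bessel_I \<nu> \<in> borel_measurable borel"
  unfolding bessel_I_def[abs_def] by measurable

lemma bessel_J_measurable [measurable]: "bessel_J \<nu> \<in> borel_measurable borel"
  unfolding bessel_J_def[abs_def] by measurable

lemma measurable_heat_kernel [measurable (raw)]:
  assumes [measurable]: "f \<in> borel_measurable M" "g \<in> borel_measurable M" "h \<in> borel_measurable M"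
  shows "(\<lambda>w. heat_kernel lam (f w) (g w) (h w)) \<in> borel_measurable M"
  unfolding heat_kernel_def by measurable

lemma measurable_rk [measurable (raw)]:
  assumes [measurable]: "f \<in> borel_measurable M" "g \<in> borel_measurable M"
  shows "(\<lambda>w. rk (f w) (g w)) \<in> borel_measurable M"
  unfolding rk_def by measurable

lemma heat_kernel_commute: "heat_kernel lam t x y = heat_kernel lam t y x"
  by (simp add: heat_kernel_def mult.commute add.commute)

lemma heat_kernel_eq_gauss:
  assumes "lam > 0" "t > 0" "x > 0" "y > 0"
  shows "heat_kernel lam t x y = gauss t (x - y) * bessel_ratio lam (x * y / (2 * t))"
proof -
  define z where "z = x * y / (2 * t)"
  have z: "z > 0" using assms by (simp add: z_def)
  have e1: "(z / 2) powr lam = (z / 2) powr (lam - 1/2) * sqrt (z / 2)"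
    using z by (simp add: powr_half_sqrt[symmetric] flip: powr_add)
  have e2: "exp (- ((x - y)\<^sup>2 / (4 * t))) * exp (- z) = exp (- (x\<^sup>2 + y\<^sup>2) / (4 * t))"
    using assms by (simp add: z_def field_simps power2_eq_square flip: exp_add)
  have e3: "2 * sqrt pi * sqrt (z / 2) / sqrt (4 * pi * t) = sqrt (x * y) / (2 * t)"
    using assms by (simp add: z_def real_sqrt_mult real_sqrt_divide field_simps)
  have "gauss t (x - y) * bessel_ratio lam z
      = (2 * sqrt pi * sqrt (z / 2) / sqrt (4 * pi * t)) * ((z / 2) powr (lam - 1/2) * bes (lam + 1/2) (z\<^sup>2 / 4))
        * (exp (- ((x - y)\<^sup>2 / (4 * t))) * exp (- z))"
    unfolding gauss_def bessel_ratio_def e1 by (simp only: divide_inverse mult_ac)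
  then have "gauss t (x - y) * bessel_ratio lam z
      = sqrt (x * y) / (2 * t) * ((z / 2) powr (lam - 1/2) * bes (lam + 1/2) (z\<^sup>2 / 4)) * exp (- (x\<^sup>2 + y\<^sup>2) / (4 * t))"
    unfolding e2 e3 .
  then show ?thesis
    unfolding heat_kernel_def bessel_I_eq[OF assms(1) z, unfolded z_def] z_def by simp
qed

lemma rk_nonneg [simp]: "t > 0 \<Longrightarrow> 0 \<le> rk t h"
  by (simp add: rk_def add_nonneg_nonneg)

lemma cauchy_nonneg [simp]: "t > 0 \<Longrightarrow> 0 \<le> cauchy t h"
  by (simp add: cauchy_def add_nonneg_nonneg)

lemma gauss_nonneg [simp]: "t > 0 \<Longrightarrow> 0 \<le> gauss t h"
  by (simp add: gauss_def)

lemma has_bochner_integral_gauss: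
  assumes "t > 0"
  shows "has_bochner_integral lborel (\<lambda>y. gauss t (x - y)) 1"
proof -
  have "gauss t (x - y) = normal_density x (sqrt (2 * t)) y" for y
    using assms by (simp add: gauss_def normal_density_def power2_commute[of x y] real_sqrt_mult field_simps)
  then show ?thesis
    using assms by (simp add: has_bochner_integral_iff)
qed

lemma gauss_le_rk:
  assumes "t > 0"
  shows "gauss t h \<le> 3456 * rk t h"
proof -
  \<comment> \<open>With w = (t + h^2) / (4 t) the exponential is exp(1/4) exp(-w). The constant is
    assembled from w^3 exp(-w) <= 27, exp(1/4) <= 2 and the 4^3 hidden in w^3: 27 * 2 * 64 =
    3456.\<close>
  define w where "w = (1 + h\<^sup>2 / t) / 4"
  have w: "w > 0" using assms by (simp add: w_def add_pos_nonneg)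
  have "w ^ 3 * exp (- w) \<le> 27"
    using powr_exp_le[of 3 w] w by (simp add: powr_numeral)
  then have "w ^ 3 * exp (- (h\<^sup>2 / (4 * t))) \<le> 27 * exp (1/4)"
  proof -
    have "exp (- (h\<^sup>2 / (4 * t))) = exp (- w) * exp (1/4)"
      by (simp add: w_def field_simps flip: exp_add)
    then show ?thesis using \<open>w ^ 3 * exp (- w) \<le> 27\<close> by (simp add: mult.assoc[symmetric] mult_right_mono)
  qed
  also have "27 * exp (1/4::real) \<le> 54"
  proof -
    have "exp (1/4::real) \<le> exp (1/2)" by simp
    also have "\<dots> \<le> 2" using exp_bound_half[of "1/2::real"] by simp
    finally show ?thesis by simp
  qed
  finally have e: "exp (- (h\<^sup>2 / (4 * t))) \<le> 54 / w ^ 3"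
    using w by (simp add: pos_le_divide_eq mult.commute)
  have "1 \<le> 4 * pi" using pi_gt3 by simp
  then have "sqrt t \<le> sqrt (4 * pi * t)"
    using assms by (intro real_sqrt_le_mono) (simp add: mult_le_cancel_right1)
  then have "gauss t h \<le> (54 / w ^ 3) / sqrt t"
    unfolding gauss_def using e assms w by (intro frac_le) auto
  also have "w = (t + h\<^sup>2) / (4 * t)"
    using assms by (simp add: w_def field_simps)
  also have "54 / ((t + h\<^sup>2) / (4 * t)) ^ 3 / sqrt t = 3456 * (t ^ 3 / sqrt t / (t + h\<^sup>2) ^ 3)"
    by (simp add: power_divide power_mult_distrib field_simps)
  also have "t ^ 3 / sqrt t = t powr (5/2)"
  proof -
    have "t powr (5/2) * sqrt t = t ^ 3"
      using powr_add[of t "5/2" "1/2"] powr_realpow[of t 3] assms by (simp add: powr_half_sqrt)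
    then show ?thesis using assms by (simp add: divide_eq_eq)
  qed
  finally show ?thesis by (simp add: rk_def)
qed

text \<open>The two spare factors t / (t + h^2), each at most one, are what pays for moments and
  weights in the estimates that follow.\<close>

lemma rk_eq_cauchy:
  assumes "t > 0"
  shows "rk t h = cauchy t h * (t / (t + h\<^sup>2))\<^sup>2"
proof -
  have "t powr (5/2) = sqrt t * t\<^sup>2"
    using powr_add[of t "1/2" 2] powr_realpow[of t 2] assms by (simp add: powr_half_sqrt)
  moreover have "t + h\<^sup>2 > 0" using assms by (simp add: add_pos_nonneg)
  ultimately show ?thesis
    by (simp add: rk_def cauchy_def power_divide power3_eq_cube power2_eq_square mult_ac)
qed

lemma rk_le_cauchy: "t > 0 \<Longrightarrow> rk t h \<le> cauchy t h"
  unfolding rk_eq_cauchy by (intro mult_left_le power_le_one) (auto simp: add_pos_nonneg intro!: divide_nonneg_pos)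

text \<open>Parabolic scaling: each h counts as sqrt t. With r = t + h^2, the moment |h|^p is at
  most r^(p/2), and the spare factors (t/r)^2 are at most (t/r)^(p/2) precisely because p <=
  4.\<close>

lemma rk_moment_le:
  assumes "t > 0" "0 \<le> p" "p \<le> 4"
  shows "rk t h * \<bar>h\<bar> powr p \<le> t powr (p / 2) * cauchy t h"
proof -
  define r where "r = t + h\<^sup>2"
  have r: "r > 0" "t \<le> r" "h\<^sup>2 \<le> r" using assms by (auto simp: r_def add_pos_nonneg)
  have "\<bar>h\<bar> powr p \<le> r powr (p / 2)"
  proof (cases "h = 0")
    case False
    then have "h\<^sup>2 = \<bar>h\<bar> powr 2"
      using powr_realpow[of "\<bar>h\<bar>" 2] by simp
    then have "\<bar>h\<bar> powr p = (h\<^sup>2) powr (p / 2)"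
      unfolding \<open>h\<^sup>2 = \<bar>h\<bar> powr 2\<close> powr_powr by simp
    also have "\<dots> \<le> r powr (p / 2)" using r assms by (intro powr_mono2) auto
    finally show ?thesis .
  qed simp
  moreover have "(t / r)\<^sup>2 \<le> (t / r) powr (p / 2)"
  proof -
    have "(t / r)\<^sup>2 = (t / r) powr 2" using assms r by (simp add: powr_numeral)
    also have "\<dots> \<le> (t / r) powr (p / 2)"
      using assms r by (intro powr_mono') auto
    finally show ?thesis .
  qed
  ultimately have "(t / r)\<^sup>2 * \<bar>h\<bar> powr p \<le> (t / r) powr (p / 2) * r powr (p / 2)"
    using assms by (intro mult_mono) auto
  also have "\<dots> = t powr (p / 2)" using assms r by (simp add: powr_divide)
  finally have "cauchy t h * ((t / r)\<^sup>2 * \<bar>h\<bar> powr p) \<le> cauchy t h * t powr (p / 2)"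
    using assms by (intro mult_left_mono) auto
  then show ?thesis using assms by (simp add: rk_eq_cauchy r_def mult_ac)
qed

lemma rk_mult_le:
  assumes "t > 0"
  shows "rk t h * (t + h\<^sup>2) \<le> t * cauchy t h"
proof -
  have r: "t + h\<^sup>2 > 0" "t \<le> t + h\<^sup>2" using assms by (auto simp: add_pos_nonneg)
  have "(t / (t + h\<^sup>2))\<^sup>2 * (t + h\<^sup>2) = t * (t / (t + h\<^sup>2))"
    using r by (simp add: power2_eq_square)
  also have "\<dots> \<le> t * 1"
  proof (rule mult_left_mono)
    show "t / (t + h\<^sup>2) \<le> 1" using r(2) unfolding divide_le_eq_1_pos[OF r(1)] .
  qed (use assms in simp)
  finally have "cauchy t h * ((t / (t + h\<^sup>2))\<^sup>2 * (t + h\<^sup>2)) \<le> cauchy t h * t"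
    using assms by (intro mult_left_mono) auto
  then show ?thesis using assms by (simp add: rk_eq_cauchy mult_ac)
qed

lemma abs_le_sqrt_sum:
  assumes "t > 0"
  shows "sqrt t * \<bar>h\<bar> \<le> t + h\<^sup>2"
proof -
  have "(sqrt t - \<bar>h\<bar>)\<^sup>2 = t + h\<^sup>2 - 2 * (sqrt t * \<bar>h\<bar>)"
    using assms by (simp add: power2_diff)
  moreover have "0 \<le> (sqrt t - \<bar>h\<bar>)\<^sup>2" "0 \<le> sqrt t * \<bar>h\<bar>" using assms by auto
  ultimately show ?thesis by linarith
qed

text \<open>Both spare factors are spent: one on t + h^2, the other on |h| through sqrt t |h| <= t +
  h^2. This is the weight met by the first moment of the deviation from the Gaussian.\<close>

lemma rk_mult_abs_le:
  assumes "t > 0"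
  shows "rk t h * (t + h\<^sup>2) * \<bar>h\<bar> \<le> t * sqrt t * cauchy t h"
proof -
  have r: "t + h\<^sup>2 > 0" using assms by (auto simp: add_pos_nonneg)
  have "(t / (t + h\<^sup>2))\<^sup>2 * (t + h\<^sup>2) * \<bar>h\<bar> = t * sqrt t * ((sqrt t * \<bar>h\<bar>) / (t + h\<^sup>2))"
    using r assms by (simp add: power2_eq_square)
  also have "\<dots> \<le> t * sqrt t * 1"
    using r assms abs_le_sqrt_sum[OF assms, of h] by (intro mult_left_mono) auto
  finally have "cauchy t h * ((t / (t + h\<^sup>2))\<^sup>2 * (t + h\<^sup>2) * \<bar>h\<bar>) \<le> cauchy t h * (t * sqrt t)"
    using assms by (intro mult_left_mono) auto
  then show ?thesis using assms by (simp add: rk_eq_cauchy mult_ac)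
qed

section \<open>Integrals dominated by the Cauchy kernel\<close>

lemma has_bochner_integral_cauchy:
  assumes "t > 0"
  shows "has_bochner_integral lborel (\<lambda>y. cauchy t (x - y)) pi"
proof -
  have "(\<integral>\<^sup>+h. ennreal (cauchy t h) * indicator {0..} h \<partial>lborel) = ennreal (pi / 2 - arctan (0 / sqrt t))"
  proof (rule nn_integral_FTC_atLeast)
    fix h :: real
    show "((\<lambda>h. arctan (h / sqrt t)) has_real_derivative cauchy t h) (at h)"
    proof (rule DERIV_cong[OF DERIV_chain2[OF DERIV_arctan DERIV_cdivide[OF DERIV_ident]]])
      have "1 + (h / sqrt t)\<^sup>2 = (t + h\<^sup>2) / t"
        using assms by (simp add: power_divide add_divide_distrib)
      then have "inverse (1 + (h / sqrt t)\<^sup>2) * (1 / sqrt t) = t / sqrt t / (t + h\<^sup>2)"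
        by simp
      then show "inverse (1 + (h / sqrt t)\<^sup>2) * (1 / sqrt t) = cauchy t h"
        using assms by (simp add: cauchy_def real_div_sqrt)
    qed
    show "0 \<le> cauchy t h" using assms by simp
  next
    have c: "((\<lambda>h::real. 1 / sqrt t) \<longlongrightarrow> 1 / sqrt t) at_top" "0 < 1 / sqrt t"
      using assms by auto
    have "LIM h at_top. (1 / sqrt t) * h :> at_top"
      by (rule filterlim_tendsto_pos_mult_at_top[OF c filterlim_ident])
    then have "LIM h at_top. h / sqrt t :> at_top" by simp
    then show "((\<lambda>h. arctan (h / sqrt t)) \<longlongrightarrow> pi / 2) at_top"
      by (rule filterlim_compose[OF tendsto_arctan_at_top])
  qed measurable
  then have "has_bochner_integral lborel (\<lambda>h. indicator {0..} h *\<^sub>R cauchy t h) (pi / 2)"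
  proof (intro has_bochner_integral_nn_integral)
    assume *: "(\<integral>\<^sup>+h. ennreal (cauchy t h) * indicator {0..} h \<partial>lborel) = ennreal (pi / 2 - arctan (0 / sqrt t))"
    have "(\<integral>\<^sup>+h. ennreal (indicator {0..} h *\<^sub>R cauchy t h) \<partial>lborel) = (\<integral>\<^sup>+h. ennreal (cauchy t h) * indicator {0..} h \<partial>lborel)"
      by (intro nn_integral_cong) (simp add: indicator_def)
    then show "(\<integral>\<^sup>+h. ennreal (indicator {0..} h *\<^sub>R cauchy t h) \<partial>lborel) = ennreal (pi / 2)"
      using * by simp
  qed (use assms in auto)
  then have "has_bochner_integral lborel (cauchy t) (2 *\<^sub>R (pi / 2))"
    by (rule has_bochner_integral_even_function) (simp add: cauchy_def)
  then have "has_bochner_integral lborel (cauchy t) pi" by simp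
  then show ?thesis
    using lborel_has_bochner_integral_real_affine_iff[of "- 1" "cauchy t" pi x] by simp
qed

lemma integrable_halfline_iff:
  "integrable halfline f \<longleftrightarrow> integrable lborel (\<lambda>y. if 0 < y then f y else (0::real))"
proof -
  have "integrable halfline f \<longleftrightarrow> integrable lborel (\<lambda>y. indicator {0<..} y *\<^sub>R f y)"
    unfolding halfline_def by (rule integrable_restrict_space) simp
  also have "(\<lambda>y. indicator {0<..} y *\<^sub>R f y) = (\<lambda>y. if 0 < y then f y else 0)"
    by (auto simp: indicator_def)
  finally show ?thesis .
qed

lemma integral_halfline_eq:
  "integral\<^sup>L halfline f = integral\<^sup>L lborel (\<lambda>y. if 0 < y then f y else (0::real))"
proof -
  have "integral\<^sup>L halfline f = integral\<^sup>L lborel (\<lambda>y. indicator {0<..} y *\<^sub>R f y)"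
    unfolding halfline_def by (rule integral_restrict_space) simp
  also have "(\<lambda>y. indicator {0<..} y *\<^sub>R f y) = (\<lambda>y. if 0 < y then f y else 0)"
    by (auto simp: indicator_def)
  finally show ?thesis .
qed

lemma integral_abs_le:
  fixes f g :: "'a \<Rightarrow> real"
  assumes "integrable M g" "f \<in> borel_measurable M" "\<And>x. x \<in> space M \<Longrightarrow> \<bar>f x\<bar> \<le> g x"
  shows "integrable M f" "\<bar>integral\<^sup>L M f\<bar> \<le> integral\<^sup>L M g"
proof -
  show f: "integrable M f"
  proof (rule Bochner_Integration.integrable_bound[OF assms(1,2)], rule AE_I2)
    fix x assume "x \<in> space M"
    from assms(3)[OF this] show "norm (f x) \<le> norm (g x)" by simp
  qed
  show "\<bar>integral\<^sup>L M f\<bar> \<le> integral\<^sup>L M g"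
    by (rule has_bochner_integral_abs_le[OF has_bochner_integral_integrable[OF f]
          has_bochner_integral_integrable[OF assms(1)] assms(3)])
qed

lemma lborel_cauchy_bound:
  assumes "t > 0" and "f \<in> borel_measurable borel" and "\<And>y. \<bar>f y\<bar> \<le> A * cauchy t (x - y)"
  shows "integrable lborel f" "\<bar>integral\<^sup>L lborel f\<bar> \<le> A * pi"
proof -
  have g: "has_bochner_integral lborel (\<lambda>y. A * cauchy t (x - y)) (A * pi)"
    by (intro has_bochner_integral_mult_right has_bochner_integral_cauchy assms)
  then have i: "integrable lborel (\<lambda>y. A * cauchy t (x - y))" and e: "(LBINT y. A * cauchy t (x - y)) = A * pi"
    unfolding has_bochner_integral_iff by auto
  have m: "f \<in> borel_measurable lborel" using assms(2) by simp
  show "integrable lborel f" by (rule integral_abs_le(1)[OF i m assms(3)])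
  show "\<bar>integral\<^sup>L lborel f\<bar> \<le> A * pi"
    using integral_abs_le(2)[OF i m assms(3)] unfolding e .
qed

lemma halfline_cauchy_bound:
  assumes "t > 0" and "f \<in> borel_measurable halfline" and "\<And>y. y > 0 \<Longrightarrow> \<bar>f y\<bar> \<le> A * cauchy t (x - y)" and "A \<ge> 0"
  shows "integrable halfline f" "\<bar>integral\<^sup>L halfline f\<bar> \<le> A * pi"
proof -
  have m: "(\<lambda>y. if 0 < y then f y else 0) \<in> borel_measurable borel"
  proof -
    have "(\<lambda>y. indicator {0<..} y *\<^sub>R f y) = (\<lambda>y. if 0 < y then f y else 0)" by (auto simp: indicator_def)
    then show ?thesis using assms(2) by (simp add: borel_measurable_halfline_iff)
  qed
  show "integrable halfline f" "\<bar>integral\<^sup>L halfline f\<bar> \<le> A * pi"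
    unfolding integrable_halfline_iff integral_halfline_eq
    using assms by (intro lborel_cauchy_bound[OF assms(1) m, where x = x and A = A]; simp)+
qed

text \<open>These two estimates carry all the size information on the kernel. The second is stated
  for every real y, with the kernel extended by zero, so that it also accounts for the Gaussian mass
  leaking across the origin: at such y the distance |x-y| is at least x, and the factor (t +
  (x-y)^2) / x^2 exceeds one.\<close>

locale bessel_heat =
  fixes lam C :: real
  assumes lam: "0 < lam" and C: "0 < C"
    and heat_le: "\<And>t x y. 0 < t \<Longrightarrow> 0 < x \<Longrightarrow> 0 < y \<Longrightarrow> heat_kernel lam t x y \<le> C * rk t (x - y)"
    and heat_gauss: "\<And>t x y. 0 < t \<Longrightarrow> 0 < x \<Longrightarrow>
      \<bar>(if 0 < y then heat_kernel lam t x y else 0) - gauss t (x - y)\<bar> \<le> C / x\<^sup>2 * (rk t (x - y) * (t + (x - y)\<^sup>2))"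

text \<open>The cut is at y = x/2. Below it |x-y| >= x/2, so four times the factor (t + (x-y)^2) /
  x^2 exceeds one and boundedness of the ratio suffices. Above it the argument of the ratio is at
  least x^2 / (4 t), and the bound A / z for its deviation from one gives 4 A t / x^2.\<close>

lemma bessel_heat_exists:
  assumes "lam > 0"
  obtains C where "bessel_heat lam C"
proof -
  obtain A where A: "A > 0" "\<And>z. z > 0 \<Longrightarrow> bessel_ratio lam z \<le> A"
    "\<And>z. z > 0 \<Longrightarrow> \<bar>bessel_ratio lam z - 1\<bar> \<le> A / z"
    using bessel_ratio_bounds[OF assms] by blast
  \<comment> \<open>Here 4 is the square of the 2 in x <= 2 |x-y|, \<open>A + 1\<close> bounds the
    deviation of the ratio from one, and 3456 passes from the Gaussian to its majorant.\<close>
  define C where "C = 4 * (A + 1) * 3456"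
  have "bessel_heat lam C"
  proof
    show "0 < lam" "0 < C" using assms A by (auto simp: C_def)
    fix t x y :: real
    assume t: "0 < t" and x: "0 < x"
    have g: "0 \<le> gauss t (x - y)" "gauss t (x - y) \<le> 3456 * rk t (x - y)" "0 \<le> rk t (x - y)"
      using t gauss_le_rk by auto
    {
      assume y: "0 < y"
      have "heat_kernel lam t x y = gauss t (x - y) * bessel_ratio lam (x * y / (2 * t))"
        using assms t x y by (rule heat_kernel_eq_gauss)
      also have "\<dots> \<le> (3456 * rk t (x - y)) * A"
        using A(2)[of "x * y / (2 * t)"] g t x y A bessel_ratio_nonneg[OF assms]
        by (intro mult_mono) auto
      also have "\<dots> \<le> C * rk t (x - y)"
        using g(3) A(1) by (simp add: C_def mult_right_mono algebra_simps)
      finally show "heat_kernel lam t x y \<le> C * rk t (x - y)" .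
    }
    have "\<bar>(if 0 < y then heat_kernel lam t x y else 0) - gauss t (x - y)\<bar> \<le> gauss t (x - y) * (4 * (A + 1) * (t + (x - y)\<^sup>2) / x\<^sup>2)"
    proof (cases "y \<le> x / 2")
      case True
      then have "(x / 2)\<^sup>2 \<le> (x - y)\<^sup>2" using x by (intro power_mono) auto
      then have "x\<^sup>2 \<le> 4 * (t + (x - y)\<^sup>2)" using t by (simp add: power_divide)
      then have 1: "1 \<le> 4 * (t + (x - y)\<^sup>2) / x\<^sup>2" using x by simp
      have "\<bar>(if 0 < y then heat_kernel lam t x y else 0) - gauss t (x - y)\<bar> \<le> gauss t (x - y) * (A + 1)"
      proof (cases "0 < y")
        case True
        have "heat_kernel lam t x y - gauss t (x - y) = gauss t (x - y) * (bessel_ratio lam (x * y / (2 * t)) - 1)"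
          using heat_kernel_eq_gauss[OF assms t x True] by (simp add: algebra_simps)
        moreover have "\<bar>bessel_ratio lam (x * y / (2 * t)) - 1\<bar> \<le> A + 1"
          using A(2)[of "x * y / (2 * t)"] bessel_ratio_nonneg[OF assms, of "x * y / (2 * t)"] t x True A(1)
          by (auto simp: abs_le_iff)
        ultimately show ?thesis using True g(1) by (simp add: abs_mult mult_left_mono)
      qed (use g A in \<open>auto simp: mult_le_cancel_left1\<close>)
      also have "\<dots> \<le> gauss t (x - y) * ((A + 1) * (4 * (t + (x - y)\<^sup>2) / x\<^sup>2))"
        using g A 1 mult_left_mono[OF 1, of "A + 1"] by (intro mult_left_mono) auto
      also have "\<dots> = gauss t (x - y) * (4 * (A + 1) * (t + (x - y)\<^sup>2) / x\<^sup>2)"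
        by (simp only: times_divide_eq_right mult_ac)
      finally show ?thesis .
    next
      case False
      then have y: "y > 0" "y > x / 2" using x by auto
      have "\<bar>bessel_ratio lam (x * y / (2 * t)) - 1\<bar> \<le> A / (x * y / (2 * t))"
        using t x y by (intro A(3)) auto
      also have "\<dots> = 2 * A * t / (x * y)" using t x y by (simp add: field_simps)
      also have "\<dots> \<le> 2 * A * t / (x * (x / 2))"
        using t x y A by (intro divide_left_mono mult_left_mono) auto
      also have "\<dots> = 4 * A * t / x\<^sup>2" by (simp add: power2_eq_square)
      also have "\<dots> \<le> 4 * (A + 1) * (t + (x - y)\<^sup>2) / x\<^sup>2"
        using t x A by (intro divide_right_mono mult_mono) auto
      finally have "gauss t (x - y) * \<bar>bessel_ratio lam (x * y / (2 * t)) - 1\<bar>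
        \<le> gauss t (x - y) * (4 * (A + 1) * (t + (x - y)\<^sup>2) / x\<^sup>2)"
        using g by (intro mult_left_mono)
      moreover have "heat_kernel lam t x y - gauss t (x - y) = gauss t (x - y) * (bessel_ratio lam (x * y / (2 * t)) - 1)"
        using heat_kernel_eq_gauss[OF assms t x y(1)] by (simp add: algebra_simps)
      ultimately show ?thesis using y g by (simp add: abs_mult)
    qed
    also have "\<dots> \<le> (3456 * rk t (x - y)) * (4 * (A + 1) * (t + (x - y)\<^sup>2) / x\<^sup>2)"
      using g t A by (intro mult_right_mono) (auto intro!: divide_nonneg_nonneg mult_nonneg_nonneg add_nonneg_nonneg)
    also have "\<dots> = C / x\<^sup>2 * (rk t (x - y) * (t + (x - y)\<^sup>2))" by (simp add: C_def)
    finally show "\<bar>(if 0 < y then heat_kernel lam t x y else 0) - gauss t (x - y)\<bar>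
      \<le> C / x\<^sup>2 * (rk t (x - y) * (t + (x - y)\<^sup>2))" .
  qed
  then show ?thesis by (rule that)
qed

text \<open>The two terms of t + d balance at t = d. Dropping the smaller one on either side leaves
  pure powers, and both pieces are multiples of d^(-1/2-\<sigma>). For d = (x-y)^2 this is the order
  |x-y|^(-1-2\<sigma>) of K.\<close>

lemma nn_integral_rk_le:
  assumes "d > 0" "0 < \<sigma>" "\<sigma> < 1"
  shows "(\<integral>\<^sup>+t. ennreal (t powr (5/2) / (t + d) ^ 3 / t powr (1 + \<sigma>)) \<partial>halfline)
    \<le> ennreal ((1 / (5/2 - \<sigma>) + 1 / (1/2 + \<sigma>)) * d powr (- 1/2 - \<sigma>))"
proof -
  have "(\<integral>\<^sup>+t. ennreal (t powr (5/2) / (t + d) ^ 3 / t powr (1 + \<sigma>)) \<partial>halfline)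
    \<le> (\<integral>\<^sup>+t. ennreal (if t \<le> d then 1 / d ^ 3 * t powr (3/2 - \<sigma>) else 1 * t powr (- (3/2 + \<sigma>))) \<partial>halfline)"
  proof (intro nn_integral_mono ennreal_leI)
    fix t assume "t \<in> space halfline"
    then have t: "t > 0" by simp
    have e: "t powr (5/2) / t powr (1 + \<sigma>) = t powr (3/2 - \<sigma>)"
      using t by (simp flip: powr_diff)
    show "t powr (5/2) / (t + d) ^ 3 / t powr (1 + \<sigma>)
      \<le> (if t \<le> d then 1 / d ^ 3 * t powr (3/2 - \<sigma>) else 1 * t powr (- (3/2 + \<sigma>)))"
    proof (cases "t \<le> d")
      case True
      have "t powr (3/2 - \<sigma>) / (t + d) ^ 3 \<le> t powr (3/2 - \<sigma>) / d ^ 3"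
        using t assms by (intro divide_left_mono power_mono mult_pos_pos) auto
      then show ?thesis using True e by (simp add: divide_divide_eq_left mult.commute flip: divide_divide_eq_left[of _ "t powr (1 + \<sigma>)"])
    next
      case False
      have "t powr (3/2 - \<sigma>) / (t + d) ^ 3 \<le> t powr (3/2 - \<sigma>) / t ^ 3"
        using t assms by (intro divide_left_mono power_mono mult_pos_pos) auto
      also have "\<dots> = t powr (3/2 - \<sigma>) / t powr 3" using t by (simp add: powr_numeral)
      also have "\<dots> = t powr (- (3/2 + \<sigma>))" unfolding powr_diff[symmetric] by (simp add: algebra_simps)
      finally show ?thesis using False e by (simp add: divide_divide_eq_left mult.commute flip: divide_divide_eq_left[of _ "t powr (1 + \<sigma>)"])
    qed
  qed
  also have "\<dots> = ennreal (1 / d ^ 3 * d powr (3/2 - \<sigma> + 1) / (3/2 - \<sigma> + 1) + 1 * d powr (1 - (3/2 + \<sigma>)) / (3/2 + \<sigma> - 1))"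
    using assms by (intro nn_integral_halfline_two_powers) auto
  also have "1 / d ^ 3 * d powr (3/2 - \<sigma> + 1) = d powr (3/2 - \<sigma> + 1) / d powr 3"
    using assms by (simp add: powr_numeral)
  also have "\<dots> = d powr (- 1/2 - \<sigma>)"
    unfolding powr_diff[symmetric] by (rule arg_cong[where f = "\<lambda>e. d powr e"]) simp
  also have "d powr (- 1/2 - \<sigma>) / (3/2 - \<sigma> + 1) + 1 * d powr (1 - (3/2 + \<sigma>)) / (3/2 + \<sigma> - 1)
     = (1 / (5/2 - \<sigma>) + 1 / (1/2 + \<sigma>)) * d powr (- 1/2 - \<sigma>)"
  proof -
    have e: "1 - (3/2 + \<sigma>) = - 1/2 - \<sigma>" "3/2 - \<sigma> + 1 = 5/2 - \<sigma>" "3/2 + \<sigma> - 1 = 1/2 + \<sigma>" by auto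
    show ?thesis
      unfolding e by (simp only: distrib_right mult_1_left times_divide_eq_left)
  qed
  finally show ?thesis .
qed

subsection \<open>The kernels \<open>K\<close> and \<open>B\<close>\<close>

lemma has_bochner_integral_two_powers:
  assumes "p > -1" "q > 1" "d > 0" "0 \<le> A" "0 \<le> B"
  shows "has_bochner_integral halfline (\<lambda>t. if t \<le> d then A * t powr p else B * t powr (- q))
    (A * d powr (p + 1) / (p + 1) + B * d powr (1 - q) / (q - 1))"
proof (rule has_bochner_integral_nn_integral)
  show "(\<integral>\<^sup>+t. ennreal (if t \<le> d then A * t powr p else B * t powr (- q)) \<partial>halfline)
    = ennreal (A * d powr (p + 1) / (p + 1) + B * d powr (1 - q) / (q - 1))"
    by (rule nn_integral_halfline_two_powers) fact+
  show "0 \<le> A * d powr (p + 1) / (p + 1) + B * d powr (1 - q) / (q - 1)"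
    using assms by (intro add_nonneg_nonneg[OF divide_nonneg_pos divide_nonneg_pos]) auto
  show "AE t in halfline. 0 \<le> (if t \<le> d then A * t powr p else B * t powr (- q))"
    using assms by auto
qed measurable

lemma Gamma_uminus_neg:
  fixes \<sigma> :: real
  assumes "0 < \<sigma>" "\<sigma> < 1"
  shows "- Gamma (- \<sigma>) > 0"
proof -
  have "- \<sigma> \<notin> \<int>\<^sub>\<le>\<^sub>0"
  proof
    assume "- \<sigma> \<in> \<int>\<^sub>\<le>\<^sub>0"
    then obtain n where "- \<sigma> = of_int n" by (auto elim!: nonpos_Ints_cases)
    then have n: "real_of_int n = - \<sigma>" by simp
    then have "real_of_int n > - 1" using assms by linarith
    then have "n > - 1" by linarith
    have "real_of_int n < 0" using n assms by linarith
    then have "n < 0" by linarith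
    then show False using \<open>n > - 1\<close> by linarith
  qed
  then have "Gamma (- \<sigma> + 1) = - \<sigma> * Gamma (- \<sigma>)"
    by (rule Gamma_plus1)
  moreover have "Gamma (- \<sigma> + 1) > 0" using assms by (intro Gamma_real_pos) simp
  ultimately show ?thesis using assms by (simp add: mult_less_0_iff)
qed

text \<open>Interpolation between a trivial and a linear bound. Deviations from the Gaussian are
  bounded both by a constant and by a multiple of t / x^2; any intermediate power can then be
  selected to match the growth of u or its derivative in x.\<close>

lemma min_one_le_powr:
  fixes a r \<gamma> M :: real
  assumes "0 \<le> a" "0 < r" "0 \<le> \<gamma>" "\<gamma> \<le> 1" "a \<le> M" "a \<le> M * r"
  shows "a \<le> M * r powr \<gamma>"
proof (cases "r \<le> 1")
  case True
  have "r powr 1 \<le> r powr \<gamma>" using assms True by (intro powr_mono') auto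
  then have "M * r \<le> M * r powr \<gamma>" using assms by (intro mult_left_mono) auto
  then show ?thesis using assms by linarith
next
  case False
  then have "1 \<le> r powr \<gamma>" using assms by (intro ge_one_powr_ge_zero) auto
  then have "M * 1 \<le> M * r powr \<gamma>" using assms by (intro mult_left_mono) auto
  then show ?thesis using assms by linarith
qed

section \<open>Moments of the Bessel heat kernel\<close>

context bessel_heat begin

lemma heat_nonneg: "0 < t \<Longrightarrow> 0 < x \<Longrightarrow> 0 < y \<Longrightarrow> 0 \<le> heat_kernel lam t x y"
  using heat_kernel_eq_gauss[OF lam] bessel_ratio_nonneg[OF lam] by simp

lemma heat_moment:
  assumes t: "0 < t" and x: "0 < x" and p: "0 \<le> p" "p \<le> 4" and A: "0 \<le> A"
    and [measurable]: "f \<in> borel_measurable halfline"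
    and f: "\<And>y. 0 < y \<Longrightarrow> \<bar>f y\<bar> \<le> A * \<bar>x - y\<bar> powr p"
  shows "integrable halfline (\<lambda>y. heat_kernel lam t x y * f y)"
    and "\<bar>\<integral>y. heat_kernel lam t x y * f y \<partial>halfline\<bar> \<le> C * A * t powr (p / 2) * pi"
proof -
  have b: "\<bar>heat_kernel lam t x y * f y\<bar> \<le> C * A * t powr (p / 2) * cauchy t (x - y)" if y: "y > 0" for y
  proof -
    have "\<bar>heat_kernel lam t x y * f y\<bar> \<le> (C * rk t (x - y)) * (A * \<bar>x - y\<bar> powr p)"
      using heat_nonneg[OF t x y] heat_le[OF t x y] f[OF y] t C A
      by (simp add: abs_mult mult_mono)
    also have "\<dots> = C * A * (rk t (x - y) * \<bar>x - y\<bar> powr p)" by simp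
    also have "\<dots> \<le> C * A * (t powr (p / 2) * cauchy t (x - y))"
      using C A rk_moment_le[OF t p] by (intro mult_left_mono) auto
    finally show ?thesis by (simp add: mult_ac)
  qed
  show "integrable halfline (\<lambda>y. heat_kernel lam t x y * f y)"
    and "\<bar>\<integral>y. heat_kernel lam t x y * f y \<partial>halfline\<bar> \<le> C * A * t powr (p / 2) * pi"
    by (rule halfline_cauchy_bound[OF t _ b], use C A in auto)+
qed

lemma heat_integrable_bounded:
  assumes t: "0 < t" and x: "0 < x" and A: "0 \<le> A"
    and [measurable]: "f \<in> borel_measurable halfline"
    and f: "\<And>y. 0 < y \<Longrightarrow> \<bar>f y\<bar> \<le> A"
  shows "integrable halfline (\<lambda>y. heat_kernel lam t x y * f y)"
    and "\<bar>\<integral>y. heat_kernel lam t x y * f y \<partial>halfline\<bar> \<le> C * A * pi"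
proof -
  have b: "\<bar>heat_kernel lam t x y * f y\<bar> \<le> C * A * cauchy t (x - y)" if y: "y > 0" for y
  proof -
    have "heat_kernel lam t x y \<le> C * cauchy t (x - y)"
      using heat_le[OF t x y] rk_le_cauchy[OF t, of "x - y"] C by (meson mult_left_mono order_trans less_imp_le)
    then have "\<bar>heat_kernel lam t x y * f y\<bar> \<le> (C * cauchy t (x - y)) * A"
      using heat_nonneg[OF t x y] f[OF y] t C A
      by (simp add: abs_mult mult_mono)
    then show ?thesis by (simp add: mult_ac)
  qed
  show "integrable halfline (\<lambda>y. heat_kernel lam t x y * f y)"
    and "\<bar>\<integral>y. heat_kernel lam t x y * f y \<partial>halfline\<bar> \<le> C * A * pi"
    by (rule halfline_cauchy_bound[OF t _ b], use C A in auto)+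
qed

lemma heat_integrable: "0 < t \<Longrightarrow> 0 < x \<Longrightarrow> integrable halfline (heat_kernel lam t x)"
  using heat_integrable_bounded(1)[of t x 1 "\<lambda>_. 1"] by simp

lemma heat_one_eq: "heat_one lam t x = (\<integral>y. heat_kernel lam t x y \<partial>halfline)"
  unfolding heat_one_def by (rule set_lebesgue_integral_halfline) measurable

text \<open>On the whole line the Gaussian has mass one, so the difference is the integral of the
  deviation of the extended kernel, of order t / x^2; uniform boundedness takes over for t > x^2.
  The exponent \<gamma> stays free: 0 and 1 serve B, while \<alpha>/2 and (1+\<alpha>)/2 serve the
  regularity estimates.\<close>

lemma heat_one_bound:
  assumes t: "0 < t" and x: "0 < x" and \<gamma>: "0 \<le> \<gamma>" "\<gamma> \<le> 1"
  shows "\<bar>heat_one lam t x - 1\<bar> \<le> (C * pi + 1) * (t / x\<^sup>2) powr \<gamma>"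
proof (rule min_one_le_powr[OF _ _ \<gamma>])
  have "\<bar>heat_one lam t x\<bar> \<le> C * pi"
    using heat_integrable_bounded(2)[of t x 1 "\<lambda>_. 1"] t x by (simp add: heat_one_eq)
  then show "\<bar>heat_one lam t x - 1\<bar> \<le> C * pi + 1" by linarith
  let ?w = "\<lambda>y. if 0 < y then heat_kernel lam t x y else 0"
  have i: "integrable lborel ?w"
    using heat_integrable[OF t x] unfolding integrable_halfline_iff .
  have "heat_one lam t x - 1 = (LBINT y. ?w y - gauss t (x - y))"
    using i has_bochner_integral_gauss[OF t, of x]
    by (simp add: heat_one_eq integral_halfline_eq has_bochner_integral_iff)
  also have "\<bar>\<dots>\<bar> \<le> C / x\<^sup>2 * t * pi"
  proof (rule lborel_cauchy_bound(2)[OF t, where x = x])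
    fix y
    have "C / x\<^sup>2 * (rk t (x - y) * (t + (x - y)\<^sup>2)) \<le> C / x\<^sup>2 * (t * cauchy t (x - y))"
      using C by (intro mult_left_mono rk_mult_le[OF t]) auto
    then show "\<bar>?w y - gauss t (x - y)\<bar> \<le> C / x\<^sup>2 * t * cauchy t (x - y)"
      using heat_gauss[OF t x, of y] by (simp only: mult.assoc)
  qed measurable
  also have "\<dots> = C * pi * (t / x\<^sup>2)" by simp
  also have "\<dots> \<le> (C * pi + 1) * (t / x\<^sup>2)" using t by (intro mult_right_mono) auto
  finally show "\<bar>heat_one lam t x - 1\<bar> \<le> (C * pi + 1) * (t / x\<^sup>2)" .
qed (use t x in auto)

text \<open>The Gaussian part is odd around \<open>x\<close>, so only the deviation from it contributes.\<close>

lemma heat_first_moment: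
  assumes t: "0 < t" and x: "0 < x" and \<gamma>: "0 \<le> \<gamma>" "\<gamma> \<le> 1"
  shows "\<bar>\<integral>y. (if \<epsilon> < \<bar>x - y\<bar> then heat_kernel lam t x y * (y - x) else 0) \<partial>halfline\<bar>
    \<le> C * pi * sqrt t * (t / x\<^sup>2) powr \<gamma>"
proof (rule min_one_le_powr[OF _ _ \<gamma>])
  let ?f = "\<lambda>y. if \<epsilon> < \<bar>x - y\<bar> then y - x else 0"
  have fm: "\<bar>?f y\<bar> \<le> 1 * \<bar>x - y\<bar> powr 1" for y by (simp add: abs_minus_commute)
  have e: "(\<lambda>y. if \<epsilon> < \<bar>x - y\<bar> then heat_kernel lam t x y * (y - x) else 0) = (\<lambda>y. heat_kernel lam t x y * ?f y)"
    by auto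
  have meas: "?f \<in> borel_measurable borel" by measurable
  have p: "0 \<le> (1::real)" "(1::real) \<le> 4" by auto
  note hm = heat_moment[OF t x p p(1) borel_measurable_halflineI[OF meas] fm]
  show "\<bar>\<integral>y. (if \<epsilon> < \<bar>x - y\<bar> then heat_kernel lam t x y * (y - x) else 0) \<partial>halfline\<bar> \<le> C * pi * sqrt t"
    using hm(2) t unfolding e by (simp add: powr_half_sqrt mult_ac)
  \<comment> \<open>The kernel is extended by zero to the whole line because the reflection y -> 2 x
    - y, which annihilates the Gaussian part, does not preserve the half-line. It does preserve the
    truncation set.\<close>
  let ?w = "\<lambda>y. if 0 < y then heat_kernel lam t x y else 0"
  have iw: "integrable lborel (\<lambda>y. ?w y * ?f y)"
  proof -
    have "(\<lambda>y. ?w y * ?f y) = (\<lambda>y. if 0 < y then heat_kernel lam t x y * ?f y else 0)" by auto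
    then show ?thesis using hm(1) unfolding integrable_halfline_iff by simp
  qed
  have ig: "integrable lborel (\<lambda>y. gauss t (x - y) * ?f y)"
  proof (rule lborel_cauchy_bound(1)[OF t, where x = x])
    fix y
    have "\<bar>gauss t (x - y) * ?f y\<bar> \<le> (3456 * rk t (x - y)) * (\<bar>x - y\<bar> powr 1)"
      using t gauss_le_rk[OF t, of "x - y"] fm[of y] unfolding abs_mult by (intro mult_mono) auto
    also have "\<dots> \<le> 3456 * (t powr (1/2) * cauchy t (x - y))"
      using rk_moment_le[OF t p, of "x - y"] by simp
    finally show "\<bar>gauss t (x - y) * ?f y\<bar> \<le> (3456 * t powr (1/2)) * cauchy t (x - y)" by (simp only: mult.assoc)
  qed measurable
  have g0: "(LBINT y. gauss t (x - y) * ?f y) = 0"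
  proof -
    have "(LBINT y. gauss t (x - y) * ?f y) = \<bar>- 1\<bar> *\<^sub>R (LBINT y. gauss t (x - (2 * x + (- 1) * y)) * ?f (2 * x + (- 1) * y))"
      by (rule lborel_integral_real_affine) simp
    also have "\<dots> = (LBINT y. - (gauss t (x - y) * ?f y))"
    proof -
      have "gauss t (x - (2 * x + (- 1) * y)) * ?f (2 * x + (- 1) * y) = - (gauss t (x - y) * ?f y)" for y
      proof -
        have e: "x - (2 * x + (- 1) * y) = - (x - y)" "2 * x + (- 1) * y - x = - (y - x)" by simp_all
        have g: "gauss t (- (x - y)) = gauss t (x - y)" by (simp add: gauss_def power2_commute)
        show ?thesis
          unfolding e g abs_minus_cancel by (cases "\<epsilon> < \<bar>x - y\<bar>") (simp_all add: algebra_simps)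
      qed
      then show ?thesis by simp
    qed
    finally show ?thesis by simp
  qed
  have "(\<integral>y. (if \<epsilon> < \<bar>x - y\<bar> then heat_kernel lam t x y * (y - x) else 0) \<partial>halfline)
      = (LBINT y. ?w y * ?f y) - (LBINT y. gauss t (x - y) * ?f y)"
    unfolding g0 e integral_halfline_eq by (auto intro!: Bochner_Integration.integral_cong)
  also have "\<dots> = (LBINT y. ?w y * ?f y - gauss t (x - y) * ?f y)"
    using iw ig by (rule Bochner_Integration.integral_diff[symmetric])
  also have "\<bar>\<dots>\<bar> \<le> C / x\<^sup>2 * (t * sqrt t) * pi"
  proof (rule lborel_cauchy_bound(2)[OF t, where x = x])
    fix y
    have "\<bar>?w y * ?f y - gauss t (x - y) * ?f y\<bar> = \<bar>?w y - gauss t (x - y)\<bar> * \<bar>?f y\<bar>"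
      unfolding left_diff_distrib[symmetric] abs_mult ..
    also have "\<dots> \<le> (C / x\<^sup>2 * (rk t (x - y) * (t + (x - y)\<^sup>2))) * \<bar>x - y\<bar>"
    proof (rule mult_mono)
      show "0 \<le> C / x\<^sup>2 * (rk t (x - y) * (t + (x - y)\<^sup>2))"
        by (rule order_trans[OF abs_ge_zero heat_gauss[OF t x]])
    qed (use fm[of y] heat_gauss[OF t x, of y] in auto)
    also have "\<dots> = C / x\<^sup>2 * (rk t (x - y) * (t + (x - y)\<^sup>2) * \<bar>x - y\<bar>)" by simp
    also have "\<dots> \<le> C / x\<^sup>2 * (t * sqrt t * cauchy t (x - y))"
      using C by (intro mult_left_mono rk_mult_abs_le[OF t]) auto
    finally show "\<bar>?w y * ?f y - gauss t (x - y) * ?f y\<bar> \<le> C / x\<^sup>2 * (t * sqrt t) * cauchy t (x - y)"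
      by (simp only: mult.assoc)
  qed measurable
  finally show "\<bar>\<integral>y. (if \<epsilon> < \<bar>x - y\<bar> then heat_kernel lam t x y * (y - x) else 0) \<partial>halfline\<bar>
      \<le> C * pi * sqrt t * (t / x\<^sup>2)" by (simp add: mult_ac)
qed (use t x in auto)

section \<open>The time integrals defining K and B\<close>

definition Ksig :: "real \<Rightarrow> real" where
  "Ksig \<sigma> = C * (1 / (5/2 - \<sigma>) + 1 / (1/2 + \<sigma>))"

lemma Ksig_pos: "0 < \<sigma> \<Longrightarrow> \<sigma> < 1 \<Longrightarrow> 0 < Ksig \<sigma>"
  unfolding Ksig_def using C by (intro mult_pos_pos add_pos_pos) auto

lemma nn_integral_heat_le:
  assumes "x > 0" "y > 0" "x \<noteq> y" "0 < \<sigma>" "\<sigma> < 1"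
  shows "(\<integral>\<^sup>+t. ennreal (K_integrand lam \<sigma> x y t) \<partial>halfline) \<le> ennreal (Ksig \<sigma> / \<bar>x - y\<bar> powr (1 + 2 * \<sigma>))"
proof -
  have d: "(x - y)\<^sup>2 > 0" using assms by simp
  have "(\<integral>\<^sup>+t. ennreal (K_integrand lam \<sigma> x y t) \<partial>halfline)
      \<le> (\<integral>\<^sup>+t. ennreal C * ennreal (t powr (5/2) / (t + (x - y)\<^sup>2) ^ 3 / t powr (1 + \<sigma>)) \<partial>halfline)"
  proof (intro nn_integral_mono)
    fix t assume "t \<in> space halfline"
    then have t: "t > 0" by simp
    have "K_integrand lam \<sigma> x y t \<le> C * rk t (x - y) / t powr (1 + \<sigma>)"
      unfolding K_integrand_def using heat_le[OF t assms(1,2)] by (intro divide_right_mono) auto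
    then show "ennreal (K_integrand lam \<sigma> x y t)
      \<le> ennreal C * ennreal (t powr (5/2) / (t + (x - y)\<^sup>2) ^ 3 / t powr (1 + \<sigma>))"
      using C t by (subst ennreal_mult'[symmetric]) (auto simp: rk_def intro!: ennreal_leI)
  qed
  also have "\<dots> = ennreal C * (\<integral>\<^sup>+t. ennreal (t powr (5/2) / (t + (x - y)\<^sup>2) ^ 3 / t powr (1 + \<sigma>)) \<partial>halfline)"
    by (rule nn_integral_cmult) measurable
  also have "\<dots> \<le> ennreal C * ennreal ((1 / (5/2 - \<sigma>) + 1 / (1/2 + \<sigma>)) * ((x - y)\<^sup>2) powr (- 1/2 - \<sigma>))"
    by (intro mult_left_mono nn_integral_rk_le d assms) simp
  also have "\<dots> = ennreal (Ksig \<sigma> * ((x - y)\<^sup>2) powr (- 1/2 - \<sigma>))"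
    using C by (subst ennreal_mult'[symmetric]) (auto simp: Ksig_def mult.assoc)
  also have "((x - y)\<^sup>2) powr (- 1/2 - \<sigma>) = \<bar>x - y\<bar> powr (- (1 + 2 * \<sigma>))"
  proof -
    have e: "(x - y)\<^sup>2 = \<bar>x - y\<bar> powr 2" using assms powr_realpow[of "\<bar>x - y\<bar>" 2] by simp
    show ?thesis unfolding e powr_powr by (simp add: algebra_simps)
  qed
  finally show ?thesis by (simp only: powr_minus divide_inverse)
qed

lemma K_integrand_nonneg: "0 < x \<Longrightarrow> 0 < y \<Longrightarrow> 0 < t \<Longrightarrow> 0 \<le> K_integrand lam \<sigma> x y t"
  unfolding K_integrand_def using heat_nonneg by simp

lemma K_integrand_measurable [measurable (raw)]:
  assumes [measurable]: "f \<in> borel_measurable M" "g \<in> borel_measurable M" "h \<in> borel_measurable M"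
  shows "(\<lambda>w. K_integrand lam \<sigma> (f w) (g w) (h w)) \<in> borel_measurable M"
  unfolding K_integrand_def by measurable

lemma K_integrand_integrable:
  assumes "x > 0" "y > 0" "x \<noteq> y" "0 < \<sigma>" "\<sigma> < 1"
  shows "integrable halfline (K_integrand lam \<sigma> x y)"
proof (rule integrableI_bounded)
  have "(\<integral>\<^sup>+t. ennreal (norm (K_integrand lam \<sigma> x y t)) \<partial>halfline) = (\<integral>\<^sup>+t. ennreal (K_integrand lam \<sigma> x y t) \<partial>halfline)"
    using assms K_integrand_nonneg by (intro nn_integral_cong) simp
  then show "(\<integral>\<^sup>+t. ennreal (norm (K_integrand lam \<sigma> x y t)) \<partial>halfline) < \<infinity>"
    using nn_integral_heat_le[OF assms] by (simp add: order.strict_trans1)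
qed measurable

lemma K_kernel_eq:
  "K_kernel lam \<sigma> x y = 1 / (- Gamma (- \<sigma>)) * (\<integral>t. K_integrand lam \<sigma> x y t \<partial>halfline)"
  unfolding K_kernel_def by (subst set_lebesgue_integral_halfline) measurable

lemma K_integral_bounds:
  assumes "x > 0" "y > 0" "x \<noteq> y" "0 < \<sigma>" "\<sigma> < 1"
  shows "0 \<le> (\<integral>t. K_integrand lam \<sigma> x y t \<partial>halfline)"
    and "(\<integral>t. K_integrand lam \<sigma> x y t \<partial>halfline) \<le> Ksig \<sigma> / \<bar>x - y\<bar> powr (1 + 2 * \<sigma>)"
proof -
  have nn: "AE t in halfline. 0 \<le> K_integrand lam \<sigma> x y t"
    using assms K_integrand_nonneg by auto
  show "0 \<le> (\<integral>t. K_integrand lam \<sigma> x y t \<partial>halfline)"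
    by (rule integral_nonneg_AE[OF nn])
  have "ennreal (\<integral>t. K_integrand lam \<sigma> x y t \<partial>halfline) \<le> ennreal (Ksig \<sigma> / \<bar>x - y\<bar> powr (1 + 2 * \<sigma>))"
    using nn_integral_eq_integral[OF K_integrand_integrable[OF assms] nn] nn_integral_heat_le[OF assms] by simp
  then show "(\<integral>t. K_integrand lam \<sigma> x y t \<partial>halfline) \<le> Ksig \<sigma> / \<bar>x - y\<bar> powr (1 + 2 * \<sigma>)"
    using Ksig_pos[OF assms(4,5)] by (subst (asm) ennreal_le_iff) auto
qed

lemma K_kernel_bounds:
  assumes "x > 0" "y > 0" "x \<noteq> y" "0 < \<sigma>" "\<sigma> < 1"
  shows "0 \<le> K_kernel lam \<sigma> x y"
    and "K_kernel lam \<sigma> x y \<le> (Ksig \<sigma> / (- Gamma (- \<sigma>))) / \<bar>x - y\<bar> powr (1 + 2 * \<sigma>)"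
proof -
  have g: "0 \<le> 1 / (- Gamma (- \<sigma>))" using Gamma_uminus_neg[OF assms(4,5)] by simp
  show "0 \<le> K_kernel lam \<sigma> x y"
    unfolding K_kernel_eq by (rule mult_nonneg_nonneg[OF g K_integral_bounds(1)[OF assms]])
  have "K_kernel lam \<sigma> x y \<le> 1 / (- Gamma (- \<sigma>)) * (Ksig \<sigma> / \<bar>x - y\<bar> powr (1 + 2 * \<sigma>))"
    unfolding K_kernel_eq by (rule mult_left_mono[OF K_integral_bounds(2)[OF assms] g])
  then show "K_kernel lam \<sigma> x y \<le> (Ksig \<sigma> / (- Gamma (- \<sigma>))) / \<bar>x - y\<bar> powr (1 + 2 * \<sigma>)" by simp
qed

lemma heat_one_measurable [measurable (raw)]:
  assumes [measurable]: "f \<in> borel_measurable M" "g \<in> borel_measurable M"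
  shows "(\<lambda>w. heat_one lam (f w) (g w)) \<in> borel_measurable M"
  unfolding heat_one_eq by measurable

lemma B_integrand_measurable [measurable]: "B_integrand lam \<sigma> x \<in> borel_measurable halfline"
  unfolding B_integrand_def[abs_def] by measurable

lemma B_integral:
  assumes "x > 0" "0 < \<sigma>" "\<sigma> < 1"
  shows "integrable halfline (B_integrand lam \<sigma> x)"
    and "\<bar>\<integral>t. B_integrand lam \<sigma> x t \<partial>halfline\<bar> \<le> (C * pi + 1) * (1 / (1 - \<sigma>) + 1 / \<sigma>) / x powr (2 * \<sigma>)"
proof -
  define M where "M = C * pi + 1"
  have M: "M > 0" using C by (simp add: M_def add_pos_pos)
  \<comment> \<open>Up to t = x^2 the bound with \<gamma> = 1 is the better one, afterwards the one
    with \<gamma> = 0. With this crossover both pieces are multiples of x^(-2\<sigma>).\<close>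
  let ?g = "\<lambda>t. if t \<le> x\<^sup>2 then M / x\<^sup>2 * t powr (- \<sigma>) else M * t powr (- (1 + \<sigma>))"
  have g: "has_bochner_integral halfline ?g
      (M / x\<^sup>2 * (x\<^sup>2) powr (- \<sigma> + 1) / (- \<sigma> + 1) + M * (x\<^sup>2) powr (1 - (1 + \<sigma>)) / (1 + \<sigma> - 1))"
    using assms M by (intro has_bochner_integral_two_powers) auto
  have v: "M / x\<^sup>2 * (x\<^sup>2) powr (- \<sigma> + 1) / (- \<sigma> + 1) + M * (x\<^sup>2) powr (1 - (1 + \<sigma>)) / (1 + \<sigma> - 1)
      = M * (1 / (1 - \<sigma>) + 1 / \<sigma>) / x powr (2 * \<sigma>)"
  proof -
    have "(x\<^sup>2) powr (- \<sigma>) = x powr (- (2 * \<sigma>))"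
    proof -
      have e: "x\<^sup>2 = x powr 2" using assms powr_realpow[of x 2] by simp
      show ?thesis unfolding e powr_powr by simp
    qed
    moreover have "(x\<^sup>2) powr (- \<sigma> + 1) = (x\<^sup>2) powr (- \<sigma>) * x\<^sup>2"
      using powr_add[of "x\<^sup>2" "- \<sigma>" 1] assms by simp
    ultimately have "M / x\<^sup>2 * (x\<^sup>2) powr (- \<sigma> + 1) / (- \<sigma> + 1) + M * (x\<^sup>2) powr (1 - (1 + \<sigma>)) / (1 + \<sigma> - 1)
       = M * x powr (- (2 * \<sigma>)) / (1 - \<sigma>) + M * x powr (- (2 * \<sigma>)) / \<sigma>"
      using assms by simp
    also have "\<dots> = M * (1 / (1 - \<sigma>) + 1 / \<sigma>) * x powr (- (2 * \<sigma>))"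
      by (simp only: distrib_left distrib_right times_divide_eq_left times_divide_eq_right mult_1_left mult_1_right)
    finally show ?thesis by (simp add: powr_minus divide_inverse)
  qed
  have b: "\<bar>B_integrand lam \<sigma> x t\<bar> \<le> ?g t" if t: "t \<in> space halfline" for t
  proof -
    have t: "t > 0" using t by simp
    have eq: "\<bar>B_integrand lam \<sigma> x t\<bar> = \<bar>heat_one lam t x - 1\<bar> / t powr (1 + \<sigma>)"
      by (simp add: B_integrand_def)
    show ?thesis
    proof (cases "t \<le> x\<^sup>2")
      case True
      have "\<bar>heat_one lam t x - 1\<bar> / t powr (1 + \<sigma>) \<le> M * (t / x\<^sup>2) powr 1 / t powr (1 + \<sigma>)"
        using heat_one_bound[OF t assms(1), of 1] by (intro divide_right_mono) (auto simp: M_def)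
      also have "\<dots> = M / x\<^sup>2 * (t powr 1 / t powr (1 + \<sigma>))" using t by simp
      also have "t powr 1 / t powr (1 + \<sigma>) = t powr (- \<sigma>)" unfolding powr_diff[symmetric] by simp
      finally show ?thesis using True eq by simp
    next
      case False
      have "(t / x\<^sup>2) powr 0 \<le> 1" by simp
      then have "\<bar>heat_one lam t x - 1\<bar> \<le> M"
        using heat_one_bound[OF t assms(1), of 0] t assms(1) by (simp add: M_def)
      then have "\<bar>heat_one lam t x - 1\<bar> / t powr (1 + \<sigma>) \<le> M / t powr (1 + \<sigma>)"
        by (intro divide_right_mono) auto
      moreover have "?g t = M / t powr (1 + \<sigma>)"
        using False by (simp only: if_False powr_minus divide_inverse)
      ultimately show ?thesis unfolding eq by simp
    qed
  qed
  have ig: "integrable halfline ?g" using g by (rule integrable.intros)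
  show "integrable halfline (B_integrand lam \<sigma> x)"
    by (rule integral_abs_le(1)[OF ig _ b]) measurable
  have "\<bar>\<integral>t. B_integrand lam \<sigma> x t \<partial>halfline\<bar> \<le> integral\<^sup>L halfline ?g"
    by (rule integral_abs_le(2)[OF ig _ b]) measurable
  also have "\<dots> = M * (1 / (1 - \<sigma>) + 1 / \<sigma>) / x powr (2 * \<sigma>)"
    unfolding has_bochner_integral_integral_eq[OF g] v ..
  finally show "\<bar>\<integral>t. B_integrand lam \<sigma> x t \<partial>halfline\<bar> \<le> (C * pi + 1) * (1 / (1 - \<sigma>) + 1 / \<sigma>) / x powr (2 * \<sigma>)"
    unfolding M_def .
qed

lemma B_fun_eq: "B_fun lam \<sigma> x = 1 / Gamma (- \<sigma>) * (\<integral>t. B_integrand lam \<sigma> x t \<partial>halfline)"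
  unfolding B_fun_def by (subst set_lebesgue_integral_halfline) measurable

lemma B_fun_bound:
  assumes "x > 0" "0 < \<sigma>" "\<sigma> < 1"
  shows "\<bar>B_fun lam \<sigma> x\<bar> \<le> ((C * pi + 1) * (1 / (1 - \<sigma>) + 1 / \<sigma>) / (- Gamma (- \<sigma>))) / x powr (2 * \<sigma>)"
proof -
  have g: "- Gamma (- \<sigma>) > 0" using Gamma_uminus_neg[OF assms(2,3)] .
  have "\<bar>B_fun lam \<sigma> x\<bar> = \<bar>\<integral>t. B_integrand lam \<sigma> x t \<partial>halfline\<bar> / (- Gamma (- \<sigma>))"
    unfolding B_fun_eq abs_mult using g by simp
  also have "\<dots> \<le> ((C * pi + 1) * (1 / (1 - \<sigma>) + 1 / \<sigma>) / x powr (2 * \<sigma>)) / (- Gamma (- \<sigma>))"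
    using g by (intro divide_right_mono B_integral(2)[OF assms]) auto
  finally show ?thesis by (simp add: field_simps)
qed

lemma kernel_estimates:
  assumes "0 < \<sigma>" "\<sigma> < 1"
  shows "(\<forall>x>0. \<forall>y>0. x \<noteq> y \<longrightarrow> set_integrable lebesgue {0<..} (K_integrand lam \<sigma> x y))
    \<and> (\<forall>x>0. set_integrable lebesgue {0<..} (B_integrand lam \<sigma> x))
    \<and> (\<exists>C. (\<forall>x>0. \<forall>y>0. x \<noteq> y \<longrightarrow>
              0 \<le> K_kernel lam \<sigma> x y \<and> K_kernel lam \<sigma> x y \<le> C / \<bar>x - y\<bar> powr (1 + 2 * \<sigma>))
           \<and> (\<forall>x>0. \<bar>B_fun lam \<sigma> x\<bar> \<le> C / x powr (2 * \<sigma>)))"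
proof (intro conjI exI allI impI)
  let ?C1 = "Ksig \<sigma> / (- Gamma (- \<sigma>))"
  let ?C2 = "(C * pi + 1) * (1 / (1 - \<sigma>) + 1 / \<sigma>) / (- Gamma (- \<sigma>))"
  fix x :: real assume x: "x > 0"
  show "set_integrable lebesgue {0<..} (B_integrand lam \<sigma> x)"
    using B_integral(1)[OF x assms] by (subst set_integrable_halfline) auto
  show "\<bar>B_fun lam \<sigma> x\<bar> \<le> max ?C1 ?C2 / x powr (2 * \<sigma>)"
    by (rule order_trans[OF B_fun_bound[OF x assms]]) (intro divide_right_mono max.cobounded2, simp)
  fix y :: real assume y: "y > 0" "x \<noteq> y"
  show "set_integrable lebesgue {0<..} (K_integrand lam \<sigma> x y)"
    using K_integrand_integrable[OF x y assms] by (subst set_integrable_halfline) auto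
  show "0 \<le> K_kernel lam \<sigma> x y" by (rule K_kernel_bounds[OF x y assms])
  show "K_kernel lam \<sigma> x y \<le> max ?C1 ?C2 / \<bar>x - y\<bar> powr (1 + 2 * \<sigma>)"
    by (rule order_trans[OF K_kernel_bounds(2)[OF x y assms]]) (intro divide_right_mono max.cobounded1, simp)
qed

end

subsection \<open>Weber's integral\<close>

lemma halfline_square_subst:
  assumes [measurable]: "f \<in> borel_measurable borel" and f: "has_bochner_integral halfline f b"
  shows "has_bochner_integral halfline (\<lambda>y. 2 * y * f (y\<^sup>2)) b"
proof -
  have fm: "f \<in> borel_measurable halfline" by (rule borel_measurable_halflineI) simp
  have "f absolutely_integrable_on {0<..} \<and> integral {0<..} f = b"
    using f set_integrable_halfline[OF fm] set_lebesgue_integral_halfline[OF fm]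
      set_lebesgue_integral_eq_integral(2)[of "{0<..}" f]
    by (auto simp: has_bochner_integral_iff)
  moreover have "(\<lambda>y::real. y\<^sup>2) ` {0<..} = {0<..}"
  proof (intro equalityI subsetI)
    fix v :: real assume "v \<in> {0<..}"
    then show "v \<in> (\<lambda>y. y\<^sup>2) ` {0<..}" by (intro image_eqI[of _ _ "sqrt v"]) auto
  qed auto
  ultimately have "f absolutely_integrable_on ((\<lambda>y. y\<^sup>2) ` {0<..}) \<and> integral ((\<lambda>y. y\<^sup>2) ` {0<..}) f = b"
    by simp
  moreover have "((\<lambda>y. y\<^sup>2) has_field_derivative 2 * y) (at y within {0<..})" for y :: real
    by (auto intro!: derivative_eq_intros)
  moreover have "inj_on (\<lambda>y::real. y\<^sup>2) {0<..}" by (auto simp: inj_on_def power2_eq_iff)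
  ultimately have a: "(\<lambda>y. \<bar>2 * y\<bar> * f (y\<^sup>2)) absolutely_integrable_on {0<..}"
    and b: "integral {0<..} (\<lambda>y. \<bar>2 * y\<bar> * f (y\<^sup>2)) = b"
    using has_absolute_integral_change_of_variables_1'[of "{0<..}" "\<lambda>y. y\<^sup>2" "\<lambda>y. 2 * y" f b] by auto
  have gm: "(\<lambda>y. \<bar>2 * y\<bar> * f (y\<^sup>2)) \<in> borel_measurable halfline"
    by (rule borel_measurable_halflineI) measurable
  have "has_bochner_integral halfline (\<lambda>y. \<bar>2 * y\<bar> * f (y\<^sup>2)) b"
    using a b set_integrable_halfline[OF gm] set_lebesgue_integral_halfline[OF gm]
      set_lebesgue_integral_eq_integral(2)[OF a]
    by (simp add: has_bochner_integral_iff)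
  then show ?thesis
    by (subst has_bochner_integral_cong[OF refl _ refl]) auto
qed

lemma has_bochner_integral_gaussian_power:
  assumes "q > 0" "t > 0"
  shows "has_bochner_integral halfline (\<lambda>y. y powr (2 * q - 1) * exp (- (t * y\<^sup>2))) (Gamma q / (2 * t powr q))"
proof -
  have "has_bochner_integral halfline (\<lambda>y. 2 * y * ((y\<^sup>2) powr (q - 1) * exp (- (t * y\<^sup>2)))) (Gamma q / t powr q)"
    using assms by (intro halfline_square_subst[where f = "\<lambda>v. v powr (q - 1) * exp (- (t * v))"] has_bochner_integral_Gamma) auto
  then have "has_bochner_integral halfline (\<lambda>y. 1/2 * (2 * y * ((y\<^sup>2) powr (q - 1) * exp (- (t * y\<^sup>2))))) (1/2 * (Gamma q / t powr q))"
    by (rule has_bochner_integral_mult_right)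
  moreover have "1/2 * (2 * y * ((y\<^sup>2) powr (q - 1) * exp (- (t * y\<^sup>2)))) = y powr (2 * q - 1) * exp (- (t * y\<^sup>2))"
    if "y \<in> space halfline" for y
  proof -
    have y: "y > 0" using that by simp
    have "(y\<^sup>2) powr (q - 1) = y powr (2 * (q - 1))"
    proof -
      have e: "y\<^sup>2 = y powr 2" using y powr_realpow[of y 2] by simp
      show ?thesis unfolding e powr_powr ..
    qed
    then have "y * (y\<^sup>2) powr (q - 1) = y powr 1 * y powr (2 * (q - 1))" using y by simp
    also have "\<dots> = y powr (2 * q - 1)" unfolding powr_add[symmetric] by (simp add: algebra_simps)
    finally show ?thesis by simp
  qed
  ultimately show ?thesis
    by (subst has_bochner_integral_cong[OF refl _ refl]) auto
qed

section \<open>A terminating Kummer series\<close>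

lemma pos_not_nonpos_Ints: "x > 0 \<Longrightarrow> (x::real) \<notin> \<int>\<^sub>\<le>\<^sub>0"
  by (auto dest: nonpos_Ints_nonpos)

text \<open>Vandermonde's convolution for generalised binomials with upper entries n and m + \<mu> -
  1. The condition \<open>k \<le> n\<close> records that n choose k vanishes otherwise; the sum over
  k has the fixed length m, so a later summation over n can be done for each k separately.\<close>

lemma Gamma_ratio_Vandermonde:
  assumes "\<mu> > 0"
  shows "Gamma (real (m + n) + \<mu>) / (fact n * Gamma (real n + \<mu>))
    = (\<Sum>k\<le>m. if k \<le> n then real (m choose k) * Gamma (real m + \<mu>) / Gamma (real k + \<mu>) / fact (n - k) else 0)"
proof -
  have gp: "Gamma (real k + \<mu>) > 0" for k using assms by (rule Gamma_shift_pos)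
  have poch: "pochhammer (real k + \<mu>) j = Gamma (real (k + j) + \<mu>) / Gamma (real k + \<mu>)" for k j
    using pochhammer_Gamma[of "real k + \<mu>" j] pos_not_nonpos_Ints[of "real k + \<mu>"] assms
    by (simp add: algebra_simps)
  have "(\<Sum>k\<le>m. (real n gchoose k) * ((real m + \<mu> - 1) gchoose (m - k))) = (real n + (real m + \<mu> - 1)) gchoose m"
    using gbinomial_Vandermonde[of "real n" "real m + \<mu> - 1" m] by (simp add: atMost_atLeast0)
  also have "\<dots> = pochhammer (real n + \<mu>) m / fact m"
    by (simp add: gbinomial_pochhammer' algebra_simps)
  also have "\<dots> = Gamma (real (m + n) + \<mu>) / Gamma (real n + \<mu>) / fact m"
    unfolding poch by (simp add: add.commute)
  finally have eq: "Gamma (real (m + n) + \<mu>) / Gamma (real n + \<mu>) / fact m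
    = (\<Sum>k\<le>m. (real n gchoose k) * ((real m + \<mu> - 1) gchoose (m - k)))" ..
  have "Gamma (real (m + n) + \<mu>) / (fact n * Gamma (real n + \<mu>))
    = fact m / fact n * (Gamma (real (m + n) + \<mu>) / Gamma (real n + \<mu>) / fact m)"
    by simp
  also have "\<dots> = (\<Sum>k\<le>m. fact m / fact n * ((real n gchoose k) * ((real m + \<mu> - 1) gchoose (m - k))))"
    unfolding eq by (rule sum_distrib_left)
  also have "\<dots> = (\<Sum>k\<le>m. if k \<le> n then real (m choose k) * Gamma (real m + \<mu>) / Gamma (real k + \<mu>) / fact (n - k) else 0)"
  proof (intro sum.cong refl)
    fix k assume "k \<in> {..m}"
    then have k: "k \<le> m" by simp
    have "real m + \<mu> - 1 - real (m - k) + 1 = real k + \<mu>" using k by (simp add: of_nat_diff)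
    then have "(real m + \<mu> - 1) gchoose (m - k) = pochhammer (real k + \<mu>) (m - k) / fact (m - k)"
      by (simp add: gbinomial_pochhammer' add.commute)
    also have "\<dots> = Gamma (real m + \<mu>) / Gamma (real k + \<mu>) / fact (m - k)"
      unfolding poch using k by simp
    finally have b: "(real m + \<mu> - 1) gchoose (m - k) = Gamma (real m + \<mu>) / Gamma (real k + \<mu>) / fact (m - k)" .
    have a: "(real n gchoose k) = real (n choose k)" by (simp add: binomial_gbinomial)
    show "fact m / fact n * ((real n gchoose k) * ((real m + \<mu> - 1) gchoose (m - k)))
      = (if k \<le> n then real (m choose k) * Gamma (real m + \<mu>) / Gamma (real k + \<mu>) / fact (n - k) else 0)"
    proof (cases "k \<le> n")
      case True
      have c: "real (m choose k) = fact m / (fact k * fact (m - k))"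
        "real (n choose k) = fact n / (fact k * fact (n - k))"
        using binomial_fact[OF k, where 'a = real] binomial_fact[OF True, where 'a = real] by auto
      show ?thesis unfolding a b c using True by simp
    qed (simp add: a)
  qed
  finally show ?thesis .
qed

lemma sums_exp_shift: "(\<lambda>n. if k \<le> n then x ^ n / fact (n - k) else 0) sums (x ^ k * exp (x::real))"
proof -
  have "(\<lambda>n. x ^ k * (x ^ n /\<^sub>R fact n)) sums (x ^ k * exp x)"
    by (intro sums_mult exp_converges)
  then have "(\<lambda>n. (\<lambda>n. if k \<le> n then x ^ n / fact (n - k) else 0) (n + k)) sums (x ^ k * exp x)"
    by (simp add: power_add field_simps)
  then show ?thesis
    by (subst (asm) sums_iff_shift) simp
qed

text \<open>Kummer's transformation of 1F1(m + \<mu>; \<mu>; x): an integer shift leaves exp x times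
  a polynomial, here m! times the Laguerre polynomial of degree m and order \<mu> - 1 at -x. Both
  signs of x are used below, one for the value of an integral and one for its domination.\<close>

lemma kummer_sums:
  assumes "\<mu> > 0"
  shows "(\<lambda>n. x ^ n * (Gamma (real (m + n) + \<mu>) / (fact n * Gamma (real n + \<mu>))))
    sums (exp x * (\<Sum>k\<le>m. real (m choose k) * Gamma (real m + \<mu>) / Gamma (real k + \<mu>) * x ^ k))"
proof -
  have "(\<lambda>n. \<Sum>k\<le>m. real (m choose k) * Gamma (real m + \<mu>) / Gamma (real k + \<mu>) * (if k \<le> n then x ^ n / fact (n - k) else 0))
    sums (\<Sum>k\<le>m. real (m choose k) * Gamma (real m + \<mu>) / Gamma (real k + \<mu>) * (x ^ k * exp x))"
    by (intro sums_sum sums_mult sums_exp_shift)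
  also have "(\<Sum>k\<le>m. real (m choose k) * Gamma (real m + \<mu>) / Gamma (real k + \<mu>) * (x ^ k * exp x))
    = exp x * (\<Sum>k\<le>m. real (m choose k) * Gamma (real m + \<mu>) / Gamma (real k + \<mu>) * x ^ k)"
    by (simp add: sum_distrib_left mult_ac)
  also have "(\<lambda>n. \<Sum>k\<le>m. real (m choose k) * Gamma (real m + \<mu>) / Gamma (real k + \<mu>) * (if k \<le> n then x ^ n / fact (n - k) else 0))
    = (\<lambda>n. x ^ n * (Gamma (real (m + n) + \<mu>) / (fact n * Gamma (real n + \<mu>))))"
    unfolding Gamma_ratio_Vandermonde[OF assms] sum_distrib_left
    by (intro ext sum.cong) (auto simp: mult_ac)
  finally show ?thesis .
qed

text \<open>\<open>J\<close> without its leading power: up to a constant, \<open>z powr (1/2 - lam) * bessel_J (lam - 1/2) z\<close>.\<close>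

definition jb :: "real \<Rightarrow> real \<Rightarrow> real" where
  "jb lam w = bes (lam + 1/2) (- (w\<^sup>2 / 4))"

lemma measurable_jb [measurable]: "jb lam \<in> borel_measurable borel"
  unfolding jb_def[abs_def] by measurable

lemma jb_abs_le: "lam > 0 \<Longrightarrow> \<bar>jb lam w\<bar> \<le> inverse (Gamma (lam + 1/2))"
  unfolding jb_def by (rule abs_bes_le) auto

lemma jb_sums:
  assumes "lam > 0"
  shows "(\<lambda>n. inverse (fact n * Gamma (real n + (lam + 1/2))) * (- (z\<^sup>2 / 4)) ^ n * y ^ (2 * n)) sums jb lam (z * y)"
proof -
  have "(- ((z * y)\<^sup>2 / 4)) ^ n = (- (z\<^sup>2 / 4)) ^ n * y ^ (2 * n)" for n
    unfolding power_mult power_mult_distrib[symmetric] by (simp add: power_mult_distrib)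
  then show ?thesis
    using bes_sums[of "lam + 1/2" "- ((z * y)\<^sup>2 / 4)"] assms
    by (simp only: jb_def mult.assoc)
qed

lemma gaussian_moment_power:
  assumes "lam > 0" "t > 0"
  shows "has_bochner_integral halfline (\<lambda>y. y powr (2 * lam) * exp (- (t * y\<^sup>2)) * y ^ (2 * m))
    (Gamma (real m + (lam + 1/2)) / (2 * (t powr (lam + 1/2) * t ^ m)))"
proof -
  have "has_bochner_integral halfline (\<lambda>y. y powr (2 * (real m + (lam + 1/2)) - 1) * exp (- (t * y\<^sup>2)))
      (Gamma (real m + (lam + 1/2)) / (2 * t powr (real m + (lam + 1/2))))"
    using assms by (intro has_bochner_integral_gaussian_power) auto
  moreover have "t powr (real m + (lam + 1/2)) = t powr (lam + 1/2) * t ^ m"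
    using assms by (simp add: powr_add powr_realpow)
  moreover have "y powr (2 * (real m + (lam + 1/2)) - 1) = y powr (2 * lam) * y ^ (2 * m)" if "y > 0" for y
  proof -
    have "2 * (real m + (lam + 1/2)) - 1 = 2 * lam + real (2 * m)" by simp
    then show ?thesis using that by (simp only: powr_add powr_realpow)
  qed
  ultimately show ?thesis
    by (subst has_bochner_integral_cong[OF refl _ refl, where g = "\<lambda>y. y powr (2 * (real m + (lam + 1/2)) - 1) * exp (- (t * y\<^sup>2))"])
       (auto simp: mult_ac)
qed

text \<open>Only one Bessel function is expanded here; y^(2m) stands for the m-th term in the
  expansion of the other. Gaussian moments then produce a Kummer series in -b, which sums in closed
  form.\<close>

lemma weber_single:
  fixes lam t z :: real
  assumes lam: "lam > 0" and t: "t > 0"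
  defines "b \<equiv> z\<^sup>2 / (4 * t)" and "\<mu> \<equiv> lam + 1/2"
  shows "has_bochner_integral halfline
    (\<lambda>y. y powr (2 * lam) * exp (- (t * y\<^sup>2)) * y ^ (2 * m) * jb lam (z * y))
    (1 / (2 * (t powr \<mu> * t ^ m)) * (exp (- b) * (\<Sum>k\<le>m. real (m choose k) * Gamma (real m + \<mu>) / Gamma (real k + \<mu>) * (- b) ^ k)))"
proof -
  define w where "w y = y powr (2 * lam) * exp (- (t * y\<^sup>2))" for y
  define f where "f n y = inverse (fact n * Gamma (real n + \<mu>)) * (- (z\<^sup>2 / 4)) ^ n * (w y * y ^ (2 * (m + n)))" for n y
  have mu: "\<mu> > 0" using lam by (simp add: \<mu>_def)
  have bt: "b * t = z\<^sup>2 / 4" using t by (simp add: b_def)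
  have mom: "has_bochner_integral halfline (\<lambda>y. w y * y ^ (2 * (m + n)))
      (Gamma (real (m + n) + \<mu>) / (2 * (t powr \<mu> * t ^ (m + n))))" for n
    using gaussian_moment_power[OF lam t, of "m + n"] unfolding w_def \<mu>_def .
  have val: "inverse (fact n * Gamma (real n + \<mu>)) * c ^ n * (Gamma (real (m + n) + \<mu>) / (2 * (t powr \<mu> * t ^ (m + n))))
     = 1 / (2 * (t powr \<mu> * t ^ m)) * ((c / t) ^ n * (Gamma (real (m + n) + \<mu>) / (fact n * Gamma (real n + \<mu>))))" for n c
    using t by (simp add: power_add power_divide divide_simps)
  have fint: "has_bochner_integral halfline (f n)
      (1 / (2 * (t powr \<mu> * t ^ m)) * ((- b) ^ n * (Gamma (real (m + n) + \<mu>) / (fact n * Gamma (real n + \<mu>)))))" for n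
  proof -
    have "- (z\<^sup>2 / 4) / t = - b" using t by (simp add: b_def)
    then show ?thesis
      using has_bochner_integral_mult_right[OF mom[of n], of "inverse (fact n * Gamma (real n + \<mu>)) * (- (z\<^sup>2 / 4)) ^ n"]
      unfolding f_def val by simp
  qed
  have nf: "norm (f n y) = inverse (fact n * Gamma (real n + \<mu>)) * (z\<^sup>2 / 4) ^ n * (w y * y ^ (2 * (m + n)))" for n y
  proof -
    have g: "Gamma (real n + \<mu>) > 0" using mu by (rule Gamma_shift_pos)
    have "\<bar>y ^ (2 * (m + n))\<bar> = y ^ (2 * (m + n))" by (simp add: power_abs power_even_abs)
    moreover have "\<bar>(- (z\<^sup>2 / 4)) ^ n\<bar> = (z\<^sup>2 / 4) ^ n" by (simp add: power_abs)
    ultimately show ?thesis using g by (simp add: f_def w_def abs_mult)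
  qed
  have fabs: "has_bochner_integral halfline (\<lambda>y. norm (f n y))
      (1 / (2 * (t powr \<mu> * t ^ m)) * (b ^ n * (Gamma (real (m + n) + \<mu>) / (fact n * Gamma (real n + \<mu>)))))" for n
  proof -
    have e: "(z\<^sup>2 / 4) / t = b" using t by (simp add: b_def)
    show ?thesis
      using has_bochner_integral_mult_right[OF mom[of n], of "inverse (fact n * Gamma (real n + \<mu>)) * (z\<^sup>2 / 4) ^ n"]
      unfolding val e nf .
  qed
  have fs: "(\<lambda>n. f n y) sums (w y * y ^ (2 * m) * jb lam (z * y))" for y
  proof -
    have "(\<lambda>n. w y * y ^ (2 * m) * (inverse (fact n * Gamma (real n + \<mu>)) * (- (z\<^sup>2 / 4)) ^ n * y ^ (2 * n)))
        sums (w y * y ^ (2 * m) * jb lam (z * y))"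
      unfolding \<mu>_def by (intro sums_mult jb_sums lam)
    moreover have "w y * y ^ (2 * m) * (inverse (fact n * Gamma (real n + \<mu>)) * (- (z\<^sup>2 / 4)) ^ n * y ^ (2 * n)) = f n y" for n
      by (simp add: f_def power_add distrib_left mult_ac)
    ultimately show ?thesis by simp
  qed
  \<comment> \<open>The integrals of the moduli form the same series with b in place of -b, so the
    closed form also proves the convergence that justifies termwise integration.\<close>
  have sums_norm: "(\<lambda>n. \<integral>y. norm (f n y) \<partial>halfline) sums
     (1 / (2 * (t powr \<mu> * t ^ m)) * (exp b * (\<Sum>k\<le>m. real (m choose k) * Gamma (real m + \<mu>) / Gamma (real k + \<mu>) * b ^ k)))"
    unfolding has_bochner_integral_integral_eq[OF fabs] by (intro sums_mult kummer_sums mu)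
  have sn: "AE y in halfline. summable (\<lambda>n. norm (f n y))"
  proof (rule AE_I2)
    fix y
    have "summable (\<lambda>n. w y * y ^ (2 * m) * (inverse (fact n * Gamma (real n + \<mu>)) * (z\<^sup>2 / 4 * y\<^sup>2) ^ n))"
      unfolding \<mu>_def using lam by (intro summable_mult summable_bes) simp
    moreover have "norm (f n y) = w y * y ^ (2 * m) * (inverse (fact n * Gamma (real n + \<mu>)) * (z\<^sup>2 / 4 * y\<^sup>2) ^ n)" for n
    proof -
      have pw: "(z\<^sup>2 / 4 * y\<^sup>2) ^ n = (z\<^sup>2 / 4) ^ n * y ^ (2 * n)" by (simp only: power_mult_distrib power_mult)
      have pw2: "y ^ (2 * (m + n)) = y ^ (2 * m) * y ^ (2 * n)" by (simp add: power_add distrib_left)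
      show ?thesis unfolding nf pw pw2 by (simp only: mult_ac)
    qed
    ultimately show "summable (\<lambda>n. norm (f n y))" by (simp only:)
  qed
  have i: "integrable halfline (f n)" for n using fint by (rule integrable.intros)
  have "integrable halfline (\<lambda>y. \<Sum>n. f n y)"
    by (rule integrable_suminf[OF i sn sums_summable[OF sums_norm]])
  moreover have "(\<lambda>n. integral\<^sup>L halfline (f n)) sums (\<integral>y. (\<Sum>n. f n y) \<partial>halfline)"
    by (rule sums_integral[OF i sn sums_summable[OF sums_norm]])
  moreover have "(\<lambda>n. integral\<^sup>L halfline (f n)) sums
      (1 / (2 * (t powr \<mu> * t ^ m)) * (exp (- b) * (\<Sum>k\<le>m. real (m choose k) * Gamma (real m + \<mu>) / Gamma (real k + \<mu>) * (- b) ^ k)))"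
    unfolding has_bochner_integral_integral_eq[OF fint] by (intro sums_mult kummer_sums mu)
  ultimately have "has_bochner_integral halfline (\<lambda>y. \<Sum>n. f n y)
     (1 / (2 * (t powr \<mu> * t ^ m)) * (exp (- b) * (\<Sum>k\<le>m. real (m choose k) * Gamma (real m + \<mu>) / Gamma (real k + \<mu>) * (- b) ^ k)))"
    by (simp add: has_bochner_integral_iff sums_unique2)
  then show ?thesis
    unfolding sums_unique[OF fs, symmetric] w_def .
qed

text \<open>Weber's second exponential integral: both Bessel functions are expanded, and the double
  series factors by Vandermonde's convolution.\<close>

lemma weber:
  fixes lam t x z :: real
  assumes lam: "lam > 0" and t: "t > 0"
  defines "a \<equiv> x\<^sup>2 / (4 * t)" and "b \<equiv> z\<^sup>2 / (4 * t)" and "\<mu> \<equiv> lam + 1/2"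
  shows "has_bochner_integral halfline
    (\<lambda>y. y powr (2 * lam) * exp (- (t * y\<^sup>2)) * jb lam (x * y) * jb lam (z * y))
    (1 / (2 * t powr \<mu>) * (exp (- a) * exp (- b) * bes \<mu> (a * b)))"
proof -
  define w where "w y = y powr (2 * lam) * exp (- (t * y\<^sup>2))" for y
  define c where "c m = inverse (fact m * Gamma (real m + \<mu>)) * (- (x\<^sup>2 / 4)) ^ m" for m
  define f where "f m y = c m * (w y * y ^ (2 * m) * jb lam (z * y))" for m y
  define S where "S m = 1 / (2 * (t powr \<mu> * t ^ m)) * (exp (- b) * (\<Sum>k\<le>m. real (m choose k) * Gamma (real m + \<mu>) / Gamma (real k + \<mu>) * (- b) ^ k))" for m
  have mu: "\<mu> > 0" "\<mu> \<ge> 1/2" using lam by (auto simp: \<mu>_def)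
  have gp: "Gamma (real n + \<mu>) > 0" for n using mu(1) by (rule Gamma_shift_pos)
  have fint: "has_bochner_integral halfline (f m) (c m * S m)" for m
    unfolding f_def S_def w_def b_def \<mu>_def by (intro has_bochner_integral_mult_right weber_single lam t)
  \<comment> \<open>Multiplication by \<open>c m\<close> cancels Gamma(m + \<mu>), and the binomial
    becomes 1 / (k! (m-k)!) up to m!. What is left is the m-th term of the Cauchy product of the
    series for \<open>bes \<mu> (a * b)\<close> and for exp(-a).\<close>
  have cS: "c m * S m = exp (- b) / (2 * t powr \<mu>) *
     (\<Sum>k\<le>m. (inverse (fact k * Gamma (real k + \<mu>)) * (a * b) ^ k) * ((- a) ^ (m - k) /\<^sub>R fact (m - k)))" for m
  proof -
    have "c m * S m = exp (- b) / (2 * t powr \<mu>) * (\<Sum>k\<le>m. (- a) ^ m / (fact m * Gamma (real m + \<mu>)) * (real (m choose k) * Gamma (real m + \<mu>) / Gamma (real k + \<mu>) * (- b) ^ k))"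
    proof -
      have "(- (x\<^sup>2 / 4)) ^ m / t ^ m = (- a) ^ m"
        unfolding power_divide[symmetric] using t by (simp add: a_def)
      then have "c m * (1 / (2 * (t powr \<mu> * t ^ m))) = (- a) ^ m / (fact m * Gamma (real m + \<mu>)) * (1 / (2 * t powr \<mu>))"
        unfolding c_def by (simp add: divide_simps)
      moreover have "c m * S m = c m * (1 / (2 * (t powr \<mu> * t ^ m))) *
          (exp (- b) * (\<Sum>k\<le>m. real (m choose k) * Gamma (real m + \<mu>) / Gamma (real k + \<mu>) * (- b) ^ k))"
        unfolding S_def by (simp only: mult.assoc)
      ultimately show ?thesis
        unfolding sum_distrib_left[symmetric] by (simp only: divide_inverse mult_1_left mult_ac)
    qed
    also have "(\<Sum>k\<le>m. (- a) ^ m / (fact m * Gamma (real m + \<mu>)) * (real (m choose k) * Gamma (real m + \<mu>) / Gamma (real k + \<mu>) * (- b) ^ k))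
      = (\<Sum>k\<le>m. (inverse (fact k * Gamma (real k + \<mu>)) * (a * b) ^ k) * ((- a) ^ (m - k) /\<^sub>R fact (m - k)))"
    proof (intro sum.cong refl)
      fix k assume "k \<in> {..m}"
      then have k: "k \<le> m" by simp
      have ch: "real (m choose k) = fact m / (fact k * fact (m - k))" using binomial_fact[OF k, where 'a = real] .
      have "(- a) ^ m * (- b) ^ k = (a * b) ^ k * (- a) ^ (m - k)"
      proof -
        have "(- a) ^ m = (- a) ^ k * (- a) ^ (m - k)" using k by (simp flip: power_add)
        moreover have "(- a) ^ k * (- b) ^ k = (a * b) ^ k" by (simp flip: power_mult_distrib)
        ultimately show ?thesis by (metis mult.assoc mult.commute)
      qed
      moreover have "A / (F * G) * (F / (f * h) * G / g * B) = (inverse (f * g) * P) * (Q / h)"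
        if "A * B = P * Q" "F > 0" "G > 0" for A B P Q F G f g h :: real
      proof -
        have "A / (F * G) * (F / (f * h) * G / g * B) = (A * B) / (f * g * h)"
          using that(2,3) by (simp add: divide_simps)
        then show ?thesis unfolding that(1) by (simp add: divide_simps)
      qed
      ultimately show "(- a) ^ m / (fact m * Gamma (real m + \<mu>)) * (real (m choose k) * Gamma (real m + \<mu>) / Gamma (real k + \<mu>) * (- b) ^ k)
        = (inverse (fact k * Gamma (real k + \<mu>)) * (a * b) ^ k) * ((- a) ^ (m - k) /\<^sub>R fact (m - k))"
        unfolding ch using gp[of m] by (simp add: divide_inverse_commute[symmetric])
    qed
    finally show ?thesis .
  qed
  have sS: "(\<lambda>m. c m * S m) sums (exp (- b) / (2 * t powr \<mu>) * (bes \<mu> (a * b) * exp (- a)))"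
    unfolding cS
  proof (intro sums_mult)
    have n1: "summable (\<lambda>k. norm (inverse (fact k * Gamma (real k + \<mu>)) * (a * b) ^ k))"
    proof -
      have "summable (\<lambda>k. inverse (fact k * Gamma (real k + \<mu>)) * \<bar>a * b\<bar> ^ k)"
        by (intro summable_bes mu)
      moreover have "norm (inverse (fact k * Gamma (real k + \<mu>)) * (a * b) ^ k) = inverse (fact k * Gamma (real k + \<mu>)) * \<bar>a * b\<bar> ^ k" for k
        using gp[of k] by (simp add: abs_mult power_abs)
      ultimately show ?thesis by simp
    qed
    have n2: "summable (\<lambda>k. norm ((- a) ^ k /\<^sub>R fact k))" by (rule summable_norm_exp)
    have "(\<lambda>m. \<Sum>k\<le>m. (inverse (fact k * Gamma (real k + \<mu>)) * (a * b) ^ k) * ((- a) ^ (m - k) /\<^sub>R fact (m - k)))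
      sums ((\<Sum>k. inverse (fact k * Gamma (real k + \<mu>)) * (a * b) ^ k) * (\<Sum>k. (- a) ^ k /\<^sub>R fact k))"
      by (rule Cauchy_product_sums[OF n1 n2])
    then show "(\<lambda>m. \<Sum>k\<le>m. (inverse (fact k * Gamma (real k + \<mu>)) * (a * b) ^ k) * ((- a) ^ (m - k) /\<^sub>R fact (m - k)))
      sums (bes \<mu> (a * b) * exp (- a))"
      unfolding bes_def exp_def .
  qed
  have fs: "(\<lambda>m. f m y) sums (w y * jb lam (x * y) * jb lam (z * y))" for y
  proof -
    have "(\<lambda>m. w y * jb lam (z * y) * (inverse (fact m * Gamma (real m + \<mu>)) * (- (x\<^sup>2 / 4)) ^ m * y ^ (2 * m)))
        sums (w y * jb lam (z * y) * jb lam (x * y))"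
      unfolding \<mu>_def by (intro sums_mult jb_sums lam)
    moreover have "w y * jb lam (z * y) * (inverse (fact m * Gamma (real m + \<mu>)) * (- (x\<^sup>2 / 4)) ^ m * y ^ (2 * m)) = f m y" for m
      by (simp add: f_def c_def mult_ac)
    ultimately show ?thesis by (simp add: mult_ac)
  qed
  have nb: "norm (f m y) \<le> inverse (Gamma \<mu>) * (\<bar>c m\<bar> * (w y * y ^ (2 * m)))" for m y
  proof -
    have "norm (f m y) = \<bar>c m\<bar> * (w y * y ^ (2 * m)) * \<bar>jb lam (z * y)\<bar>"
      by (simp add: f_def abs_mult w_def power_mult)
    also have "\<dots> \<le> \<bar>c m\<bar> * (w y * y ^ (2 * m)) * inverse (Gamma \<mu>)"
      using jb_abs_le[OF lam, of "z * y"] by (intro mult_left_mono) (auto simp: \<mu>_def w_def power_mult)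
    finally show ?thesis by (simp add: mult_ac)
  qed
  have i: "integrable halfline (f m)" for m using fint by (rule integrable.intros)
  have sn: "AE y in halfline. summable (\<lambda>m. norm (f m y))"
  proof (rule AE_I2)
    fix y
    have "summable (\<lambda>m. inverse (Gamma \<mu>) * w y * (inverse (fact m * Gamma (real m + \<mu>)) * (x\<^sup>2 / 4 * y\<^sup>2) ^ m))"
      by (intro summable_mult summable_bes mu)
    moreover have "inverse (Gamma \<mu>) * (\<bar>c m\<bar> * (w y * y ^ (2 * m)))
       = inverse (Gamma \<mu>) * w y * (inverse (fact m * Gamma (real m + \<mu>)) * (x\<^sup>2 / 4 * y\<^sup>2) ^ m)" for m
    proof -
      have pw: "(x\<^sup>2 / 4 * y\<^sup>2) ^ m = (x\<^sup>2 / 4) ^ m * y ^ (2 * m)" by (simp only: power_mult_distrib power_mult)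
      show ?thesis unfolding pw using gp[of m] by (simp add: c_def abs_mult power_abs)
    qed
    ultimately have "summable (\<lambda>m. inverse (Gamma \<mu>) * (\<bar>c m\<bar> * (w y * y ^ (2 * m))))" by (simp only:)
    then show "summable (\<lambda>m. norm (f m y))"
      by (rule summable_comparison_test') (use nb in simp)
  qed
  \<comment> \<open>With the unexpanded Bessel factor bounded by its supremum, each norm is a
    Gaussian moment whose Gamma value cancels the one in \<open>c m\<close>; the exponential series
    in a remains.\<close>
  have si: "summable (\<lambda>m. \<integral>y. norm (f m y) \<partial>halfline)"
  proof (rule summable_comparison_test')
    show "summable (\<lambda>m. inverse (Gamma \<mu>) / (2 * t powr \<mu>) * (inverse (fact m) * a ^ m))"
      by (intro summable_mult summable_exp)
    fix m
    have mom: "has_bochner_integral halfline (\<lambda>y. inverse (Gamma \<mu>) * (\<bar>c m\<bar> * (w y * y ^ (2 * m))))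
        (inverse (Gamma \<mu>) * (\<bar>c m\<bar> * (Gamma (real m + \<mu>) / (2 * (t powr \<mu> * t ^ m)))))"
      using gaussian_moment_power[OF lam t, of m] unfolding w_def \<mu>_def by (intro has_bochner_integral_mult_right)
    have "(\<integral>y. norm (f m y) \<partial>halfline) \<le> inverse (Gamma \<mu>) * (\<bar>c m\<bar> * (Gamma (real m + \<mu>) / (2 * (t powr \<mu> * t ^ m))))"
      by (rule has_bochner_integral_mono[OF has_bochner_integral_integrable[OF integrable_norm[OF i]] mom nb])
    also have "\<bar>c m\<bar> = (x\<^sup>2 / 4) ^ m / (fact m * Gamma (real m + \<mu>))"
    proof -
      have "\<bar>c m\<bar> = inverse (fact m * Gamma (real m + \<mu>)) * (x\<^sup>2 / 4) ^ m"
        using gp[of m] by (simp add: c_def abs_mult power_abs)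
      then show ?thesis by (simp only: divide_inverse mult.commute)
    qed
    also have "inverse (Gamma \<mu>) * ((x\<^sup>2 / 4) ^ m / (fact m * Gamma (real m + \<mu>)) * (Gamma (real m + \<mu>) / (2 * (t powr \<mu> * t ^ m))))
      = inverse (Gamma \<mu>) / (2 * t powr \<mu>) * (inverse (fact m) * ((x\<^sup>2 / 4) ^ m / t ^ m))"
    proof -
      have "i * (X / (f * G) * (G / (2 * (T * s)))) = i / (2 * T) * (inverse f * (X / s))" if "G > 0" for i X f G T s :: real
      proof -
        have e: "X / (f * G) * (G / (2 * (T * s))) = X / f / (2 * (T * s))" using that by simp
        show ?thesis unfolding e by (simp only: divide_inverse inverse_mult_distrib mult_ac)
      qed
      from this[OF gp[of m]] show ?thesis .
    qed
    also have "(x\<^sup>2 / 4) ^ m / t ^ m = a ^ m" unfolding power_divide[symmetric] by (simp add: a_def)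
    finally show "norm (\<integral>y. norm (f m y) \<partial>halfline) \<le> inverse (Gamma \<mu>) / (2 * t powr \<mu>) * (inverse (fact m) * a ^ m)"
      by (simp add: integral_nonneg_AE)
  qed
  have "integrable halfline (\<lambda>y. \<Sum>n. f n y)"
    by (rule integrable_suminf[OF i sn si])
  moreover have "(\<lambda>n. integral\<^sup>L halfline (f n)) sums (\<integral>y. (\<Sum>n. f n y) \<partial>halfline)"
    by (rule sums_integral[OF i sn si])
  moreover have "(\<lambda>n. integral\<^sup>L halfline (f n)) sums (1 / (2 * t powr \<mu>) * (exp (- a) * exp (- b) * bes \<mu> (a * b)))"
    unfolding has_bochner_integral_integral_eq[OF fint] using sS by (simp add: mult_ac)
  ultimately have "has_bochner_integral halfline (\<lambda>y. \<Sum>n. f n y) (1 / (2 * t powr \<mu>) * (exp (- a) * exp (- b) * bes \<mu> (a * b)))"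
    by (simp add: has_bochner_integral_iff sums_unique2)
  then show ?thesis
    unfolding sums_unique[OF fs, symmetric] w_def .
qed

text \<open>The constant is the square of the normalisation \<open>2 powr (1/2 - lam)\<close>
  carried by each of two Hankel transforms, so the heat kernel is exactly what Weber's formula
  leaves of their composition.\<close>

lemma heat_kernel_eq_weber:
  assumes "lam > 0" "t > 0" "x > 0" "z > 0"
  shows "heat_kernel lam t x z = 2 powr (1 - 2 * lam) * (x * z) powr lam *
    (1 / (2 * t powr (lam + 1/2)) * (exp (- (x\<^sup>2 / (4 * t))) * exp (- (z\<^sup>2 / (4 * t))) * bes (lam + 1/2) (x\<^sup>2 / (4 * t) * (z\<^sup>2 / (4 * t)))))"
proof -
  define w where "w = x * z / (2 * t)"
  have w: "w > 0" using assms by (simp add: w_def)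
  have xz: "x * z > 0" using assms by simp
  have w4: "w\<^sup>2 / 4 = x\<^sup>2 / (4 * t) * (z\<^sup>2 / (4 * t))"
    using assms by (simp add: w_def power_divide power_mult_distrib power2_eq_square)
  have e: "exp (- (x\<^sup>2 + z\<^sup>2) / (4 * t)) = exp (- (x\<^sup>2 / (4 * t))) * exp (- (z\<^sup>2 / (4 * t)))"
    by (simp add: add_divide_distrib diff_divide_distrib flip: exp_add)
  have "(w / 2) powr (lam - 1/2) = (x * z) powr (lam - 1/2) / ((4 * t) powr (lam - 1/2))"
    using assms by (simp add: w_def powr_divide)
  also have "(4 * t) powr (lam - 1/2) = 2 powr (2 * lam - 1) * t powr (lam - 1/2)"
  proof -
    have "(4::real) powr (lam - 1/2) = (2 powr 2) powr (lam - 1/2)" by simp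
    also have "\<dots> = 2 powr (2 * lam - 1)" unfolding powr_powr by (simp add: algebra_simps)
    finally show ?thesis using assms by (simp add: powr_mult)
  qed
  finally have p: "(w / 2) powr (lam - 1/2) = (x * z) powr (lam - 1/2) / (2 powr (2 * lam - 1) * t powr (lam - 1/2))" .
  have s: "sqrt (x * z) * (x * z) powr (lam - 1/2) = (x * z) powr lam"
    using xz by (simp add: powr_half_sqrt[symmetric] flip: powr_add)
  have tt: "t * t powr (lam - 1/2) = t powr (lam + 1/2)"
  proof -
    have "t * t powr (lam - 1/2) = t powr 1 * t powr (lam - 1/2)" using assms by simp
    also have "\<dots> = t powr (lam + 1/2)" unfolding powr_add[symmetric] by (simp add: algebra_simps)
    finally show ?thesis .
  qed
  have two: "2 powr (1 - 2 * lam) = inverse (2 powr (2 * lam - 1) :: real)"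
    by (simp flip: powr_minus)
  have "sqrt (x * z) / (2 * t) * (w / 2) powr (lam - 1/2) = (sqrt (x * z) * (x * z) powr (lam - 1/2)) / (2 * (t * t powr (lam - 1/2)) * 2 powr (2 * lam - 1))"
    unfolding p by simp
  also have "\<dots> = 2 powr (1 - 2 * lam) * (x * z) powr lam * (1 / (2 * t powr (lam + 1/2)))"
    unfolding s tt two by (simp add: field_simps)
  finally have k: "sqrt (x * z) / (2 * t) * (w / 2) powr (lam - 1/2) = 2 powr (1 - 2 * lam) * (x * z) powr lam * (1 / (2 * t powr (lam + 1/2)))" .
  have "heat_kernel lam t x z = (sqrt (x * z) / (2 * t) * (w / 2) powr (lam - 1/2)) * bes (lam + 1/2) (w\<^sup>2 / 4) * exp (- (x\<^sup>2 + z\<^sup>2) / (4 * t))"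
    unfolding heat_kernel_def w_def[symmetric] bessel_I_eq[OF assms(1) w] by (simp only: mult.assoc)
  then show ?thesis
    unfolding k w4 e by (simp only: mult_ac)
qed

subsection \<open>The Hankel transform of test functions\<close>

lemma jb_has_derivative:
  assumes "lam > 0"
  shows "((\<lambda>x. jb lam (x * y)) has_real_derivative - (x * y\<^sup>2 / 2) * jb (lam + 1) (x * y)) (at x)"
proof -
  have "((\<lambda>x. - ((x * y)\<^sup>2 / 4)) has_real_derivative - (x * y\<^sup>2 / 2)) (at x)"
    by (auto intro!: derivative_eq_intros simp: power2_eq_square)
  from DERIV_chain2[OF bes_has_derivative this, of "lam + 1/2"]
  have "((\<lambda>x. bes (lam + 1/2) (- ((x * y)\<^sup>2 / 4))) has_real_derivative
      bes (lam + 1/2 + 1) (- ((x * y)\<^sup>2 / 4)) * - (x * y\<^sup>2 / 2)) (at x)"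
    using assms by simp
  moreover have "lam + 1 + 1/2 = lam + 1/2 + 1" by simp
  ultimately show ?thesis by (simp only: jb_def mult.commute)
qed

lemma jb_recurrence:
  assumes "lam > 0"
  shows "jb lam w = (lam + 1/2) * jb (lam + 1) w - w\<^sup>2 / 4 * jb (lam + 2) w"
proof -
  have "lam + 1 + 1/2 = lam + 1/2 + 1" "lam + 2 + 1/2 = lam + 1/2 + 2" by auto
  then show ?thesis
    using bes_recurrence[of "lam + 1/2" "- (w\<^sup>2 / 4)"] assms by (simp add: jb_def)
qed

text \<open>\<open>\<psi> k\<close> plays the role of \<open>(1/x d/dx)\<^sup>k (x powr - lam * \<phi>)\<close> for a test function \<open>\<phi>\<close>.\<close>

definition test_jet :: "(nat \<Rightarrow> real \<Rightarrow> real) \<Rightarrow> bool" where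
  "test_jet \<psi> \<longleftrightarrow> (\<forall>k. \<forall>x>0. (\<psi> k has_real_derivative x * \<psi> (Suc k) x) (at x))
     \<and> (\<forall>m k. \<exists>B. \<forall>x>0. (1 + x) ^ m * \<bar>\<psi> k x\<bar> \<le> B)"

text \<open>At k = 0 this is the Bessel operator conjugated by x^lam: apply - d^2/dx^2 + lam (lam -
  1)/x^2 to x^lam times \<psi> 0 and divide by x^lam. The summand 2 k comes from moving the k-th
  power of 1/x d/dx past the factor x^2.\<close>

definition jet_bessel :: "real \<Rightarrow> (nat \<Rightarrow> real \<Rightarrow> real) \<Rightarrow> nat \<Rightarrow> real \<Rightarrow> real" where
  "jet_bessel lam \<psi> k x = - (2 * lam + 1 + 2 * real k) * \<psi> (k + 1) x - x\<^sup>2 * \<psi> (k + 2) x"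

lemma test_jet_derivative: "test_jet \<psi> \<Longrightarrow> x > 0 \<Longrightarrow> (\<psi> k has_real_derivative x * \<psi> (Suc k) x) (at x)"
  by (simp add: test_jet_def)

lemma test_jet_decay:
  assumes "test_jet \<psi>"
  obtains B where "B \<ge> 0" "\<And>x. x > 0 \<Longrightarrow> \<bar>\<psi> k x\<bar> \<le> B / (1 + x) ^ m"
proof -
  obtain B where B: "\<And>x. x > 0 \<Longrightarrow> (1 + x) ^ m * \<bar>\<psi> k x\<bar> \<le> B"
    using assms unfolding test_jet_def by meson
  have "0 \<le> B" using B[of 1] by (smt (verit) mult_nonneg_nonneg abs_ge_zero zero_le_power)
  moreover have "\<bar>\<psi> k x\<bar> \<le> B / (1 + x) ^ m" if "x > 0" for x
    using B[OF that] that by (simp add: pos_le_divide_eq mult.commute)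
  ultimately show ?thesis by (rule that)
qed

lemma test_jet_measurable:
  assumes "test_jet \<psi>"
  shows "\<psi> k \<in> borel_measurable halfline"
proof (rule continuous_on_imp_measurable_halfline)
  show "continuous_on {0<..} (\<psi> k)"
    by (intro continuous_at_imp_continuous_on ballI DERIV_isCont[OF test_jet_derivative[OF assms]]) simp
qed

lemma test_jet_bessel:
  assumes "test_jet \<psi>"
  shows "test_jet (jet_bessel lam \<psi>)"
  unfolding test_jet_def
proof (intro conjI allI impI)
  fix k and x :: real assume x: "x > 0"
  have d1: "(\<psi> (k + 1) has_real_derivative x * \<psi> (k + 2) x) (at x)"
    and d2: "(\<psi> (k + 2) has_real_derivative x * \<psi> (k + 3) x) (at x)"
    using test_jet_derivative[OF assms x, of "k + 1"] test_jet_derivative[OF assms x, of "k + 2"]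
    by (simp_all add: numeral_eq_Suc)
  have "((\<lambda>x. - (2 * lam + 1 + 2 * real k) * \<psi> (k + 1) x - x\<^sup>2 * \<psi> (k + 2) x) has_real_derivative
     - (2 * lam + 1 + 2 * real k) * (x * \<psi> (k + 2) x) - (x\<^sup>2 * (x * \<psi> (k + 3) x) + 2 * x * \<psi> (k + 2) x)) (at x)"
    by (intro DERIV_diff DERIV_cmult d1 DERIV_cong[OF DERIV_mult[OF DERIV_power[OF DERIV_ident, of 2] d2]]) simp
  moreover have "- (2 * lam + 1 + 2 * real k) * (x * \<psi> (k + 2) x) - (x\<^sup>2 * (x * \<psi> (k + 3) x) + 2 * x * \<psi> (k + 2) x)
     = x * jet_bessel lam \<psi> (Suc k) x"
    by (simp add: jet_bessel_def numeral_eq_Suc algebra_simps)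
  ultimately show "(jet_bessel lam \<psi> k has_real_derivative x * jet_bessel lam \<psi> (Suc k) x) (at x)"
    by (simp add: jet_bessel_def[abs_def])
next
  fix m k :: nat
  obtain A where A: "A \<ge> 0" "\<And>x. x > 0 \<Longrightarrow> \<bar>\<psi> (k + 1) x\<bar> \<le> A / (1 + x) ^ m"
    using test_jet_decay[OF assms, of "k + 1" m] by blast
  obtain B where B: "B \<ge> 0" "\<And>x. x > 0 \<Longrightarrow> \<bar>\<psi> (k + 2) x\<bar> \<le> B / (1 + x) ^ (m + 2)"
    using test_jet_decay[OF assms, of "k + 2" "m + 2"] by blast
  show "\<exists>B. \<forall>x>0. (1 + x) ^ m * \<bar>jet_bessel lam \<psi> k x\<bar> \<le> B"
  proof (intro exI allI impI)
    fix x :: real assume x: "x > 0"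
    have a: "(1 + x) ^ m * \<bar>\<psi> (k + 1) x\<bar> \<le> A"
      using A(2)[OF x] x by (simp add: pos_le_divide_eq mult.commute)
    have "x\<^sup>2 \<le> (1 + x)\<^sup>2" using x by (intro power_mono) auto
    then have "(1 + x) ^ m * (x\<^sup>2 * \<bar>\<psi> (k + 2) x\<bar>) \<le> (1 + x) ^ m * ((1 + x)\<^sup>2 * \<bar>\<psi> (k + 2) x\<bar>)"
      using x by (intro mult_left_mono mult_right_mono) auto
    also have "\<dots> = (1 + x) ^ (m + 2) * \<bar>\<psi> (k + 2) x\<bar>" by (simp only: power_add mult.assoc)
    also have "\<dots> \<le> B"
      using B(2)[OF x] x by (simp add: pos_le_divide_eq mult.commute)
    finally have b: "(1 + x) ^ m * (x\<^sup>2 * \<bar>\<psi> (k + 2) x\<bar>) \<le> B" .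
    have "\<bar>jet_bessel lam \<psi> k x\<bar> \<le> \<bar>2 * lam + 1 + 2 * real k\<bar> * \<bar>\<psi> (k + 1) x\<bar> + x\<^sup>2 * \<bar>\<psi> (k + 2) x\<bar>"
      unfolding jet_bessel_def by (rule order_trans[OF abs_triangle_ineq4]) (simp only: abs_mult abs_minus_cancel abs_power2 order_refl)
    then have "(1 + x) ^ m * \<bar>jet_bessel lam \<psi> k x\<bar> \<le> (1 + x) ^ m * (\<bar>2 * lam + 1 + 2 * real k\<bar> * \<bar>\<psi> (k + 1) x\<bar> + x\<^sup>2 * \<bar>\<psi> (k + 2) x\<bar>)"
      using x by (intro mult_left_mono) auto
    also have "\<dots> = \<bar>2 * lam + 1 + 2 * real k\<bar> * ((1 + x) ^ m * \<bar>\<psi> (k + 1) x\<bar>) + (1 + x) ^ m * (x\<^sup>2 * \<bar>\<psi> (k + 2) x\<bar>)"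
      by (simp only: distrib_left mult_ac)
    also have "\<dots> \<le> \<bar>2 * lam + 1 + 2 * real k\<bar> * A + B"
      using a b by (intro add_mono mult_left_mono) auto
    finally show "(1 + x) ^ m * \<bar>jet_bessel lam \<psi> k x\<bar> \<le> \<bar>2 * lam + 1 + 2 * real k\<bar> * A + B" .
  qed
qed

section \<open>Boundedness and rapid decay of the Hankel transform of a test function\<close>

lemma integrable_powr_decay:
  fixes p :: real
  assumes "p > -1" "p + 2 \<le> real m"
  shows "integrable halfline (\<lambda>x. x powr p / (1 + x) ^ m)"
proof (rule integral_abs_le(1))
  show "integrable halfline (\<lambda>x. if x \<le> 1 then 1 * x powr p else 1 * x powr (- 2))"
    using assms by (intro integrable_halfline_two_powers) auto
  fix x :: real assume "x \<in> space halfline"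
  then have x: "x > 0" by simp
  show "\<bar>x powr p / (1 + x) ^ m\<bar> \<le> (if x \<le> 1 then 1 * x powr p else 1 * x powr (- 2))"
  proof (cases "x \<le> 1")
    case True
    have "x powr p / (1 + x) ^ m \<le> x powr p / 1"
      using x by (intro divide_left_mono one_le_power) auto
    then show ?thesis using True x by simp
  next
    case False
    have "x powr (p + 2) \<le> x powr real m" using False assms by (intro powr_mono) auto
    also have "\<dots> = x ^ m" using x by (rule powr_realpow)
    also have "\<dots> \<le> (1 + x) ^ m" using x by (intro power_mono) auto
    finally have "x powr p / (1 + x) ^ m \<le> x powr p / x powr (p + 2)"
      using x by (intro divide_left_mono) auto
    also have "\<dots> = x powr (- 2)" unfolding powr_diff[symmetric] by simp
    finally show ?thesis using False x by simp
  qed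
qed measurable

lemma test_jet_integrable:
  assumes \<psi>: "test_jet \<psi>" and "p > -1" and [measurable]: "h \<in> borel_measurable halfline"
    and h: "\<And>x. x > 0 \<Longrightarrow> \<bar>h x\<bar> \<le> H * (1 + x) ^ j"
  shows "integrable halfline (\<lambda>x. x powr p * h x * \<psi> k x)"
proof -
  obtain m where m: "p + 2 \<le> real m" using real_arch_simple by blast
  obtain B where B: "B \<ge> 0" "\<And>x. x > 0 \<Longrightarrow> \<bar>\<psi> k x\<bar> \<le> B / (1 + x) ^ (m + j)"
    using test_jet_decay[OF \<psi>, of k "m + j"] by blast
  note [measurable] = test_jet_measurable[OF \<psi>, of k]
  show ?thesis
  proof (rule integral_abs_le(1))
    show "integrable halfline (\<lambda>x. (H * B) * (x powr p / (1 + x) ^ m))"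
      using assms m by (intro integrable_mult_right integrable_powr_decay)
    fix x :: real assume "x \<in> space halfline"
    then have x: "x > 0" by simp
    have H: "0 \<le> H * (1 + x) ^ j" using h[OF x] by linarith
    have "\<bar>x powr p * h x * \<psi> k x\<bar> = x powr p * \<bar>h x\<bar> * \<bar>\<psi> k x\<bar>" by (simp add: abs_mult)
    also have "\<dots> \<le> x powr p * (H * (1 + x) ^ j) * (B / (1 + x) ^ (m + j))"
      using h[OF x] B(2)[OF x] H by (intro mult_mono) auto
    also have "\<dots> = (H * B) * (x powr p / (1 + x) ^ m)"
      using x by (simp add: power_add)
    finally show "\<bar>x powr p * h x * \<psi> k x\<bar> \<le> (H * B) * (x powr p / (1 + x) ^ m)" .
  qed measurable
qed

text \<open>The Hankel transform conjugated by the weight \<open>x powr lam\<close>.\<close>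

definition hk :: "real \<Rightarrow> (real \<Rightarrow> real) \<Rightarrow> real \<Rightarrow> real" where
  "hk lam f y = 2 powr (1/2 - lam) * (\<integral>x. x powr (2 * lam) * jb lam (x * y) * f x \<partial>halfline)"

lemma hk_integrable:
  assumes "lam > 0" "test_jet \<psi>"
  shows "integrable halfline (\<lambda>x. x powr (2 * lam) * jb lam (x * y) * \<psi> k x)"
proof (rule test_jet_integrable[OF assms(2), where j = 0 and H = "inverse (Gamma (lam + 1/2))"])
  show "(\<lambda>x. jb lam (x * y)) \<in> borel_measurable halfline"
    by measurable
qed (use assms jb_abs_le in auto)

lemma hk_bounded:
  assumes "lam > 0" "test_jet \<psi>"
  obtains B where "B \<ge> 0" "\<And>y. \<bar>hk lam (\<psi> k) y\<bar> \<le> B"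
proof -
  define g where "g x = inverse (Gamma (lam + 1/2)) * \<bar>x powr (2 * lam) * \<psi> k x\<bar>" for x
  have "integrable halfline (\<lambda>x. x powr (2 * lam) * 1 * \<psi> k x)"
    using assms by (intro test_jet_integrable[where j = 0 and H = 1]) auto
  then have g: "integrable halfline g"
    unfolding g_def by (intro integrable_mult_right integrable_abs) simp
  define B where "B = 2 powr (1/2 - lam) * integral\<^sup>L halfline g"
  have "\<bar>hk lam (\<psi> k) y\<bar> \<le> B" for y
  proof -
    have "\<bar>\<integral>x. x powr (2 * lam) * jb lam (x * y) * \<psi> k x \<partial>halfline\<bar> \<le> integral\<^sup>L halfline g"
    proof (rule integral_abs_le(2)[OF g])
      show "(\<lambda>x. x powr (2 * lam) * jb lam (x * y) * \<psi> k x) \<in> borel_measurable halfline"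
        using hk_integrable[OF assms, of y k] by (rule borel_measurable_integrable)
      fix x
      have "\<bar>x powr (2 * lam) * jb lam (x * y) * \<psi> k x\<bar> = \<bar>jb lam (x * y)\<bar> * \<bar>x powr (2 * lam) * \<psi> k x\<bar>"
        by (simp add: abs_mult)
      also have "\<dots> \<le> g x"
        unfolding g_def by (intro mult_right_mono jb_abs_le assms) auto
      finally show "\<bar>x powr (2 * lam) * jb lam (x * y) * \<psi> k x\<bar> \<le> g x" .
    qed
    then show ?thesis
      unfolding hk_def B_def abs_mult by (intro mult_mono) auto
  qed
  moreover from this[of 0] have "B \<ge> 0" by linarith
  ultimately show ?thesis using that by blast
qed

lemma measurable_hk [measurable]:
  assumes "f \<in> borel_measurable halfline"
  shows "hk lam f \<in> borel_measurable borel"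
proof -
  note [measurable] = assms
  have [measurable]: "(\<lambda>p. f (snd p)) \<in> borel_measurable (borel \<Otimes>\<^sub>M halfline)"
    by (rule measurable_compose[OF measurable_snd assms])
  show ?thesis
    unfolding hk_def[abs_def] by measurable
qed

lemma integral_halfline_derivative_0:
  fixes F f :: "real \<Rightarrow> real"
  assumes d: "\<And>x. x > 0 \<Longrightarrow> (F has_real_derivative f x) (at x)"
    and c: "\<And>x. x > 0 \<Longrightarrow> isCont f x"
    and i: "integrable halfline f"
    and l: "(F \<longlongrightarrow> 0) (at_right 0)" "(F \<longlongrightarrow> 0) at_top"
  shows "integral\<^sup>L halfline f = 0"
proof -
  have e: "einterval 0 \<infinity> = {0<..}" by (auto simp: einterval_def zero_ereal_def)
  have "(LBINT x=0..\<infinity>. f x) = 0 - 0"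
  proof (rule interval_integral_FTC_integrable)
    fix x :: real assume "0 < ereal x"
    then have "x > 0" by (simp add: zero_ereal_def)
    then show "(F has_vector_derivative f x) (at x)" "isCont f x"
      using d c by (auto simp: has_real_derivative_iff_has_vector_derivative)
  next
    show "set_integrable lborel (einterval 0 \<infinity>) f"
      using i unfolding e set_integrable_def halfline_def
      by (subst (asm) integrable_restrict_space) auto
    show "((F \<circ> real_of_ereal) \<longlongrightarrow> 0) (at_right 0)"
      using l(1) unfolding zero_ereal_def ereal_tendsto_simps .
    show "((F \<circ> real_of_ereal) \<longlongrightarrow> 0) (at_left \<infinity>)"
      using l(2) unfolding ereal_tendsto_simps .
  qed simp
  then have "(LBINT x:{0<..}. f x) = 0"
    by (simp add: interval_lebesgue_integral_def e)
  then show ?thesis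
    unfolding set_lebesgue_integral_def halfline_def by (subst integral_restrict_space) auto
qed

text \<open>Green's identity: \<open>x powr (2 * lam) * (E' \<psi> - E \<psi>')\<close> with \<open>E x = jb lam (x * y)\<close> has derivative
  \<open>x powr (2 * lam) * E * (L \<psi> - y\<^sup>2 \<psi>)\<close> and vanishes at both ends.\<close>

lemma hk_jet_bessel:
  assumes lam: "lam > 0" and \<psi>: "test_jet \<psi>"
  shows "hk lam (jet_bessel lam \<psi> 0) y = y\<^sup>2 * hk lam (\<psi> 0) y"
proof -
  let ?p = "2 * lam"
  define b where "b j x = jb (lam + j) (x * y)" for j x
  \<comment> \<open>Since E has derivative -(x y^2 / 2) \<open>b 1\<close> and \<psi> 0 has
    derivative x \<psi> 1, this is the boundary term of Green's identity with one factor x drawn out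
    of both products.\<close>
  define F where "F x = - (x powr (?p + 1) * (y\<^sup>2 / 2 * (b 1 x * \<psi> 0 x) + b 0 x * \<psi> 1 x))" for x
  define f where "f x = x powr ?p * b 0 x * jet_bessel lam \<psi> 0 x - y\<^sup>2 * (x powr ?p * b 0 x * \<psi> 0 x)" for x
  have db: "(b j has_real_derivative - (x * y\<^sup>2 / 2) * b (j + 1) x) (at x)" if "j \<ge> 0" for j x
    using jb_has_derivative[of "lam + j" y x] lam that unfolding b_def[abs_def] by (simp add: add.assoc)
  have d: "(F has_real_derivative f x) (at x)" if x: "x > 0" for x
  proof -
    have p0: "(\<psi> 0 has_real_derivative x * \<psi> 1 x) (at x)" and p1: "(\<psi> 1 has_real_derivative x * \<psi> 2 x) (at x)"
      using test_jet_derivative[OF \<psi> x, of 0] test_jet_derivative[OF \<psi> x, of 1] by (simp_all add: numeral_2_eq_2)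
    have b0: "(b 0 has_real_derivative - (x * y\<^sup>2 / 2) * b 1 x) (at x)" and b1: "(b 1 has_real_derivative - (x * y\<^sup>2 / 2) * b 2 x) (at x)"
      using db[of 0 x] db[of 1 x] by simp_all
    have pw: "((\<lambda>x. x powr (?p + 1)) has_real_derivative (?p + 1) * x powr ?p) (at x)"
      using has_real_derivative_powr[OF x, of "?p + 1"] by simp
    have rec: "b 0 x = (lam + 1/2) * b 1 x - (x * y)\<^sup>2 / 4 * b 2 x"
      unfolding b_def using jb_recurrence[OF lam, of "x * y"] by simp
    have xp: "x powr (?p + 1) = x powr ?p * x" using x by (simp add: powr_add)
    show ?thesis
      unfolding F_def
      apply (rule DERIV_cong[OF DERIV_minus[OF DERIV_mult[OF pw DERIV_add[OF DERIV_cmult[OF DERIV_mult[OF b1 p0]] DERIV_mult[OF b0 p1]]]]])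
      unfolding f_def jet_bessel_def xp rec
      by (simp add: algebra_simps power2_eq_square numeral_2_eq_2 add_divide_distrib diff_divide_distrib)
  qed
  have cb: "isCont (b 0) x" for x using db[of 0 x] by (intro DERIV_isCont) auto
  have cp: "isCont (\<psi> k) x" if "x > 0" for k x using test_jet_derivative[OF \<psi> that, of k] by (rule DERIV_isCont)
  have c: "isCont f x" if x: "x > 0" for x
    unfolding f_def jet_bessel_def
    by (intro continuous_intros cb cp x) (use x in auto)
  have i1: "integrable halfline (\<lambda>x. x powr ?p * b 0 x * jet_bessel lam \<psi> 0 x)"
    and i2: "integrable halfline (\<lambda>x. x powr ?p * b 0 x * \<psi> 0 x)"
    using hk_integrable[OF lam test_jet_bessel[OF \<psi>], of y lam 0] hk_integrable[OF lam \<psi>, of y 0]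
    unfolding b_def by simp_all
  have i: "integrable halfline f"
    unfolding f_def by (intro Bochner_Integration.integrable_diff integrable_mult_right i1 i2)
  \<comment> \<open>One power more than the exponent \<open>?p + 1\<close> of the boundary term,
    which makes that term O(1/x) at infinity.\<close>
  obtain m where m: "?p + 2 \<le> real m" using real_arch_simple by blast
  obtain A where A: "A \<ge> 0" "\<And>x. x > 0 \<Longrightarrow> \<bar>\<psi> 0 x\<bar> \<le> A / (1 + x) ^ m"
    using test_jet_decay[OF \<psi>, of 0 m] by blast
  obtain B where B: "B \<ge> 0" "\<And>x. x > 0 \<Longrightarrow> \<bar>\<psi> 1 x\<bar> \<le> B / (1 + x) ^ m"
    using test_jet_decay[OF \<psi>, of 1 m] by blast
  define M where "M = y\<^sup>2 / 2 * (inverse (Gamma (lam + 1 + 1/2)) * A) + inverse (Gamma (lam + 1/2)) * B"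
  have G: "Gamma (lam + 1/2) > 0" "Gamma (lam + 1 + 1/2) > 0" using lam by auto
  have Fb: "\<bar>F x\<bar> \<le> x powr (?p + 1) * (M / (1 + x) ^ m)" if x: "x > 0" for x
  proof -
    have "\<bar>y\<^sup>2 / 2 * (b 1 x * \<psi> 0 x) + b 0 x * \<psi> 1 x\<bar> \<le> y\<^sup>2 / 2 * (\<bar>b 1 x\<bar> * \<bar>\<psi> 0 x\<bar>) + \<bar>b 0 x\<bar> * \<bar>\<psi> 1 x\<bar>"
      by (rule order_trans[OF abs_triangle_ineq]) (simp add: abs_mult)
    also have "\<dots> \<le> y\<^sup>2 / 2 * (inverse (Gamma (lam + 1 + 1/2)) * (A / (1 + x) ^ m)) + inverse (Gamma (lam + 1/2)) * (B / (1 + x) ^ m)"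
      using jb_abs_le[of "lam + 1" "x * y"] jb_abs_le[OF lam, of "x * y"] lam A(2)[OF x] B(2)[OF x] G
      by (intro add_mono mult_left_mono mult_mono) (auto simp: b_def)
    also have "\<dots> = M / (1 + x) ^ m" by (simp add: M_def add_divide_distrib)
    finally show ?thesis
      unfolding F_def abs_minus_cancel abs_mult using x by (intro mult_mono) auto
  qed
  have M: "M \<ge> 0" using A B G by (auto simp: M_def)
  have l0: "(F \<longlongrightarrow> 0) (at_right 0)"
  proof (rule Lim_null_comparison)
    show "\<forall>\<^sub>F x in at_right 0. norm (F x) \<le> M * x"
    proof (rule eventually_at_rightI[of 0 1])
      fix x :: real assume x: "x \<in> {0<..<1}"
      have "\<bar>F x\<bar> \<le> x powr (?p + 1) * (M / (1 + x) ^ m)" using x by (intro Fb) simp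
      also have "\<dots> \<le> x powr 1 * (M / 1)"
        using x M lam by (intro mult_mono divide_left_mono one_le_power powr_mono') auto
      finally show "norm (F x) \<le> M * x" using x by (simp add: mult.commute)
    qed simp
    show "((\<lambda>x. M * x) \<longlongrightarrow> 0) (at_right 0)"
      by (intro tendsto_mult_right_zero tendsto_ident_at)
  qed
  have l1: "(F \<longlongrightarrow> 0) at_top"
  proof (rule Lim_null_comparison)
    show "\<forall>\<^sub>F x in at_top. norm (F x) \<le> M * inverse x"
      using eventually_gt_at_top[of 0]
    proof eventually_elim
      case (elim x)
      have "\<bar>F x\<bar> \<le> x powr (?p + 1) * (M / (1 + x) ^ m)" using elim by (rule Fb)
      also have "\<dots> \<le> (1 + x) powr (?p + 1) * (M / (1 + x) ^ m)"
        using elim M lam by (intro mult_right_mono powr_mono2) auto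
      also have "\<dots> = M * ((1 + x) powr (?p + 1) / (1 + x) powr real m)"
        using elim by (simp add: powr_realpow)
      also have "(1 + x) powr (?p + 1) / (1 + x) powr real m = (1 + x) powr (?p + 1 - real m)"
        by (rule powr_diff[symmetric])
      also have "M * (1 + x) powr (?p + 1 - real m) \<le> M * (1 + x) powr (- 1)"
        using elim M m by (intro mult_left_mono powr_mono) auto
      also have "\<dots> \<le> M * inverse x"
        using elim M by (intro mult_left_mono) (auto simp: powr_minus field_simps)
      finally show ?case by simp
    qed
    show "((\<lambda>x. M * inverse x) \<longlongrightarrow> 0) at_top"
      by (intro tendsto_mult_right_zero tendsto_inverse_0_at_top filterlim_ident)
  qed
  have "integral\<^sup>L halfline f = 0"
    by (rule integral_halfline_derivative_0[OF d c i l0 l1])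
  then have "(\<integral>x. x powr ?p * b 0 x * jet_bessel lam \<psi> 0 x \<partial>halfline) = y\<^sup>2 * (\<integral>x. x powr ?p * b 0 x * \<psi> 0 x \<partial>halfline)"
    unfolding f_def using i1 i2 by (simp add: Bochner_Integration.integral_diff)
  then show ?thesis
    unfolding hk_def b_def by simp
qed

text \<open>Each factor y^2 is traded for one Bessel operator on the test function, whose jet is
  again of the same kind; the transform of any jet is bounded. The induction therefore has to range
  over all jets.\<close>

lemma hk_decay:
  assumes lam: "lam > 0" and \<psi>: "test_jet \<psi>"
  shows "\<exists>B\<ge>0. \<forall>y. y ^ (2 * N) * \<bar>hk lam (\<psi> 0) y\<bar> \<le> B"
  using \<psi>
proof (induction N arbitrary: \<psi>)
  case 0
  obtain B where B: "B \<ge> 0" "\<And>y. \<bar>hk lam (\<psi> 0) y\<bar> \<le> B"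
    using hk_bounded[OF lam 0, of 0] by blast
  show ?case
    using B by (intro exI[of _ B] conjI allI) simp_all
next
  case (Suc N)
  have e: "y ^ (2 * Suc N) * \<bar>hk lam (\<psi> 0) y\<bar> = y ^ (2 * N) * \<bar>hk lam (jet_bessel lam \<psi> 0) y\<bar>" for y
  proof -
    have "y ^ (2 * Suc N) = y ^ (2 * N) * y\<^sup>2" by (simp add: power2_eq_square)
    then show ?thesis
      unfolding hk_jet_bessel[OF lam Suc.prems] by (simp only: abs_mult abs_power2 mult.assoc)
  qed
  show ?case
    unfolding e by (rule Suc.IH[OF test_jet_bessel[OF Suc.prems]])
qed

lemma hk_powr_integrable:
  assumes lam: "lam > 0" and \<psi>: "test_jet \<psi>" and p: "p > -1"
  shows "integrable halfline (\<lambda>y. y powr p * hk lam (\<psi> 0) y)"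
proof -
  obtain N :: nat where N: "p + 2 \<le> real N" using real_arch_simple by blast
  obtain A where A: "A \<ge> 0" "\<And>y. \<bar>hk lam (\<psi> 0) y\<bar> \<le> A" using hk_bounded[OF lam \<psi>, of 0] by blast
  obtain B where B: "B \<ge> 0" "\<And>y. y ^ (2 * N) * \<bar>hk lam (\<psi> 0) y\<bar> \<le> B" using hk_decay[OF lam \<psi>, of N] by blast
  have [measurable]: "hk lam (\<psi> 0) \<in> borel_measurable halfline"
    by (intro borel_measurable_halflineI measurable_hk test_jet_measurable \<psi>)
  show ?thesis
  proof (rule integral_abs_le(1))
    show "integrable halfline (\<lambda>y. if y \<le> 1 then A * y powr p else B * y powr (- 2))"
      using p by (intro integrable_halfline_two_powers) auto
    fix y :: real assume "y \<in> space halfline"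
    then have y: "y > 0" by simp
    show "\<bar>y powr p * hk lam (\<psi> 0) y\<bar> \<le> (if y \<le> 1 then A * y powr p else B * y powr (- 2))"
    proof (cases "y \<le> 1")
      case True
      then show ?thesis using A(2)[of y] by (simp add: abs_mult mult.commute[of A] mult_left_mono)
    next
      case False
      have "\<bar>hk lam (\<psi> 0) y\<bar> \<le> B / y ^ (2 * N)"
        using B(2)[of y] y by (simp add: pos_le_divide_eq mult.commute)
      then have "y powr p * \<bar>hk lam (\<psi> 0) y\<bar> \<le> y powr p * (B / y ^ (2 * N))"
        by (intro mult_left_mono) auto
      also have "\<dots> = B * (y powr p / y powr real (2 * N))" using powr_realpow[OF y, of "2 * N"] by simp
      also have "y powr p / y powr real (2 * N) = y powr (p - real (2 * N))" by (rule powr_diff[symmetric])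
      also have "B * y powr (p - real (2 * N)) \<le> B * y powr (- 2)"
        using False B N by (intro mult_left_mono powr_mono) auto
      finally show ?thesis using False by (simp add: abs_mult)
    qed
  qed measurable
qed

subsection \<open>The heat semigroup on test functions\<close>

text \<open>The weight of \<open>L_space \<sigma>\<close> recast in terms of x^2, so that it fits
  the denominators t + h^2 of the kernel majorant.\<close>

definition wt :: "real \<Rightarrow> real \<Rightarrow> real" where
  "wt \<sigma> x = (1 + x\<^sup>2) powr (- 1/2 - \<sigma>)"

lemma measurable_wt [measurable]: "wt \<sigma> \<in> borel_measurable borel"
  unfolding wt_def[abs_def] by measurable

lemma wt_nonneg [simp]: "0 \<le> wt \<sigma> x"
  by (simp add: wt_def)

lemma inverse_le_wt:
  assumes "\<sigma> < 1"
  shows "1 / (1 + x\<^sup>2)\<^sup>2 \<le> wt \<sigma> x"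
proof -
  have b: "1 + x\<^sup>2 \<ge> 1" by simp
  have "1 / (1 + x\<^sup>2)\<^sup>2 = (1 + x\<^sup>2) powr (- 2)"
    using powr_realpow[of "1 + x\<^sup>2" 2] by (simp add: powr_minus divide_simps add_pos_nonneg)
  also have "\<dots> \<le> wt \<sigma> x"
    unfolding wt_def using assms b by (intro powr_mono) auto
  finally show ?thesis .
qed

text \<open>Peetre's inequality, from the convexity bound for the square of z + (x - z). It moves
  algebraic decay between x, z and x - z at the price of a factor.\<close>

lemma one_add_square_le: "1 + x\<^sup>2 \<le> 2 * (1 + z\<^sup>2) * (1 + (x - z)\<^sup>2)" for x z :: real
proof -
  have "x\<^sup>2 \<le> 2 * z\<^sup>2 + 2 * (x - z)\<^sup>2"
    using sum_squares_ge_zero[of "x - 2 * z" 0] by (simp add: power2_eq_square algebra_simps)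
  moreover have "0 \<le> 2 * (z\<^sup>2 * (x - z)\<^sup>2)" by simp
  ultimately have "1 + x\<^sup>2 \<le> 1 + 2 * z\<^sup>2 + 2 * (x - z)\<^sup>2 + 2 * (z\<^sup>2 * (x - z)\<^sup>2) + 1" by linarith
  also have "\<dots> = 2 * (1 + z\<^sup>2) * (1 + (x - z)\<^sup>2)" by (simp add: algebra_simps)
  finally show ?thesis .
qed

text \<open>Peetre's inequality raised to the power 1/2 + \<sigma>; as this exponent is below 2, its
  factor 2 (1 + z^2) enters at most squared.\<close>

lemma wt_shift_le:
  assumes "0 < \<sigma>" "\<sigma> < 1"
  shows "wt \<sigma> (x - z) \<le> 4 * (1 + z\<^sup>2)\<^sup>2 * wt \<sigma> x"
proof -
  let ?q = "1/2 + \<sigma>"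
  have p: "1 + z\<^sup>2 > 0" "1 + x\<^sup>2 > 0" "1 + (x - z)\<^sup>2 > 0" by (auto simp: add_pos_nonneg)
  have "(1 + x\<^sup>2) powr ?q \<le> (2 * (1 + z\<^sup>2) * (1 + (x - z)\<^sup>2)) powr ?q"
    using assms p by (intro powr_mono2 one_add_square_le) auto
  also have "\<dots> = (2 * (1 + z\<^sup>2)) powr ?q * (1 + (x - z)\<^sup>2) powr ?q"
    using p by (intro powr_mult) 
  also have "\<dots> \<le> (2 * (1 + z\<^sup>2)) powr 2 * (1 + (x - z)\<^sup>2) powr ?q"
    using assms p by (intro mult_right_mono powr_mono) auto
  also have "(2 * (1 + z\<^sup>2)) powr 2 = 4 * (1 + z\<^sup>2)\<^sup>2"
  proof -
    have "(2 * (1 + z\<^sup>2)) powr 2 = (2 * (1 + z\<^sup>2))\<^sup>2"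
      using powr_realpow[of "2 * (1 + z\<^sup>2)" 2] p by simp
    then show ?thesis unfolding power_mult_distrib by simp
  qed
  finally have a: "(1 + x\<^sup>2) powr ?q \<le> 4 * (1 + z\<^sup>2)\<^sup>2 * (1 + (x - z)\<^sup>2) powr ?q" .
  have e: "wt \<sigma> y = 1 / (1 + y\<^sup>2) powr ?q" for y
  proof -
    have "- 1/2 - \<sigma> = - ?q" by simp
    then show ?thesis unfolding wt_def by (simp only: powr_minus divide_inverse mult_1_left)
  qed
  have "(1 + x\<^sup>2) powr ?q > 0" "(1 + (x - z)\<^sup>2) powr ?q > 0" using p by auto
  then show ?thesis unfolding e using a by (simp add: divide_simps mult.commute)
qed

section \<open>Subordination of powers to exponentials, and the large-time tail of the
  majorant\<close>

lemma has_bochner_integral_halfline_FTC: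
  fixes F f :: "real \<Rightarrow> real"
  assumes "t > 0" and "\<And>s. (F has_real_derivative f s) (at s)" and "\<And>s. isCont f s" and "\<And>s. 0 \<le> f s"
  shows "has_bochner_integral halfline (\<lambda>s. if s \<le> t then f s else 0) (F t - F 0)"
proof -
  have cf: "continuous_on UNIV f" using assms(3) by (simp add: continuous_on_eq_continuous_at)
  have [measurable]: "f \<in> borel_measurable borel" by (rule borel_measurable_continuous_onI[OF cf])
  have b: "has_bochner_integral lborel (\<lambda>s. f s * indicator {0..t} s) (F t - F 0)"
    using assms by (intro has_bochner_integral_FTC_Icc_nonneg) auto
  have ae: "AE s in lborel. f s * indicator {0..t} s = indicator {0<..} s *\<^sub>R (if s \<le> t then f s else 0)"
    using AE_lborel_singleton[of 0] by eventually_elim (auto simp: indicator_def)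
  have "has_bochner_integral lborel (\<lambda>s. indicator {0<..} s *\<^sub>R (if s \<le> t then f s else 0)) (F t - F 0)"
    using b by (subst (asm) has_bochner_integral_cong_AE[OF _ _ ae]) auto
  then show ?thesis
    unfolding has_bochner_integral_iff halfline_def
    by (subst integrable_restrict_space, simp, subst integral_restrict_space) auto
qed

lemma has_bochner_integral_one_minus_exp:
  assumes a: "a > 0" and t: "t > 0"
  shows "has_bochner_integral halfline (\<lambda>s. if s \<le> t then a * exp (- (a * s)) else 0) (1 - exp (- (a * t)))"
proof -
  have "has_bochner_integral halfline (\<lambda>s. if s \<le> t then a * exp (- (a * s)) else 0) (- exp (- (a * t)) - - exp (- (a * 0)))"
    using a t by (intro has_bochner_integral_halfline_FTC) (auto intro!: derivative_eq_intros continuous_intros)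
  then show ?thesis by simp
qed

text \<open>Writing 1 - exp(-a t) as the integral of a exp(-a s) over s <= t and applying Tonelli
  leaves a Gamma integral of order 1 - \<sigma>. The functional equation turns Gamma(1 - \<sigma>) /
  \<sigma> into - Gamma(-\<sigma>).\<close>

lemma has_bochner_integral_power_subordination:
  assumes a: "a > 0" and \<sigma>: "0 < \<sigma>" "\<sigma> < 1"
  shows "has_bochner_integral halfline (\<lambda>t. (1 - exp (- (a * t))) / t powr (1 + \<sigma>)) (- Gamma (- \<sigma>) * a powr \<sigma>)"
proof (rule has_bochner_integral_nn_integral)
  let ?g = "\<lambda>s. a * exp (- (a * s))"
  have "(\<integral>\<^sup>+t. ennreal ((1 - exp (- (a * t))) / t powr (1 + \<sigma>)) \<partial>halfline)
    = (\<integral>\<^sup>+t. (\<integral>\<^sup>+s. ennreal (if s \<le> t then ?g s else 0) * ennreal (t powr (- (1 + \<sigma>))) \<partial>halfline) \<partial>halfline)"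
  proof (intro nn_integral_cong)
    fix t assume "t \<in> space halfline"
    then have t: "t > 0" by simp
    have h: "has_bochner_integral halfline (\<lambda>s. if s \<le> t then ?g s else 0) (1 - exp (- (a * t)))"
      by (rule has_bochner_integral_one_minus_exp[OF a t])
    have "(\<integral>\<^sup>+s. ennreal (if s \<le> t then ?g s else 0) * ennreal (t powr (- (1 + \<sigma>))) \<partial>halfline)
      = (\<integral>\<^sup>+s. ennreal (if s \<le> t then ?g s else 0) \<partial>halfline) * ennreal (t powr (- (1 + \<sigma>)))"
      by (rule nn_integral_multc) measurable
    also have "(\<integral>\<^sup>+s. ennreal (if s \<le> t then ?g s else 0) \<partial>halfline) = ennreal (1 - exp (- (a * t)))"
      using h a by (subst nn_integral_eq_integral) (auto simp: has_bochner_integral_iff)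
    also have "\<dots> * ennreal (t powr (- (1 + \<sigma>))) = ennreal ((1 - exp (- (a * t))) * t powr (- (1 + \<sigma>)))"
      by (rule ennreal_mult''[symmetric]) simp
    finally show "ennreal ((1 - exp (- (a * t))) / t powr (1 + \<sigma>))
      = (\<integral>\<^sup>+s. ennreal (if s \<le> t then ?g s else 0) * ennreal (t powr (- (1 + \<sigma>))) \<partial>halfline)"
      by (simp only: powr_minus divide_inverse)
  qed
  also have "\<dots> = (\<integral>\<^sup>+s. (\<integral>\<^sup>+t. ennreal (if s \<le> t then ?g s else 0) * ennreal (t powr (- (1 + \<sigma>))) \<partial>halfline) \<partial>halfline)"
    by (rule halfline_pair.Fubini') measurable
  also have "\<dots> = (\<integral>\<^sup>+s. ennreal (a / \<sigma>) * ennreal (s powr (1 - \<sigma> - 1) * exp (- (a * s))) \<partial>halfline)"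
  proof (intro nn_integral_cong)
    fix s assume "s \<in> space halfline"
    then have s: "s > 0" by simp
    have "(\<integral>\<^sup>+t. ennreal (if s \<le> t then ?g s else 0) * ennreal (t powr (- (1 + \<sigma>))) \<partial>halfline)
      = (\<integral>\<^sup>+t. ennreal (?g s) * (ennreal (t powr (- (1 + \<sigma>))) * indicator {s<..} t) \<partial>halfline)"
    proof (rule nn_integral_cong_AE)
      have "AE t in lborel. 0 < t \<longrightarrow> t \<noteq> s"
        using AE_lborel_singleton[of s] by eventually_elim auto
      then have "AE t in halfline. t \<noteq> s"
        unfolding halfline_def by (subst AE_restrict_space_iff) auto
      then show "AE t in halfline. ennreal (if s \<le> t then ?g s else 0) * ennreal (t powr (- (1 + \<sigma>)))
         = ennreal (?g s) * (ennreal (t powr (- (1 + \<sigma>))) * indicator {s<..} t)"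
        by eventually_elim (auto simp: indicator_def)
    qed
    also have "\<dots> = ennreal (?g s) * (\<integral>\<^sup>+t. ennreal (t powr (- (1 + \<sigma>))) * indicator {s<..} t \<partial>halfline)"
      by (rule nn_integral_cmult) measurable
    also have "(\<integral>\<^sup>+t. ennreal (t powr (- (1 + \<sigma>))) * indicator {s<..} t \<partial>halfline) = ennreal (s powr (- \<sigma>) / \<sigma>)"
      using nn_integral_halfline_powr_inf[of "- (1 + \<sigma>)" s] \<sigma> s by simp
    also have "ennreal (?g s) * ennreal (s powr (- \<sigma>) / \<sigma>) = ennreal (?g s * (s powr (- \<sigma>) / \<sigma>))"
      using a by (intro ennreal_mult'[symmetric]) simp
    also have "?g s * (s powr (- \<sigma>) / \<sigma>) = (a / \<sigma>) * (s powr (1 - \<sigma> - 1) * exp (- (a * s)))" by simp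
    also have "ennreal \<dots> = ennreal (a / \<sigma>) * ennreal (s powr (1 - \<sigma> - 1) * exp (- (a * s)))"
      using a \<sigma> by (intro ennreal_mult') simp
    finally show "(\<integral>\<^sup>+t. ennreal (if s \<le> t then ?g s else 0) * ennreal (t powr (- (1 + \<sigma>))) \<partial>halfline)
      = ennreal (a / \<sigma>) * ennreal (s powr (1 - \<sigma> - 1) * exp (- (a * s)))" .
  qed
  also have "\<dots> = ennreal (a / \<sigma>) * (\<integral>\<^sup>+s. ennreal (s powr (1 - \<sigma> - 1) * exp (- (a * s))) \<partial>halfline)"
    by (rule nn_integral_cmult) measurable
  also have "(\<integral>\<^sup>+s. ennreal (s powr (1 - \<sigma> - 1) * exp (- (a * s))) \<partial>halfline) = ennreal (Gamma (1 - \<sigma>) / a powr (1 - \<sigma>))"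
    using has_bochner_integral_Gamma[of "1 - \<sigma>" a] a \<sigma>
    by (subst nn_integral_eq_integral) (auto simp: has_bochner_integral_iff)
  also have "ennreal (a / \<sigma>) * ennreal (Gamma (1 - \<sigma>) / a powr (1 - \<sigma>)) = ennreal (a / \<sigma> * (Gamma (1 - \<sigma>) / a powr (1 - \<sigma>)))"
    using a \<sigma> by (intro ennreal_mult'[symmetric]) simp
  also have "a / \<sigma> * (Gamma (1 - \<sigma>) / a powr (1 - \<sigma>)) = - Gamma (- \<sigma>) * a powr \<sigma>"
  proof -
    have "- \<sigma> \<notin> \<int>\<^sub>\<le>\<^sub>0" using Gamma_uminus_neg[OF \<sigma>] Gamma_eq_zero_iff[of "- \<sigma>"] by auto
    from Gamma_plus1[OF this] have "Gamma (1 - \<sigma>) = - \<sigma> * Gamma (- \<sigma>)" by simp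
    moreover have "a powr (1 - \<sigma>) = a / a powr \<sigma>" using a by (simp add: powr_diff)
    ultimately show ?thesis using a \<sigma> by simp
  qed
  finally show "(\<integral>\<^sup>+t. ennreal ((1 - exp (- (a * t))) / t powr (1 + \<sigma>)) \<partial>halfline) = ennreal (- Gamma (- \<sigma>) * a powr \<sigma>)" .
  show "0 \<le> - Gamma (- \<sigma>) * a powr \<sigma>" using Gamma_uminus_neg[OF \<sigma>] by (intro mult_nonneg_nonneg) auto
  show "AE t in halfline. 0 \<le> (1 - exp (- (a * t))) / t powr (1 + \<sigma>)" using a by (intro AE_I2) auto
qed measurable

text \<open>For t > 1 the quantity t + 1 + h^2 is at most twice t + h^2, which costs 2^3 = 8 and
  reduces the tail to \<open>nn_integral_rk_le\<close> at d = 1 + h^2. Without the small times there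
  is no singularity at h = 0, and the outcome is a multiple of the weight.\<close>

lemma nn_integral_rk_tail:
  assumes "0 < \<sigma>" "\<sigma> < 1"
  shows "(\<integral>\<^sup>+t. ennreal (if t \<le> 1 then 0 else rk t h / t powr (1 + \<sigma>)) \<partial>halfline)
    \<le> ennreal (8 * (1 / (5/2 - \<sigma>) + 1 / (1/2 + \<sigma>)) * wt \<sigma> h)"
proof -
  have d: "1 + h\<^sup>2 > 0" by (simp add: add_pos_nonneg)
  have "(\<integral>\<^sup>+t. ennreal (if t \<le> 1 then 0 else rk t h / t powr (1 + \<sigma>)) \<partial>halfline)
    \<le> (\<integral>\<^sup>+t. ennreal 8 * ennreal (t powr (5/2) / (t + (1 + h\<^sup>2)) ^ 3 / t powr (1 + \<sigma>)) \<partial>halfline)"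
  proof (intro nn_integral_mono)
    fix t assume "t \<in> space halfline"
    then have t: "t > 0" by simp
    show "ennreal (if t \<le> 1 then 0 else rk t h / t powr (1 + \<sigma>))
      \<le> ennreal 8 * ennreal (t powr (5/2) / (t + (1 + h\<^sup>2)) ^ 3 / t powr (1 + \<sigma>))"
    proof (cases "t \<le> 1")
      case False
      have "(t + (1 + h\<^sup>2)) ^ 3 \<le> (2 * (t + h\<^sup>2)) ^ 3"
      proof (rule power_mono)
        have "1 + 0 \<le> t + h\<^sup>2" using False by (intro add_mono) auto
        then show "t + (1 + h\<^sup>2) \<le> 2 * (t + h\<^sup>2)" by (simp add: distrib_left)
        show "0 \<le> t + (1 + h\<^sup>2)" using t by (intro add_nonneg_nonneg) auto
      qed
      then have "(t + (1 + h\<^sup>2)) ^ 3 \<le> 8 * (t + h\<^sup>2) ^ 3" unfolding power_mult_distrib by simp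
      moreover have "0 < (t + h\<^sup>2) ^ 3" "0 < (t + (1 + h\<^sup>2)) ^ 3" using t by (auto intro!: zero_less_power simp: add_pos_nonneg)
      ultimately have "1 / (t + h\<^sup>2) ^ 3 \<le> 8 * (1 / (t + (1 + h\<^sup>2)) ^ 3)"
        by (simp add: divide_simps)
      then have "t powr (5/2) * (1 / (t + h\<^sup>2) ^ 3) \<le> t powr (5/2) * (8 * (1 / (t + (1 + h\<^sup>2)) ^ 3))"
        by (intro mult_left_mono) auto
      then have "rk t h \<le> 8 * (t powr (5/2) / (t + (1 + h\<^sup>2)) ^ 3)" by (simp add: rk_def mult.commute)
      then have "rk t h / t powr (1 + \<sigma>) \<le> 8 * (t powr (5/2) / (t + (1 + h\<^sup>2)) ^ 3) / t powr (1 + \<sigma>)"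
        by (intro divide_right_mono) auto
      then have "ennreal (rk t h / t powr (1 + \<sigma>)) \<le> ennreal (8 * (t powr (5/2) / (t + (1 + h\<^sup>2)) ^ 3 / t powr (1 + \<sigma>)))"
        by (intro ennreal_leI) simp
      also have "\<dots> = ennreal 8 * ennreal (t powr (5/2) / (t + (1 + h\<^sup>2)) ^ 3 / t powr (1 + \<sigma>))"
        by (intro ennreal_mult') simp
      finally show ?thesis using False by simp
    qed simp
  qed
  also have "\<dots> = ennreal 8 * (\<integral>\<^sup>+t. ennreal (t powr (5/2) / (t + (1 + h\<^sup>2)) ^ 3 / t powr (1 + \<sigma>)) \<partial>halfline)"
    by (rule nn_integral_cmult) measurable
  also have "\<dots> \<le> ennreal 8 * ennreal ((1 / (5/2 - \<sigma>) + 1 / (1/2 + \<sigma>)) * (1 + h\<^sup>2) powr (- 1/2 - \<sigma>))"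
    by (intro mult_left_mono nn_integral_rk_le d assms) simp
  also have "\<dots> = ennreal (8 * ((1 / (5/2 - \<sigma>) + 1 / (1/2 + \<sigma>)) * (1 + h\<^sup>2) powr (- 1/2 - \<sigma>)))"
    by (intro ennreal_mult'[symmetric]) simp
  finally show ?thesis by (simp only: wt_def mult.assoc)
qed

section \<open>Kernel form and spectral form of the heat semigroup\<close>

context bessel_heat begin

definition heat_op :: "real \<Rightarrow> (real \<Rightarrow> real) \<Rightarrow> real \<Rightarrow> real" where
  "heat_op t f x = (\<integral>y. heat_kernel lam t x y * f y \<partial>halfline)"

definition jet_fun :: "(nat \<Rightarrow> real \<Rightarrow> real) \<Rightarrow> real \<Rightarrow> real" where
  "jet_fun \<psi> x = x powr lam * \<psi> 0 x"

lemma jet_fun_measurable: "test_jet \<psi> \<Longrightarrow> jet_fun \<psi> \<in> borel_measurable halfline"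
proof -
  assume "test_jet \<psi>"
  note [measurable] = test_jet_measurable[OF this, of 0]
  show ?thesis unfolding jet_fun_def[abs_def] by measurable
qed

text \<open>The inverse Hankel transform of \<open>exp (- t y\<^sup>2)\<close> times the Hankel transform.\<close>

definition spec_heat :: "(nat \<Rightarrow> real \<Rightarrow> real) \<Rightarrow> real \<Rightarrow> real \<Rightarrow> real" where
  "spec_heat \<psi> t x = 2 powr (1/2 - lam) * x powr lam *
     (\<integral>y. y powr (2 * lam) * jb lam (x * y) * hk lam (\<psi> 0) y * exp (- (t * y\<^sup>2)) \<partial>halfline)"

lemma hk_measurable_halfline: "test_jet \<psi> \<Longrightarrow> hk lam (\<psi> k) \<in> borel_measurable halfline"
  by (intro borel_measurable_halflineI measurable_hk test_jet_measurable)

lemma spec_integrable: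
  assumes \<psi>: "test_jet \<psi>" and p: "p > -1" and [measurable]: "h \<in> borel_measurable borel"
    and h: "\<And>y. y > 0 \<Longrightarrow> \<bar>h y\<bar> \<le> H"
  shows "integrable halfline (\<lambda>y. y powr p * jb lam (x * y) * hk lam (\<psi> 0) y * h y)"
proof (rule integral_abs_le(1))
  note [measurable] = hk_measurable_halfline[OF \<psi>, of 0] borel_measurable_halflineI[of h]
  let ?G = "inverse (Gamma (lam + 1/2))"
  have G: "?G \<ge> 0" using lam by simp
  show "integrable halfline (\<lambda>y. (?G * H) * \<bar>y powr p * hk lam (\<psi> 0) y\<bar>)"
    by (intro integrable_mult_right integrable_abs hk_powr_integrable lam \<psi> p)
  show "(\<lambda>y. y powr p * jb lam (x * y) * hk lam (\<psi> 0) y * h y) \<in> borel_measurable halfline"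
    by measurable
  fix y :: real assume "y \<in> space halfline"
  then have y: "y > 0" by simp
  have "\<bar>y powr p * jb lam (x * y) * hk lam (\<psi> 0) y * h y\<bar> = (\<bar>jb lam (x * y)\<bar> * \<bar>h y\<bar>) * \<bar>y powr p * hk lam (\<psi> 0) y\<bar>"
    by (simp add: abs_mult)
  also have "\<dots> \<le> (?G * H) * \<bar>y powr p * hk lam (\<psi> 0) y\<bar>"
    using jb_abs_le[OF lam, of "x * y"] h[OF y] G by (intro mult_right_mono mult_mono) auto
  finally show "\<bar>y powr p * jb lam (x * y) * hk lam (\<psi> 0) y * h y\<bar> \<le> (?G * H) * \<bar>y powr p * hk lam (\<psi> 0) y\<bar>" .
qed

text \<open>Inserting the inner transform gives a double integral in y and z. Both factors
  \<open>jb\<close> are bounded, so the Gaussian makes it absolutely convergent, and its y-integral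
  is Weber's. At t = 0 this convergence is lost; that case is reached by a limit.\<close>

lemma spec_heat_eq_heat_op:
  assumes \<psi>: "test_jet \<psi>" and t: "t > 0" and x: "x > 0"
  shows "spec_heat \<psi> t x = heat_op t (jet_fun \<psi>) x"
proof -
  let ?\<kappa> = "2 powr (1/2 - lam) :: real"
  let ?G = "inverse (Gamma (lam + 1/2))"
  have G: "?G \<ge> 0" using lam by simp
  define w where "w y = y powr (2 * lam) * exp (- (t * y\<^sup>2))" for y
  define c where "c z = 1 / (2 * t powr (lam + 1/2)) * (exp (- (x\<^sup>2 / (4 * t))) * exp (- (z\<^sup>2 / (4 * t))) * bes (lam + 1/2) (x\<^sup>2 / (4 * t) * (z\<^sup>2 / (4 * t))))" for z
  define F where "F y z = (w y * jb lam (x * y)) * (z powr (2 * lam) * jb lam (z * y) * \<psi> 0 z)" for y z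
  note [measurable] = test_jet_measurable[OF \<psi>, of 0] hk_measurable_halfline[OF \<psi>, of 0]
  have [measurable]: "(\<lambda>p. \<psi> 0 (snd p)) \<in> borel_measurable (halfline \<Otimes>\<^sub>M halfline)"
    by (rule measurable_compose[OF measurable_snd test_jet_measurable[OF \<psi>]])
  have i\<psi>: "integrable halfline (\<lambda>z. \<bar>z powr (2 * lam) * \<psi> 0 z\<bar>)"
    using test_jet_integrable[OF \<psi>, where h = "\<lambda>_. 1" and j = 0 and H = 1 and p = "2 * lam" and k = 0] lam
    by (intro integrable_abs) simp
  define N where "N = (\<integral>z. \<bar>z powr (2 * lam) * \<psi> 0 z\<bar> \<partial>halfline)"
  have m: "case_prod F \<in> borel_measurable (halfline \<Otimes>\<^sub>M halfline)"
    unfolding F_def w_def by measurable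
  have iw: "integrable halfline w"
    using gaussian_moment_power[OF lam t, of 0] unfolding w_def by (auto intro: integrable.intros)
  have bound: "(\<integral>\<^sup>+z. ennreal \<bar>F y z\<bar> \<partial>halfline) \<le> ennreal (w y * (?G * (?G * N)))" for y
  proof -
    have wp: "0 \<le> w y" by (simp add: w_def)
    have "(\<integral>\<^sup>+z. ennreal \<bar>F y z\<bar> \<partial>halfline) \<le> (\<integral>\<^sup>+z. ennreal ((w y * (?G * ?G)) * \<bar>z powr (2 * lam) * \<psi> 0 z\<bar>) \<partial>halfline)"
    proof (intro nn_integral_mono ennreal_leI)
      fix z
      have "\<bar>F y z\<bar> = (w y * (\<bar>jb lam (x * y)\<bar> * \<bar>jb lam (z * y)\<bar>)) * \<bar>z powr (2 * lam) * \<psi> 0 z\<bar>"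
        using wp by (simp add: F_def abs_mult)
      also have "\<dots> \<le> (w y * (?G * ?G)) * \<bar>z powr (2 * lam) * \<psi> 0 z\<bar>"
        using wp G jb_abs_le[OF lam, of "x * y"] jb_abs_le[OF lam, of "z * y"]
        by (intro mult_right_mono mult_left_mono mult_mono) auto
      finally show "\<bar>F y z\<bar> \<le> (w y * (?G * ?G)) * \<bar>z powr (2 * lam) * \<psi> 0 z\<bar>" .
    qed
    also have "\<dots> = ennreal ((w y * (?G * ?G)) * N)"
      using i\<psi> wp G unfolding N_def by (subst nn_integral_eq_integral) auto
    finally show ?thesis by (simp only: mult.assoc)
  qed
  have b: "integrable halfline (\<lambda>y. w y * (?G * (?G * N)))"
    using iw by (rule integrable_mult_left)
  have fub: "(\<integral>y. \<integral>z. F y z \<partial>halfline \<partial>halfline) = (\<integral>z. \<integral>y. F y z \<partial>halfline \<partial>halfline)"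
    by (rule halfline_pair.Fubini_bounded(4)[OF m bound b])
  have e1: "?\<kappa> * (\<integral>z. F y z \<partial>halfline) = y powr (2 * lam) * jb lam (x * y) * hk lam (\<psi> 0) y * exp (- (t * y\<^sup>2))" for y
  proof -
    have "(\<integral>z. F y z \<partial>halfline) = (w y * jb lam (x * y)) * (\<integral>z. z powr (2 * lam) * jb lam (z * y) * \<psi> 0 z \<partial>halfline)"
      unfolding F_def by (rule integral_mult_right_zero)
    then show ?thesis unfolding hk_def w_def by simp
  qed
  have e2: "(\<integral>y. F y z \<partial>halfline) = c z * (z powr (2 * lam) * \<psi> 0 z)" for z
  proof -
    have "(\<integral>y. F y z \<partial>halfline) = (\<integral>y. (y powr (2 * lam) * exp (- (t * y\<^sup>2)) * jb lam (x * y) * jb lam (z * y)) * (z powr (2 * lam) * \<psi> 0 z) \<partial>halfline)"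
      by (intro Bochner_Integration.integral_cong refl) (simp add: F_def w_def)
    also have "\<dots> = c z * (z powr (2 * lam) * \<psi> 0 z)"
      unfolding integral_mult_left_zero has_bochner_integral_integral_eq[OF weber[OF lam t]] c_def ..
    finally show ?thesis .
  qed
  have eq: "(\<integral>y. y powr (2 * lam) * jb lam (x * y) * hk lam (\<psi> 0) y * exp (- (t * y\<^sup>2)) \<partial>halfline)
    = ?\<kappa> * (\<integral>z. c z * (z powr (2 * lam) * \<psi> 0 z) \<partial>halfline)"
    unfolding e1[symmetric] integral_mult_right_zero fub by (simp only: e2)
  have kk: "?\<kappa> * ?\<kappa> = 2 powr (1 - 2 * lam)" unfolding powr_add[symmetric] by (simp add: algebra_simps)
  have "spec_heat \<psi> t x = (\<integral>z. (?\<kappa> * ?\<kappa>) * x powr lam * (c z * (z powr (2 * lam) * \<psi> 0 z)) \<partial>halfline)"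
    unfolding spec_heat_def eq integral_mult_right_zero by (simp only: mult_ac)
  also have "\<dots> = heat_op t (jet_fun \<psi>) x"
    unfolding heat_op_def kk
  proof (rule Bochner_Integration.integral_cong[OF refl])
    fix z assume "z \<in> space halfline"
    then have z: "z > 0" by simp
    have h: "heat_kernel lam t x z = 2 powr (1 - 2 * lam) * (x * z) powr lam * c z"
      unfolding c_def by (rule heat_kernel_eq_weber[OF lam t x z])
    have "z powr (2 * lam) = z powr lam * z powr lam" unfolding powr_add[symmetric] by simp
    moreover have "(x * z) powr lam = x powr lam * z powr lam" using x z by (simp add: powr_mult)
    ultimately show "2 powr (1 - 2 * lam) * x powr lam * (c z * (z powr (2 * lam) * \<psi> 0 z)) = heat_kernel lam t x z * jet_fun \<psi> z"
      unfolding h jet_fun_def by (simp only: mult_ac)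
  qed
  finally show ?thesis .
qed

lemma powr_le_power:
  assumes "x > 0" "0 \<le> p" "p \<le> real n"
  shows "x powr p \<le> (1 + x) ^ n"
proof -
  have "x powr p \<le> (1 + x) powr p" using assms by (intro powr_mono2) auto
  also have "\<dots> \<le> (1 + x) powr real n" using assms by (intro powr_mono) auto
  also have "\<dots> = (1 + x) ^ n" using assms by (intro powr_realpow) simp
  finally show ?thesis .
qed

text \<open>The derivative contains lam x^(lam-1), which stays bounded near the origin because lam
  >= 1; at infinity the decay of the jet wins over all powers.\<close>

lemma jet_fun_lipschitz:
  assumes \<psi>: "test_jet \<psi>" and lam1: "lam \<ge> 1"
  obtains L where "L \<ge> 0" "\<And>x z. x > 0 \<Longrightarrow> z > 0 \<Longrightarrow> \<bar>jet_fun \<psi> z - jet_fun \<psi> x\<bar> \<le> L * \<bar>x - z\<bar>"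
proof -
  obtain n where n: "lam + 1 \<le> real n" using real_arch_simple by blast
  obtain A where A: "A \<ge> 0" "\<And>x. x > 0 \<Longrightarrow> \<bar>\<psi> 0 x\<bar> \<le> A / (1 + x) ^ n"
    using test_jet_decay[OF \<psi>, of 0 n] by blast
  obtain B where B: "B \<ge> 0" "\<And>x. x > 0 \<Longrightarrow> \<bar>\<psi> 1 x\<bar> \<le> B / (1 + x) ^ n"
    using test_jet_decay[OF \<psi>, of 1 n] by blast
  define L where "L = lam * A + B"
  have d: "(jet_fun \<psi> has_real_derivative lam * x powr (lam - 1) * \<psi> 0 x + x powr (lam + 1) * \<psi> 1 x) (at x)"
    if x: "x > 0" for x
  proof -
    have "x powr (lam + 1) = x * x powr lam" using x by (simp add: powr_add)
    then show ?thesis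
      using DERIV_mult[OF has_real_derivative_powr[OF x, of lam] test_jet_derivative[OF \<psi> x, of 0]]
      unfolding jet_fun_def[abs_def] by (simp add: mult_ac add.commute)
  qed
  have b: "\<bar>lam * x powr (lam - 1) * \<psi> 0 x + x powr (lam + 1) * \<psi> 1 x\<bar> \<le> L" if x: "x > 0" for x
  proof -
    have p: "(1 + x) ^ n > 0" using x by simp
    have "x powr (lam - 1) * \<bar>\<psi> 0 x\<bar> \<le> (1 + x) ^ n * (A / (1 + x) ^ n)"
      using powr_le_power[OF x, of "lam - 1" n] A(2)[OF x] lam1 n x by (intro mult_mono) auto
    then have 1: "x powr (lam - 1) * \<bar>\<psi> 0 x\<bar> \<le> A" using x by simp
    have "x powr (lam + 1) * \<bar>\<psi> 1 x\<bar> \<le> (1 + x) ^ n * (B / (1 + x) ^ n)"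
      using powr_le_power[OF x, of "lam + 1" n] B(2)[OF x] lam1 n x by (intro mult_mono) auto
    then have 2: "x powr (lam + 1) * \<bar>\<psi> 1 x\<bar> \<le> B" using x by simp
    have "\<bar>lam * x powr (lam - 1) * \<psi> 0 x + x powr (lam + 1) * \<psi> 1 x\<bar>
      \<le> lam * (x powr (lam - 1) * \<bar>\<psi> 0 x\<bar>) + x powr (lam + 1) * \<bar>\<psi> 1 x\<bar>"
      using lam by (intro order_trans[OF abs_triangle_ineq]) (simp add: abs_mult)
    also have "\<dots> \<le> lam * A + B" using 1 2 lam by (intro add_mono mult_left_mono) auto
    finally show ?thesis unfolding L_def .
  qed
  show ?thesis
  proof
    show "L \<ge> 0" using A B lam by (simp add: L_def)
    fix x z :: real assume "x > 0" "z > 0"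
    then show "\<bar>jet_fun \<psi> z - jet_fun \<psi> x\<bar> \<le> L * \<bar>x - z\<bar>"
      using field_differentiable_bound[of "{0<..}" "jet_fun \<psi>" _ L z x, OF _ has_field_derivative_at_within[OF d]] b
      by (simp add: abs_minus_commute)
  qed
qed

lemma heat_op_diff:
  assumes t: "t > 0" and x: "x > 0" and i: "integrable halfline (\<lambda>y. heat_kernel lam t x y * f y)"
  shows "integrable halfline (\<lambda>y. heat_kernel lam t x y * (f y - f x))"
    and "heat_op t f x - f x = (\<integral>y. heat_kernel lam t x y * (f y - f x) \<partial>halfline) + f x * (heat_one lam t x - 1)"
proof -
  have i2: "integrable halfline (\<lambda>y. heat_kernel lam t x y * f x)"
    using heat_integrable[OF t x] by (rule integrable_mult_left)
  have e: "(\<lambda>y. heat_kernel lam t x y * (f y - f x)) = (\<lambda>y. heat_kernel lam t x y * f y - heat_kernel lam t x y * f x)"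
    by (simp add: right_diff_distrib)
  show "integrable halfline (\<lambda>y. heat_kernel lam t x y * (f y - f x))"
    unfolding e by (rule Bochner_Integration.integrable_diff[OF i i2])
  show "heat_op t f x - f x = (\<integral>y. heat_kernel lam t x y * (f y - f x) \<partial>halfline) + f x * (heat_one lam t x - 1)"
    unfolding e Bochner_Integration.integral_diff[OF i i2] heat_op_def heat_one_eq integral_mult_left_zero
    by (simp add: algebra_simps)
qed

lemma jet_fun_le:
  assumes "test_jet \<psi>"
  obtains A where "A \<ge> 0" "\<And>x. x > 0 \<Longrightarrow> \<bar>jet_fun \<psi> x\<bar> \<le> A / (1 + x) ^ m"
proof -
  obtain n where n: "lam \<le> real n" using real_arch_simple by blast
  obtain A where A: "A \<ge> 0" "\<And>x. x > 0 \<Longrightarrow> \<bar>\<psi> 0 x\<bar> \<le> A / (1 + x) ^ (n + m)"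
    using test_jet_decay[OF assms, of 0 "n + m"] by blast
  have "\<bar>jet_fun \<psi> x\<bar> \<le> A / (1 + x) ^ m" if x: "x > 0" for x
  proof -
    have "\<bar>jet_fun \<psi> x\<bar> \<le> (1 + x) ^ n * (A / (1 + x) ^ (n + m))"
      unfolding jet_fun_def abs_mult using powr_le_power[OF x, of lam n] A(2)[OF x] lam n x by (intro mult_mono) auto
    then show ?thesis using x by (simp add: power_add)
  qed
  then show ?thesis using A(1) that by blast
qed

lemma heat_op_integrable_jet:
  assumes "test_jet \<psi>" "t > 0" "x > 0"
  shows "integrable halfline (\<lambda>y. heat_kernel lam t x y * jet_fun \<psi> y)"
proof -
  obtain A where A: "A \<ge> 0" "\<And>x. x > 0 \<Longrightarrow> \<bar>jet_fun \<psi> x\<bar> \<le> A / (1 + x) ^ 0"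
    using jet_fun_le[OF assms(1), of 0] by blast
  show ?thesis
    using A by (intro heat_integrable_bounded(1)[OF assms(2,3) A(1)] jet_fun_measurable assms) auto
qed

lemma heat_op_tendsto_jet:
  assumes \<psi>: "test_jet \<psi>" and lam1: "lam \<ge> 1" and x: "x > 0"
  shows "((\<lambda>t. heat_op t (jet_fun \<psi>) x) \<longlongrightarrow> jet_fun \<psi> x) (at_right 0)"
proof -
  obtain L where L: "L \<ge> 0" "\<And>x z. x > 0 \<Longrightarrow> z > 0 \<Longrightarrow> \<bar>jet_fun \<psi> z - jet_fun \<psi> x\<bar> \<le> L * \<bar>x - z\<bar>"
    using jet_fun_lipschitz[OF \<psi> lam1] by blast
  note [measurable] = jet_fun_measurable[OF \<psi>]
  have "((\<lambda>t. heat_op t (jet_fun \<psi>) x - jet_fun \<psi> x) \<longlongrightarrow> 0) (at_right 0)"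
  proof (rule Lim_null_comparison)
    show "\<forall>\<^sub>F t in at_right 0. norm (heat_op t (jet_fun \<psi>) x - jet_fun \<psi> x)
      \<le> C * L * sqrt t * pi + \<bar>jet_fun \<psi> x\<bar> * ((C * pi + 1) * (t / x\<^sup>2))"
    proof (rule eventually_at_rightI[of 0 1])
      fix t :: real assume "t \<in> {0<..<1}"
      then have t: "t > 0" by simp
      note h = heat_op_diff[OF t x heat_op_integrable_jet[OF \<psi> t x]]
      have "\<bar>\<integral>y. heat_kernel lam t x y * (jet_fun \<psi> y - jet_fun \<psi> x) \<partial>halfline\<bar> \<le> C * L * t powr (1 / 2) * pi"
        using L x by (intro heat_moment(2)[OF t x]) auto
      moreover have "\<bar>jet_fun \<psi> x * (heat_one lam t x - 1)\<bar> \<le> \<bar>jet_fun \<psi> x\<bar> * ((C * pi + 1) * (t / x\<^sup>2))"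
        unfolding abs_mult using heat_one_bound[OF t x, of 1] t by (intro mult_left_mono) auto
      ultimately show "norm (heat_op t (jet_fun \<psi>) x - jet_fun \<psi> x)
        \<le> C * L * sqrt t * pi + \<bar>jet_fun \<psi> x\<bar> * ((C * pi + 1) * (t / x\<^sup>2))"
        unfolding h(2) real_norm_def using t by (simp add: powr_half_sqrt)
    qed simp
    have "((\<lambda>t. C * L * sqrt t * pi + \<bar>jet_fun \<psi> x\<bar> * ((C * pi + 1) * (t / x\<^sup>2))) \<longlongrightarrow>
      C * L * sqrt 0 * pi + \<bar>jet_fun \<psi> x\<bar> * ((C * pi + 1) * (0 / x\<^sup>2))) (at_right 0)"
      using x by (intro tendsto_intros) auto
    then show "((\<lambda>t. C * L * sqrt t * pi + \<bar>jet_fun \<psi> x\<bar> * ((C * pi + 1) * (t / x\<^sup>2))) \<longlongrightarrow> 0) (at_right 0)"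
      by simp
  qed
  then show ?thesis by (rule LIM_zero_cancel)
qed

text \<open>This is Hankel inversion on test functions. Along t = 1/(n+1) the kernel form tends to
  the function itself, while the spectral form converges by domination, the transform being
  integrable against y^(2 lam).\<close>

lemma spec_heat_0:
  assumes \<psi>: "test_jet \<psi>" and lam1: "lam \<ge> 1" and x: "x > 0"
  shows "spec_heat \<psi> 0 x = jet_fun \<psi> x"
proof -
  note [measurable] = hk_measurable_halfline[OF \<psi>, of 0]
  have lim0: "(\<lambda>n. inverse (real (Suc n))) \<longlonglongrightarrow> 0" by (rule LIMSEQ_inverse_real_of_nat)
  have "filterlim (\<lambda>n. inverse (real (Suc n))) (at_right 0) sequentially"
    unfolding filterlim_at using lim0 by (auto intro!: always_eventually)
  from filterlim_compose[OF heat_op_tendsto_jet[OF assms] this]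
  have a: "(\<lambda>n. heat_op (inverse (real (Suc n))) (jet_fun \<psi>) x) \<longlonglongrightarrow> jet_fun \<psi> x" .
  have "(\<lambda>n. \<integral>y. y powr (2 * lam) * jb lam (x * y) * hk lam (\<psi> 0) y * exp (- (inverse (real (Suc n)) * y\<^sup>2)) \<partial>halfline)
    \<longlonglongrightarrow> (\<integral>y. y powr (2 * lam) * jb lam (x * y) * hk lam (\<psi> 0) y * exp (- (0 * y\<^sup>2)) \<partial>halfline)"
  proof (rule integral_dominated_convergence[where w = "\<lambda>y. \<bar>y powr (2 * lam) * jb lam (x * y) * hk lam (\<psi> 0) y * 1\<bar>"])
    show "integrable halfline (\<lambda>y. \<bar>y powr (2 * lam) * jb lam (x * y) * hk lam (\<psi> 0) y * 1\<bar>)"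
      using lam by (intro integrable_abs spec_integrable[OF \<psi>, where H = 1]) auto
    show "AE y in halfline. (\<lambda>n. y powr (2 * lam) * jb lam (x * y) * hk lam (\<psi> 0) y * exp (- (inverse (real (Suc n)) * y\<^sup>2)))
      \<longlonglongrightarrow> y powr (2 * lam) * jb lam (x * y) * hk lam (\<psi> 0) y * exp (- (0 * y\<^sup>2))"
      by (intro AE_I2 tendsto_intros lim0)
    show "AE y in halfline. norm (y powr (2 * lam) * jb lam (x * y) * hk lam (\<psi> 0) y * exp (- (inverse (real (Suc n)) * y\<^sup>2)))
      \<le> \<bar>y powr (2 * lam) * jb lam (x * y) * hk lam (\<psi> 0) y * 1\<bar>" for n
      unfolding real_norm_def abs_mult by (intro AE_I2 mult_left_mono) auto
  qed measurable
  then have "(\<lambda>n. spec_heat \<psi> (inverse (real (Suc n))) x) \<longlonglongrightarrow> spec_heat \<psi> 0 x"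
    unfolding spec_heat_def by (intro tendsto_intros)
  moreover have "spec_heat \<psi> (inverse (real (Suc n))) x = heat_op (inverse (real (Suc n))) (jet_fun \<psi>) x" for n
    by (intro spec_heat_eq_heat_op \<psi> x) simp
  ultimately show ?thesis using a LIMSEQ_unique by auto
qed

end

text \<open>For s <= 1 one has s (1 + h^2) <= s + h^2, so each spare factor s / (s + h^2) absorbs
  one factor 1 + h^2.\<close>

lemma rk_weight_le:
  assumes "0 < s" "s \<le> 1"
  shows "rk s h * (1 + h\<^sup>2)\<^sup>2 \<le> cauchy s h"
proof -
  have r: "s + h\<^sup>2 > 0" using assms by (simp add: add_pos_nonneg)
  have "s * h\<^sup>2 \<le> 1 * h\<^sup>2" using assms by (intro mult_right_mono) auto
  then have "s * (1 + h\<^sup>2) \<le> s + h\<^sup>2" by (simp add: distrib_left)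
  then have "s / (s + h\<^sup>2) * (1 + h\<^sup>2) \<le> 1" using r by (simp add: divide_simps)
  then have "(s / (s + h\<^sup>2) * (1 + h\<^sup>2))\<^sup>2 \<le> 1"
    using r assms by (intro power_le_one) (auto intro!: mult_nonneg_nonneg divide_nonneg_pos add_nonneg_nonneg)
  then have "cauchy s h * (s / (s + h\<^sup>2) * (1 + h\<^sup>2))\<^sup>2 \<le> cauchy s h * 1"
    using assms by (intro mult_left_mono) auto
  then show ?thesis
    unfolding rk_eq_cauchy[OF assms(1)] power_mult_distrib by (simp only: mult.assoc mult_1_right)
qed

context bessel_heat begin

text \<open>The integrated heat equation: exp(-t y^2) - 1 is minus the integral of y^2 exp(-s y^2)
  over s <= t, and y^2 times the transform is the transform of the Bessel operator applied to the
  function. On the spectral side Fubini is immediate and time 0 is included.\<close>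

lemma spec_heat_diff:
  assumes \<psi>: "test_jet \<psi>" and t: "t > 0" and x: "x > 0"
  shows "integrable halfline (\<lambda>s. if s \<le> t then spec_heat (jet_bessel lam \<psi>) s x else 0)"
    and "spec_heat \<psi> t x - spec_heat \<psi> 0 x = - (\<integral>s. (if s \<le> t then spec_heat (jet_bessel lam \<psi>) s x else 0) \<partial>halfline)"
proof -
  let ?c = "2 powr (1/2 - lam) * x powr lam"
  define Y where "Y y = y powr (2 * lam) * jb lam (x * y) * hk lam (\<psi> 0) y" for y
  define F where "F y s = Y y * (if s \<le> t then y\<^sup>2 * exp (- (y\<^sup>2 * s)) else 0)" for y s
  note [measurable] = hk_measurable_halfline[OF \<psi>, of 0]
  have [measurable]: "(\<lambda>p. hk lam (\<psi> 0) (fst p)) \<in> borel_measurable (halfline \<Otimes>\<^sub>M halfline)"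
    by (rule measurable_compose[OF measurable_fst hk_measurable_halfline[OF \<psi>]])
  have m: "case_prod F \<in> borel_measurable (halfline \<Otimes>\<^sub>M halfline)"
    unfolding F_def Y_def by measurable
  have iY: "integrable halfline (\<lambda>y. Y y * exp (- (r * y\<^sup>2)))" if "r \<ge> 0" for r
    using spec_integrable[OF \<psi>, of "2 * lam" "\<lambda>y. exp (- (r * y\<^sup>2))" 1 x] lam that unfolding Y_def by simp
  have iY0: "integrable halfline Y" using iY[of 0] by simp
  have one: "has_bochner_integral halfline (\<lambda>s. if s \<le> t then y\<^sup>2 * exp (- (y\<^sup>2 * s)) else 0) (1 - exp (- (y\<^sup>2 * t)))"
    if "y > 0" for y
    using that t by (intro has_bochner_integral_one_minus_exp) auto
  have bound: "(\<integral>\<^sup>+s. ennreal \<bar>F y s\<bar> \<partial>halfline) \<le> ennreal \<bar>Y y\<bar>" if "y \<in> space halfline" for y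
  proof -
    have y: "y > 0" using that by simp
    have "(\<integral>\<^sup>+s. ennreal \<bar>F y s\<bar> \<partial>halfline) = (\<integral>\<^sup>+s. ennreal (\<bar>Y y\<bar> * (if s \<le> t then y\<^sup>2 * exp (- (y\<^sup>2 * s)) else 0)) \<partial>halfline)"
      by (intro nn_integral_cong) (auto simp: F_def abs_mult)
    also have "\<dots> = ennreal (\<bar>Y y\<bar> * (1 - exp (- (y\<^sup>2 * t))))"
      using has_bochner_integral_mult_right[OF one[OF y], of "\<bar>Y y\<bar>"]
      by (subst nn_integral_eq_integral) (auto simp: has_bochner_integral_iff)
    also have "\<dots> \<le> ennreal \<bar>Y y\<bar>" by (intro ennreal_leI mult_left_le) auto
    finally show ?thesis .
  qed
  note fub = halfline_pair.Fubini_bounded[OF m bound integrable_abs[OF iY0]]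
  have s1: "(\<integral>s. F y s \<partial>halfline) = Y y - Y y * exp (- (t * y\<^sup>2))" if "y \<in> space halfline" for y
  proof -
    have "(\<integral>s. F y s \<partial>halfline) = Y y * (1 - exp (- (y\<^sup>2 * t)))"
      using that unfolding F_def integral_mult_right_zero by (subst has_bochner_integral_integral_eq[OF one]) auto
    then show ?thesis by (simp add: right_diff_distrib mult.commute)
  qed
  have s2: "?c * (\<integral>y. F y s \<partial>halfline) = (if s \<le> t then spec_heat (jet_bessel lam \<psi>) s x else 0)" for s
  proof -
    have "(\<integral>y. Y y * (y\<^sup>2 * exp (- (y\<^sup>2 * s))) \<partial>halfline)
       = (\<integral>y. y powr (2 * lam) * jb lam (x * y) * hk lam (jet_bessel lam \<psi> 0) y * exp (- (s * y\<^sup>2)) \<partial>halfline)"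
      by (intro Bochner_Integration.integral_cong refl) (simp add: Y_def hk_jet_bessel[OF lam \<psi>] mult_ac)
    then show ?thesis unfolding F_def spec_heat_def by simp
  qed
  show "integrable halfline (\<lambda>s. if s \<le> t then spec_heat (jet_bessel lam \<psi>) s x else 0)"
    unfolding s2[symmetric] by (intro integrable_mult_right fub(3)) auto
  have "(\<integral>s. (if s \<le> t then spec_heat (jet_bessel lam \<psi>) s x else 0) \<partial>halfline) = ?c * (\<integral>s. \<integral>y. F y s \<partial>halfline \<partial>halfline)"
    unfolding s2[symmetric] by (rule integral_mult_right_zero)
  also have "\<dots> = ?c * (\<integral>y. \<integral>s. F y s \<partial>halfline \<partial>halfline)" using fub(4) by simp
  also have "(\<integral>y. \<integral>s. F y s \<partial>halfline \<partial>halfline) = (\<integral>y. Y y - Y y * exp (- (t * y\<^sup>2)) \<partial>halfline)"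
    by (rule Bochner_Integration.integral_cong[OF refl s1])
  also have "\<dots> = (\<integral>y. Y y \<partial>halfline) - (\<integral>y. Y y * exp (- (t * y\<^sup>2)) \<partial>halfline)"
    using t by (intro Bochner_Integration.integral_diff iY0 iY) simp
  also have "?c * \<dots> = spec_heat \<psi> 0 x - spec_heat \<psi> t x"
    unfolding spec_heat_def Y_def by (simp add: right_diff_distrib)
  finally show "spec_heat \<psi> t x - spec_heat \<psi> 0 x = - (\<integral>s. (if s \<le> t then spec_heat (jet_bessel lam \<psi>) s x else 0) \<partial>halfline)"
    by simp
qed

text \<open>Peetre's inequality splits (1 + x^2)^2 into (1 + y^2)^2, paid for by f, and (1 +
  (x-y)^2)^2, paid for by the spare factors of the kernel majorant as long as t <= 1.\<close>

lemma heat_op_decay: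
  assumes t: "0 < t" "t \<le> 1" and x: "0 < x" and [measurable]: "f \<in> borel_measurable halfline" and A: "A \<ge> 0"
    and f: "\<And>y. y > 0 \<Longrightarrow> (1 + y\<^sup>2)\<^sup>2 * \<bar>f y\<bar> \<le> A"
  shows "\<bar>heat_op t f x\<bar> \<le> 4 * C * A * pi / (1 + x\<^sup>2)\<^sup>2"
proof -
  have p: "1 + z\<^sup>2 > 0" for z :: real by (simp add: add_pos_nonneg)
  have b: "\<bar>heat_kernel lam t x y * f y\<bar> \<le> (4 * C * A / (1 + x\<^sup>2)\<^sup>2) * cauchy t (x - y)" if y: "y > 0" for y
  proof -
    let ?h = "x - y"
    have "(1 + x\<^sup>2)\<^sup>2 \<le> (2 * (1 + y\<^sup>2) * (1 + ?h\<^sup>2))\<^sup>2"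
      using p[of x] by (intro power_mono one_add_square_le) auto
    then have "(1 + x\<^sup>2)\<^sup>2 \<le> 4 * ((1 + y\<^sup>2)\<^sup>2 * (1 + ?h\<^sup>2)\<^sup>2)" unfolding power_mult_distrib by simp
    then have "(1 + x\<^sup>2)\<^sup>2 * (rk t ?h * \<bar>f y\<bar>) \<le> (4 * ((1 + y\<^sup>2)\<^sup>2 * (1 + ?h\<^sup>2)\<^sup>2)) * (rk t ?h * \<bar>f y\<bar>)"
      using t by (intro mult_right_mono) auto
    also have "\<dots> = 4 * ((rk t ?h * (1 + ?h\<^sup>2)\<^sup>2) * ((1 + y\<^sup>2)\<^sup>2 * \<bar>f y\<bar>))" by (simp only: mult_ac)
    also have "\<dots> \<le> 4 * (cauchy t ?h * A)"
      using rk_weight_le[OF t, of ?h] f[OF y] t A by (intro mult_left_mono mult_mono) auto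
    finally have a: "(1 + x\<^sup>2)\<^sup>2 * (rk t ?h * \<bar>f y\<bar>) \<le> 4 * (cauchy t ?h * A)" .
    have "\<bar>heat_kernel lam t x y * f y\<bar> \<le> (C * rk t ?h) * \<bar>f y\<bar>"
      unfolding abs_mult using heat_nonneg[OF t(1) x y] heat_le[OF t(1) x y] by (intro mult_right_mono) auto
    then have "(1 + x\<^sup>2)\<^sup>2 * \<bar>heat_kernel lam t x y * f y\<bar> \<le> (1 + x\<^sup>2)\<^sup>2 * ((C * rk t ?h) * \<bar>f y\<bar>)"
      by (intro mult_left_mono) auto
    also have "\<dots> = C * ((1 + x\<^sup>2)\<^sup>2 * (rk t ?h * \<bar>f y\<bar>))" by (simp only: mult_ac)
    also have "\<dots> \<le> C * (4 * (cauchy t ?h * A))" using a C by (intro mult_left_mono) auto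
    finally have "(1 + x\<^sup>2)\<^sup>2 * \<bar>heat_kernel lam t x y * f y\<bar> \<le> 4 * C * A * cauchy t ?h" by (simp only: mult_ac)
    then have "\<bar>heat_kernel lam t x y * f y\<bar> \<le> 4 * C * A * cauchy t ?h / (1 + x\<^sup>2)\<^sup>2"
      using p[of x] by (subst pos_le_divide_eq) (auto simp: mult.commute)
    then show ?thesis by simp
  qed
  have "\<bar>\<integral>y. heat_kernel lam t x y * f y \<partial>halfline\<bar> \<le> (4 * C * A / (1 + x\<^sup>2)\<^sup>2) * pi"
    using C A by (intro halfline_cauchy_bound(2)[OF t(1) _ b]) auto
  then show ?thesis by (simp add: heat_op_def)
qed

text \<open>One number in place of finitely many seminorms: continuity of the functional asks for
  bounds linear in S. The order reserves \<open>nat \<lceil>lam\<rceil>\<close> powers for the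
  factor x^lam of \<open>jet_fun\<close> and six for decay; a single limit for both indices matches
  the form of \<open>test_dual\<close>.\<close>

definition jet_le :: "real \<Rightarrow> (nat \<Rightarrow> real \<Rightarrow> real) \<Rightarrow> bool" where
  "jet_le S \<psi> \<longleftrightarrow> (\<forall>m\<le>nat \<lceil>lam\<rceil> + 6. \<forall>k\<le>nat \<lceil>lam\<rceil> + 6. \<forall>x>0. (1 + x) ^ m * \<bar>\<psi> k x\<bar> \<le> S)"

lemma jet_le_bounds:
  assumes S: "jet_le S \<psi>" and x: "x > 0"
  shows "(1 + x) ^ 6 * \<bar>jet_fun \<psi> x\<bar> \<le> S"
    and "(1 + x) ^ 4 * \<bar>jet_fun (jet_bessel lam \<psi>) x\<bar> \<le> (2 * lam + 2) * S"
    and "0 \<le> S"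
proof -
  define n where "n = nat \<lceil>lam\<rceil>"
  have n: "lam \<le> real n" using lam by (simp add: n_def real_nat_ceiling_ge)
  have le: "(1 + x) ^ m * \<bar>\<psi> k x\<bar> \<le> S" if "m \<le> n + 6" "k \<le> n + 6" for m k
    using S x that unfolding jet_le_def n_def by auto
  have xl: "x powr lam \<le> (1 + x) ^ n" using powr_le_power[OF x _ n] lam by simp
  have red: "(1 + x) ^ j * (x powr lam * \<bar>\<psi> k x\<bar>) \<le> S" if "j \<le> 6" "k \<le> n + 6" for j k
  proof -
    have "(1 + x) ^ j * (x powr lam * \<bar>\<psi> k x\<bar>) \<le> (1 + x) ^ j * ((1 + x) ^ n * \<bar>\<psi> k x\<bar>)"
      using xl x by (intro mult_left_mono mult_right_mono) auto
    also have "\<dots> = (1 + x) ^ (j + n) * \<bar>\<psi> k x\<bar>" by (simp only: power_add mult.assoc)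
    also have "\<dots> \<le> S" using that by (intro le) auto
    finally show ?thesis .
  qed
  show "(1 + x) ^ 6 * \<bar>jet_fun \<psi> x\<bar> \<le> S"
    using red[of 6 0] by (simp add: jet_fun_def abs_mult)
  have "0 \<le> (1 + x) ^ 0 * \<bar>\<psi> 0 x\<bar>" by simp
  also have "\<dots> \<le> S" by (rule le) auto
  finally show S0: "0 \<le> S" .
  have r1: "(1 + x) ^ 4 * (x powr lam * \<bar>\<psi> 1 x\<bar>) \<le> S" by (rule red) auto
  \<comment> \<open>The coefficient x^2 of the second jet term uses up two of the six powers of
    decay, so four are left.\<close>
  have x2: "x\<^sup>2 \<le> (1 + x)\<^sup>2" using x by (intro power_mono) auto
  have "(1 + x) ^ 4 * (x powr lam * (x\<^sup>2 * \<bar>\<psi> 2 x\<bar>)) = x\<^sup>2 * ((1 + x) ^ 4 * (x powr lam * \<bar>\<psi> 2 x\<bar>))" by (simp only: mult_ac)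
  also have "\<dots> \<le> (1 + x)\<^sup>2 * ((1 + x) ^ 4 * (x powr lam * \<bar>\<psi> 2 x\<bar>))"
    using x2 x by (intro mult_right_mono) auto
  also have "\<dots> = (1 + x) ^ 6 * (x powr lam * \<bar>\<psi> 2 x\<bar>)" by (simp only: mult.assoc[symmetric] power_add[symmetric]) simp
  also have "\<dots> \<le> S" by (rule red) auto
  finally have r2: "(1 + x) ^ 4 * (x powr lam * (x\<^sup>2 * \<bar>\<psi> 2 x\<bar>)) \<le> S" .
  have "\<bar>jet_bessel lam \<psi> 0 x\<bar> \<le> (2 * lam + 1) * \<bar>\<psi> 1 x\<bar> + x\<^sup>2 * \<bar>\<psi> 2 x\<bar>"
    using lam order_trans[OF abs_triangle_ineq4[of "- (2 * lam + 1 + 2 * real 0) * \<psi> (0 + 1) x" "x\<^sup>2 * \<psi> (0 + 2) x"] order_refl]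
    unfolding jet_bessel_def by (simp add: abs_mult numeral_2_eq_2 add_ac)
  then have "(1 + x) ^ 4 * (x powr lam * \<bar>jet_bessel lam \<psi> 0 x\<bar>)
     \<le> (1 + x) ^ 4 * (x powr lam * ((2 * lam + 1) * \<bar>\<psi> 1 x\<bar> + x\<^sup>2 * \<bar>\<psi> 2 x\<bar>))"
    using x by (intro mult_left_mono) auto
  also have "\<dots> = (2 * lam + 1) * ((1 + x) ^ 4 * (x powr lam * \<bar>\<psi> 1 x\<bar>)) + (1 + x) ^ 4 * (x powr lam * (x\<^sup>2 * \<bar>\<psi> 2 x\<bar>))"
    by (simp add: algebra_simps)
  also have "\<dots> \<le> (2 * lam + 1) * S + S"
    using r1 r2 lam by (intro add_mono mult_left_mono) auto
  finally show "(1 + x) ^ 4 * \<bar>jet_fun (jet_bessel lam \<psi>) x\<bar> \<le> (2 * lam + 2) * S"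
    by (simp add: jet_fun_def abs_mult algebra_simps)
qed

lemma one_add_square_power_le:
  fixes x :: real
  assumes "x > 0"
  shows "(1 + x\<^sup>2)\<^sup>2 \<le> (1 + x) ^ 4" "(1 + x\<^sup>2)\<^sup>2 * (1 + x)\<^sup>2 \<le> (1 + x) ^ 6"
proof -
  have "1 + x\<^sup>2 \<le> (1 + x)\<^sup>2" using assms by (simp add: power2_sum)
  then have "(1 + x\<^sup>2)\<^sup>2 \<le> ((1 + x)\<^sup>2)\<^sup>2" by (intro power_mono) auto
  then show a: "(1 + x\<^sup>2)\<^sup>2 \<le> (1 + x) ^ 4" by (simp flip: power_mult)
  have "(1 + x\<^sup>2)\<^sup>2 * (1 + x)\<^sup>2 \<le> (1 + x) ^ 4 * (1 + x)\<^sup>2" using a by (intro mult_right_mono) auto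
  then show "(1 + x\<^sup>2)\<^sup>2 * (1 + x)\<^sup>2 \<le> (1 + x) ^ 6" by (simp flip: power_add)
qed

text \<open>The integrated heat equation reduces the difference to the semigroup, at times s <= t,
  acting on the Bessel operator of the function, which still decays like (1 + x^2)^(-2). The gained
  factor t makes the integral against t^(-1-\<sigma>) converge at zero.\<close>

lemma heat_op_jet_small_time:
  assumes \<psi>: "test_jet \<psi>" and lam1: "lam \<ge> 1" and S: "jet_le S \<psi>" and t: "0 < t" "t \<le> 1" and x: "0 < x"
  shows "\<bar>heat_op t (jet_fun \<psi>) x - jet_fun \<psi> x\<bar> \<le> t * (4 * C * ((2 * lam + 2) * S) * pi / (1 + x\<^sup>2)\<^sup>2)"
proof -
  let ?M = "4 * C * ((2 * lam + 2) * S) * pi / (1 + x\<^sup>2)\<^sup>2"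
  have S0: "0 \<le> (2 * lam + 2) * S" using jet_le_bounds(3)[OF S x] lam by simp
  have M0: "?M \<ge> 0" using S0 C by simp
  have b: "\<bar>spec_heat (jet_bessel lam \<psi>) s x\<bar> \<le> ?M" if s: "0 < s" "s \<le> t" for s
    unfolding spec_heat_eq_heat_op[OF test_jet_bessel[OF \<psi>] s(1) x]
  proof (rule heat_op_decay[OF s(1) _ x jet_fun_measurable[OF test_jet_bessel[OF \<psi>]] S0])
    show "s \<le> 1" using s t by simp
    fix y :: real assume y: "y > 0"
    have "(1 + y\<^sup>2)\<^sup>2 * \<bar>jet_fun (jet_bessel lam \<psi>) y\<bar> \<le> (1 + y) ^ 4 * \<bar>jet_fun (jet_bessel lam \<psi>) y\<bar>"
      using one_add_square_power_le(1)[OF y] by (intro mult_right_mono) auto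
    also have "\<dots> \<le> (2 * lam + 2) * S" by (rule jet_le_bounds(2)[OF S y])
    finally show "(1 + y\<^sup>2)\<^sup>2 * \<bar>jet_fun (jet_bessel lam \<psi>) y\<bar> \<le> (2 * lam + 2) * S" .
  qed
  have d: "heat_op t (jet_fun \<psi>) x - jet_fun \<psi> x = - (\<integral>s. (if s \<le> t then spec_heat (jet_bessel lam \<psi>) s x else 0) \<partial>halfline)"
    using spec_heat_diff(2)[OF \<psi> t(1) x] unfolding spec_heat_0[OF \<psi> lam1 x] spec_heat_eq_heat_op[OF \<psi> t(1) x] .
  have one: "has_bochner_integral halfline (\<lambda>s. if s \<le> t then 1 else 0) (t - 0)"
    using t by (intro has_bochner_integral_halfline_FTC[where F = "\<lambda>s. s"]) (auto intro!: derivative_eq_intros)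
  have g: "has_bochner_integral halfline (\<lambda>s. ?M * (if s \<le> t then 1 else 0)) (?M * (t - 0))"
    by (rule has_bochner_integral_mult_right[OF one])
  have "\<bar>\<integral>s. (if s \<le> t then spec_heat (jet_bessel lam \<psi>) s x else 0) \<partial>halfline\<bar> \<le> ?M * (t - 0)"
  proof (rule has_bochner_integral_abs_le[OF has_bochner_integral_integrable[OF spec_heat_diff(1)[OF \<psi> t(1) x]] g])
    fix s assume "s \<in> space halfline"
    then show "\<bar>if s \<le> t then spec_heat (jet_bessel lam \<psi>) s x else 0\<bar> \<le> ?M * (if s \<le> t then 1 else 0)"
      using b[of s] M0 by auto
  qed
  then show ?thesis unfolding d by (simp only: abs_minus_cancel diff_zero mult.commute)
qed

definition frac_jet :: "real \<Rightarrow> (nat \<Rightarrow> real \<Rightarrow> real) \<Rightarrow> real \<Rightarrow> real" where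
  "frac_jet \<sigma> \<psi> x = 2 powr (1/2 - lam) * x powr lam *
     (\<integral>y. y powr (2 * lam) * jb lam (x * y) * (y powr (2 * \<sigma>) * hk lam (\<psi> 0) y) \<partial>halfline)"

text \<open>Fubini with t inside: since 1 - exp is nonnegative, the t-integral of the modulus
  reproduces - Gamma(-\<sigma>) y^(2\<sigma>) exactly, and the rapid decay of the Hankel transform
  makes that integrable in y. After the exchange the y-integral is a difference of spectral heat
  operators at times 0 and t.\<close>

lemma frac_jet_eq:
  assumes \<psi>: "test_jet \<psi>" and lam1: "lam \<ge> 1" and \<sigma>: "0 < \<sigma>" "\<sigma> < 1" and x: "x > 0"
  shows "frac_jet \<sigma> \<psi> x = 1 / Gamma (- \<sigma>) * (\<integral>t. (heat_op t (jet_fun \<psi>) x - jet_fun \<psi> x) / t powr (1 + \<sigma>) \<partial>halfline)"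
proof -
  let ?c = "2 powr (1/2 - lam) * x powr lam"
  let ?g = "- Gamma (- \<sigma>)"
  have g: "?g > 0" by (rule Gamma_uminus_neg[OF \<sigma>])
  define Y where "Y y = y powr (2 * lam) * jb lam (x * y) * hk lam (\<psi> 0) y" for y
  define F where "F y t = Y y * ((1 - exp (- (y\<^sup>2 * t))) / t powr (1 + \<sigma>))" for y t
  note [measurable] = hk_measurable_halfline[OF \<psi>, of 0]
  have [measurable]: "(\<lambda>p. hk lam (\<psi> 0) (fst p)) \<in> borel_measurable (halfline \<Otimes>\<^sub>M halfline)"
    by (rule measurable_compose[OF measurable_fst hk_measurable_halfline[OF \<psi>]])
  have m: "case_prod F \<in> borel_measurable (halfline \<Otimes>\<^sub>M halfline)"
    unfolding F_def Y_def by measurable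
  have iY: "integrable halfline (\<lambda>y. Y y * exp (- (r * y\<^sup>2)))" if "r \<ge> 0" for r
    using spec_integrable[OF \<psi>, of "2 * lam" "\<lambda>y. exp (- (r * y\<^sup>2))" 1 x] lam that unfolding Y_def by simp
  have iY0: "integrable halfline Y" using iY[of 0] by simp
  have pw: "(y\<^sup>2) powr \<sigma> = y powr (2 * \<sigma>)" if "y > 0" for y
  proof -
    have e: "y\<^sup>2 = y powr 2" using powr_realpow[of y 2] that by simp
    show ?thesis unfolding e powr_powr ..
  qed
  have iYs: "integrable halfline (\<lambda>y. Y y * (y\<^sup>2) powr \<sigma>)"
  proof -
    have "integrable halfline (\<lambda>y. y powr (2 * lam + 2 * \<sigma>) * jb lam (x * y) * hk lam (\<psi> 0) y * 1)"
      using \<sigma> lam by (intro spec_integrable[OF \<psi>, where H = 1]) auto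
    then show ?thesis
      by (rule Bochner_Integration.integrable_cong[OF refl, THEN iffD1, rotated])
        (simp add: Y_def pw powr_add mult_ac)
  qed
  have one: "has_bochner_integral halfline (\<lambda>t. (1 - exp (- (y\<^sup>2 * t))) / t powr (1 + \<sigma>)) (?g * (y\<^sup>2) powr \<sigma>)" if "y > 0" for y
    using that by (intro has_bochner_integral_power_subordination \<sigma>) simp
  have bound: "(\<integral>\<^sup>+t. ennreal \<bar>F y t\<bar> \<partial>halfline) \<le> ennreal (?g * \<bar>Y y * (y\<^sup>2) powr \<sigma>\<bar>)" if "y \<in> space halfline" for y
  proof -
    have y: "y > 0" using that by simp
    have "(\<integral>\<^sup>+t. ennreal \<bar>F y t\<bar> \<partial>halfline) = (\<integral>\<^sup>+t. ennreal (\<bar>Y y\<bar> * ((1 - exp (- (y\<^sup>2 * t))) / t powr (1 + \<sigma>))) \<partial>halfline)"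
      by (intro nn_integral_cong) (auto simp: F_def abs_mult)
    also have "\<dots> = ennreal (\<bar>Y y\<bar> * (?g * (y\<^sup>2) powr \<sigma>))"
      using has_bochner_integral_mult_right[OF one[OF y], of "\<bar>Y y\<bar>"]
      by (subst nn_integral_eq_integral) (auto simp: has_bochner_integral_iff)
    finally show ?thesis by (simp add: abs_mult mult_ac)
  qed
  note fub = halfline_pair.Fubini_bounded[OF m bound integrable_mult_right[OF integrable_abs[OF iYs]]]
  have s1: "(\<integral>t. F y t \<partial>halfline) = ?g * (Y y * (y\<^sup>2) powr \<sigma>)" if "y \<in> space halfline" for y
    using that unfolding F_def integral_mult_right_zero by (subst has_bochner_integral_integral_eq[OF one]) auto
  have s2: "?c * (\<integral>y. F y t \<partial>halfline) = - ((heat_op t (jet_fun \<psi>) x - jet_fun \<psi> x) / t powr (1 + \<sigma>))"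
    if "t \<in> space halfline" for t
  proof -
    have t: "t > 0" using that by simp
    have "(\<integral>y. F y t \<partial>halfline) = (\<integral>y. (Y y - Y y * exp (- (t * y\<^sup>2))) / t powr (1 + \<sigma>) \<partial>halfline)"
      by (intro Bochner_Integration.integral_cong refl) (simp add: F_def right_diff_distrib mult.commute)
    also have "\<dots> = ((\<integral>y. Y y \<partial>halfline) - (\<integral>y. Y y * exp (- (t * y\<^sup>2)) \<partial>halfline)) / t powr (1 + \<sigma>)"
      using t iY[of t] iY0 by (simp add: Bochner_Integration.integral_diff)
    finally have "?c * (\<integral>y. F y t \<partial>halfline) = (?c * (\<integral>y. Y y \<partial>halfline) - ?c * (\<integral>y. Y y * exp (- (t * y\<^sup>2)) \<partial>halfline)) / t powr (1 + \<sigma>)"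
      by (simp add: right_diff_distrib)
    also have "\<dots> = (spec_heat \<psi> 0 x - spec_heat \<psi> t x) / t powr (1 + \<sigma>)"
      unfolding spec_heat_def Y_def by simp
    finally show ?thesis
      unfolding spec_heat_0[OF \<psi> lam1 x] spec_heat_eq_heat_op[OF \<psi> t x]
      by (simp only: minus_divide_left minus_diff_eq)
  qed
  have "?g * frac_jet \<sigma> \<psi> x = ?c * (\<integral>y. ?g * (Y y * (y\<^sup>2) powr \<sigma>) \<partial>halfline)"
  proof -
    have "(\<integral>y. y powr (2 * lam) * jb lam (x * y) * (y powr (2 * \<sigma>) * hk lam (\<psi> 0) y) \<partial>halfline) = (\<integral>y. Y y * (y\<^sup>2) powr \<sigma> \<partial>halfline)"
      by (intro Bochner_Integration.integral_cong refl) (simp add: Y_def pw mult_ac)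
    then show ?thesis unfolding frac_jet_def integral_mult_right_zero by (simp only: mult_ac)
  qed
  also have "\<dots> = ?c * (\<integral>y. \<integral>t. F y t \<partial>halfline \<partial>halfline)"
    by (rule arg_cong[where f = "\<lambda>v. ?c * v"], rule Bochner_Integration.integral_cong[OF refl s1, symmetric])
  also have "\<dots> = ?c * (\<integral>t. \<integral>y. F y t \<partial>halfline \<partial>halfline)"
    using fub(4) by simp
  also have "\<dots> = (\<integral>t. ?c * (\<integral>y. F y t \<partial>halfline) \<partial>halfline)"
    by (rule integral_mult_right_zero[symmetric])
  also have "\<dots> = - (\<integral>t. (heat_op t (jet_fun \<psi>) x - jet_fun \<psi> x) / t powr (1 + \<sigma>) \<partial>halfline)"
    unfolding Bochner_Integration.integral_minus[symmetric] by (rule Bochner_Integration.integral_cong[OF refl s2])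
  finally show ?thesis using g by (simp add: field_simps)
qed

lemma measurable_heat_op:
  assumes [measurable]: "f \<in> borel_measurable halfline" "a \<in> borel_measurable M" "b \<in> borel_measurable M"
  shows "(\<lambda>w. heat_op (a w) f (b w)) \<in> borel_measurable M"
proof -
  have [measurable]: "(\<lambda>p. f (snd p)) \<in> borel_measurable (M \<Otimes>\<^sub>M halfline)"
    by (rule measurable_compose[OF measurable_snd assms(1)])
  show ?thesis unfolding heat_op_def by measurable
qed

text \<open>The domination behind the transposition, for functions \<open>u\<close> in \<open>L_space \<sigma>\<close>.\<close>

lemma heat_op_jet_bound:
  assumes lam1: "lam \<ge> 1" and \<sigma>: "0 < \<sigma>" "\<sigma> < 1"
  obtains D where "D \<ge> 0" and
    "\<And>\<psi> S x. test_jet \<psi> \<Longrightarrow> jet_le S \<psi> \<Longrightarrow> x > 0 \<Longrightarrow>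
      (\<integral>\<^sup>+t. ennreal (\<bar>heat_op t (jet_fun \<psi>) x - jet_fun \<psi> x\<bar> / t powr (1 + \<sigma>)) \<partial>halfline) \<le> ennreal (D * S * wt \<sigma> x)"
proof -
  let ?C = "8 * (1 / (5/2 - \<sigma>) + 1 / (1/2 + \<sigma>))"
  have C0: "?C \<ge> 0" using \<sigma> by simp
  define N where "N = (\<integral>z. 1 / (1 + z)\<^sup>2 \<partial>halfline)"
  have iN: "integrable halfline (\<lambda>z. 1 / (1 + z)\<^sup>2)"
  proof -
    have "integrable halfline (\<lambda>z. z powr 0 / (1 + z) ^ 2)" by (intro integrable_powr_decay) auto
    then show ?thesis
      by (rule Bochner_Integration.integrable_cong[OF refl, THEN iffD1, rotated]) simp
  qed
  have N0: "N \<ge> 0" unfolding N_def by (intro integral_nonneg_AE) simp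
  have KN: "(\<integral>\<^sup>+z. ennreal (K * (1 / (1 + z)\<^sup>2)) \<partial>halfline) = ennreal (K * N)" if "K \<ge> 0" for K
  proof -
    have "AE z in halfline. 0 \<le> K * (1 / (1 + z)\<^sup>2)" using that by simp
    from nn_integral_eq_integral[OF integrable_mult_right[OF iN] this] show ?thesis
      by (simp only: integral_mult_right_zero N_def)
  qed
  define a where "a = 4 * C * (2 * lam + 2) * pi"
  have a0: "a \<ge> 0" using C lam by (simp add: a_def)
  \<comment> \<open>The three summands are the time integrals of the O(t) bound over t <= 1, of the
    term \<phi>(x) over t > 1, and of the semigroup term over t > 1.\<close>
  define D where "D = a / (1 - \<sigma>) + 1 / \<sigma> + C * ?C * 4 * N"
  show ?thesis
  proof (rule that)
    show "D \<ge> 0" unfolding D_def using a0 \<sigma> C C0 N0 by (intro add_nonneg_nonneg) auto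
    fix \<psi> S and x :: real
    assume \<psi>: "test_jet \<psi>" and S: "jet_le S \<psi>" and x: "x > 0"
    note S0 = jet_le_bounds(3)[OF S x]
    let ?\<phi> = "jet_fun \<psi>"
    note [measurable] = jet_fun_measurable[OF \<psi>]
    have [measurable]: "(\<lambda>p. ?\<phi> (snd p)) \<in> borel_measurable (halfline \<Otimes>\<^sub>M halfline)"
      by (rule measurable_compose[OF measurable_snd jet_fun_measurable[OF \<psi>]])
    define q where "q = 1 / (1 + x\<^sup>2)\<^sup>2"
    have q: "0 \<le> q" "q \<le> wt \<sigma> x" using inverse_le_wt[OF \<sigma>(2), of x] by (auto simp: q_def)
    have \<phi>: "\<bar>?\<phi> z\<bar> \<le> S * (1 / (1 + z)\<^sup>2) / (1 + z\<^sup>2)\<^sup>2" if z: "z > 0" for z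
    proof -
      have "((1 + z\<^sup>2)\<^sup>2 * (1 + z)\<^sup>2) * \<bar>?\<phi> z\<bar> \<le> (1 + z) ^ 6 * \<bar>?\<phi> z\<bar>"
        using one_add_square_power_le(2)[OF z] by (intro mult_right_mono) auto
      also have "\<dots> \<le> S" by (rule jet_le_bounds(1)[OF S z])
      finally have "\<bar>?\<phi> z\<bar> \<le> S / ((1 + z\<^sup>2)\<^sup>2 * (1 + z)\<^sup>2)"
        using z by (subst pos_le_divide_eq) (auto simp: mult.commute intro!: mult_pos_pos zero_less_power add_pos_nonneg)
      then show ?thesis by (simp add: mult.commute)
    qed
    have \<phi>x: "\<bar>?\<phi> x\<bar> \<le> S * q"
    proof -
      have "S * (1 / (1 + x)\<^sup>2) \<le> S * 1"
        using S0 x by (intro mult_left_mono) (auto simp: divide_le_eq one_le_power)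
      then have "S * (1 / (1 + x)\<^sup>2) / (1 + x\<^sup>2)\<^sup>2 \<le> S * 1 / (1 + x\<^sup>2)\<^sup>2" by (intro divide_right_mono) auto
      then show ?thesis using \<phi>[OF x] by (simp add: q_def)
    qed
    \<comment> \<open>The majorant restricted to t > 1, where the semigroup term and \<phi>(x) are
      bounded separately; for t <= 1 their difference is controlled by the heat equation instead.
      The integral in z is left open until t has been integrated.\<close>
    define T where "T t z = (if t \<le> 1 then 0 else rk t (x - z) / t powr (1 + \<sigma>))" for t z
    have [measurable]: "(\<lambda>p. T (fst p) (snd p)) \<in> borel_measurable (halfline \<Otimes>\<^sub>M halfline)"
      unfolding T_def by measurable
    have [measurable]: "T t \<in> borel_measurable halfline" "(\<lambda>t. T t z) \<in> borel_measurable halfline" for t z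
      unfolding T_def by measurable
    have pt: "ennreal (\<bar>heat_op t ?\<phi> x - ?\<phi> x\<bar> / t powr (1 + \<sigma>))
       \<le> ennreal (if t \<le> 1 then (a * S * q) * t powr (- \<sigma>) else (S * q) * t powr (- (1 + \<sigma>)))
         + (\<integral>\<^sup>+z. ennreal (C * \<bar>?\<phi> z\<bar>) * ennreal (T t z) \<partial>halfline)"
      if "t \<in> space halfline" for t
    proof (cases "t \<le> 1")
      case True
      have t: "t > 0" using that by simp
      have "\<bar>heat_op t ?\<phi> x - ?\<phi> x\<bar> \<le> t * (a * S * q)"
        using heat_op_jet_small_time[OF \<psi> lam1 S t True x] by (simp add: a_def q_def mult_ac)
      then have "\<bar>heat_op t ?\<phi> x - ?\<phi> x\<bar> / t powr (1 + \<sigma>) \<le> t * (a * S * q) / t powr (1 + \<sigma>)"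
        by (intro divide_right_mono) auto
      also have "\<dots> = (a * S * q) * (t powr 1 / t powr (1 + \<sigma>))" using t by simp
      also have "t powr 1 / t powr (1 + \<sigma>) = t powr (- \<sigma>)" unfolding powr_diff[symmetric] by simp
      finally show ?thesis using True by (intro add_increasing2) (auto intro: ennreal_leI)
    next
      case False
      have t: "t > 0" using that by simp
      have hi: "ennreal \<bar>heat_op t ?\<phi> x\<bar> \<le> (\<integral>\<^sup>+z. ennreal (C * \<bar>?\<phi> z\<bar>) * ennreal (rk t (x - z)) \<partial>halfline)"
      proof -
        have "ennreal (norm (heat_op t ?\<phi> x)) \<le> (\<integral>\<^sup>+z. ennreal (norm (heat_kernel lam t x z * ?\<phi> z)) \<partial>halfline)"
          unfolding heat_op_def by (rule integral_norm_bound_ennreal[OF heat_op_integrable_jet[OF \<psi> t x]])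
        also have "\<dots> \<le> (\<integral>\<^sup>+z. ennreal (C * \<bar>?\<phi> z\<bar>) * ennreal (rk t (x - z)) \<partial>halfline)"
        proof (intro nn_integral_mono)
          fix z assume "z \<in> space halfline"
          then have z: "z > 0" by simp
          have "norm (heat_kernel lam t x z * ?\<phi> z) \<le> (C * \<bar>?\<phi> z\<bar>) * rk t (x - z)"
            using heat_nonneg[OF t x z] mult_right_mono[OF heat_le[OF t x z], of "\<bar>?\<phi> z\<bar>"]
            by (simp add: abs_mult mult_ac)
          then have "ennreal (norm (heat_kernel lam t x z * ?\<phi> z)) \<le> ennreal ((C * \<bar>?\<phi> z\<bar>) * rk t (x - z))" by (rule ennreal_leI)
          also have "\<dots> = ennreal (C * \<bar>?\<phi> z\<bar>) * ennreal (rk t (x - z))" using C by (intro ennreal_mult') simp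
          finally show "ennreal (norm (heat_kernel lam t x z * ?\<phi> z)) \<le> ennreal (C * \<bar>?\<phi> z\<bar>) * ennreal (rk t (x - z))" .
        qed
        finally show ?thesis by simp
      qed
      let ?i = "t powr (- (1 + \<sigma>))"
      have "\<bar>heat_op t ?\<phi> x - ?\<phi> x\<bar> / t powr (1 + \<sigma>) \<le> (S * q + \<bar>heat_op t ?\<phi> x\<bar>) * ?i"
      proof -
        have "\<bar>heat_op t ?\<phi> x - ?\<phi> x\<bar> \<le> S * q + \<bar>heat_op t ?\<phi> x\<bar>" using \<phi>x by linarith
        then have "\<bar>heat_op t ?\<phi> x - ?\<phi> x\<bar> * ?i \<le> (S * q + \<bar>heat_op t ?\<phi> x\<bar>) * ?i" by (intro mult_right_mono) auto
        then show ?thesis by (simp only: powr_minus divide_inverse)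
      qed
      then have "ennreal (\<bar>heat_op t ?\<phi> x - ?\<phi> x\<bar> / t powr (1 + \<sigma>)) \<le> ennreal (S * q * ?i + \<bar>heat_op t ?\<phi> x\<bar> * ?i)"
        by (intro ennreal_leI) (simp only: distrib_right)
      also have "\<dots> = ennreal (S * q * ?i) + ennreal \<bar>heat_op t ?\<phi> x\<bar> * ennreal ?i"
        using S0 q by (subst ennreal_plus) (auto simp: ennreal_mult')
      also have "\<dots> \<le> ennreal (S * q * ?i) + (\<integral>\<^sup>+z. ennreal (C * \<bar>?\<phi> z\<bar>) * ennreal (rk t (x - z)) \<partial>halfline) * ennreal ?i"
        by (intro add_left_mono mult_right_mono hi) simp
      also have "(\<integral>\<^sup>+z. ennreal (C * \<bar>?\<phi> z\<bar>) * ennreal (rk t (x - z)) \<partial>halfline) * ennreal ?i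
        = (\<integral>\<^sup>+z. ennreal (C * \<bar>?\<phi> z\<bar>) * ennreal (rk t (x - z)) * ennreal ?i \<partial>halfline)"
        by (rule nn_integral_multc[symmetric]) measurable
      also have "\<dots> = (\<integral>\<^sup>+z. ennreal (C * \<bar>?\<phi> z\<bar>) * ennreal (T t z) \<partial>halfline)"
      proof (intro nn_integral_cong)
        fix z
        have "ennreal (rk t (x - z)) * ennreal ?i = ennreal (rk t (x - z) * ?i)" by (intro ennreal_mult''[symmetric]) simp
        also have "rk t (x - z) * ?i = T t z" using False by (simp only: T_def if_False powr_minus divide_inverse)
        finally show "ennreal (C * \<bar>?\<phi> z\<bar>) * ennreal (rk t (x - z)) * ennreal ?i = ennreal (C * \<bar>?\<phi> z\<bar>) * ennreal (T t z)"
          by (simp only: mult.assoc)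
      qed
      finally show ?thesis using False by simp
    qed
    have "(\<integral>\<^sup>+t. ennreal (\<bar>heat_op t ?\<phi> x - ?\<phi> x\<bar> / t powr (1 + \<sigma>)) \<partial>halfline)
       \<le> (\<integral>\<^sup>+t. ennreal (if t \<le> 1 then (a * S * q) * t powr (- \<sigma>) else (S * q) * t powr (- (1 + \<sigma>)))
         + (\<integral>\<^sup>+z. ennreal (C * \<bar>?\<phi> z\<bar>) * ennreal (T t z) \<partial>halfline) \<partial>halfline)"
      by (intro nn_integral_mono pt)
    also have "\<dots> = (\<integral>\<^sup>+t. ennreal (if t \<le> 1 then (a * S * q) * t powr (- \<sigma>) else (S * q) * t powr (- (1 + \<sigma>))) \<partial>halfline)
         + (\<integral>\<^sup>+t. (\<integral>\<^sup>+z. ennreal (C * \<bar>?\<phi> z\<bar>) * ennreal (T t z) \<partial>halfline) \<partial>halfline)"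
      by (rule nn_integral_add) measurable
    also have "(\<integral>\<^sup>+t. ennreal (if t \<le> 1 then (a * S * q) * t powr (- \<sigma>) else (S * q) * t powr (- (1 + \<sigma>))) \<partial>halfline)
        = ennreal ((a * S * q) * 1 powr (- \<sigma> + 1) / (- \<sigma> + 1) + (S * q) * 1 powr (1 - (1 + \<sigma>)) / (1 + \<sigma> - 1))"
      using \<sigma> a0 S0 q by (intro nn_integral_halfline_two_powers) auto
    also have "(a * S * q) * 1 powr (- \<sigma> + 1) / (- \<sigma> + 1) + (S * q) * 1 powr (1 - (1 + \<sigma>)) / (1 + \<sigma> - 1) = (a / (1 - \<sigma>) + 1 / \<sigma>) * S * q"
      by (simp add: distrib_right)
    also have "(\<integral>\<^sup>+t. (\<integral>\<^sup>+z. ennreal (C * \<bar>?\<phi> z\<bar>) * ennreal (T t z) \<partial>halfline) \<partial>halfline)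
       = (\<integral>\<^sup>+z. (\<integral>\<^sup>+t. ennreal (C * \<bar>?\<phi> z\<bar>) * ennreal (T t z) \<partial>halfline) \<partial>halfline)"
      by (rule halfline_pair.Fubini'[symmetric]) measurable
    also have "\<dots> \<le> (\<integral>\<^sup>+z. ennreal ((C * ?C * 4 * S * wt \<sigma> x) * (1 / (1 + z)\<^sup>2)) \<partial>halfline)"
    proof (intro nn_integral_mono)
      fix z assume "z \<in> space halfline"
      then have z: "z > 0" by simp
      have "(\<integral>\<^sup>+t. ennreal (C * \<bar>?\<phi> z\<bar>) * ennreal (T t z) \<partial>halfline) = ennreal (C * \<bar>?\<phi> z\<bar>) * (\<integral>\<^sup>+t. ennreal (T t z) \<partial>halfline)"
        by (rule nn_integral_cmult) measurable
      also have "\<dots> \<le> ennreal (C * \<bar>?\<phi> z\<bar>) * ennreal (?C * wt \<sigma> (x - z))"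
        unfolding T_def by (intro mult_left_mono nn_integral_rk_tail \<sigma>) simp
      also have "\<dots> = ennreal (C * \<bar>?\<phi> z\<bar> * (?C * wt \<sigma> (x - z)))"
        using C by (intro ennreal_mult'[symmetric]) simp
      also have "\<dots> \<le> ennreal ((C * ?C * 4 * S * wt \<sigma> x) * (1 / (1 + z)\<^sup>2))"
      proof (rule ennreal_leI)
        have p: "(1 + z\<^sup>2)\<^sup>2 > 0" by (intro zero_less_power) (simp add: add_pos_nonneg)
        \<comment> \<open>Translating the weight from x - z to x costs (1 + z^2)^2, which the decay
          of \<phi> cancels exactly; the remaining 1 / (1 + z)^2 is integrable.\<close>
        have "C * \<bar>?\<phi> z\<bar> * (?C * wt \<sigma> (x - z)) \<le> C * (S * (1 / (1 + z)\<^sup>2) / (1 + z\<^sup>2)\<^sup>2) * (?C * (4 * (1 + z\<^sup>2)\<^sup>2 * wt \<sigma> x))"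
          using C C0 S0 \<phi>[OF z] wt_shift_le[OF \<sigma>, of x z] by (intro mult_mono mult_left_mono) auto
        also have "\<dots> = (C * ?C * 4 * S * wt \<sigma> x) * (1 / (1 + z)\<^sup>2) * ((1 + z\<^sup>2)\<^sup>2 / (1 + z\<^sup>2)\<^sup>2)"
          by (simp only: divide_inverse mult_ac)
        also have "(1 + z\<^sup>2)\<^sup>2 / (1 + z\<^sup>2)\<^sup>2 = 1" using p by simp
        finally show "C * \<bar>?\<phi> z\<bar> * (?C * wt \<sigma> (x - z)) \<le> (C * ?C * 4 * S * wt \<sigma> x) * (1 / (1 + z)\<^sup>2)"
          by (simp only: mult_1_right)
      qed
      finally show "(\<integral>\<^sup>+t. ennreal (C * \<bar>?\<phi> z\<bar>) * ennreal (T t z) \<partial>halfline) \<le> ennreal ((C * ?C * 4 * S * wt \<sigma> x) * (1 / (1 + z)\<^sup>2))" .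
    qed
    also have "\<dots> = ennreal ((C * ?C * 4 * S * wt \<sigma> x) * N)"
      using C C0 S0 by (intro KN mult_nonneg_nonneg) auto
    also have "ennreal ((a / (1 - \<sigma>) + 1 / \<sigma>) * S * q) + ennreal ((C * ?C * 4 * S * wt \<sigma> x) * N)
       = ennreal ((a / (1 - \<sigma>) + 1 / \<sigma>) * S * q + (C * ?C * 4 * S * wt \<sigma> x) * N)"
      using a0 \<sigma> S0 q C C0 N0 by (intro ennreal_plus[symmetric]) auto
    also have "\<dots> \<le> ennreal (D * S * wt \<sigma> x)"
    proof (rule ennreal_leI)
      have "(a / (1 - \<sigma>) + 1 / \<sigma>) * S * q \<le> (a / (1 - \<sigma>) + 1 / \<sigma>) * S * wt \<sigma> x"
        using a0 \<sigma> S0 q by (intro mult_left_mono) auto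
      moreover have "D * S * wt \<sigma> x = (a / (1 - \<sigma>) + 1 / \<sigma>) * S * wt \<sigma> x + (C * ?C * 4 * S * wt \<sigma> x) * N"
        unfolding D_def by (simp only: distrib_left distrib_right mult_ac)
      ultimately show "(a / (1 - \<sigma>) + 1 / \<sigma>) * S * q + (C * ?C * 4 * S * wt \<sigma> x) * N \<le> D * S * wt \<sigma> x"
        by linarith
    qed
    finally show "(\<integral>\<^sup>+t. ennreal (\<bar>heat_op t ?\<phi> x - ?\<phi> x\<bar> / t powr (1 + \<sigma>)) \<partial>halfline) \<le> ennreal (D * S * wt \<sigma> x)"
      by (simp only: add_mono order_refl)
  qed
qed

end

subsection \<open>The test space\<close>

text \<open>A class of functions containing \<open>x powr - lam * \<phi>\<close> and closed under \<open>1/x d/dx\<close>.\<close>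

inductive jet_class :: "(real \<Rightarrow> real) \<Rightarrow> (real \<Rightarrow> real) \<Rightarrow> bool" for \<phi> where
  base: "jet_class \<phi> (\<lambda>x. c * (x powr p * (deriv ^^ j) \<phi> x))"
| add: "jet_class \<phi> f \<Longrightarrow> jet_class \<phi> g \<Longrightarrow> jet_class \<phi> (\<lambda>x. f x + g x)"
| cong: "jet_class \<phi> f \<Longrightarrow> (\<And>x. x > 0 \<Longrightarrow> g x = f x) \<Longrightarrow> jet_class \<phi> g"

lemma has_real_derivative_cong_pos:
  fixes f g :: "real \<Rightarrow> real"
  assumes "(f has_real_derivative D) (at x)" "x > 0" "\<And>x. x > 0 \<Longrightarrow> g x = f x"
  shows "(g has_real_derivative D) (at x)"
proof -
  have "eventually (\<lambda>y. y \<in> {0<..}) (nhds x)" using assms(2) by (intro eventually_nhds_in_open) auto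
  then have "eventually (\<lambda>y. g y = f y) (nhds x)" by eventually_elim (use assms(3) in auto)
  then show ?thesis using assms(1) by (subst DERIV_cong_ev[OF refl _ refl])
qed

text \<open>\<open>deriv\<close> is unspecified where no derivative exists, so every iterate of 1/x
  d/dx needs differentiability of the previous one. On the half-line the members of the class are
  finite sums of terms c x^p times a derivative of \<phi>, and the product rule stays within that
  shape.\<close>

lemma jet_class_derivative:
  assumes \<phi>: "smooth_plus \<phi>" and f: "jet_class \<phi> f"
  shows "\<exists>g. jet_class \<phi> g \<and> (\<forall>x>0. (f has_real_derivative x * g x) (at x))"
  using f
proof induction
  case (base c p j)
  let ?g = "\<lambda>x. (c * p) * (x powr (p - 2) * (deriv ^^ j) \<phi> x) + c * (x powr (p - 1) * (deriv ^^ Suc j) \<phi> x)"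
  have "jet_class \<phi> ?g" by (intro jet_class.add jet_class.base)
  moreover have "((\<lambda>x. c * (x powr p * (deriv ^^ j) \<phi> x)) has_real_derivative x * ?g x) (at x)" if x: "x > 0" for x
  proof -
    have "(deriv ^^ j) \<phi> field_differentiable at x" using \<phi> x by (simp add: smooth_plus_def)
    then have d: "((deriv ^^ j) \<phi> has_real_derivative (deriv ^^ Suc j) \<phi> x) (at x)"
      by (simp add: field_differentiable_derivI)
    have e: "x powr (p - 1) = x * x powr (p - 2)" "x powr p = x * x powr (p - 1)"
      using powr_add[of x 1 "p - 2"] powr_add[of x 1 "p - 1"] x by simp_all
    have "((\<lambda>x. c * (x powr p * (deriv ^^ j) \<phi> x)) has_real_derivative
      c * (p * x powr (p - 1) * (deriv ^^ j) \<phi> x + (deriv ^^ Suc j) \<phi> x * x powr p)) (at x)"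
      by (rule DERIV_cmult[OF DERIV_mult[OF has_real_derivative_powr[OF x] d]])
    moreover have "c * (p * x powr (p - 1) * (deriv ^^ j) \<phi> x + (deriv ^^ Suc j) \<phi> x * x powr p) = x * ?g x"
      unfolding e by (simp add: algebra_simps)
    ultimately show ?thesis by (simp only:)
  qed
  ultimately show ?case by blast
next
  case (add f1 f2)
  then obtain g1 g2 where "jet_class \<phi> g1" "\<forall>x>0. (f1 has_real_derivative x * g1 x) (at x)"
    "jet_class \<phi> g2" "\<forall>x>0. (f2 has_real_derivative x * g2 x) (at x)" by blast
  then show ?case
    by (intro exI[of _ "\<lambda>x. g1 x + g2 x"] conjI jet_class.add) (auto simp: distrib_left intro!: DERIV_add)
next
  case (cong f1 f2)
  then obtain g where g: "jet_class \<phi> g" "\<And>x. x > 0 \<Longrightarrow> (f1 has_real_derivative x * g x) (at x)" by blast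
  have "(f2 has_real_derivative x * g x) (at x)" if "x > 0" for x
    by (rule has_real_derivative_cong_pos[OF g(2)[OF that] that cong(2)])
  then show ?case using g(1) by blast
qed

definition test_jet_of :: "real \<Rightarrow> (real \<Rightarrow> real) \<Rightarrow> nat \<Rightarrow> real \<Rightarrow> real" where
  "test_jet_of lam \<phi> k = ((\<lambda>f z. 1 / z * deriv f z) ^^ k) (\<lambda>z. z powr (- lam) * \<phi> z)"

lemma test_jet_of_class:
  assumes "smooth_plus \<phi>"
  shows "jet_class \<phi> (test_jet_of lam \<phi> k)"
proof (induction k)
  case 0
  show ?case
    using jet_class.base[of \<phi> 1 "- lam" 0] by (simp add: test_jet_of_def)
next
  case (Suc k)
  obtain g where g: "jet_class \<phi> g" "\<forall>x>0. (test_jet_of lam \<phi> k has_real_derivative x * g x) (at x)"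
    using jet_class_derivative[OF assms Suc] by blast
  have "test_jet_of lam \<phi> (Suc k) x = g x" if "x > 0" for x
    using DERIV_imp_deriv[of "test_jet_of lam \<phi> k" "x * g x" x] g(2) that by (simp add: test_jet_of_def)
  then show ?case using g(1) by (rule jet_class.cong[rotated])
qed

lemma test_jet_of_derivative:
  assumes "smooth_plus \<phi>" "x > 0"
  shows "(test_jet_of lam \<phi> k has_real_derivative x * test_jet_of lam \<phi> (Suc k) x) (at x)"
proof -
  obtain g where g: "\<forall>x>0. (test_jet_of lam \<phi> k has_real_derivative x * g x) (at x)"
    using jet_class_derivative[OF assms(1) test_jet_of_class[OF assms(1)]] by blast
  have "test_jet_of lam \<phi> (Suc k) x = g x"
    using DERIV_imp_deriv[of "test_jet_of lam \<phi> k" "x * g x" x] g assms(2) by (simp add: test_jet_of_def)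
  then show ?thesis using g assms(2) by simp
qed

lemma test_weight_eq: "test_weight lam m k \<phi> x = (1 + x) ^ m * \<bar>test_jet_of lam \<phi> k x\<bar>"
  unfolding test_weight_def test_jet_of_def ..

lemma test_weight_le_seminorm:
  assumes "\<phi> \<in> test_space lam" "x > 0"
  shows "test_weight lam m k \<phi> x \<le> test_seminorm lam m k \<phi>"
  unfolding test_seminorm_def
  using assms by (intro cSUP_upper) (auto simp: test_space_def)

lemma test_seminorm_nonneg:
  assumes "\<phi> \<in> test_space lam"
  shows "0 \<le> test_seminorm lam m k \<phi>"
proof -
  have "0 \<le> test_weight lam m k \<phi> 1" by (simp add: test_weight_eq)
  also have "\<dots> \<le> test_seminorm lam m k \<phi>" by (rule test_weight_le_seminorm[OF assms]) simp
  finally show ?thesis .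
qed

lemma test_jet_test_jet_of:
  assumes "\<phi> \<in> test_space lam"
  shows "test_jet (test_jet_of lam \<phi>)"
  unfolding test_jet_def
proof (intro conjI allI impI)
  fix k and x :: real assume "x > 0"
  then show "(test_jet_of lam \<phi> k has_real_derivative x * test_jet_of lam \<phi> (Suc k) x) (at x)"
    using assms by (intro test_jet_of_derivative) (simp_all add: test_space_def)
next
  fix m k
  show "\<exists>B. \<forall>x>0. (1 + x) ^ m * \<bar>test_jet_of lam \<phi> k x\<bar> \<le> B"
    using test_weight_le_seminorm[OF assms, of _ m k] unfolding test_weight_eq by blast
qed

section \<open>Test functions expressed through their jets\<close>

context bessel_heat begin

abbreviation jet_order :: nat where
  "jet_order \<equiv> nat \<lceil>lam\<rceil> + 6"

definition test_norm :: "(real \<Rightarrow> real) \<Rightarrow> real" where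
  "test_norm \<phi> = (\<Sum>m\<le>jet_order. \<Sum>k\<le>jet_order. test_seminorm lam m k \<phi>)"

lemma jet_le_test_norm:
  assumes "\<phi> \<in> test_space lam"
  shows "jet_le (test_norm \<phi>) (test_jet_of lam \<phi>)"
  unfolding jet_le_def
proof (intro allI impI)
  fix m k and x :: real assume mk: "m \<le> jet_order" "k \<le> jet_order" and x: "x > 0"
  have "(1 + x) ^ m * \<bar>test_jet_of lam \<phi> k x\<bar> \<le> test_seminorm lam m k \<phi>"
    using test_weight_le_seminorm[OF assms x, of m k] unfolding test_weight_eq .
  also have "\<dots> \<le> (\<Sum>k\<le>jet_order. test_seminorm lam m k \<phi>)"
    using mk by (intro member_le_sum test_seminorm_nonneg[OF assms]) auto
  also have "\<dots> \<le> test_norm \<phi>"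
    unfolding test_norm_def
    using mk by (intro member_le_sum[of m "{..jet_order}" "\<lambda>m. \<Sum>k\<le>jet_order. test_seminorm lam m k \<phi>"] sum_nonneg test_seminorm_nonneg[OF assms]) auto
  finally show "(1 + x) ^ m * \<bar>test_jet_of lam \<phi> k x\<bar> \<le> test_norm \<phi>" .
qed

lemma jet_fun_test_jet_of: "x > 0 \<Longrightarrow> jet_fun (test_jet_of lam \<phi>) x = \<phi> x"
proof -
  assume "x > 0"
  then have "x powr lam * x powr (- lam) = 1" by (simp flip: powr_add)
  then show ?thesis by (simp add: jet_fun_def test_jet_of_def flip: mult.assoc)
qed

lemma hankel_eq:
  assumes m: "f \<in> borel_measurable halfline" and f: "\<And>y. y > 0 \<Longrightarrow> f y = y powr lam * h y" and x: "x > 0"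
  shows "hankel lam f x = 2 powr (1/2 - lam) * x powr lam * (\<integral>y. y powr (2 * lam) * jb lam (x * y) * h y \<partial>halfline)"
proof -
  note [measurable] = m
  have "hankel lam f x = (\<integral>y. sqrt (x * y) * bessel_J (lam - 1/2) (x * y) * f y \<partial>halfline)"
    unfolding hankel_def by (rule set_lebesgue_integral_halfline) measurable
  also have "\<dots> = (\<integral>y. (2 powr (1/2 - lam) * x powr lam) * (y powr (2 * lam) * jb lam (x * y) * h y) \<partial>halfline)"
  proof (rule Bochner_Integration.integral_cong[OF refl])
    fix y assume "y \<in> space halfline"
    then have y: "y > 0" by simp
    define w where "w = x * y"
    have w: "w > 0" using x y by (simp add: w_def)
    have p: "(w / 2) powr (lam - 1/2) = w powr (lam - 1/2) * 2 powr (1/2 - lam)"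
    proof -
      have "2 powr (1/2 - lam) = inverse (2 powr (lam - 1/2) :: real)" by (simp flip: powr_minus)
      moreover have "(w / 2) powr (lam - 1/2) = w powr (lam - 1/2) / 2 powr (lam - 1/2)"
        using w by (simp add: powr_divide)
      ultimately show ?thesis by (simp only: divide_inverse)
    qed
    have s: "w powr lam = sqrt w * w powr (lam - 1/2)"
      using w by (simp add: powr_half_sqrt[symmetric] flip: powr_add)
    have "sqrt w * bessel_J (lam - 1/2) w = 2 powr (1/2 - lam) * w powr lam * jb lam w"
      unfolding bessel_J_eq[OF lam w] jb_def p s by (simp only: mult_ac)
    moreover have "w powr lam = x powr lam * y powr lam" using x y by (simp add: w_def powr_mult)
    moreover have "y powr (2 * lam) = y powr lam * y powr lam" unfolding powr_add[symmetric] by simp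
    ultimately show "sqrt (x * y) * bessel_J (lam - 1/2) (x * y) * f y
      = (2 powr (1/2 - lam) * x powr lam) * (y powr (2 * lam) * jb lam (x * y) * h y)"
      unfolding f[OF y] w_def by (simp only: mult_ac)
  qed
  finally show ?thesis unfolding integral_mult_right_zero .
qed

lemma test_fun_measurable:
  assumes "\<phi> \<in> test_space lam"
  shows "\<phi> \<in> borel_measurable halfline"
proof -
  have "jet_fun (test_jet_of lam \<phi>) \<in> borel_measurable halfline"
    by (rule jet_fun_measurable[OF test_jet_test_jet_of[OF assms]])
  then show ?thesis
    by (rule measurable_cong[THEN iffD1, rotated]) (simp add: jet_fun_test_jet_of)
qed

lemma hankel_test:
  assumes "\<phi> \<in> test_space lam" "y > 0"
  shows "hankel lam \<phi> y = y powr lam * hk lam (test_jet_of lam \<phi> 0) y"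
proof -
  have "hankel lam \<phi> y = 2 powr (1/2 - lam) * y powr lam * (\<integral>z. z powr (2 * lam) * jb lam (y * z) * test_jet_of lam \<phi> 0 z \<partial>halfline)"
    using jet_fun_test_jet_of[of _ \<phi>] assms(2)
    by (intro hankel_eq test_fun_measurable assms(1)) (auto simp: jet_fun_def)
  then show ?thesis unfolding hk_def by (simp add: mult_ac)
qed

lemma measurable_hankel:
  assumes "f \<in> borel_measurable halfline"
  shows "hankel lam f \<in> borel_measurable borel"
proof -
  note [measurable] = assms
  have [measurable]: "(\<lambda>p. f (snd p)) \<in> borel_measurable (borel \<Otimes>\<^sub>M halfline)"
    by (rule measurable_compose[OF measurable_snd assms])
  have "hankel lam f = (\<lambda>x. \<integral>y. sqrt (x * y) * bessel_J (lam - 1/2) (x * y) * f y \<partial>halfline)"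
    unfolding hankel_def by (intro ext set_lebesgue_integral_halfline) measurable
  then show ?thesis by simp
qed

lemma frac_bessel_test_measurable:
  assumes "\<phi> \<in> test_space lam"
  shows "frac_bessel_test lam \<sigma> \<phi> \<in> borel_measurable borel"
proof -
  have [measurable]: "hankel lam \<phi> \<in> borel_measurable halfline"
    by (intro borel_measurable_halflineI measurable_hankel test_fun_measurable assms)
  show ?thesis unfolding frac_bessel_test_def by (rule measurable_hankel) measurable
qed

lemma heat_op_cong: "(\<And>y. y > 0 \<Longrightarrow> f y = g y) \<Longrightarrow> heat_op t f x = heat_op t g x"
  unfolding heat_op_def by (intro Bochner_Integration.integral_cong) auto

lemma frac_bessel_test_eq:
  assumes \<phi>: "\<phi> \<in> test_space lam" and lam1: "lam \<ge> 1" and \<sigma>: "0 < \<sigma>" "\<sigma> < 1" and x: "x > 0"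
  shows "frac_bessel_test lam \<sigma> \<phi> x = 1 / Gamma (- \<sigma>) * (\<integral>t. (heat_op t \<phi> x - \<phi> x) / t powr (1 + \<sigma>) \<partial>halfline)"
proof -
  let ?\<psi> = "test_jet_of lam \<phi>"
  have [measurable]: "hankel lam \<phi> \<in> borel_measurable halfline"
    by (intro borel_measurable_halflineI measurable_hankel test_fun_measurable \<phi>)
  have "frac_bessel_test lam \<sigma> \<phi> x = frac_jet \<sigma> ?\<psi> x"
    unfolding frac_bessel_test_def frac_jet_def
  proof (rule hankel_eq[OF _ _ x])
    show "(\<lambda>y. y powr (2 * \<sigma>) * hankel lam \<phi> y) \<in> borel_measurable halfline" by measurable
    fix y :: real assume y: "y > 0"
    show "y powr (2 * \<sigma>) * hankel lam \<phi> y = y powr lam * (y powr (2 * \<sigma>) * hk lam (?\<psi> 0) y)"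
      unfolding hankel_test[OF \<phi> y] by (simp only: mult_ac)
  qed
  also have "\<dots> = 1 / Gamma (- \<sigma>) * (\<integral>t. (heat_op t (jet_fun ?\<psi>) x - jet_fun ?\<psi> x) / t powr (1 + \<sigma>) \<partial>halfline)"
    by (rule frac_jet_eq[OF test_jet_test_jet_of[OF \<phi>] lam1 \<sigma> x])
  also have "(\<lambda>t. (heat_op t (jet_fun ?\<psi>) x - jet_fun ?\<psi> x) / t powr (1 + \<sigma>)) = (\<lambda>t. (heat_op t \<phi> x - \<phi> x) / t powr (1 + \<sigma>))"
    using x by (simp add: jet_fun_test_jet_of cong: heat_op_cong)
  finally show ?thesis .
qed

lemma test_fun_bound:
  assumes lam1: "lam \<ge> 1" and \<sigma>: "0 < \<sigma>" "\<sigma> < 1"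
  obtains D where "D \<ge> 0" and
    "\<And>\<phi> x. \<phi> \<in> test_space lam \<Longrightarrow> x > 0 \<Longrightarrow>
      (\<integral>\<^sup>+t. ennreal (\<bar>heat_op t \<phi> x - \<phi> x\<bar> / t powr (1 + \<sigma>)) \<partial>halfline) \<le> ennreal (D * test_norm \<phi> * wt \<sigma> x)"
proof -
  obtain D where D: "D \<ge> 0"
    "\<And>\<psi> S x. test_jet \<psi> \<Longrightarrow> jet_le S \<psi> \<Longrightarrow> x > 0 \<Longrightarrow>
      (\<integral>\<^sup>+t. ennreal (\<bar>heat_op t (jet_fun \<psi>) x - jet_fun \<psi> x\<bar> / t powr (1 + \<sigma>)) \<partial>halfline) \<le> ennreal (D * S * wt \<sigma> x)"
    using heat_op_jet_bound[OF lam1 \<sigma>] by blast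
  have "(\<integral>\<^sup>+t. ennreal (\<bar>heat_op t \<phi> x - \<phi> x\<bar> / t powr (1 + \<sigma>)) \<partial>halfline) \<le> ennreal (D * test_norm \<phi> * wt \<sigma> x)"
    if \<phi>: "\<phi> \<in> test_space lam" and x: "x > 0" for \<phi> x
  proof -
    let ?\<psi> = "test_jet_of lam \<phi>"
    have "heat_op t (jet_fun ?\<psi>) x - jet_fun ?\<psi> x = heat_op t \<phi> x - \<phi> x" for t
      using x by (simp add: jet_fun_test_jet_of cong: heat_op_cong)
    then show ?thesis
      using D(2)[OF test_jet_test_jet_of[OF \<phi>] jet_le_test_norm[OF \<phi>] x] by simp
  qed
  then show ?thesis using D(1) that by blast
qed

text \<open>The second bound keeps the vanishing of order x^lam at the origin; it is what absorbs
  the singular factor x^(-lam) allowed in the small-time estimate for u.\<close>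

lemma test_fun_le:
  assumes "\<phi> \<in> test_space lam"
  obtains A where "A \<ge> 0" "\<And>x. x > 0 \<Longrightarrow> \<bar>\<phi> x\<bar> \<le> A / (1 + x) ^ m" "\<And>x. x > 0 \<Longrightarrow> \<bar>\<phi> x\<bar> \<le> A * x powr lam / (1 + x) ^ m"
proof -
  obtain A where A: "A \<ge> 0" "\<And>x. x > 0 \<Longrightarrow> \<bar>jet_fun (test_jet_of lam \<phi>) x\<bar> \<le> A / (1 + x) ^ m"
    using jet_fun_le[OF test_jet_test_jet_of[OF assms], of m] by blast
  obtain B where B: "B \<ge> 0" "\<And>x. x > 0 \<Longrightarrow> \<bar>test_jet_of lam \<phi> 0 x\<bar> \<le> B / (1 + x) ^ m"
    using test_jet_decay[OF test_jet_test_jet_of[OF assms], of 0 m] by blast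
  show ?thesis
  proof
    show "max A B \<ge> 0" using A by simp
    fix x :: real assume x: "x > 0"
    have "\<bar>\<phi> x\<bar> \<le> A / (1 + x) ^ m" using A(2)[OF x] x by (simp add: jet_fun_test_jet_of)
    also have "\<dots> \<le> max A B / (1 + x) ^ m" using x by (intro divide_right_mono) auto
    finally show "\<bar>\<phi> x\<bar> \<le> max A B / (1 + x) ^ m" .
    have "\<bar>\<phi> x\<bar> = x powr lam * \<bar>test_jet_of lam \<phi> 0 x\<bar>"
    proof -
      have "\<phi> x = x powr lam * test_jet_of lam \<phi> 0 x"
        using jet_fun_test_jet_of[OF x, of \<phi>] by (simp only: jet_fun_def)
      then show ?thesis by (simp only: abs_mult) simp
    qed
    also have "\<dots> \<le> x powr lam * (B / (1 + x) ^ m)" using B(2)[OF x] by (intro mult_left_mono) auto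
    also have "\<dots> \<le> x powr lam * (max A B / (1 + x) ^ m)" using x by (intro mult_left_mono divide_right_mono) auto
    finally show "\<bar>\<phi> x\<bar> \<le> max A B * x powr lam / (1 + x) ^ m" by (simp add: mult.commute)
  qed
qed

end

subsection \<open>Transposition\<close>

lemma wt_le_powr:
  assumes "0 < \<sigma>" "\<sigma> < 1" "x > 0"
  shows "wt \<sigma> x \<le> 4 * (1 + x) powr (- 1 - 2 * \<sigma>)"
proof -
  let ?q = "1/2 + \<sigma>"
  have "0 \<le> (1 - x)\<^sup>2" by simp
  then have "(1 + x)\<^sup>2 \<le> 2 * (1 + x\<^sup>2)" by (simp add: power2_eq_square algebra_simps)
  then have "((1 + x)\<^sup>2) powr ?q \<le> (2 * (1 + x\<^sup>2)) powr ?q"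
    using assms by (intro powr_mono2) auto
  also have "\<dots> = 2 powr ?q * (1 + x\<^sup>2) powr ?q" by (intro powr_mult)
  also have "\<dots> \<le> 2 powr 2 * (1 + x\<^sup>2) powr ?q"
    using assms by (intro mult_right_mono powr_mono) auto
  also have "((1 + x)\<^sup>2) powr ?q = (1 + x) powr (1 + 2 * \<sigma>)"
  proof -
    have e: "(1 + x)\<^sup>2 = (1 + x) powr 2" using powr_realpow[of "1 + x" 2] assms by simp
    show ?thesis unfolding e powr_powr by (simp add: algebra_simps)
  qed
  finally have a: "(1 + x) powr (1 + 2 * \<sigma>) \<le> 4 * (1 + x\<^sup>2) powr ?q" by simp
  have e1: "wt \<sigma> x = 1 / (1 + x\<^sup>2) powr ?q"
  proof -
    have "- 1/2 - \<sigma> = - ?q" by simp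
    then show ?thesis unfolding wt_def by (simp only: powr_minus divide_inverse mult_1_left)
  qed
  have e2: "(1 + x) powr (- 1 - 2 * \<sigma>) = 1 / (1 + x) powr (1 + 2 * \<sigma>)"
  proof -
    have "- 1 - 2 * \<sigma> = - (1 + 2 * \<sigma>)" by simp
    then show ?thesis by (simp only: powr_minus divide_inverse mult_1_left)
  qed
  have "0 < 1 + x\<^sup>2" by (simp add: add_pos_nonneg)
  then have "(1 + x\<^sup>2) powr ?q > 0" "(1 + x) powr (1 + 2 * \<sigma>) > 0"
    unfolding powr_gt_zero using assms by linarith+
  then show ?thesis unfolding e1 e2 using a by (simp add: divide_simps)
qed

lemma L_space_integrable_wt:
  assumes \<sigma>: "0 < \<sigma>" "\<sigma> < 1" and u: "u \<in> L_space \<sigma>" and um: "u \<in> borel_measurable halfline"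
  shows "integrable halfline (\<lambda>x. \<bar>u x\<bar> * wt \<sigma> x)"
proof (rule integral_abs_le(1))
  note [measurable] = um
  have m: "(\<lambda>x. \<bar>u x\<bar> * (1 + x) powr (- 1 - 2 * \<sigma>)) \<in> borel_measurable halfline" by measurable
  have "integrable halfline (\<lambda>x. \<bar>u x\<bar> * (1 + x) powr (- 1 - 2 * \<sigma>))"
    using u set_integrable_halfline[OF m] unfolding L_space_def by simp
  then show "integrable halfline (\<lambda>x. 4 * (\<bar>u x\<bar> * (1 + x) powr (- 1 - 2 * \<sigma>)))" by (rule integrable_mult_right)
  have [measurable]: "wt \<sigma> \<in> borel_measurable halfline" by (rule borel_measurable_halflineI) measurable
  show "(\<lambda>x. \<bar>u x\<bar> * wt \<sigma> x) \<in> borel_measurable halfline" by measurable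
  fix x :: real assume "x \<in> space halfline"
  then have x: "x > 0" by simp
  have "\<bar>u x\<bar> * wt \<sigma> x \<le> \<bar>u x\<bar> * (4 * (1 + x) powr (- 1 - 2 * \<sigma>))"
    using wt_le_powr[OF \<sigma> x] by (intro mult_left_mono) auto
  then show "\<bar>\<bar>u x\<bar> * wt \<sigma> x\<bar> \<le> 4 * (\<bar>u x\<bar> * (1 + x) powr (- 1 - 2 * \<sigma>))" by (simp add: abs_mult mult_ac)
qed

text \<open>The price of moving the decay of the majorant from x - y to y: Peetre's inequality
  combined with 1 + h^2 <= (1 + 1/t)(t + h^2), cubed. It is used at fixed t, where it is continuous
  in x and of growth (1 + x^2)^3.\<close>

definition rk_bound :: "real \<Rightarrow> real \<Rightarrow> real" where
  "rk_bound t x = t powr (5/2) * (2 * (1 + 1 / t) * (1 + x\<^sup>2)) ^ 3"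

lemma rk_le_bound:
  assumes t: "t > 0"
  shows "rk t (x - y) \<le> rk_bound t x / (1 + y\<^sup>2) ^ 3"
proof -
  let ?r = "t + (x - y)\<^sup>2"
  have r: "?r > 0" using t by (simp add: add_pos_nonneg)
  have p: "1 + x\<^sup>2 > 0" "1 + y\<^sup>2 > 0" by (auto simp: add_pos_nonneg)
  have "1 + (x - y)\<^sup>2 \<le> (1 + 1 / t) * ?r"
  proof -
    have "(1 + 1 / t) * ?r = ?r + 1 + (x - y)\<^sup>2 / t" using t by (simp add: field_simps)
    moreover have "0 \<le> (x - y)\<^sup>2 / t" using t by simp
    ultimately show ?thesis using t by linarith
  qed
  then have "2 * (1 + x\<^sup>2) * (1 + (x - y)\<^sup>2) \<le> 2 * (1 + x\<^sup>2) * ((1 + 1 / t) * ?r)"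
    using p by (intro mult_left_mono) auto
  moreover have "1 + y\<^sup>2 \<le> 2 * (1 + x\<^sup>2) * (1 + (x - y)\<^sup>2)"
    using one_add_square_le[of y x] by (simp only: power2_commute[of y x])
  ultimately have "1 + y\<^sup>2 \<le> (2 * (1 + 1 / t) * (1 + x\<^sup>2)) * ?r" by (simp only: mult_ac) 
  then have "(1 + y\<^sup>2) ^ 3 \<le> ((2 * (1 + 1 / t) * (1 + x\<^sup>2)) * ?r) ^ 3"
    using p by (intro power_mono) auto
  then have a: "(1 + y\<^sup>2) ^ 3 \<le> (2 * (1 + 1 / t) * (1 + x\<^sup>2)) ^ 3 * ?r ^ 3" unfolding power_mult_distrib .
  have q: "?r ^ 3 > 0" "(1 + y\<^sup>2) ^ 3 > 0" using r p by (auto intro: zero_less_power)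
  have "1 / ?r ^ 3 \<le> (2 * (1 + 1 / t) * (1 + x\<^sup>2)) ^ 3 / (1 + y\<^sup>2) ^ 3"
    using a q by (simp add: pos_divide_le_eq pos_le_divide_eq)
  then have "t powr (5/2) * (1 / ?r ^ 3) \<le> t powr (5/2) * ((2 * (1 + 1 / t) * (1 + x\<^sup>2)) ^ 3 / (1 + y\<^sup>2) ^ 3)"
    by (intro mult_left_mono) auto
  then show ?thesis by (simp add: rk_def rk_bound_def)
qed

lemma rk_bound_nonneg: "t > 0 \<Longrightarrow> 0 \<le> rk_bound t x"
  unfolding rk_bound_def by (intro mult_nonneg_nonneg zero_le_power) (auto simp: add_nonneg_nonneg)

lemma rk_le_wt:
  assumes t: "t > 0" and \<sigma>: "\<sigma> < 1"
  shows "rk t (x - y) \<le> rk_bound t x * wt \<sigma> y"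
proof -
  have p: "1 \<le> 1 + y\<^sup>2" by simp
  have "(1 + y\<^sup>2)\<^sup>2 \<le> (1 + y\<^sup>2) ^ 3" using p by (intro power_increasing) auto
  then have "1 / (1 + y\<^sup>2) ^ 3 \<le> 1 / (1 + y\<^sup>2)\<^sup>2"
    by (intro divide_left_mono) (auto intro!: mult_pos_pos zero_less_power simp: add_pos_nonneg)
  also have "\<dots> \<le> wt \<sigma> y" by (rule inverse_le_wt[OF \<sigma>])
  finally have "rk_bound t x * (1 / (1 + y\<^sup>2) ^ 3) \<le> rk_bound t x * wt \<sigma> y"
    using rk_bound_nonneg[OF t] by (intro mult_left_mono)
  then show ?thesis using rk_le_bound[OF t, of x y] by simp
qed

text \<open>In contrast to \<open>rk_bound\<close>, the factor here does not depend on t. For large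
  times the variables t and x thus separate, and the dependence on t can be integrated by
  itself.\<close>

lemma rk_large_time:
  assumes "t \<ge> 1"
  shows "rk t (x - y) \<le> (2 + 2 * x\<^sup>2) ^ 3 * rk t y"
proof -
  let ?r = "t + (x - y)\<^sup>2"
  have r: "?r > 0" "t + y\<^sup>2 > 0" using assms by (auto simp: add_pos_nonneg)
  have "y\<^sup>2 \<le> 2 * (x - y)\<^sup>2 + 2 * x\<^sup>2"
    using sum_squares_ge_zero[of "y - 2 * x" 0] by (simp add: power2_eq_square algebra_simps)
  moreover have "2 * x\<^sup>2 * 1 \<le> 2 * x\<^sup>2 * ?r"
  proof (rule mult_left_mono)
    show "1 \<le> ?r" using assms by (simp add: add_increasing2)
  qed simp
  moreover have "(2 + 2 * x\<^sup>2) * ?r = 2 * ?r + 2 * x\<^sup>2 * ?r" by (simp add: distrib_right)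
  ultimately have "t + y\<^sup>2 \<le> (2 + 2 * x\<^sup>2) * ?r" using assms by (simp add: mult.assoc)
  then have "(t + y\<^sup>2) ^ 3 \<le> ((2 + 2 * x\<^sup>2) * ?r) ^ 3" using r by (intro power_mono) auto
  then have a: "(t + y\<^sup>2) ^ 3 \<le> (2 + 2 * x\<^sup>2) ^ 3 * ?r ^ 3" unfolding power_mult_distrib .
  have q: "?r ^ 3 > 0" "(t + y\<^sup>2) ^ 3 > 0" using r by (auto intro: zero_less_power)
  have "1 / ?r ^ 3 \<le> (2 + 2 * x\<^sup>2) ^ 3 / (t + y\<^sup>2) ^ 3"
    using a q by (simp add: pos_divide_le_eq pos_le_divide_eq)
  then have "t powr (5/2) * (1 / ?r ^ 3) \<le> t powr (5/2) * ((2 + 2 * x\<^sup>2) ^ 3 / (t + y\<^sup>2) ^ 3)"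
    by (intro mult_left_mono) auto
  then show ?thesis by (simp add: rk_def mult_ac)
qed

lemma integrable_inverse_square: "integrable halfline (\<lambda>z. 1 / (1 + z)\<^sup>2)"
proof -
  have "integrable halfline (\<lambda>z. z powr 0 / (1 + z) ^ 2)" by (intro integrable_powr_decay) auto
  then show ?thesis
    by (rule Bochner_Integration.integrable_cong[OF refl, THEN iffD1, rotated]) simp
qed

text \<open>Beyond continuity and integrability, the regularity of u enters the transposition
  through \<open>small_time\<close>, with \<beta> = \<alpha>/2 or (1 + \<alpha>)/2 in the two cases.
  The factor 1 + x^(-lam) permits a singularity at the origin that test functions, of size x^lam
  there, absorb.\<close>

locale bessel_transposition = bessel_heat +
  fixes \<sigma> :: real and u :: "real \<Rightarrow> real" and \<beta> Cu :: real
  assumes lam1: "1 \<le> lam" and \<sigma>: "0 < \<sigma>" "\<sigma> < 1"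
    and u_cont: "continuous_on {0<..} u"
    and u_wt: "integrable halfline (\<lambda>x. \<bar>u x\<bar> * wt \<sigma> x)"
    and \<beta>: "\<sigma> < \<beta>" and Cu: "0 \<le> Cu"
    and small_time: "\<And>t x. 0 < t \<Longrightarrow> t \<le> 1 \<Longrightarrow> 0 < x \<Longrightarrow>
      \<bar>heat_op t u x - u x\<bar> \<le> Cu * (1 + x powr (- lam)) * t powr \<beta>"
begin

lemma u_meas [measurable]: "u \<in> borel_measurable halfline"
  by (rule continuous_on_imp_measurable_halfline[OF u_cont])

lemma heat_u_le:
  assumes "t > 0" "x > 0" "y > 0"
  shows "\<bar>heat_kernel lam t x y * u y\<bar> \<le> (C * rk_bound t x) * (\<bar>u y\<bar> * wt \<sigma> y)"
proof -
  have "\<bar>heat_kernel lam t x y * u y\<bar> \<le> (C * rk t (x - y)) * \<bar>u y\<bar>"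
    unfolding abs_mult using heat_nonneg[OF assms] heat_le[OF assms] by (intro mult_right_mono) auto
  also have "\<dots> \<le> (C * (rk_bound t x * wt \<sigma> y)) * \<bar>u y\<bar>"
    using rk_le_wt[OF assms(1) \<sigma>(2)] C by (intro mult_right_mono mult_left_mono) auto
  finally show ?thesis by (simp only: mult_ac)
qed

lemma heat_u_integrable:
  assumes "t > 0" "x > 0"
  shows "integrable halfline (\<lambda>y. heat_kernel lam t x y * u y)"
  by (rule integral_abs_le(1)[OF integrable_mult_right[OF u_wt]], measurable)
    (rule heat_u_le[OF assms], simp)

definition Eu :: "real \<Rightarrow> real" where
  "Eu t = (\<integral>y. rk t y * \<bar>u y\<bar> \<partial>halfline)"

lemma Eu_integrand:
  assumes "t > 0"
  shows "integrable halfline (\<lambda>y. rk t y * \<bar>u y\<bar>)"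
proof (rule integral_abs_le(1)[OF integrable_mult_right[OF u_wt, of "rk_bound t 0"]])
  fix y
  have "rk t y = rk t (0 - y)" by (simp add: rk_def)
  also have "\<dots> \<le> rk_bound t 0 * wt \<sigma> y" by (rule rk_le_wt[OF assms \<sigma>(2)])
  finally have "rk t y * \<bar>u y\<bar> \<le> (rk_bound t 0 * wt \<sigma> y) * \<bar>u y\<bar>" by (intro mult_right_mono) auto
  then show "\<bar>rk t y * \<bar>u y\<bar>\<bar> \<le> rk_bound t 0 * (\<bar>u y\<bar> * wt \<sigma> y)"
    using assms by (simp add: abs_mult mult_ac)
qed measurable

lemma Eu_nonneg: "t > 0 \<Longrightarrow> 0 \<le> Eu t"
  unfolding Eu_def by (intro integral_nonneg_AE AE_I2) simp

definition late :: "real \<Rightarrow> real" where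
  "late t = (if t \<le> 1 then 0 else Eu t / t powr (1 + \<sigma>))"

text \<open>Fubini with t inside: for fixed y the tail integral of \<open>rk t y\<close> over t > 1
  is at most a multiple of \<open>wt \<sigma> y\<close>, and u is integrable against this
  weight.\<close>

lemma late_integrable: "integrable halfline late"
proof -
  let ?c = "8 * (1 / (5/2 - \<sigma>) + 1 / (1/2 + \<sigma>))"
  define F where "F y t = \<bar>u y\<bar> * (if t \<le> 1 then 0 else rk t y / t powr (1 + \<sigma>))" for y t
  have m: "case_prod F \<in> borel_measurable (halfline \<Otimes>\<^sub>M halfline)"
    unfolding F_def by measurable
  have bound: "(\<integral>\<^sup>+t. ennreal \<bar>F y t\<bar> \<partial>halfline) \<le> ennreal (?c * (\<bar>u y\<bar> * wt \<sigma> y))" for y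
  proof -
    have "(\<integral>\<^sup>+t. ennreal \<bar>F y t\<bar> \<partial>halfline) = (\<integral>\<^sup>+t. ennreal \<bar>u y\<bar> * ennreal (if t \<le> 1 then 0 else rk t y / t powr (1 + \<sigma>)) \<partial>halfline)"
      by (intro nn_integral_cong) (simp add: F_def abs_mult ennreal_mult')
    also have "\<dots> = ennreal \<bar>u y\<bar> * (\<integral>\<^sup>+t. ennreal (if t \<le> 1 then 0 else rk t y / t powr (1 + \<sigma>)) \<partial>halfline)"
      by (rule nn_integral_cmult) measurable
    also have "\<dots> \<le> ennreal \<bar>u y\<bar> * ennreal (?c * wt \<sigma> y)"
      by (intro mult_left_mono nn_integral_rk_tail \<sigma>) simp
    also have "\<dots> = ennreal (\<bar>u y\<bar> * (?c * wt \<sigma> y))" by (intro ennreal_mult'[symmetric]) simp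
    finally show ?thesis by (simp only: mult_ac)
  qed
  have "integrable halfline (\<lambda>t. \<integral>y. F y t \<partial>halfline)"
    by (rule halfline_pair.Fubini_bounded(3)[OF m bound integrable_mult_right[OF u_wt]])
  moreover have "(\<integral>y. F y t \<partial>halfline) = late t" for t
  proof (cases "t \<le> 1")
    case False
    have "(\<integral>y. F y t \<partial>halfline) = (\<integral>y. (rk t y * \<bar>u y\<bar>) / t powr (1 + \<sigma>) \<partial>halfline)"
      using False by (intro Bochner_Integration.integral_cong) (auto simp: F_def)
    then show ?thesis using False by (simp add: late_def Eu_def)
  qed (simp add: F_def late_def)
  ultimately show ?thesis by simp
qed

lemma large_time:
  assumes t: "t > 1" and x: "x > 0"
  shows "\<bar>heat_op t u x - u x\<bar> \<le> \<bar>u x\<bar> + C * (2 + 2 * x\<^sup>2) ^ 3 * Eu t"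
    and "(\<integral>y. \<bar>heat_kernel lam t x y * u y\<bar> \<partial>halfline) \<le> C * (2 + 2 * x\<^sup>2) ^ 3 * Eu t"
proof -
  have t0: "t > 0" using t by simp
  have b: "\<bar>\<bar>heat_kernel lam t x y * u y\<bar>\<bar> \<le> (C * (2 + 2 * x\<^sup>2) ^ 3) * (rk t y * \<bar>u y\<bar>)" if "y \<in> space halfline" for y
  proof -
    have y: "y > 0" using that by simp
    have "\<bar>heat_kernel lam t x y * u y\<bar> \<le> (C * rk t (x - y)) * \<bar>u y\<bar>"
      unfolding abs_mult using heat_nonneg[OF t0 x y] heat_le[OF t0 x y] by (intro mult_right_mono) auto
    also have "\<dots> \<le> (C * ((2 + 2 * x\<^sup>2) ^ 3 * rk t y)) * \<bar>u y\<bar>"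
      using rk_large_time[of t x y] t C by (intro mult_right_mono mult_left_mono) auto
    finally show ?thesis by (simp only: mult_ac abs_idempotent)
  qed
  have i: "integrable halfline (\<lambda>y. (C * (2 + 2 * x\<^sup>2) ^ 3) * (rk t y * \<bar>u y\<bar>))"
    by (rule integrable_mult_right[OF Eu_integrand[OF t0]])
  have "\<bar>\<integral>y. \<bar>heat_kernel lam t x y * u y\<bar> \<partial>halfline\<bar> \<le> (\<integral>y. (C * (2 + 2 * x\<^sup>2) ^ 3) * (rk t y * \<bar>u y\<bar>) \<partial>halfline)"
    by (rule integral_abs_le(2)[OF i _ b]) measurable
  then show le: "(\<integral>y. \<bar>heat_kernel lam t x y * u y\<bar> \<partial>halfline) \<le> C * (2 + 2 * x\<^sup>2) ^ 3 * Eu t"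
    unfolding Eu_def integral_mult_right_zero by linarith
  have "\<bar>heat_op t u x\<bar> \<le> (\<integral>y. \<bar>heat_kernel lam t x y * u y\<bar> \<partial>halfline)"
    unfolding heat_op_def by (rule integral_abs_bound)
  then show "\<bar>heat_op t u x - u x\<bar> \<le> \<bar>u x\<bar> + C * (2 + 2 * x\<^sup>2) ^ 3 * Eu t"
    using le by linarith
qed

text \<open>The time majorants separate t from x. \<open>early\<close> covers t <= 1 and is
  integrable because \<sigma> < \<beta>; for t > 1 the term u(x) goes with \<open>middle\<close> and
  the semigroup term with \<open>late\<close>. The coefficients depend on x alone.\<close>

definition early :: "real \<Rightarrow> real" where
  "early t = (if t \<le> 1 then t powr (\<beta> - 1 - \<sigma>) else 0)"

definition middle :: "real \<Rightarrow> real" where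
  "middle t = (if t \<le> 1 then 0 else t powr (- (1 + \<sigma>)))"

lemma early_integrable: "integrable halfline early"
proof -
  have "integrable halfline (\<lambda>t. if t \<le> 1 then 1 * t powr (\<beta> - 1 - \<sigma>) else 0 * t powr (- 2))"
    by (rule integrable_halfline_two_powers) (use \<beta> in auto)
  then show ?thesis unfolding early_def[abs_def] by (simp only: mult_zero_left mult_1_left)
qed

lemma middle_integrable: "integrable halfline middle"
proof -
  have "integrable halfline (\<lambda>t. if t \<le> 1 then 0 * t powr 0 else 1 * t powr (- (1 + \<sigma>)))"
    by (rule integrable_halfline_two_powers) (use \<sigma> in auto)
  then show ?thesis unfolding middle_def[abs_def] by (simp only: mult_zero_left mult_1_left)
qed

definition Du :: "real \<Rightarrow> real \<Rightarrow> real" where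
  "Du t x = (heat_op t u x - u x) / t powr (1 + \<sigma>)"

lemma Du_le:
  assumes t: "t > 0" and x: "x > 0"
  shows "\<bar>Du t x\<bar> \<le> Cu * (1 + x powr (- lam)) * early t + \<bar>u x\<bar> * middle t + C * (2 + 2 * x\<^sup>2) ^ 3 * late t"
proof (cases "t \<le> 1")
  case True
  have "\<bar>Du t x\<bar> \<le> Cu * (1 + x powr (- lam)) * t powr \<beta> / t powr (1 + \<sigma>)"
    using small_time[OF t True x] unfolding Du_def abs_divide by (simp add: divide_right_mono)
  also have "\<dots> = Cu * (1 + x powr (- lam)) * (t powr \<beta> / t powr (1 + \<sigma>))" by simp
  also have "t powr \<beta> / t powr (1 + \<sigma>) = early t"
    unfolding powr_diff[symmetric] using True by (simp add: early_def algebra_simps)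
  finally show ?thesis using True by (simp add: middle_def late_def)
next
  case False
  have "\<bar>Du t x\<bar> \<le> (\<bar>u x\<bar> + C * (2 + 2 * x\<^sup>2) ^ 3 * Eu t) / t powr (1 + \<sigma>)"
    using large_time(1)[of t x] False x unfolding Du_def abs_divide by (simp add: divide_right_mono)
  also have "\<dots> = \<bar>u x\<bar> * (1 / t powr (1 + \<sigma>)) + C * (2 + 2 * x\<^sup>2) ^ 3 * (Eu t / t powr (1 + \<sigma>))"
    by (simp add: add_divide_distrib)
  also have "1 / t powr (1 + \<sigma>) = t powr (- (1 + \<sigma>))" by (simp only: powr_minus divide_inverse mult_1_left)
  finally show ?thesis using False by (simp add: early_def middle_def late_def)
qed

lemma Du_t_measurable: "(\<lambda>t. Du t x) \<in> borel_measurable halfline"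
proof -
  have [measurable]: "(\<lambda>t. heat_op t u x) \<in> borel_measurable halfline"
    by (rule measurable_heat_op) measurable
  show ?thesis unfolding Du_def by measurable
qed

lemma majorant_integrable:
  "integrable halfline (\<lambda>t. a * early t + b * middle t + c * late t)"
  by (intro Bochner_Integration.integrable_add integrable_mult_right early_integrable middle_integrable late_integrable)

lemma Du_integrable:
  assumes x: "x > 0"
  shows "integrable halfline (\<lambda>t. Du t x)"
  by (rule integral_abs_le(1)[OF majorant_integrable Du_t_measurable]) (rule Du_le[OF _ x], simp)

definition g :: "real \<Rightarrow> real" where
  "g x = 1 / Gamma (- \<sigma>) * (\<integral>t. Du t x \<partial>halfline)"

lemma heat_kernel_continuous:
  assumes t: "t > 0" and y: "y > 0"
  shows "continuous_on {0<..} (\<lambda>x. heat_kernel lam t x y)"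
proof -
  have "continuous_on {0<..} (\<lambda>x. gauss t (x - y) * bessel_ratio lam (x * y / (2 * t)))"
    unfolding gauss_def bessel_ratio_def
    using t y lam by (intro continuous_intros continuous_on_compose2[OF continuous_bes[of "lam + 1/2" UNIV]]) auto
  then show ?thesis
    by (rule continuous_on_eq) (use heat_kernel_eq_gauss[OF lam t _ y] in auto)
qed

lemma rk_bound_continuous: "t > 0 \<Longrightarrow> continuous_on A (rk_bound t)"
  unfolding rk_bound_def[abs_def] by (intro continuous_intros)

lemma convergent_abs_bounded:
  fixes f :: "real \<Rightarrow> real"
  assumes "continuous_on {0<..} f" "\<And>n. X n \<in> {0<..}" "X \<longlonglongrightarrow> x" "x \<in> {0<..}"
  obtains M where "\<And>n. \<bar>f (X n)\<bar> \<le> M"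
proof -
  have "(\<lambda>n. f (X n)) \<longlonglongrightarrow> f x"
    using assms by (intro continuous_on_tendsto_compose[OF assms(1)]) auto
  then have "Bseq (\<lambda>n. f (X n))" by (intro convergent_imp_Bseq convergentI)
  then show ?thesis using that unfolding Bseq_def by auto
qed

lemma heat_op_u_tendsto:
  assumes t: "t > 0" and X: "\<And>n. X n \<in> {0<..}" "X \<longlonglongrightarrow> x" "x \<in> {0<..}"
  shows "(\<lambda>n. heat_op t u (X n)) \<longlonglongrightarrow> heat_op t u x"
proof -
  obtain M where M: "\<And>n. \<bar>rk_bound t (X n)\<bar> \<le> M"
    using convergent_abs_bounded[OF rk_bound_continuous[OF t] X] by blast
  show ?thesis
    unfolding heat_op_def
  proof (rule integral_dominated_convergence[where w = "\<lambda>y. (C * M) * (\<bar>u y\<bar> * wt \<sigma> y)"])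
    show "integrable halfline (\<lambda>y. (C * M) * (\<bar>u y\<bar> * wt \<sigma> y))" by (rule integrable_mult_right[OF u_wt])
    show "AE y in halfline. (\<lambda>n. heat_kernel lam t (X n) y * u y) \<longlonglongrightarrow> heat_kernel lam t x y * u y"
    proof (rule AE_I2)
      fix y assume "y \<in> space halfline"
      then have "(\<lambda>n. heat_kernel lam t (X n) y) \<longlonglongrightarrow> heat_kernel lam t x y"
        using X by (intro continuous_on_tendsto_compose[OF heat_kernel_continuous[OF t]]) auto
      then show "(\<lambda>n. heat_kernel lam t (X n) y * u y) \<longlonglongrightarrow> heat_kernel lam t x y * u y"
        by (intro tendsto_intros)
    qed
    show "AE y in halfline. norm (heat_kernel lam t (X n) y * u y) \<le> (C * M) * (\<bar>u y\<bar> * wt \<sigma> y)" for n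
    proof (rule AE_I2)
      fix y assume "y \<in> space halfline"
      then have "norm (heat_kernel lam t (X n) y * u y) \<le> (C * rk_bound t (X n)) * (\<bar>u y\<bar> * wt \<sigma> y)"
        using heat_u_le[OF t, of "X n" y] X(1)[of n] by simp
      also have "\<dots> \<le> (C * M) * (\<bar>u y\<bar> * wt \<sigma> y)"
        using C M[of n] by (intro mult_right_mono mult_left_mono) auto
      finally show "norm (heat_kernel lam t (X n) y * u y) \<le> (C * M) * (\<bar>u y\<bar> * wt \<sigma> y)" .
    qed
  qed measurable
qed

text \<open>Dominated convergence along a convergent sequence of points, first in y at fixed t and
  then in t. The majorants involve the point only through continuous coefficients, which are bounded
  along the sequence.\<close>

lemma g_continuous: "continuous_on {0<..} g"
  unfolding continuous_on_sequentially
proof (intro allI ballI impI, elim conjE)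
  fix x and X :: "nat \<Rightarrow> real"
  assume x: "x \<in> {0<..}" and X: "\<forall>n. X n \<in> {0<..}" "X \<longlonglongrightarrow> x"
  note XX = X(1)[rule_format] X(2) x
  have "continuous_on {0<..} (\<lambda>x. Cu * (1 + x powr (- lam)))" by (intro continuous_intros) auto
  then obtain M1 where M1: "\<And>n. \<bar>Cu * (1 + X n powr (- lam))\<bar> \<le> M1" using convergent_abs_bounded[OF _ XX] by blast
  obtain M2 where M2: "\<And>n. \<bar>u (X n)\<bar> \<le> M2" using convergent_abs_bounded[OF u_cont XX] by blast
  have "continuous_on {0<..} (\<lambda>x. C * (2 + 2 * x\<^sup>2) ^ 3)" by (intro continuous_intros)
  then obtain M3 where M3: "\<And>n. \<bar>C * (2 + 2 * (X n)\<^sup>2) ^ 3\<bar> \<le> M3" using convergent_abs_bounded[OF _ XX] by blast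
  have nn: "0 \<le> early t" "0 \<le> middle t" "t > 0 \<Longrightarrow> 0 \<le> late t" for t
    using Eu_nonneg by (auto simp: early_def middle_def late_def)
  have "(\<lambda>n. \<integral>t. Du t (X n) \<partial>halfline) \<longlonglongrightarrow> (\<integral>t. Du t x \<partial>halfline)"
  proof (rule integral_dominated_convergence[where w = "\<lambda>t. M1 * early t + M2 * middle t + M3 * late t"])
    show "AE t in halfline. (\<lambda>n. Du t (X n)) \<longlonglongrightarrow> Du t x"
    proof (rule AE_I2)
      fix t assume "t \<in> space halfline"
      then have t: "t > 0" by simp
      have "(\<lambda>n. u (X n)) \<longlonglongrightarrow> u x" using XX by (intro continuous_on_tendsto_compose[OF u_cont]) auto
      then show "(\<lambda>n. Du t (X n)) \<longlonglongrightarrow> Du t x"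
        unfolding Du_def using t by (intro tendsto_intros heat_op_u_tendsto[OF t XX]) auto
    qed
    show "AE t in halfline. norm (Du t (X n)) \<le> M1 * early t + M2 * middle t + M3 * late t" for n
    proof (rule AE_I2)
      fix t assume "t \<in> space halfline"
      then have t: "t > 0" by simp
      have "norm (Du t (X n)) \<le> Cu * (1 + X n powr (- lam)) * early t + \<bar>u (X n)\<bar> * middle t + C * (2 + 2 * (X n)\<^sup>2) ^ 3 * late t"
        using Du_le[OF t, of "X n"] XX(1)[of n] by simp
      also have "\<dots> \<le> M1 * early t + M2 * middle t + M3 * late t"
        using M1[of n] M2[of n] M3[of n] nn t by (intro add_mono mult_right_mono) auto
      finally show "norm (Du t (X n)) \<le> M1 * early t + M2 * middle t + M3 * late t" .
    qed
  qed (rule majorant_integrable Du_t_measurable)+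
  then show "(g \<circ> X) \<longlonglongrightarrow> g x" unfolding g_def comp_def by (intro tendsto_intros)
qed

end

section \<open>Linearity of the fractional operator on test functions\<close>

context bessel_heat begin

lemma hankel_linear:
  assumes f: "f \<in> borel_measurable halfline" "\<And>y. y > 0 \<Longrightarrow> f y = y powr lam * f0 y"
    and g: "g \<in> borel_measurable halfline" "\<And>y. y > 0 \<Longrightarrow> g y = y powr lam * g0 y"
    and x: "x > 0"
    and i: "integrable halfline (\<lambda>y. y powr (2 * lam) * jb lam (x * y) * f0 y)"
      "integrable halfline (\<lambda>y. y powr (2 * lam) * jb lam (x * y) * g0 y)"
    and h: "h \<in> borel_measurable halfline" "\<And>y. y > 0 \<Longrightarrow> h y = a * f y + b * g y"
  shows "hankel lam h x = a * hankel lam f x + b * hankel lam g x"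
proof -
  have "h y = y powr lam * (a * f0 y + b * g0 y)" if "y > 0" for y
    using that f(2) g(2) h(2) by (simp add: algebra_simps)
  then have "hankel lam h x = 2 powr (1/2 - lam) * x powr lam * (\<integral>y. y powr (2 * lam) * jb lam (x * y) * (a * f0 y + b * g0 y) \<partial>halfline)"
    by (rule hankel_eq[OF h(1) _ x])
  also have "(\<integral>y. y powr (2 * lam) * jb lam (x * y) * (a * f0 y + b * g0 y) \<partial>halfline)
    = (\<integral>y. a * (y powr (2 * lam) * jb lam (x * y) * f0 y) + b * (y powr (2 * lam) * jb lam (x * y) * g0 y) \<partial>halfline)"
    by (intro Bochner_Integration.integral_cong refl) (simp add: algebra_simps)
  also have "\<dots> = a * (\<integral>y. y powr (2 * lam) * jb lam (x * y) * f0 y \<partial>halfline) + b * (\<integral>y. y powr (2 * lam) * jb lam (x * y) * g0 y \<partial>halfline)"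
    using i by (simp add: Bochner_Integration.integral_add)
  finally have "hankel lam h x = a * (2 powr (1/2 - lam) * x powr lam * (\<integral>y. y powr (2 * lam) * jb lam (x * y) * f0 y \<partial>halfline))
      + b * (2 powr (1/2 - lam) * x powr lam * (\<integral>y. y powr (2 * lam) * jb lam (x * y) * g0 y \<partial>halfline))"
    by (simp only: distrib_left mult_ac)
  moreover have "hankel lam f x = 2 powr (1/2 - lam) * x powr lam * (\<integral>y. y powr (2 * lam) * jb lam (x * y) * f0 y \<partial>halfline)"
    by (rule hankel_eq[OF f x])
  moreover have "hankel lam g x = 2 powr (1/2 - lam) * x powr lam * (\<integral>y. y powr (2 * lam) * jb lam (x * y) * g0 y \<partial>halfline)"
    by (rule hankel_eq[OF g x])
  ultimately show ?thesis by (simp only:)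
qed

lemma frac_bessel_test_linear:
  assumes \<phi>: "\<phi> \<in> test_space lam" and \<psi>: "\<psi> \<in> test_space lam" and \<sigma>: "0 < \<sigma>" and x: "x > 0"
  shows "frac_bessel_test lam \<sigma> (\<lambda>x. a * \<phi> x + b * \<psi> x) x = a * frac_bessel_test lam \<sigma> \<phi> x + b * frac_bessel_test lam \<sigma> \<psi> x"
proof -
  let ?\<chi> = "\<lambda>x. a * \<phi> x + b * \<psi> x"
  have rep: "\<eta> y = y powr lam * test_jet_of lam \<eta> 0 y" if "y > 0" for \<eta> y
    using jet_fun_test_jet_of[OF that, of \<eta>] by (simp add: jet_fun_def)
  have hi: "integrable halfline (\<lambda>z. z powr (2 * lam) * jb lam (y * z) * test_jet_of lam \<eta> 0 z)" if "\<eta> \<in> test_space lam" for \<eta> y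
    using hk_integrable[OF lam test_jet_test_jet_of[OF that], of y 0] by (simp add: mult.commute[of y])
  note m\<phi> [measurable] = test_fun_measurable[OF \<phi>] and m\<psi> [measurable] = test_fun_measurable[OF \<psi>]
  have m\<chi>: "?\<chi> \<in> borel_measurable halfline" by measurable
  have inner: "hankel lam ?\<chi> y = a * hankel lam \<phi> y + b * hankel lam \<psi> y" if "y > 0" for y
    by (rule hankel_linear[OF m\<phi> rep m\<psi> rep that hi[OF \<phi>] hi[OF \<psi>] m\<chi>]) simp_all
  have mh: "(\<lambda>y. y powr (2 * \<sigma>) * hankel lam \<eta> y) \<in> borel_measurable halfline" if "\<eta> \<in> borel_measurable halfline" for \<eta>
  proof -
    have [measurable]: "hankel lam \<eta> \<in> borel_measurable halfline"
      by (intro borel_measurable_halflineI measurable_hankel that)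
    show ?thesis by measurable
  qed
  have oi: "integrable halfline (\<lambda>y. y powr (2 * lam) * jb lam (x * y) * (y powr (2 * \<sigma>) * hk lam (test_jet_of lam \<eta> 0) y))"
    if "\<eta> \<in> test_space lam" for \<eta>
  proof -
    have "integrable halfline (\<lambda>y. y powr (2 * lam + 2 * \<sigma>) * jb lam (x * y) * hk lam (test_jet_of lam \<eta> 0) y * 1)"
      using lam \<sigma> by (intro spec_integrable[OF test_jet_test_jet_of[OF that], where H = 1]) auto
    then show ?thesis by (simp add: powr_add mult_ac)
  qed
  have orep: "y powr (2 * \<sigma>) * hankel lam \<eta> y = y powr lam * (y powr (2 * \<sigma>) * hk lam (test_jet_of lam \<eta> 0) y)"
    if "\<eta> \<in> test_space lam" "y > 0" for \<eta> y
    unfolding hankel_test[OF that] by (simp only: mult_ac)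
  show ?thesis
    unfolding frac_bessel_test_def
  proof (rule hankel_linear[OF mh[OF m\<phi>] orep[OF \<phi>] mh[OF m\<psi>] orep[OF \<psi>] x oi[OF \<phi>] oi[OF \<psi>] mh[OF m\<chi>]])
    fix y :: real assume y: "y > 0"
    show "y powr (2 * \<sigma>) * hankel lam ?\<chi> y = a * (y powr (2 * \<sigma>) * hankel lam \<phi> y) + b * (y powr (2 * \<sigma>) * hankel lam \<psi> y)"
      unfolding inner[OF y] by (simp add: algebra_simps)
  qed
qed

end

section \<open>The transposed operator as a function\<close>

context bessel_transposition begin

text \<open>These are the factors that \<phi> meets: the singular coefficient of the small-time
  bound, u itself, and the growth (1 + x^2)^3 caused by the kernel comparisons.\<close>

lemma test_mult_integrable:
  assumes \<phi>: "\<phi> \<in> test_space lam"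
  shows "integrable halfline (\<lambda>x. \<phi> x * (1 + x powr (- lam)))"
    and "integrable halfline (\<lambda>x. \<phi> x * u x)"
    and "integrable halfline (\<lambda>x. \<phi> x * (1 + x\<^sup>2) ^ 3)"
proof -
  note m [measurable] = test_fun_measurable[OF \<phi>]
  \<comment> \<open>Eight powers: six for (1 + x^2)^3 and two for integrability at infinity.\<close>
  obtain A where A: "A \<ge> 0" "\<And>x. x > 0 \<Longrightarrow> \<bar>\<phi> x\<bar> \<le> A / (1 + x) ^ 8" "\<And>x. x > 0 \<Longrightarrow> \<bar>\<phi> x\<bar> \<le> A * x powr lam / (1 + x) ^ 8"
    using test_fun_le[OF \<phi>, of 8] by blast
  have le: "A / (1 + x) ^ 8 \<le> A / (1 + x) ^ j" if "j \<le> 8" "x > 0" for j and x :: real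
    using A(1) that by (intro divide_left_mono power_increasing mult_pos_pos zero_less_power) auto
  have i2: "integrable halfline (\<lambda>x. (2 * A) * (1 / (1 + x)\<^sup>2))" by (rule integrable_mult_right[OF integrable_inverse_square])
  show "integrable halfline (\<lambda>x. \<phi> x * (1 + x powr (- lam)))"
  proof (rule integral_abs_le(1)[OF i2])
    fix x assume "x \<in> space halfline"
    then have x: "x > 0" by simp
    have p: "x powr lam * x powr (- lam) = 1" using x by (simp flip: powr_add)
    have "\<bar>\<phi> x\<bar> * x powr (- lam) \<le> (A * x powr lam / (1 + x) ^ 8) * x powr (- lam)"
      using A(3)[OF x] by (intro mult_right_mono) auto
    also have "\<dots> = A * (x powr lam * x powr (- lam)) / (1 + x) ^ 8" by simp
    also have "\<dots> \<le> A / (1 + x)\<^sup>2" using le[of 2 x] x p by simp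
    finally have "\<bar>\<phi> x\<bar> * (1 + x powr (- lam)) \<le> A / (1 + x)\<^sup>2 + A / (1 + x)\<^sup>2"
      using A(2)[OF x] le[of 2 x] x by (simp add: distrib_left)
    moreover have "\<bar>\<phi> x * (1 + x powr (- lam))\<bar> = \<bar>\<phi> x\<bar> * (1 + x powr (- lam))"
      by (simp add: abs_mult add_nonneg_nonneg)
    ultimately show "\<bar>\<phi> x * (1 + x powr (- lam))\<bar> \<le> (2 * A) * (1 / (1 + x)\<^sup>2)" by simp
  qed measurable
  show "integrable halfline (\<lambda>x. \<phi> x * u x)"
  proof (rule integral_abs_le(1)[OF integrable_mult_right[OF u_wt, of A]])
    fix x assume "x \<in> space halfline"
    then have x: "x > 0" by simp
    have "\<bar>\<phi> x\<bar> \<le> A / (1 + x) ^ 4" using A(2)[OF x] le[of 4 x] x by linarith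
    also have "\<dots> \<le> A / (1 + x\<^sup>2)\<^sup>2"
      using A(1) one_add_square_power_le(1)[OF x] x
      by (intro divide_left_mono mult_pos_pos zero_less_power) (auto simp: add_pos_nonneg)
    also have "\<dots> \<le> A * wt \<sigma> x" using inverse_le_wt[OF \<sigma>(2), of x] mult_left_mono[OF _ A(1)] by fastforce
    finally have "\<bar>\<phi> x\<bar> * \<bar>u x\<bar> \<le> (A * wt \<sigma> x) * \<bar>u x\<bar>" by (intro mult_right_mono) auto
    then show "\<bar>\<phi> x * u x\<bar> \<le> A * (\<bar>u x\<bar> * wt \<sigma> x)" by (simp add: abs_mult mult_ac)
  qed measurable
  show "integrable halfline (\<lambda>x. \<phi> x * (1 + x\<^sup>2) ^ 3)"
  proof (rule integral_abs_le(1)[OF integrable_mult_right[OF integrable_inverse_square, of A]])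
    fix x assume "x \<in> space halfline"
    then have x: "x > 0" by simp
    have "1 + x\<^sup>2 \<le> (1 + x)\<^sup>2" using x by (simp add: power2_eq_square algebra_simps)
    then have "(1 + x\<^sup>2) ^ 3 \<le> ((1 + x)\<^sup>2) ^ 3" by (intro power_mono) (auto simp: add_nonneg_nonneg)
    also have "\<dots> = (1 + x) ^ 6" by (simp flip: power_mult)
    finally have "\<bar>\<phi> x\<bar> * (1 + x\<^sup>2) ^ 3 \<le> (A / (1 + x) ^ 8) * (1 + x) ^ 6"
      using A x by (intro mult_mono) (auto simp: add_nonneg_nonneg)
    also have "(1 + x) ^ 8 = (1 + x)\<^sup>2 * (1 + x) ^ 6" by (simp flip: power_add)
    also have "(A / ((1 + x)\<^sup>2 * (1 + x) ^ 6)) * (1 + x) ^ 6 = A * (1 / (1 + x)\<^sup>2)"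
    proof -
      have "(A / (q * w)) * w = A * (1 / q)" if "w > 0" for q w :: real using that by simp
      from this[of "(1 + x) ^ 6"] show ?thesis using x by (simp only: zero_less_power add_pos_pos zero_less_one)
    qed
    finally show "\<bar>\<phi> x * (1 + x\<^sup>2) ^ 3\<bar> \<le> A * (1 / (1 + x)\<^sup>2)"
      by (simp add: abs_mult add_nonneg_nonneg)
  qed measurable
qed

lemma heat_op_symmetric:
  assumes \<phi>: "\<phi> \<in> test_space lam" and t: "t > 0"
  shows "integrable halfline (\<lambda>x. u x * heat_op t \<phi> x)"
    and "integrable halfline (\<lambda>y. \<phi> y * heat_op t u y)"
    and "(\<integral>x. u x * heat_op t \<phi> x \<partial>halfline) = (\<integral>y. \<phi> y * heat_op t u y \<partial>halfline)"
proof -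
  note m [measurable] = test_fun_measurable[OF \<phi>]
  have [measurable]: "(\<lambda>p. \<phi> (snd p)) \<in> borel_measurable (halfline \<Otimes>\<^sub>M halfline)"
    by (rule measurable_compose[OF measurable_snd m])
  have [measurable]: "(\<lambda>p. \<phi> (fst p)) \<in> borel_measurable (halfline \<Otimes>\<^sub>M halfline)"
    by (rule measurable_compose[OF measurable_fst m])
  define F where "F y x = \<phi> y * (heat_kernel lam t y x * u x)" for y x
  define c where "c = C * (t powr (5/2) * (2 * (1 + 1 / t)) ^ 3)"
  define I where "I = (\<integral>x. \<bar>u x\<bar> * wt \<sigma> x \<partial>halfline)"
  have mF: "case_prod F \<in> borel_measurable (halfline \<Otimes>\<^sub>M halfline)"
    unfolding F_def by measurable
  have bound: "(\<integral>\<^sup>+x. ennreal \<bar>F y x\<bar> \<partial>halfline) \<le> ennreal ((c * I) * \<bar>\<phi> y * (1 + y\<^sup>2) ^ 3\<bar>)" if "y \<in> space halfline" for y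
  proof -
    have y: "y > 0" using that by simp
    let ?k = "\<bar>\<phi> y\<bar> * (C * rk_bound t y)"
    have k: "?k \<ge> 0" using C rk_bound_nonneg[OF t, of y] by simp
    have "(\<integral>\<^sup>+x. ennreal \<bar>F y x\<bar> \<partial>halfline) \<le> (\<integral>\<^sup>+x. ennreal (?k * (\<bar>u x\<bar> * wt \<sigma> x)) \<partial>halfline)"
    proof (intro nn_integral_mono ennreal_leI)
      fix x assume "x \<in> space halfline"
      then have "\<bar>\<phi> y\<bar> * \<bar>heat_kernel lam t y x * u x\<bar> \<le> \<bar>\<phi> y\<bar> * ((C * rk_bound t y) * (\<bar>u x\<bar> * wt \<sigma> x))"
        using heat_u_le[OF t y, of x] by (intro mult_left_mono) auto
      then show "\<bar>F y x\<bar> \<le> ?k * (\<bar>u x\<bar> * wt \<sigma> x)" unfolding F_def abs_mult[of "\<phi> y"] by (simp only: mult.assoc)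
    qed
    also have "\<dots> = ennreal (?k * I)"
    proof -
      have "AE x in halfline. 0 \<le> ?k * (\<bar>u x\<bar> * wt \<sigma> x)" by (intro AE_I2 mult_nonneg_nonneg[OF k]) simp
      from nn_integral_eq_integral[OF integrable_mult_right[OF u_wt] this] show ?thesis
        by (simp only: integral_mult_right_zero I_def)
    qed
    also have "?k * I = (c * I) * \<bar>\<phi> y * (1 + y\<^sup>2) ^ 3\<bar>"
    proof -
      have "\<bar>\<phi> y * (1 + y\<^sup>2) ^ 3\<bar> = \<bar>\<phi> y\<bar> * (1 + y\<^sup>2) ^ 3" by (simp add: abs_mult add_nonneg_nonneg)
      then show ?thesis unfolding c_def rk_bound_def power_mult_distrib by (simp only: mult_ac)
    qed
    finally show ?thesis .
  qed
  note fub = halfline_pair.Fubini_bounded[OF mF bound integrable_mult_right[OF integrable_abs[OF test_mult_integrable(3)[OF \<phi>]]]]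
  have s1: "(\<integral>x. F y x \<partial>halfline) = \<phi> y * heat_op t u y" for y
    unfolding F_def heat_op_def by (rule integral_mult_right_zero)
  have s2: "(\<integral>y. F y x \<partial>halfline) = u x * heat_op t \<phi> x" for x
  proof -
    have "(\<integral>y. F y x \<partial>halfline) = (\<integral>y. u x * (heat_kernel lam t x y * \<phi> y) \<partial>halfline)"
      by (intro Bochner_Integration.integral_cong refl) (simp add: F_def heat_kernel_commute[of lam t x])
    then show ?thesis unfolding heat_op_def integral_mult_right_zero .
  qed
  show "integrable halfline (\<lambda>x. u x * heat_op t \<phi> x)"
    and "integrable halfline (\<lambda>y. \<phi> y * heat_op t u y)"
    and "(\<integral>x. u x * heat_op t \<phi> x \<partial>halfline) = (\<integral>y. \<phi> y * heat_op t u y \<partial>halfline)"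
    using fub(2,3,4) unfolding s1 s2 by auto
qed

text \<open>Each side is a double integral in x and t, and Fubini applies to each with its own
  majorant: seminorms times the weight where the semigroup acts on \<phi>, the time majorants where
  it acts on u. At every fixed t the symmetry of the kernel equates the two x-integrals.\<close>

lemma transposition:
  assumes \<phi>: "\<phi> \<in> test_space lam"
  shows "integrable halfline (\<lambda>x. g x * \<phi> x)"
    and "integrable halfline (\<lambda>x. u x * frac_bessel_test lam \<sigma> \<phi> x)"
    and "(\<integral>x. u x * frac_bessel_test lam \<sigma> \<phi> x \<partial>halfline) = (\<integral>x. g x * \<phi> x \<partial>halfline)"
proof -
  note m [measurable] = test_fun_measurable[OF \<phi>]
  have [measurable]: "(\<lambda>p. \<phi> (fst p)) \<in> borel_measurable (halfline \<Otimes>\<^sub>M halfline)"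
    by (rule measurable_compose[OF measurable_fst m])
  have [measurable]: "(\<lambda>p. heat_op (snd p) \<phi> (fst p)) \<in> borel_measurable (halfline \<Otimes>\<^sub>M halfline)"
    by (rule measurable_heat_op) measurable
  have [measurable]: "(\<lambda>p. heat_op (snd p) u (fst p)) \<in> borel_measurable (halfline \<Otimes>\<^sub>M halfline)"
    by (rule measurable_heat_op) measurable
  obtain D where D: "D \<ge> 0"
    "\<And>\<phi> x. \<phi> \<in> test_space lam \<Longrightarrow> x > 0 \<Longrightarrow>
      (\<integral>\<^sup>+t. ennreal (\<bar>heat_op t \<phi> x - \<phi> x\<bar> / t powr (1 + \<sigma>)) \<partial>halfline) \<le> ennreal (D * test_norm \<phi> * wt \<sigma> x)"
    using test_fun_bound[OF lam1 \<sigma>] by blast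
  define F where "F x t = u x * ((heat_op t \<phi> x - \<phi> x) / t powr (1 + \<sigma>))" for x t
  define G where "G x t = \<phi> x * Du t x" for x t
  have mF: "case_prod F \<in> borel_measurable (halfline \<Otimes>\<^sub>M halfline)" unfolding F_def by measurable
  have mG: "case_prod G \<in> borel_measurable (halfline \<Otimes>\<^sub>M halfline)" unfolding G_def Du_def by measurable
  have bF: "(\<integral>\<^sup>+t. ennreal \<bar>F x t\<bar> \<partial>halfline) \<le> ennreal ((D * test_norm \<phi>) * (\<bar>u x\<bar> * wt \<sigma> x))" if "x \<in> space halfline" for x
  proof -
    have x: "x > 0" using that by simp
    have [measurable]: "(\<lambda>t. heat_op t \<phi> x) \<in> borel_measurable halfline" by (rule measurable_heat_op) measurable
    have "(\<integral>\<^sup>+t. ennreal \<bar>F x t\<bar> \<partial>halfline) = (\<integral>\<^sup>+t. ennreal \<bar>u x\<bar> * ennreal (\<bar>heat_op t \<phi> x - \<phi> x\<bar> / t powr (1 + \<sigma>)) \<partial>halfline)"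
      unfolding F_def abs_mult by (intro nn_integral_cong, subst ennreal_mult'[symmetric]) (auto simp: abs_divide)
    also have "\<dots> = ennreal \<bar>u x\<bar> * (\<integral>\<^sup>+t. ennreal (\<bar>heat_op t \<phi> x - \<phi> x\<bar> / t powr (1 + \<sigma>)) \<partial>halfline)"
      by (rule nn_integral_cmult) measurable
    also have "\<dots> \<le> ennreal \<bar>u x\<bar> * ennreal (D * test_norm \<phi> * wt \<sigma> x)"
      by (intro mult_left_mono D(2)[OF \<phi> x]) simp
    also have "\<dots> = ennreal (\<bar>u x\<bar> * (D * test_norm \<phi> * wt \<sigma> x))" by (intro ennreal_mult'[symmetric]) simp
    finally show ?thesis by (simp only: mult_ac)
  qed
  note fF = halfline_pair.Fubini_bounded[OF mF bF integrable_mult_right[OF u_wt]]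
  define e1 where "e1 = (\<integral>t. early t \<partial>halfline)"
  define e2 where "e2 = (\<integral>t. middle t \<partial>halfline)"
  define e3 where "e3 = (\<integral>t. late t \<partial>halfline)"
  have nn: "0 \<le> early t" "0 \<le> middle t" "t > 0 \<Longrightarrow> 0 \<le> late t" for t
    using Eu_nonneg by (auto simp: early_def middle_def late_def)
  define bG where "bG x = \<bar>\<phi> x\<bar> * (Cu * (1 + x powr (- lam)) * e1 + \<bar>u x\<bar> * e2 + C * (2 + 2 * x\<^sup>2) ^ 3 * e3)" for x
  have ibG: "integrable halfline bG"
  proof -
    have "integrable halfline (\<lambda>x. (Cu * e1) * \<bar>\<phi> x * (1 + x powr (- lam))\<bar> + e2 * \<bar>\<phi> x * u x\<bar> + (C * 8 * e3) * \<bar>\<phi> x * (1 + x\<^sup>2) ^ 3\<bar>)"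
      by (intro Bochner_Integration.integrable_add integrable_mult_right integrable_abs test_mult_integrable \<phi>)
    moreover have "(Cu * e1) * \<bar>\<phi> x * (1 + x powr (- lam))\<bar> + e2 * \<bar>\<phi> x * u x\<bar> + (C * 8 * e3) * \<bar>\<phi> x * (1 + x\<^sup>2) ^ 3\<bar> = bG x" for x
    proof -
      have "(2 + 2 * x\<^sup>2) = 2 * (1 + x\<^sup>2)" by simp
      then have "(2 + 2 * x\<^sup>2) ^ 3 = 8 * (1 + x\<^sup>2) ^ 3" by (simp only: power_mult_distrib) simp
      moreover have "\<bar>\<phi> x * (1 + x\<^sup>2) ^ 3\<bar> = \<bar>\<phi> x\<bar> * (1 + x\<^sup>2) ^ 3"
        "\<bar>\<phi> x * (1 + x powr (- lam))\<bar> = \<bar>\<phi> x\<bar> * (1 + x powr (- lam))"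
        "\<bar>\<phi> x * u x\<bar> = \<bar>\<phi> x\<bar> * \<bar>u x\<bar>"
        by (simp_all add: abs_mult add_nonneg_nonneg)
      ultimately show ?thesis unfolding bG_def by (simp only: distrib_left mult_ac)
    qed
    ultimately show ?thesis by simp
  qed
  have bGb: "(\<integral>\<^sup>+t. ennreal \<bar>G x t\<bar> \<partial>halfline) \<le> ennreal (bG x)" if "x \<in> space halfline" for x
  proof -
    have x: "x > 0" using that by simp
    let ?w = "\<lambda>t. \<bar>\<phi> x\<bar> * (Cu * (1 + x powr (- lam)) * early t + \<bar>u x\<bar> * middle t + C * (2 + 2 * x\<^sup>2) ^ 3 * late t)"
    have iw: "integrable halfline ?w" by (rule integrable_mult_right[OF majorant_integrable])
    have f1: "0 \<le> Cu * (1 + x powr (- lam))" using Cu by (simp add: add_nonneg_nonneg)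
    have "0 \<le> 2 + 2 * x\<^sup>2" by (simp add: add_nonneg_nonneg)
    then have f2: "0 \<le> C * (2 + 2 * x\<^sup>2) ^ 3" using C by (intro mult_nonneg_nonneg zero_le_power) auto
    have nw: "AE t in halfline. 0 \<le> ?w t"
      using nn by (intro AE_I2 mult_nonneg_nonneg[OF abs_ge_zero] add_nonneg_nonneg mult_nonneg_nonneg[OF f1] mult_nonneg_nonneg[OF f2]) auto
    have "(\<integral>\<^sup>+t. ennreal \<bar>G x t\<bar> \<partial>halfline) \<le> (\<integral>\<^sup>+t. ennreal (?w t) \<partial>halfline)"
    proof (intro nn_integral_mono ennreal_leI)
      fix t assume "t \<in> space halfline"
      then show "\<bar>G x t\<bar> \<le> ?w t" unfolding G_def abs_mult[of "\<phi> x"] using Du_le[of t x] x by (intro mult_left_mono) auto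
    qed
    also have "\<dots> = ennreal (\<integral>t. ?w t \<partial>halfline)" by (rule nn_integral_eq_integral[OF iw nw])
    also have "(\<integral>t. ?w t \<partial>halfline) = bG x"
      using early_integrable middle_integrable late_integrable
      by (simp add: bG_def e1_def e2_def e3_def Bochner_Integration.integral_add)
    finally show ?thesis .
  qed
  note fG = halfline_pair.Fubini_bounded[OF mG bGb ibG]
  have sF: "(\<integral>t. F x t \<partial>halfline) = Gamma (- \<sigma>) * (u x * frac_bessel_test lam \<sigma> \<phi> x)" if "x \<in> space halfline" for x
  proof -
    have x: "x > 0" using that by simp
    have "Gamma (- \<sigma>) \<noteq> 0" using Gamma_uminus_neg[OF \<sigma>] by simp
    then show ?thesis
      unfolding F_def integral_mult_right_zero frac_bessel_test_eq[OF \<phi> lam1 \<sigma> x] by simp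
  qed
  have sG: "(\<integral>t. G x t \<partial>halfline) = Gamma (- \<sigma>) * (g x * \<phi> x)" for x
  proof -
    have "Gamma (- \<sigma>) \<noteq> 0" using Gamma_uminus_neg[OF \<sigma>] by simp
    then show ?thesis unfolding G_def integral_mult_right_zero g_def by simp
  qed
  have swap: "(\<integral>x. F x t \<partial>halfline) = (\<integral>x. G x t \<partial>halfline)" if "t \<in> space halfline" for t
  proof -
    have t: "t > 0" using that by simp
    note hs = heat_op_symmetric[OF \<phi> t]
    have i: "integrable halfline (\<lambda>x. u x * \<phi> x)" using test_mult_integrable(2)[OF \<phi>] by (simp add: mult.commute)
    have "(\<integral>x. F x t \<partial>halfline) = (\<integral>x. (u x * heat_op t \<phi> x - u x * \<phi> x) / t powr (1 + \<sigma>) \<partial>halfline)"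
      by (intro Bochner_Integration.integral_cong refl) (simp add: F_def right_diff_distrib)
    also have "\<dots> = ((\<integral>x. u x * heat_op t \<phi> x \<partial>halfline) - (\<integral>x. u x * \<phi> x \<partial>halfline)) / t powr (1 + \<sigma>)"
      using hs(1) i by (simp add: Bochner_Integration.integral_diff)
    also have "\<dots> = ((\<integral>x. \<phi> x * heat_op t u x \<partial>halfline) - (\<integral>x. \<phi> x * u x \<partial>halfline)) / t powr (1 + \<sigma>)"
      using hs(3) by (simp add: mult.commute)
    also have "\<dots> = (\<integral>x. (\<phi> x * heat_op t u x - \<phi> x * u x) / t powr (1 + \<sigma>) \<partial>halfline)"
      using hs(2) test_mult_integrable(2)[OF \<phi>] by (simp add: Bochner_Integration.integral_diff)
    also have "\<dots> = (\<integral>x. G x t \<partial>halfline)"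
      by (intro Bochner_Integration.integral_cong refl) (simp add: G_def Du_def right_diff_distrib)
    finally show ?thesis .
  qed
  have gam: "Gamma (- \<sigma>) \<noteq> 0" using Gamma_uminus_neg[OF \<sigma>] by simp
  have "integrable halfline (\<lambda>x. Gamma (- \<sigma>) * (u x * frac_bessel_test lam \<sigma> \<phi> x))"
  proof (rule iffD1[OF Bochner_Integration.integrable_cong[OF refl sF]])
    show "integrable halfline (\<lambda>x. \<integral>t. F x t \<partial>halfline)" by (rule fF(2))
  qed
  then show "integrable halfline (\<lambda>x. u x * frac_bessel_test lam \<sigma> \<phi> x)" using gam by simp
  have "integrable halfline (\<lambda>x. Gamma (- \<sigma>) * (g x * \<phi> x))" by (rule fG(2)[unfolded sG])
  then show "integrable halfline (\<lambda>x. g x * \<phi> x)" using gam by simp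
  have "Gamma (- \<sigma>) * (\<integral>x. u x * frac_bessel_test lam \<sigma> \<phi> x \<partial>halfline) = (\<integral>x. \<integral>t. F x t \<partial>halfline \<partial>halfline)"
    unfolding integral_mult_right_zero[symmetric] by (rule Bochner_Integration.integral_cong[OF refl sF[symmetric]])
  also have "\<dots> = (\<integral>t. \<integral>x. F x t \<partial>halfline \<partial>halfline)" by (rule fF(4))
  also have "\<dots> = (\<integral>t. \<integral>x. G x t \<partial>halfline \<partial>halfline)" by (rule Bochner_Integration.integral_cong[OF refl swap])
  also have "\<dots> = (\<integral>x. \<integral>t. G x t \<partial>halfline \<partial>halfline)" by (rule fG(4)[symmetric])
  also have "\<dots> = Gamma (- \<sigma>) * (\<integral>x. g x * \<phi> x \<partial>halfline)" unfolding sG integral_mult_right_zero ..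
  finally show "(\<integral>x. u x * frac_bessel_test lam \<sigma> \<phi> x \<partial>halfline) = (\<integral>x. g x * \<phi> x \<partial>halfline)" using gam by simp
qed

lemma frac_bessel_eq:
  assumes "\<phi> \<in> test_space lam"
  shows "frac_bessel lam \<sigma> u \<phi> = (\<integral>x. u x * frac_bessel_test lam \<sigma> \<phi> x \<partial>halfline)"
proof -
  have [measurable]: "frac_bessel_test lam \<sigma> \<phi> \<in> borel_measurable halfline"
    by (rule borel_measurable_halflineI[OF frac_bessel_test_measurable[OF assms]])
  show ?thesis unfolding frac_bessel_def by (rule set_lebesgue_integral_halfline) measurable
qed

lemma frac_bessel_in_test_dual: "frac_bessel lam \<sigma> u \<in> test_dual lam"
  unfolding test_dual_def mem_Collect_eq
proof (intro conjI ballI allI)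
  fix \<phi> \<psi> a b assume \<phi>: "\<phi> \<in> test_space lam" and \<psi>: "\<psi> \<in> test_space lam"
  let ?\<chi> = "\<lambda>x. a * \<phi> x + b * \<psi> x"
  note i = transposition(2)[OF \<phi>] transposition(2)[OF \<psi>]
  have lin: "u x * frac_bessel_test lam \<sigma> ?\<chi> x = a * (u x * frac_bessel_test lam \<sigma> \<phi> x) + b * (u x * frac_bessel_test lam \<sigma> \<psi> x)"
    if "x \<in> space halfline" for x
    using frac_bessel_test_linear[OF \<phi> \<psi> \<sigma>(1), of x a b] that by (simp add: algebra_simps)
  have m: "?\<chi> \<in> borel_measurable halfline"
  proof -
    note [measurable] = test_fun_measurable[OF \<phi>] test_fun_measurable[OF \<psi>]
    show ?thesis by measurable
  qed
  have [measurable]: "frac_bessel_test lam \<sigma> ?\<chi> \<in> borel_measurable halfline"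
  proof -
    have [measurable]: "hankel lam ?\<chi> \<in> borel_measurable halfline"
      by (intro borel_measurable_halflineI measurable_hankel m)
    show ?thesis unfolding frac_bessel_test_def by (rule borel_measurable_halflineI, rule measurable_hankel, measurable)
  qed
  have "frac_bessel lam \<sigma> u ?\<chi> = (\<integral>x. u x * frac_bessel_test lam \<sigma> ?\<chi> x \<partial>halfline)"
    unfolding frac_bessel_def by (rule set_lebesgue_integral_halfline) measurable
  also have "\<dots> = (\<integral>x. a * (u x * frac_bessel_test lam \<sigma> \<phi> x) + b * (u x * frac_bessel_test lam \<sigma> \<psi> x) \<partial>halfline)"
    by (rule Bochner_Integration.integral_cong[OF refl lin])
  also have "\<dots> = a * frac_bessel lam \<sigma> u \<phi> + b * frac_bessel lam \<sigma> u \<psi>"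
    unfolding frac_bessel_eq[OF \<phi>] frac_bessel_eq[OF \<psi>] using i by (simp add: Bochner_Integration.integral_add)
  finally show "frac_bessel lam \<sigma> u ?\<chi> = a * frac_bessel lam \<sigma> u \<phi> + b * frac_bessel lam \<sigma> u \<psi>" .
next
  obtain D where D: "D \<ge> 0"
    "\<And>\<phi> x. \<phi> \<in> test_space lam \<Longrightarrow> x > 0 \<Longrightarrow>
      (\<integral>\<^sup>+t. ennreal (\<bar>heat_op t \<phi> x - \<phi> x\<bar> / t powr (1 + \<sigma>)) \<partial>halfline) \<le> ennreal (D * test_norm \<phi> * wt \<sigma> x)"
    using test_fun_bound[OF lam1 \<sigma>] by blast
  define I where "I = (\<integral>x. \<bar>u x\<bar> * wt \<sigma> x \<partial>halfline)"
  let ?g = "- Gamma (- \<sigma>)"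
  have g: "?g > 0" by (rule Gamma_uminus_neg[OF \<sigma>])
  show "\<exists>C M. \<forall>\<phi>\<in>test_space lam. \<bar>frac_bessel lam \<sigma> u \<phi>\<bar> \<le> C * (\<Sum>m\<le>M. \<Sum>k\<le>M. test_seminorm lam m k \<phi>)"
  proof (intro exI ballI)
    fix \<phi> assume \<phi>: "\<phi> \<in> test_space lam"
    have N0: "0 \<le> test_norm \<phi>" unfolding test_norm_def by (intro sum_nonneg test_seminorm_nonneg[OF \<phi>])
    have [measurable]: "frac_bessel_test lam \<sigma> \<phi> \<in> borel_measurable halfline"
      by (rule borel_measurable_halflineI[OF frac_bessel_test_measurable[OF \<phi>]])
    have b: "\<bar>u x * frac_bessel_test lam \<sigma> \<phi> x\<bar> \<le> (D * test_norm \<phi> / ?g) * (\<bar>u x\<bar> * wt \<sigma> x)" if "x \<in> space halfline" for x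
    proof -
      have x: "x > 0" using that by simp
      note [measurable] = test_fun_measurable[OF \<phi>]
      have [measurable]: "(\<lambda>t. heat_op t \<phi> x) \<in> borel_measurable halfline" by (rule measurable_heat_op) measurable
      let ?d = "\<lambda>t. (heat_op t \<phi> x - \<phi> x) / t powr (1 + \<sigma>)"
      have nd: "norm (?d t) = \<bar>heat_op t \<phi> x - \<phi> x\<bar> / t powr (1 + \<sigma>)" for t by (simp add: abs_divide)
      have fin: "(\<integral>\<^sup>+t. ennreal (norm (?d t)) \<partial>halfline) \<le> ennreal (D * test_norm \<phi> * wt \<sigma> x)"
        unfolding nd by (rule D(2)[OF \<phi> x])
      have "integrable halfline ?d"
      proof (rule integrableI_bounded)
        show "(\<integral>\<^sup>+t. ennreal (norm (?d t)) \<partial>halfline) < \<infinity>" using fin by (simp add: order.strict_trans1)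
      qed measurable
      then have "ennreal (norm (\<integral>t. ?d t \<partial>halfline)) \<le> ennreal (D * test_norm \<phi> * wt \<sigma> x)"
        by (rule order_trans[OF integral_norm_bound_ennreal fin])
      then have "\<bar>\<integral>t. ?d t \<partial>halfline\<bar> \<le> D * test_norm \<phi> * wt \<sigma> x"
        using D(1) N0 by (subst (asm) ennreal_le_iff) auto
      then have "\<bar>\<integral>t. ?d t \<partial>halfline\<bar> / ?g \<le> D * test_norm \<phi> * wt \<sigma> x / ?g"
        using g by (intro divide_right_mono) auto
      moreover have "\<bar>frac_bessel_test lam \<sigma> \<phi> x\<bar> = \<bar>\<integral>t. ?d t \<partial>halfline\<bar> / ?g"
        unfolding frac_bessel_test_eq[OF \<phi> lam1 \<sigma> x] abs_mult using g by simp
      ultimately have "\<bar>u x\<bar> * \<bar>frac_bessel_test lam \<sigma> \<phi> x\<bar> \<le> \<bar>u x\<bar> * (D * test_norm \<phi> * wt \<sigma> x / ?g)"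
        by (intro mult_left_mono) auto
      also have "\<dots> = (D * test_norm \<phi> / ?g) * (\<bar>u x\<bar> * wt \<sigma> x)" by (simp only: divide_inverse mult_ac)
      finally show ?thesis unfolding abs_mult .
    qed
    have "\<bar>frac_bessel lam \<sigma> u \<phi>\<bar> \<le> (\<integral>x. (D * test_norm \<phi> / ?g) * (\<bar>u x\<bar> * wt \<sigma> x) \<partial>halfline)"
      unfolding frac_bessel_eq[OF \<phi>] by (rule integral_abs_le(2)[OF integrable_mult_right[OF u_wt] _ b]) measurable
    also have "\<dots> = (D / ?g * I) * test_norm \<phi>"
      unfolding integral_mult_right_zero I_def by (simp only: divide_inverse mult_ac)
    finally show "\<bar>frac_bessel lam \<sigma> u \<phi>\<bar> \<le> (D / ?g * I) * (\<Sum>m\<le>jet_order. \<Sum>k\<le>jet_order. test_seminorm lam m k \<phi>)"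
      unfolding test_norm_def .
  qed
qed

lemma frac_bessel_is_function_g: "frac_bessel_is_function lam \<sigma> u g"
  unfolding frac_bessel_is_function_def dual_is_function_def
proof (intro conjI ballI frac_bessel_in_test_dual)
  fix \<phi> assume \<phi>: "\<phi> \<in> test_space lam"
  note [measurable] = test_fun_measurable[OF \<phi>] continuous_on_imp_measurable_halfline[OF g_continuous]
  have [measurable]: "frac_bessel_test lam \<sigma> \<phi> \<in> borel_measurable halfline"
    by (rule borel_measurable_halflineI[OF frac_bessel_test_measurable[OF \<phi>]])
  show "set_integrable lebesgue {0<..} (\<lambda>x. u x * frac_bessel_test lam \<sigma> \<phi> x)"
    using transposition(2)[OF \<phi>] by (subst set_integrable_halfline) auto
  show "set_integrable lebesgue {0<..} (\<lambda>x. g x * \<phi> x)"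
    using transposition(1)[OF \<phi>] by (subst set_integrable_halfline) auto
  show "frac_bessel lam \<sigma> u \<phi> = (LINT x:{0<..}|lebesgue. g x * \<phi> x)"
    unfolding frac_bessel_eq[OF \<phi>] transposition(3)[OF \<phi>]
    by (rule set_lebesgue_integral_halfline[symmetric]) measurable
qed

end

subsection \<open>Hoelder functions\<close>

lemma holder_plusE:
  assumes "f \<in> holder_plus \<alpha>"
  obtains H where "H \<ge> 0" and "\<And>x y. x > 0 \<Longrightarrow> y > 0 \<Longrightarrow> \<bar>f y - f x\<bar> \<le> H * \<bar>x - y\<bar> powr \<alpha>"
    and "\<And>x. x > 0 \<Longrightarrow> \<bar>f x\<bar> \<le> H * x powr \<alpha>"
proof -
  obtain A where A: "\<And>x y. 0 < x \<Longrightarrow> 0 < y \<Longrightarrow> x \<noteq> y \<Longrightarrow> \<bar>f x - f y\<bar> / \<bar>x - y\<bar> powr \<alpha> \<le> A"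
  proof -
    have "bdd_above {\<bar>f x - f y\<bar> / \<bar>x - y\<bar> powr \<alpha> | x y. 0 < x \<and> 0 < y \<and> x \<noteq> y}"
      using assms by (simp add: holder_plus_def)
    then obtain A where A: "\<And>z. z \<in> {\<bar>f x - f y\<bar> / \<bar>x - y\<bar> powr \<alpha> | x y. 0 < x \<and> 0 < y \<and> x \<noteq> y} \<Longrightarrow> z \<le> A"
      unfolding bdd_above_def by auto
    show thesis by (rule that, rule A) auto
  qed
  obtain B where B: "\<And>x. 0 < x \<Longrightarrow> x powr (- \<alpha>) * \<bar>f x\<bar> \<le> B"
  proof -
    have "bdd_above {x powr (- \<alpha>) * \<bar>f x\<bar> | x. 0 < x}" using assms by (simp add: holder_plus_def)
    then obtain B where B: "\<And>z. z \<in> {x powr (- \<alpha>) * \<bar>f x\<bar> | x. 0 < x} \<Longrightarrow> z \<le> B"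
      unfolding bdd_above_def by auto
    show thesis by (rule that, rule B) auto
  qed
  show ?thesis
  proof
    show "0 \<le> max 0 (max A B)" by simp
    fix x :: real assume x: "x > 0"
    have "x powr \<alpha> * x powr (- \<alpha>) = 1" using x by (simp flip: powr_add)
    then have "\<bar>f x\<bar> = x powr \<alpha> * (x powr (- \<alpha>) * \<bar>f x\<bar>)" by (simp flip: mult.assoc)
    also have "\<dots> \<le> x powr \<alpha> * max 0 (max A B)" using B[OF x] by (intro mult_left_mono) auto
    finally show "\<bar>f x\<bar> \<le> max 0 (max A B) * x powr \<alpha>" by (simp add: mult.commute)
    fix y :: real assume y: "y > 0"
    show "\<bar>f y - f x\<bar> \<le> max 0 (max A B) * \<bar>x - y\<bar> powr \<alpha>"
    proof (cases "x = y")
      case False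
      then have "\<bar>f x - f y\<bar> \<le> A * \<bar>x - y\<bar> powr \<alpha>" using A[OF x y] by (simp add: pos_divide_le_eq)
      also have "\<dots> \<le> max 0 (max A B) * \<bar>x - y\<bar> powr \<alpha>" by (intro mult_right_mono) auto
      finally show ?thesis by (simp only: abs_minus_commute)
    qed simp
  qed
qed

lemma holder_plus_continuous: "f \<in> holder_plus \<alpha> \<Longrightarrow> continuous_on {0<..} f"
  by (simp add: holder_plus_def)

lemma powr_scaling:
  fixes t x \<beta> :: real
  assumes "t > 0" "x > 0"
  shows "(t / x\<^sup>2) powr \<beta> = t powr \<beta> * x powr (- (2 * \<beta>))"
proof -
  have e: "x\<^sup>2 = x powr 2" using powr_realpow[of x 2] assms by simp
  have "x\<^sup>2 powr \<beta> = x powr (2 * \<beta>)" unfolding e powr_powr ..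
  then show ?thesis using assms by (simp add: powr_divide powr_minus field_simps)
qed

lemma integrable_wt:
  assumes "0 < \<sigma>" "\<sigma> < 1"
  shows "integrable halfline (wt \<sigma>)"
proof (rule integral_abs_le(1))
  show "integrable halfline (\<lambda>y. if y \<le> 1 then 4 * y powr 0 else 4 * y powr (- (1 + 2 * \<sigma>)))"
    using assms by (intro integrable_halfline_two_powers) auto
  show "wt \<sigma> \<in> borel_measurable halfline" by (rule borel_measurable_halflineI) measurable
  fix y :: real assume "y \<in> space halfline"
  then have y: "y > 0" by simp
  have a: "\<bar>wt \<sigma> y\<bar> \<le> 4 * (1 + y) powr (- 1 - 2 * \<sigma>)" using wt_le_powr[OF assms y] by simp
  show "\<bar>wt \<sigma> y\<bar> \<le> (if y \<le> 1 then 4 * y powr 0 else 4 * y powr (- (1 + 2 * \<sigma>)))"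
  proof (cases "y \<le> 1")
    case True
    have "(1 + y) powr (- 1 - 2 * \<sigma>) \<le> (1 + y) powr 0" using assms y by (intro powr_mono) auto
    then show ?thesis using a True y by simp
  next
    case False
    have "(1 + y) powr (- 1 - 2 * \<sigma>) \<le> y powr (- 1 - 2 * \<sigma>)" using assms y by (intro powr_mono2') auto
    then show ?thesis using a False by simp
  qed
qed

context bessel_heat begin

lemma heat_op_integrable_of_diff:
  assumes t: "t > 0" and x: "x > 0" and i: "integrable halfline (\<lambda>y. heat_kernel lam t x y * (f y - f x))"
  shows "integrable halfline (\<lambda>y. heat_kernel lam t x y * f y)"
proof -
  have "integrable halfline (\<lambda>y. heat_kernel lam t x y * (f y - f x) + heat_kernel lam t x y * f x)"
    by (intro Bochner_Integration.integrable_add i integrable_mult_left heat_integrable t x)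
  then show ?thesis by (simp add: right_diff_distrib)
qed

lemma measurable_K_kernel [measurable (raw)]:
  assumes [measurable]: "f \<in> borel_measurable M" "h \<in> borel_measurable M"
  shows "(\<lambda>w. K_kernel lam \<sigma> (f w) (h w)) \<in> borel_measurable M"
  unfolding K_kernel_eq by measurable

text \<open>The moment of order \<alpha> bounds the part with u(y) - u(x). In the part u(x) times
  the mass defect, the growth |u(x)| <= H x^\<alpha> exactly offsets the factor x^(-\<alpha>) of
  (t/x^2)^(\<alpha>/2), so the bound is uniform in x.\<close>

lemma holder_small_time:
  assumes t: "t > 0" and x: "x > 0" and \<alpha>: "0 < \<alpha>" "\<alpha> \<le> 1" and um: "u \<in> borel_measurable halfline"
    and H: "H \<ge> 0" "\<And>x y. x > 0 \<Longrightarrow> y > 0 \<Longrightarrow> \<bar>u y - u x\<bar> \<le> H * \<bar>x - y\<bar> powr \<alpha>" "\<And>x. x > 0 \<Longrightarrow> \<bar>u x\<bar> \<le> H * x powr \<alpha>"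
  shows "(\<integral>y. \<bar>heat_kernel lam t x y * (u y - u x)\<bar> \<partial>halfline) \<le> C * H * pi * t powr (\<alpha> / 2)"
    and "\<bar>heat_op t u x - u x\<bar> \<le> H * (2 * C * pi + 1) * t powr (\<alpha> / 2)"
proof -
  note [measurable] = um
  have m: "(\<lambda>y. u y - u x) \<in> borel_measurable halfline" "(\<lambda>y. \<bar>u y - u x\<bar>) \<in> borel_measurable halfline" by measurable
  note h = heat_moment[OF t x _ _ H(1) m(1) H(2)[OF x]] and h' = heat_moment[OF t x _ _ H(1) m(2), of \<alpha>]
  have e: "(\<integral>y. \<bar>heat_kernel lam t x y * (u y - u x)\<bar> \<partial>halfline) = (\<integral>y. heat_kernel lam t x y * \<bar>u y - u x\<bar> \<partial>halfline)"
    using heat_nonneg[OF t x] by (intro Bochner_Integration.integral_cong) (auto simp: abs_mult)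
  have "\<bar>\<integral>y. heat_kernel lam t x y * \<bar>u y - u x\<bar> \<partial>halfline\<bar> \<le> C * H * t powr (\<alpha> / 2) * pi"
    using \<alpha> H(2)[OF x] by (intro h'(2)) auto
  then show "(\<integral>y. \<bar>heat_kernel lam t x y * (u y - u x)\<bar> \<partial>halfline) \<le> C * H * pi * t powr (\<alpha> / 2)"
    unfolding e by (simp add: mult_ac)
  have i: "integrable halfline (\<lambda>y. heat_kernel lam t x y * (u y - u x))" using \<alpha> by (intro h(1)) auto
  have a: "\<bar>\<integral>y. heat_kernel lam t x y * (u y - u x) \<partial>halfline\<bar> \<le> C * H * t powr (\<alpha> / 2) * pi"
    using \<alpha> by (intro h(2)) auto
  have "\<bar>u x\<bar> * \<bar>heat_one lam t x - 1\<bar> \<le> (H * x powr \<alpha>) * ((C * pi + 1) * (t / x\<^sup>2) powr (\<alpha> / 2))"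
    using H(1,3) x \<alpha> heat_one_bound[OF t x, of "\<alpha> / 2"] by (intro mult_mono) auto
  also have "\<dots> = H * (C * pi + 1) * t powr (\<alpha> / 2) * (x powr \<alpha> * x powr (- \<alpha>))"
    unfolding powr_scaling[OF t x] by simp
  also have "x powr \<alpha> * x powr (- \<alpha>) = 1" using x by (simp flip: powr_add)
  finally have b: "\<bar>u x * (heat_one lam t x - 1)\<bar> \<le> H * (C * pi + 1) * t powr (\<alpha> / 2)" by (simp add: abs_mult)
  have "\<bar>heat_op t u x - u x\<bar> \<le> C * H * t powr (\<alpha> / 2) * pi + H * (C * pi + 1) * t powr (\<alpha> / 2)"
    unfolding heat_op_diff(2)[OF t x heat_op_integrable_of_diff[OF t x i]] using a b by linarith
  then show "\<bar>heat_op t u x - u x\<bar> \<le> H * (2 * C * pi + 1) * t powr (\<alpha> / 2)" by (simp add: algebra_simps)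
qed

end

section \<open>Pointwise formulas: absolute convergence and principal value\<close>

context bessel_transposition begin

lemma diff_integrable:
  assumes "t > 0" "x > 0"
  shows "integrable halfline (\<lambda>y. heat_kernel lam t x y * (u y - u x))"
  by (rule heat_op_diff(1)[OF assms heat_u_integrable[OF assms]])

lemma large_time_diff:
  assumes t: "t > 1" and x: "x > 0"
  shows "(\<integral>y. \<bar>heat_kernel lam t x y * (u y - u x)\<bar> \<partial>halfline) \<le> C * pi * \<bar>u x\<bar> + C * (2 + 2 * x\<^sup>2) ^ 3 * Eu t"
proof -
  have t0: "t > 0" using t by simp
  have i1: "integrable halfline (\<lambda>y. \<bar>heat_kernel lam t x y * u y\<bar>)" by (rule integrable_abs[OF heat_u_integrable[OF t0 x]])
  have i2: "integrable halfline (\<lambda>y. heat_kernel lam t x y * \<bar>u x\<bar>)" by (rule integrable_mult_left[OF heat_integrable[OF t0 x]])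
  have "(\<integral>y. \<bar>heat_kernel lam t x y * (u y - u x)\<bar> \<partial>halfline) \<le> (\<integral>y. \<bar>heat_kernel lam t x y * u y\<bar> + heat_kernel lam t x y * \<bar>u x\<bar> \<partial>halfline)"
  proof (rule integral_mono)
    show "integrable halfline (\<lambda>y. \<bar>heat_kernel lam t x y * (u y - u x)\<bar>)" by (rule integrable_abs[OF diff_integrable[OF t0 x]])
    show "integrable halfline (\<lambda>y. \<bar>heat_kernel lam t x y * u y\<bar> + heat_kernel lam t x y * \<bar>u x\<bar>)"
      by (rule Bochner_Integration.integrable_add[OF i1 i2])
    fix y assume "y \<in> space halfline"
    then have h: "0 \<le> heat_kernel lam t x y" using heat_nonneg[OF t0 x] by simp
    have "heat_kernel lam t x y * \<bar>u y - u x\<bar> \<le> heat_kernel lam t x y * (\<bar>u y\<bar> + \<bar>u x\<bar>)" using h by (intro mult_left_mono) auto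
    then show "\<bar>heat_kernel lam t x y * (u y - u x)\<bar> \<le> \<bar>heat_kernel lam t x y * u y\<bar> + heat_kernel lam t x y * \<bar>u x\<bar>"
      using h by (simp add: abs_mult distrib_left)
  qed
  also have "\<dots> = (\<integral>y. \<bar>heat_kernel lam t x y * u y\<bar> \<partial>halfline) + (\<integral>y. heat_kernel lam t x y \<partial>halfline) * \<bar>u x\<bar>"
    using Bochner_Integration.integral_add[OF i1 i2] by simp
  also have "\<dots> \<le> C * (2 + 2 * x\<^sup>2) ^ 3 * Eu t + (C * pi) * \<bar>u x\<bar>"
  proof (intro add_mono mult_right_mono large_time(2)[OF t x])
    show "(\<integral>y. heat_kernel lam t x y \<partial>halfline) \<le> C * pi"
      using heat_integrable_bounded(2)[OF t0 x, of 1 "\<lambda>_. 1"] by simp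
  qed simp
  finally show ?thesis by simp
qed

lemma Du_eq:
  assumes t: "t > 0" and x: "x > 0"
  shows "Du t x = (\<integral>y. K_integrand lam \<sigma> x y t * (u y - u x) \<partial>halfline) + u x * B_integrand lam \<sigma> x t"
proof -
  have "Du t x = (\<integral>y. heat_kernel lam t x y * (u y - u x) \<partial>halfline) / t powr (1 + \<sigma>) + u x * B_integrand lam \<sigma> x t"
    unfolding Du_def heat_op_diff(2)[OF t x heat_u_integrable[OF t x]] by (simp add: B_integrand_def add_divide_distrib)
  also have "(\<integral>y. heat_kernel lam t x y * (u y - u x) \<partial>halfline) / t powr (1 + \<sigma>)
    = (\<integral>y. heat_kernel lam t x y * (u y - u x) / t powr (1 + \<sigma>) \<partial>halfline)" by simp
  also have "\<dots> = (\<integral>y. K_integrand lam \<sigma> x y t * (u y - u x) \<partial>halfline)"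
    by (intro Bochner_Integration.integral_cong refl) (simp add: K_integrand_def)
  finally show ?thesis .
qed

text \<open>The y-integral stays inside the t-integral: for \<sigma> >= 1/2 the cancellation in y
  may be essential, so the exchange is left to the two formulas below.\<close>

lemma g_eq:
  assumes x: "x > 0"
  shows "integrable halfline (\<lambda>t. \<integral>y. K_integrand lam \<sigma> x y t * (u y - u x) \<partial>halfline)"
    and "g x = 1 / Gamma (- \<sigma>) * (\<integral>t. (\<integral>y. K_integrand lam \<sigma> x y t * (u y - u x) \<partial>halfline) \<partial>halfline) + u x * B_fun lam \<sigma> x"
proof -
  have iB: "integrable halfline (\<lambda>t. u x * B_integrand lam \<sigma> x t)"
    by (rule integrable_mult_right[OF B_integral(1)[OF x \<sigma>]])
  have i: "integrable halfline (\<lambda>t. Du t x - u x * B_integrand lam \<sigma> x t)"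
    by (rule Bochner_Integration.integrable_diff[OF Du_integrable[OF x] iB])
  have e: "Du t x - u x * B_integrand lam \<sigma> x t = (\<integral>y. K_integrand lam \<sigma> x y t * (u y - u x) \<partial>halfline)"
    if "t \<in> space halfline" for t using Du_eq[OF _ x, of t] that by simp
  show i': "integrable halfline (\<lambda>t. \<integral>y. K_integrand lam \<sigma> x y t * (u y - u x) \<partial>halfline)"
    by (rule iffD1[OF Bochner_Integration.integrable_cong[OF refl e] i])
  have "(\<integral>t. Du t x \<partial>halfline) = (\<integral>t. (\<integral>y. K_integrand lam \<sigma> x y t * (u y - u x) \<partial>halfline) + u x * B_integrand lam \<sigma> x t \<partial>halfline)"
    by (rule Bochner_Integration.integral_cong[OF refl]) (use Du_eq[OF _ x] in simp)
  also have "\<dots> = (\<integral>t. (\<integral>y. K_integrand lam \<sigma> x y t * (u y - u x) \<partial>halfline) \<partial>halfline) + (\<integral>t. u x * B_integrand lam \<sigma> x t \<partial>halfline)"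
    by (rule Bochner_Integration.integral_add[OF i' iB])
  finally show "g x = 1 / Gamma (- \<sigma>) * (\<integral>t. (\<integral>y. K_integrand lam \<sigma> x y t * (u y - u x) \<partial>halfline) \<partial>halfline) + u x * B_fun lam \<sigma> x"
    unfolding g_def B_fun_eq integral_mult_right_zero by (simp add: distrib_left)
qed

text \<open>Valid on the diagonal too, where the t-integral of the kernel diverges: both sides are
  then the default value zero.\<close>

lemma K_integral_eq: "(\<integral>t. K_integrand lam \<sigma> x y t * c \<partial>halfline) = - Gamma (- \<sigma>) * ((c * K_kernel lam \<sigma> x y))"
proof -
  have "Gamma (- \<sigma>) \<noteq> 0" using Gamma_uminus_neg[OF \<sigma>] by simp
  then show ?thesis unfolding integral_mult_left_zero K_kernel_eq by simp
qed

lemma nn_diff_eq: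
  assumes "t > 0" "x > 0"
  shows "(\<integral>\<^sup>+y. ennreal \<bar>K_integrand lam \<sigma> x y t * (u y - u x)\<bar> \<partial>halfline)
    = ennreal ((\<integral>y. \<bar>heat_kernel lam t x y * (u y - u x)\<bar> \<partial>halfline) / t powr (1 + \<sigma>))"
proof -
  have e: "\<bar>K_integrand lam \<sigma> x y t * (u y - u x)\<bar> = \<bar>heat_kernel lam t x y * (u y - u x)\<bar> / t powr (1 + \<sigma>)" for y
    by (simp add: K_integrand_def abs_mult)
  have i: "integrable halfline (\<lambda>y. \<bar>heat_kernel lam t x y * (u y - u x)\<bar> / t powr (1 + \<sigma>))"
    by (intro integrable_divide integrable_abs diff_integrable assms)
  show ?thesis unfolding e using nn_integral_eq_integral[OF i] by simp
qed

text \<open>The hypothesis controls the y-integral of the modulus, so with \<sigma> < \<beta> the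
  whole double integral converges absolutely and the order may be exchanged without
  truncation.\<close>

lemma g_formula_holder:
  assumes x: "x > 0" and M: "\<And>t. 0 < t \<Longrightarrow> t \<le> 1 \<Longrightarrow> (\<integral>y. \<bar>heat_kernel lam t x y * (u y - u x)\<bar> \<partial>halfline) \<le> M * t powr \<beta>"
  shows "integrable halfline (\<lambda>y. (u x - u y) * K_kernel lam \<sigma> x y)"
    and "g x = (\<integral>y. (u x - u y) * K_kernel lam \<sigma> x y \<partial>halfline) + u x * B_fun lam \<sigma> x"
proof -
  define F where "F t y = K_integrand lam \<sigma> x y t * (u y - u x)" for t y
  have mF: "case_prod F \<in> borel_measurable (halfline \<Otimes>\<^sub>M halfline)" unfolding F_def by measurable
  have bF: "(\<integral>\<^sup>+y. ennreal \<bar>F t y\<bar> \<partial>halfline) \<le> ennreal (M * early t + (C * pi * \<bar>u x\<bar>) * middle t + (C * (2 + 2 * x\<^sup>2) ^ 3) * late t)"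
    if "t \<in> space halfline" for t
  proof -
    have t: "t > 0" using that by simp
    have "(\<integral>y. \<bar>heat_kernel lam t x y * (u y - u x)\<bar> \<partial>halfline) / t powr (1 + \<sigma>)
      \<le> M * early t + (C * pi * \<bar>u x\<bar>) * middle t + (C * (2 + 2 * x\<^sup>2) ^ 3) * late t"
    proof (cases "t \<le> 1")
      case True
      have "(\<integral>y. \<bar>heat_kernel lam t x y * (u y - u x)\<bar> \<partial>halfline) / t powr (1 + \<sigma>) \<le> M * t powr \<beta> / t powr (1 + \<sigma>)"
        using M[OF t True] by (intro divide_right_mono) auto
      also have "\<dots> = M * (t powr \<beta> / t powr (1 + \<sigma>))" by simp
      also have "t powr \<beta> / t powr (1 + \<sigma>) = early t"
        unfolding powr_diff[symmetric] using True by (simp add: early_def algebra_simps)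
      finally show ?thesis using True by (simp add: middle_def late_def)
    next
      case False
      have "(\<integral>y. \<bar>heat_kernel lam t x y * (u y - u x)\<bar> \<partial>halfline) / t powr (1 + \<sigma>)
        \<le> (C * pi * \<bar>u x\<bar> + C * (2 + 2 * x\<^sup>2) ^ 3 * Eu t) / t powr (1 + \<sigma>)"
        using large_time_diff[of t x] False x by (intro divide_right_mono) auto
      also have "\<dots> = (C * pi * \<bar>u x\<bar>) * (1 / t powr (1 + \<sigma>)) + C * (2 + 2 * x\<^sup>2) ^ 3 * (Eu t / t powr (1 + \<sigma>))"
        by (simp add: add_divide_distrib)
      also have "1 / t powr (1 + \<sigma>) = t powr (- (1 + \<sigma>))" by (simp only: powr_minus divide_inverse mult_1_left)
      finally show ?thesis using False by (simp add: early_def middle_def late_def)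
    qed
    then show ?thesis unfolding F_def nn_diff_eq[OF t x] by (rule ennreal_leI)
  qed
  note fub = halfline_pair.Fubini_bounded[OF mF bF majorant_integrable]
  have gam: "Gamma (- \<sigma>) \<noteq> 0" using Gamma_uminus_neg[OF \<sigma>] by simp
  \<comment> \<open>The prefactors in g and in K have opposite signs, which turns u(y) - u(x) into
    u(x) - u(y).\<close>
  have s: "(\<integral>t. F t y \<partial>halfline) = Gamma (- \<sigma>) * ((u x - u y) * K_kernel lam \<sigma> x y)" for y
    unfolding F_def K_integral_eq by (simp add: algebra_simps)
  have "integrable halfline (\<lambda>y. Gamma (- \<sigma>) * ((u x - u y) * K_kernel lam \<sigma> x y))" by (rule fub(3)[unfolded s])
  then show "integrable halfline (\<lambda>y. (u x - u y) * K_kernel lam \<sigma> x y)" using gam by simp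
  have "(\<integral>t. (\<integral>y. K_integrand lam \<sigma> x y t * (u y - u x) \<partial>halfline) \<partial>halfline) = (\<integral>t. \<integral>y. F t y \<partial>halfline \<partial>halfline)"
    unfolding F_def ..
  also have "\<dots> = (\<integral>y. \<integral>t. F t y \<partial>halfline \<partial>halfline)" by (rule fub(4))
  also have "\<dots> = Gamma (- \<sigma>) * (\<integral>y. (u x - u y) * K_kernel lam \<sigma> x y \<partial>halfline)" unfolding s integral_mult_right_zero ..
  finally show "g x = (\<integral>y. (u x - u y) * K_kernel lam \<sigma> x y \<partial>halfline) + u x * B_fun lam \<sigma> x"
    unfolding g_eq(2)[OF x] using gam by simp
qed

text \<open>Off the diagonal the t-integral is at most \<open>Ksig \<sigma>\<close> times
  |x-y|^(-1-2\<sigma>). For |x-y| > \<epsilon>, the inequality 1 + h^2 <= (1 + 1/\<epsilon>^2) h^2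
  and a translation of the weight turn this into \<open>c * wt \<sigma> y\<close>, against which
  both u and constants are integrable.\<close>

lemma truncated_Fubini:
  assumes x: "x > 0" and \<epsilon>: "\<epsilon> > 0"
  shows "integrable halfline (\<lambda>y. if \<epsilon> < \<bar>x - y\<bar> then (u x - u y) * K_kernel lam \<sigma> x y else 0)"
    and "Gamma (- \<sigma>) * (\<integral>y. (if \<epsilon> < \<bar>x - y\<bar> then (u x - u y) * K_kernel lam \<sigma> x y else 0) \<partial>halfline)
      = (\<integral>t. (\<integral>y. (if \<epsilon> < \<bar>x - y\<bar> then K_integrand lam \<sigma> x y t * (u y - u x) else 0) \<partial>halfline) \<partial>halfline)"
proof -
  define F where "F y t = (if \<epsilon> < \<bar>x - y\<bar> then K_integrand lam \<sigma> x y t * (u y - u x) else 0)" for y t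
  define c where "c = Ksig \<sigma> * ((1 + 1 / \<epsilon>\<^sup>2) powr (1/2 + \<sigma>) * (4 * (1 + x\<^sup>2)\<^sup>2))"
  have mF: "case_prod F \<in> borel_measurable (halfline \<Otimes>\<^sub>M halfline)" unfolding F_def by measurable
  have Kp: "Ksig \<sigma> > 0" by (rule Ksig_pos[OF \<sigma>])
  have c0: "c \<ge> 0" unfolding c_def using Kp by (intro mult_nonneg_nonneg) auto
  have far: "Ksig \<sigma> / \<bar>x - y\<bar> powr (1 + 2 * \<sigma>) \<le> c * wt \<sigma> y" if y: "\<epsilon> < \<bar>x - y\<bar>" for y
  proof -
    let ?h = "\<bar>x - y\<bar>" and ?q = "1/2 + \<sigma>"
    have h: "?h > 0" using \<epsilon> y by linarith
    have "1 + ?h\<^sup>2 \<le> (1 + 1 / \<epsilon>\<^sup>2) * ?h\<^sup>2"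
    proof -
      have "\<epsilon>\<^sup>2 \<le> ?h\<^sup>2" using \<epsilon> y by (intro power_mono) auto
      then have "1 \<le> ?h\<^sup>2 / \<epsilon>\<^sup>2" using \<epsilon> by simp
      then show ?thesis by (simp add: distrib_right)
    qed
    then have "(1 + ?h\<^sup>2) powr ?q \<le> ((1 + 1 / \<epsilon>\<^sup>2) * ?h\<^sup>2) powr ?q"
      using \<sigma> by (intro powr_mono2) (auto simp: add_nonneg_nonneg)
    also have "\<dots> = (1 + 1 / \<epsilon>\<^sup>2) powr ?q * (?h\<^sup>2) powr ?q"
      using \<epsilon> by (intro powr_mult)
    also have "(?h\<^sup>2) powr ?q = ?h powr (1 + 2 * \<sigma>)"
    proof -
      have e: "?h\<^sup>2 = ?h powr 2" using h powr_realpow[of ?h 2] by simp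
      show ?thesis unfolding e powr_powr by (simp add: algebra_simps)
    qed
    finally have a: "(1 + ?h\<^sup>2) powr ?q \<le> (1 + 1 / \<epsilon>\<^sup>2) powr ?q * ?h powr (1 + 2 * \<sigma>)" .
    have p: "(1 + ?h\<^sup>2) powr ?q > 0" "?h powr (1 + 2 * \<sigma>) > 0"
    proof -
      have "0 < 1 + ?h\<^sup>2" by (simp add: add_pos_nonneg)
      then show "(1 + ?h\<^sup>2) powr ?q > 0" unfolding powr_gt_zero by linarith
      show "?h powr (1 + 2 * \<sigma>) > 0" using h by simp
    qed
    have w: "wt \<sigma> (y - x) = 1 / (1 + ?h\<^sup>2) powr ?q"
    proof -
      have "- 1/2 - \<sigma> = - ?q" "(y - x)\<^sup>2 = ?h\<^sup>2" by (auto simp: power2_commute)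
      then show ?thesis unfolding wt_def by (simp only: powr_minus divide_inverse mult_1_left)
    qed
    have "1 / ?h powr (1 + 2 * \<sigma>) \<le> (1 + 1 / \<epsilon>\<^sup>2) powr ?q * wt \<sigma> (y - x)"
      unfolding w using a p by (simp add: pos_divide_le_eq pos_le_divide_eq mult.commute)
    also have "\<dots> \<le> (1 + 1 / \<epsilon>\<^sup>2) powr ?q * (4 * (1 + x\<^sup>2)\<^sup>2 * wt \<sigma> y)"
      by (intro mult_left_mono wt_shift_le \<sigma>) auto
    finally have "Ksig \<sigma> * (1 / ?h powr (1 + 2 * \<sigma>)) \<le> Ksig \<sigma> * ((1 + 1 / \<epsilon>\<^sup>2) powr ?q * (4 * (1 + x\<^sup>2)\<^sup>2 * wt \<sigma> y))"
      using Kp by (intro mult_left_mono) auto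
    then show ?thesis unfolding c_def by (simp add: mult.assoc)
  qed
  define b where "b y = c * (\<bar>u y\<bar> * wt \<sigma> y) + c * (\<bar>u x\<bar> * wt \<sigma> y)" for y
  have ib: "integrable halfline b"
    unfolding b_def by (intro Bochner_Integration.integrable_add integrable_mult_right u_wt integrable_wt \<sigma>)
  have bF: "(\<integral>\<^sup>+t. ennreal \<bar>F y t\<bar> \<partial>halfline) \<le> ennreal (b y)" if "y \<in> space halfline" for y
  proof (cases "\<epsilon> < \<bar>x - y\<bar>")
    case True
    have y: "y > 0" using that by simp
    have ne: "x \<noteq> y" using True \<epsilon> by auto
    have "(\<integral>\<^sup>+t. ennreal \<bar>F y t\<bar> \<partial>halfline) = (\<integral>\<^sup>+t. ennreal \<bar>u y - u x\<bar> * ennreal (K_integrand lam \<sigma> x y t) \<partial>halfline)"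
    proof (intro nn_integral_cong)
      fix t assume "t \<in> space halfline"
      then have "0 \<le> K_integrand lam \<sigma> x y t" using K_integrand_nonneg[OF x y] by simp
      then have "\<bar>F y t\<bar> = \<bar>u y - u x\<bar> * K_integrand lam \<sigma> x y t" using True by (simp add: F_def abs_mult)
      then show "ennreal \<bar>F y t\<bar> = ennreal \<bar>u y - u x\<bar> * ennreal (K_integrand lam \<sigma> x y t)"
        by (simp only: ennreal_mult'[OF abs_ge_zero])
    qed
    also have "\<dots> = ennreal \<bar>u y - u x\<bar> * (\<integral>\<^sup>+t. ennreal (K_integrand lam \<sigma> x y t) \<partial>halfline)"
      by (rule nn_integral_cmult) measurable
    also have "\<dots> \<le> ennreal \<bar>u y - u x\<bar> * ennreal (Ksig \<sigma> / \<bar>x - y\<bar> powr (1 + 2 * \<sigma>))"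
      by (intro mult_left_mono nn_integral_heat_le x y ne \<sigma>) simp
    also have "\<dots> = ennreal (\<bar>u y - u x\<bar> * (Ksig \<sigma> / \<bar>x - y\<bar> powr (1 + 2 * \<sigma>)))" by (intro ennreal_mult'[symmetric]) simp
    also have "\<dots> \<le> ennreal (b y)"
    proof (rule ennreal_leI)
      have "\<bar>u y - u x\<bar> * (Ksig \<sigma> / \<bar>x - y\<bar> powr (1 + 2 * \<sigma>)) \<le> (\<bar>u y\<bar> + \<bar>u x\<bar>) * (c * wt \<sigma> y)"
        using far[OF True] Kp by (intro mult_mono) auto
      then show "\<bar>u y - u x\<bar> * (Ksig \<sigma> / \<bar>x - y\<bar> powr (1 + 2 * \<sigma>)) \<le> b y"
        unfolding b_def by (simp add: algebra_simps)
    qed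
    finally show ?thesis .
  next
    case False
    then show ?thesis by (simp add: F_def)
  qed
  note fub = halfline_pair.Fubini_bounded[OF mF bF ib]
  have gam: "Gamma (- \<sigma>) \<noteq> 0" using Gamma_uminus_neg[OF \<sigma>] by simp
  have s: "(\<integral>t. F y t \<partial>halfline) = Gamma (- \<sigma>) * (if \<epsilon> < \<bar>x - y\<bar> then (u x - u y) * K_kernel lam \<sigma> x y else 0)" for y
    unfolding F_def using K_integral_eq[of x y "u y - u x"] by (simp add: algebra_simps)
  have "integrable halfline (\<lambda>y. Gamma (- \<sigma>) * (if \<epsilon> < \<bar>x - y\<bar> then (u x - u y) * K_kernel lam \<sigma> x y else 0))"
    by (rule fub(2)[unfolded s])
  then show "integrable halfline (\<lambda>y. if \<epsilon> < \<bar>x - y\<bar> then (u x - u y) * K_kernel lam \<sigma> x y else 0)" using gam by simp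
  show "Gamma (- \<sigma>) * (\<integral>y. (if \<epsilon> < \<bar>x - y\<bar> then (u x - u y) * K_kernel lam \<sigma> x y else 0) \<partial>halfline)
      = (\<integral>t. (\<integral>y. (if \<epsilon> < \<bar>x - y\<bar> then K_integrand lam \<sigma> x y t * (u y - u x) else 0) \<partial>halfline) \<partial>halfline)"
  proof -
    have "(\<integral>y. \<integral>t. F y t \<partial>halfline \<partial>halfline) = (\<integral>t. \<integral>y. F y t \<partial>halfline \<partial>halfline)" by (rule fub(4))
    then show ?thesis unfolding s integral_mult_right_zero unfolding F_def .
  qed
qed

text \<open>For each \<epsilon> the order is exchanged by \<open>truncated_Fubini\<close>; then
  \<epsilon> -> 0 is taken under the t-integral. The bound on the signed y-integral does not depend
  on \<epsilon>, so one majorant in t serves all truncations, while at fixed t the y-integral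
  converges absolutely and its limit is the untruncated one.\<close>

lemma g_formula_pv:
  assumes x: "x > 0" and M: "\<And>t \<epsilon>. 0 < t \<Longrightarrow> t \<le> 1 \<Longrightarrow>
      \<bar>\<integral>y. (if \<epsilon> < \<bar>x - y\<bar> then heat_kernel lam t x y * (u y - u x) else 0) \<partial>halfline\<bar> \<le> M * t powr \<beta>"
  shows "((\<lambda>\<epsilon>. \<integral>y. (if \<epsilon> < \<bar>x - y\<bar> then (u x - u y) * K_kernel lam \<sigma> x y else 0) \<partial>halfline)
      \<longlongrightarrow> g x - u x * B_fun lam \<sigma> x) (at_right 0)"
proof -
  have gam: "Gamma (- \<sigma>) \<noteq> 0" using Gamma_uminus_neg[OF \<sigma>] by simp
  define I where "I \<epsilon> t = (\<integral>y. (if \<epsilon> < \<bar>x - y\<bar> then K_integrand lam \<sigma> x y t * (u y - u x) else 0) \<partial>halfline)" for \<epsilon> t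
  have I_heat: "I \<epsilon> t = (\<integral>y. (if \<epsilon> < \<bar>x - y\<bar> then heat_kernel lam t x y * (u y - u x) else 0) \<partial>halfline) / t powr (1 + \<sigma>)" for \<epsilon> t
  proof -
    have "I \<epsilon> t = (\<integral>y. (if \<epsilon> < \<bar>x - y\<bar> then heat_kernel lam t x y * (u y - u x) else 0) / t powr (1 + \<sigma>) \<partial>halfline)"
      unfolding I_def by (intro Bochner_Integration.integral_cong) (auto simp: K_integrand_def)
    then show ?thesis by simp
  qed
  have Ib: "\<bar>I \<epsilon> t\<bar> \<le> M * early t + (C * pi * \<bar>u x\<bar>) * middle t + (C * (2 + 2 * x\<^sup>2) ^ 3) * late t" if t: "t > 0" for \<epsilon> t
  proof (cases "t \<le> 1")
    case True
    have "\<bar>I \<epsilon> t\<bar> \<le> M * t powr \<beta> / t powr (1 + \<sigma>)"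
      unfolding I_heat abs_divide using M[OF t True] by (simp add: divide_right_mono)
    also have "\<dots> = M * (t powr \<beta> / t powr (1 + \<sigma>))" by simp
    also have "t powr \<beta> / t powr (1 + \<sigma>) = early t"
      unfolding powr_diff[symmetric] using True by (simp add: early_def algebra_simps)
    finally show ?thesis using True by (simp add: middle_def late_def)
  next
    case False
    have "\<bar>\<integral>y. (if \<epsilon> < \<bar>x - y\<bar> then heat_kernel lam t x y * (u y - u x) else 0) \<partial>halfline\<bar>
      \<le> (\<integral>y. \<bar>heat_kernel lam t x y * (u y - u x)\<bar> \<partial>halfline)"
      by (rule integral_abs_le(2)[OF integrable_abs[OF diff_integrable[OF t x]]]) auto
    also have "\<dots> \<le> C * pi * \<bar>u x\<bar> + C * (2 + 2 * x\<^sup>2) ^ 3 * Eu t" using False x by (intro large_time_diff) auto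
    finally have "\<bar>I \<epsilon> t\<bar> \<le> (C * pi * \<bar>u x\<bar> + C * (2 + 2 * x\<^sup>2) ^ 3 * Eu t) / t powr (1 + \<sigma>)"
      unfolding I_heat abs_divide by (simp add: divide_right_mono)
    also have "\<dots> = (C * pi * \<bar>u x\<bar>) * (1 / t powr (1 + \<sigma>)) + C * (2 + 2 * x\<^sup>2) ^ 3 * (Eu t / t powr (1 + \<sigma>))"
      by (simp add: add_divide_distrib)
    also have "1 / t powr (1 + \<sigma>) = t powr (- (1 + \<sigma>))" by (simp only: powr_minus divide_inverse mult_1_left)
    finally show ?thesis using False by (simp add: early_def middle_def late_def)
  qed
  have mI: "(\<lambda>t. I \<epsilon> t) \<in> borel_measurable halfline" for \<epsilon> unfolding I_def by measurable
  show ?thesis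
  proof (rule tendsto_at_right_sequentially[of 0 1])
    fix S :: "nat \<Rightarrow> real" assume S: "\<And>n. 0 < S n" "S \<longlonglongrightarrow> 0"
    have inner: "(\<lambda>n. I (S n) t) \<longlonglongrightarrow> (\<integral>y. K_integrand lam \<sigma> x y t * (u y - u x) \<partial>halfline)" if t: "t > 0" for t
      unfolding I_def
    proof (rule integral_dominated_convergence[where w = "\<lambda>y. \<bar>heat_kernel lam t x y * (u y - u x)\<bar> / t powr (1 + \<sigma>)"])
      show "integrable halfline (\<lambda>y. \<bar>heat_kernel lam t x y * (u y - u x)\<bar> / t powr (1 + \<sigma>))"
        by (intro integrable_divide integrable_abs diff_integrable t x)
      show "AE y in halfline. (\<lambda>n. if S n < \<bar>x - y\<bar> then K_integrand lam \<sigma> x y t * (u y - u x) else 0)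
        \<longlonglongrightarrow> K_integrand lam \<sigma> x y t * (u y - u x)"
      proof (rule AE_I2)
        fix y
        show "(\<lambda>n. if S n < \<bar>x - y\<bar> then K_integrand lam \<sigma> x y t * (u y - u x) else 0) \<longlonglongrightarrow> K_integrand lam \<sigma> x y t * (u y - u x)"
        proof (cases "x = y")
          case False
          then have "\<forall>\<^sub>F n in sequentially. S n < \<bar>x - y\<bar>" using S(2) by (intro order_tendstoD(2)) auto
          then have "\<forall>\<^sub>F n in sequentially. (if S n < \<bar>x - y\<bar> then K_integrand lam \<sigma> x y t * (u y - u x) else 0) = K_integrand lam \<sigma> x y t * (u y - u x)"
            by eventually_elim simp
          then show ?thesis by (rule tendsto_eventually)
        next
          \<comment> \<open>At y = x the truncated integrand is zero because S n is positive, and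
            the limit is zero because u(y) - u(x) is.\<close>
          case True
          have "\<not> S n < 0" for n using S(1)[of n] by simp
          then show ?thesis using True by simp
        qed
      qed
      show "AE y in halfline. norm (if S n < \<bar>x - y\<bar> then K_integrand lam \<sigma> x y t * (u y - u x) else 0)
        \<le> \<bar>heat_kernel lam t x y * (u y - u x)\<bar> / t powr (1 + \<sigma>)" for n
        by (intro AE_I2) (auto simp: K_integrand_def abs_mult)
    qed measurable
    have "(\<lambda>n. \<integral>t. I (S n) t \<partial>halfline) \<longlonglongrightarrow> (\<integral>t. (\<integral>y. K_integrand lam \<sigma> x y t * (u y - u x) \<partial>halfline) \<partial>halfline)"
    proof (rule integral_dominated_convergence[where w = "\<lambda>t. M * early t + (C * pi * \<bar>u x\<bar>) * middle t + (C * (2 + 2 * x\<^sup>2) ^ 3) * late t"])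
      show "AE t in halfline. (\<lambda>n. I (S n) t) \<longlonglongrightarrow> (\<integral>y. K_integrand lam \<sigma> x y t * (u y - u x) \<partial>halfline)"
        using inner by (intro AE_I2) simp
      show "AE t in halfline. norm (I (S n) t) \<le> M * early t + (C * pi * \<bar>u x\<bar>) * middle t + (C * (2 + 2 * x\<^sup>2) ^ 3) * late t" for n
        using Ib by (intro AE_I2) simp
      show "(\<lambda>t. \<integral>y. K_integrand lam \<sigma> x y t * (u y - u x) \<partial>halfline) \<in> borel_measurable halfline" by measurable
    qed (rule mI majorant_integrable)+
    then have "(\<lambda>n. 1 / Gamma (- \<sigma>) * (\<integral>t. I (S n) t \<partial>halfline)) \<longlonglongrightarrow> g x - u x * B_fun lam \<sigma> x"
      unfolding g_eq(2)[OF x] add_diff_cancel_right' by (rule tendsto_mult_left)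
    moreover have "1 / Gamma (- \<sigma>) * (\<integral>t. I (S n) t \<partial>halfline) = (\<integral>y. (if S n < \<bar>x - y\<bar> then (u x - u y) * K_kernel lam \<sigma> x y else 0) \<partial>halfline)" for n
      unfolding I_def truncated_Fubini(2)[OF x S(1), symmetric] using gam by simp
    ultimately show "(\<lambda>n. \<integral>y. (if S n < \<bar>x - y\<bar> then (u x - u y) * K_kernel lam \<sigma> x y else 0) \<partial>halfline)
      \<longlonglongrightarrow> g x - u x * B_fun lam \<sigma> x" by simp
  qed simp
qed

end

text \<open>The mean value theorem, used between x and y for the Taylor remainder and on [0,x] for
  the growth. The second use is where continuity of u at the origin enters.\<close>

lemma C1_holder_bounds:
  fixes u u' :: "real \<Rightarrow> real"
  assumes \<alpha>: "0 < \<alpha>" and cont: "continuous_on {0..} u"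
    and d: "\<And>x. x > 0 \<Longrightarrow> (u has_real_derivative u' x) (at x)"
    and H: "H \<ge> 0" "\<And>x y. x > 0 \<Longrightarrow> y > 0 \<Longrightarrow> \<bar>u' y - u' x\<bar> \<le> H * \<bar>x - y\<bar> powr \<alpha>"
      "\<And>x. x > 0 \<Longrightarrow> \<bar>u' x\<bar> \<le> H * x powr \<alpha>"
    and x: "x > 0"
  shows "y > 0 \<Longrightarrow> \<bar>u y - u x - u' x * (y - x)\<bar> \<le> H * \<bar>x - y\<bar> powr (1 + \<alpha>)"
    and "\<bar>u x\<bar> \<le> \<bar>u 0\<bar> + H * x powr (1 + \<alpha>)"
proof -
  assume y: "y > 0"
  have "\<exists>z. z > 0 \<and> \<bar>x - z\<bar> \<le> \<bar>x - y\<bar> \<and> u y - u x = (y - x) * u' z"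
  proof (rule linorder_cases[of x y])
    assume xy: "x < y"
    have "\<exists>z. z > x \<and> z < y \<and> u y - u x = (y - x) * u' z"
      using x by (intro MVT2[OF xy] d) linarith
    then obtain z where z: "z > x" "z < y" "u y - u x = (y - x) * u' z" by blast
    show ?thesis using z x by (intro exI[of _ z]) auto
  next
    assume xy: "y < x"
    have "\<exists>z. z > y \<and> z < x \<and> u x - u y = (x - y) * u' z"
      using y by (intro MVT2[OF xy] d) linarith
    then obtain z where z: "z > y" "z < x" "u x - u y = (x - y) * u' z" by blast
    show ?thesis using z y by (intro exI[of _ z]) (auto simp: algebra_simps)
  next
    assume "x = y"
    then show ?thesis using x by (intro exI[of _ x]) auto
  qed
  then obtain z where z: "z > 0" "\<bar>x - z\<bar> \<le> \<bar>x - y\<bar>" "u y - u x = (y - x) * u' z" by blast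
  have "\<bar>u y - u x - u' x * (y - x)\<bar> = \<bar>x - y\<bar> * \<bar>u' z - u' x\<bar>"
    unfolding z(3) abs_minus_commute[of x y] abs_mult[symmetric] by (simp add: algebra_simps)
  also have "\<dots> \<le> \<bar>x - y\<bar> * (H * \<bar>x - y\<bar> powr \<alpha>)"
  proof (intro mult_left_mono abs_ge_zero order_trans[OF H(2)[OF x z(1)]] H(1))
    show "\<bar>x - z\<bar> powr \<alpha> \<le> \<bar>x - y\<bar> powr \<alpha>" using \<alpha> z(2) by (intro powr_mono2) auto
  qed
  also have "\<dots> = H * \<bar>x - y\<bar> powr (1 + \<alpha>)" by (simp add: powr_add)
  finally show "\<bar>u y - u x - u' x * (y - x)\<bar> \<le> H * \<bar>x - y\<bar> powr (1 + \<alpha>)" .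
next
  have "\<exists>l z. 0 < z \<and> z < x \<and> DERIV u z :> l \<and> u x - u 0 = (x - 0) * l"
  proof (rule MVT[OF x])
    show "continuous_on {0..x} u" by (rule continuous_on_subset[OF cont]) auto
    show "u differentiable (at z)" if "0 < z" "z < x" for z
      unfolding real_differentiable_def using d[OF that(1)] by blast
  qed
  then obtain l z where z: "0 < z" "z < x" "DERIV u z :> l" "u x - u 0 = (x - 0) * l" by blast
  have l: "l = u' z" by (rule DERIV_unique[OF z(3) d[OF z(1)]])
  have "\<bar>u x - u 0\<bar> = x * \<bar>u' z\<bar>" using z(4) x unfolding l by (simp add: abs_mult)
  also have "\<dots> \<le> x * (H * x powr \<alpha>)"
  proof (intro mult_left_mono order_trans[OF H(3)[OF z(1)]] H(1))
    show "z powr \<alpha> \<le> x powr \<alpha>" using \<alpha> z by (intro powr_mono2) auto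
  qed (use x in simp)
  also have "\<dots> = H * x powr (1 + \<alpha>)" using x by (simp add: powr_add)
  finally show "\<bar>u x\<bar> \<le> \<bar>u 0\<bar> + H * x powr (1 + \<alpha>)" by linarith
qed

section \<open>Functions with a Hoelder derivative, and the two cases of the theorem\<close>

context bessel_heat begin

text \<open>The Taylor remainder is a moment of order 1 + \<alpha>. The linear term meets only the
  truncated first moment, of order sqrt t (t/x^2)^(\<alpha>/2), whose factor x^(-\<alpha>) is offset
  by |u'(x)| <= H x^\<alpha>. Both give t^((1+\<alpha>)/2), uniformly in x and \<epsilon>.\<close>

lemma C1_holder_small_time:
  assumes t: "t > 0" and x: "x > 0" and \<alpha>: "0 < \<alpha>" "\<alpha> \<le> 1" and cont: "continuous_on {0..} u"
    and d: "\<And>x. x > 0 \<Longrightarrow> (u has_real_derivative u' x) (at x)"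
    and H: "H \<ge> 0" "\<And>x y. x > 0 \<Longrightarrow> y > 0 \<Longrightarrow> \<bar>u' y - u' x\<bar> \<le> H * \<bar>x - y\<bar> powr \<alpha>"
      "\<And>x. x > 0 \<Longrightarrow> \<bar>u' x\<bar> \<le> H * x powr \<alpha>"
  shows "integrable halfline (\<lambda>y. if \<epsilon> < \<bar>x - y\<bar> then heat_kernel lam t x y * (u y - u x) else 0)" (is ?int)
    and "\<bar>\<integral>y. (if \<epsilon> < \<bar>x - y\<bar> then heat_kernel lam t x y * (u y - u x) else 0) \<partial>halfline\<bar>
      \<le> H * (2 * C * pi) * t powr ((1 + \<alpha>) / 2)" (is ?bound)
proof -
  have taylor: "\<bar>u y - u x - u' x * (y - x)\<bar> \<le> H * \<bar>x - y\<bar> powr (1 + \<alpha>)" if "y > 0" for y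
    by (rule C1_holder_bounds(1)[OF \<alpha>(1) cont d H x that])
  have [measurable]: "u \<in> borel_measurable halfline"
    by (rule continuous_on_imp_measurable_halfline[OF continuous_on_subset[OF cont]]) auto
  have [measurable]: "(\<lambda>y. y) \<in> borel_measurable halfline" by (rule borel_measurable_halflineI) measurable
  define r where "r y = (if \<epsilon> < \<bar>x - y\<bar> then u y - u x - u' x * (y - x) else 0)" for y
  define l where "l y = (if \<epsilon> < \<bar>x - y\<bar> then y - x else 0)" for y :: real
  have mr: "r \<in> borel_measurable halfline" unfolding r_def by measurable
  have ml: "l \<in> borel_measurable halfline" unfolding l_def by measurable
  have r: "\<bar>r y\<bar> \<le> H * \<bar>x - y\<bar> powr (1 + \<alpha>)" if "0 < y" for y
    using taylor[OF that] H(1) by (simp add: r_def)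
  have l: "\<bar>l y\<bar> \<le> 1 * \<bar>x - y\<bar> powr 1" for y by (simp add: l_def abs_minus_commute)
  have p: "0 \<le> 1 + \<alpha>" "1 + \<alpha> \<le> 4" "0 \<le> (1::real)" "(1::real) \<le> 4" using \<alpha> by auto
  note hr = heat_moment[OF t x p(1,2) H(1) mr r] and hl = heat_moment[OF t x p(3,4) p(3) ml l]
  have e: "(if \<epsilon> < \<bar>x - y\<bar> then heat_kernel lam t x y * (u y - u x) else 0)
    = heat_kernel lam t x y * r y + u' x * (heat_kernel lam t x y * l y)" for y
    by (simp add: r_def l_def algebra_simps)
  have il: "integrable halfline (\<lambda>y. u' x * (heat_kernel lam t x y * l y))" by (rule integrable_mult_right[OF hl(1)])
  show ?int unfolding e by (rule Bochner_Integration.integrable_add[OF hr(1) il])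
  have "(\<integral>y. heat_kernel lam t x y * l y \<partial>halfline) = (\<integral>y. (if \<epsilon> < \<bar>x - y\<bar> then heat_kernel lam t x y * (y - x) else 0) \<partial>halfline)"
    by (intro Bochner_Integration.integral_cong) (auto simp: l_def)
  then have b: "\<bar>\<integral>y. heat_kernel lam t x y * l y \<partial>halfline\<bar> \<le> C * pi * sqrt t * (t / x\<^sup>2) powr (\<alpha> / 2)"
    using heat_first_moment[OF t x, of "\<alpha> / 2" \<epsilon>] \<alpha> by simp
  have "\<bar>u' x * (\<integral>y. heat_kernel lam t x y * l y \<partial>halfline)\<bar> \<le> (H * x powr \<alpha>) * (C * pi * sqrt t * (t / x\<^sup>2) powr (\<alpha> / 2))"
    unfolding abs_mult using H(1) x by (intro mult_mono H(3) b) auto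
  also have "\<dots> = H * C * pi * (sqrt t * t powr (\<alpha> / 2)) * (x powr \<alpha> * x powr (- \<alpha>))"
    unfolding powr_scaling[OF t x] by simp
  also have "x powr \<alpha> * x powr (- \<alpha>) = 1" using x by (simp flip: powr_add)
  also have "sqrt t * t powr (\<alpha> / 2) = t powr ((1 + \<alpha>) / 2)"
    using t by (simp add: powr_half_sqrt[symmetric] powr_add[symmetric] add_divide_distrib)
  finally have c: "\<bar>u' x * (\<integral>y. heat_kernel lam t x y * l y \<partial>halfline)\<bar> \<le> H * C * pi * t powr ((1 + \<alpha>) / 2)" by simp
  have "(\<integral>y. (if \<epsilon> < \<bar>x - y\<bar> then heat_kernel lam t x y * (u y - u x) else 0) \<partial>halfline)
    = (\<integral>y. heat_kernel lam t x y * r y \<partial>halfline) + u' x * (\<integral>y. heat_kernel lam t x y * l y \<partial>halfline)"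
    unfolding e using Bochner_Integration.integral_add[OF hr(1) il] by simp
  also have "\<bar>\<dots>\<bar> \<le> C * H * t powr ((1 + \<alpha>) / 2) * pi + H * C * pi * t powr ((1 + \<alpha>) / 2)"
    using hr(2) c by linarith
  also have "\<dots> = H * (2 * C * pi) * t powr ((1 + \<alpha>) / 2)" by (simp add: algebra_simps)
  finally show ?bound .
qed

text \<open>The growth x^(1+\<alpha>) of u again offsets the mass defect, but the constant u(0) does
  not and leaves x^(-(1+\<alpha>)). Since 1 + \<alpha> <= 2 <= lam, this singularity stays within 1
  + x^(-lam).\<close>

lemma C1_holder_heat_op:
  assumes t: "t > 0" and x: "x > 0" and \<alpha>: "0 < \<alpha>" "\<alpha> \<le> 1" and lam2: "2 \<le> lam" and cont: "continuous_on {0..} u"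
    and d: "\<And>x. x > 0 \<Longrightarrow> (u has_real_derivative u' x) (at x)"
    and H: "H \<ge> 0" "\<And>x y. x > 0 \<Longrightarrow> y > 0 \<Longrightarrow> \<bar>u' y - u' x\<bar> \<le> H * \<bar>x - y\<bar> powr \<alpha>"
      "\<And>x. x > 0 \<Longrightarrow> \<bar>u' x\<bar> \<le> H * x powr \<alpha>"
  shows "\<bar>heat_op t u x - u x\<bar>
    \<le> (H * (2 * C * pi) + (C * pi + 1) * (\<bar>u 0\<bar> + H)) * (1 + x powr (- lam)) * t powr ((1 + \<alpha>) / 2)"
proof -
  let ?T = "t powr ((1 + \<alpha>) / 2)" and ?Y = "1 + x powr (- lam)" and ?I = "\<integral>y. heat_kernel lam t x y * (u y - u x) \<partial>halfline"
  \<comment> \<open>With \<epsilon> = -1 the truncation is void, so the uniform estimate yields the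
    full integral.\<close>
  note st = C1_holder_small_time[OF t x \<alpha> cont d H, of "- 1"]
  have s: "- 1 < \<bar>x - y\<bar>" for y by linarith
  have i: "integrable halfline (\<lambda>y. heat_kernel lam t x y * (u y - u x))"
    and a: "\<bar>?I\<bar> \<le> H * (2 * C * pi) * ?T"
    using st s by (simp_all del: abs_mult)
  have Y: "x powr (- (1 + \<alpha>)) \<le> ?Y"
  proof (cases "x \<le> 1")
    case True
    have "x powr (- (1 + \<alpha>)) \<le> x powr (- lam)" using True x \<alpha> lam2 by (intro powr_mono') auto
    then show ?thesis by simp
  next
    case False
    have "x powr (- (1 + \<alpha>)) \<le> x powr 0" using False \<alpha> by (intro powr_mono) auto
    then show ?thesis using x by (simp add: add_increasing2)
  qed
  have "\<bar>u x\<bar> * \<bar>heat_one lam t x - 1\<bar>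
    \<le> (\<bar>u 0\<bar> + H * x powr (1 + \<alpha>)) * ((C * pi + 1) * (t / x\<^sup>2) powr ((1 + \<alpha>) / 2))"
    using H(1) x \<alpha> C1_holder_bounds(2)[OF \<alpha>(1) cont d H x]
    by (intro mult_mono heat_one_bound t x) (auto simp: add_nonneg_nonneg)
  also have "\<dots> = (C * pi + 1) * ?T * (\<bar>u 0\<bar> * x powr (- (1 + \<alpha>)) + H * (x powr (1 + \<alpha>) * x powr (- (1 + \<alpha>))))"
  proof -
    have "2 * ((1 + \<alpha>) / 2) = 1 + \<alpha>" by simp
    then show ?thesis unfolding powr_scaling[OF t x] by (simp only: distrib_left distrib_right mult_ac)
  qed
  also have "x powr (1 + \<alpha>) * x powr (- (1 + \<alpha>)) = 1"
    unfolding powr_add[symmetric] using x by simp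
  also have "(C * pi + 1) * ?T * (\<bar>u 0\<bar> * x powr (- (1 + \<alpha>)) + H * 1) \<le> (C * pi + 1) * ?T * (\<bar>u 0\<bar> * ?Y + H * ?Y)"
    using C H(1) Y by (intro mult_left_mono add_mono) (auto simp: add_nonneg_nonneg)
  finally have b: "\<bar>u x * (heat_one lam t x - 1)\<bar> \<le> (C * pi + 1) * ?T * (\<bar>u 0\<bar> * ?Y + H * ?Y)" by (simp add: abs_mult)
  have "H * (2 * C * pi) * ?T * 1 \<le> H * (2 * C * pi) * ?T * ?Y"
    using H(1) C by (intro mult_left_mono) auto
  then have "\<bar>?I\<bar> \<le> H * (2 * C * pi) * ?T * ?Y" using a by linarith
  then have "\<bar>heat_op t u x - u x\<bar> \<le> H * (2 * C * pi) * ?T * ?Y + (C * pi + 1) * ?T * (\<bar>u 0\<bar> * ?Y + H * ?Y)"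
    unfolding heat_op_diff(2)[OF t x heat_op_integrable_of_diff[OF t x i]] using b by linarith
  also have "\<dots> = (H * (2 * C * pi) + (C * pi + 1) * (\<bar>u 0\<bar> + H)) * ?Y * ?T" by (simp add: algebra_simps)
  finally show ?thesis .
qed

lemma frac_bessel_holder:
  assumes lam1: "1 \<le> lam" and \<sigma>: "0 < \<sigma>" "\<sigma> < 1" and u: "u \<in> L_space \<sigma>"
    and \<alpha>: "2 * \<sigma> < \<alpha>" "\<alpha> \<le> 1" and uh: "u \<in> holder_plus \<alpha>"
  shows "\<exists>g. continuous_on {0<..} g \<and> frac_bessel_is_function lam \<sigma> u g \<and>
    (\<forall>x>0. set_integrable lebesgue {0<..} (\<lambda>y. (u x - u y) * K_kernel lam \<sigma> x y)
       \<and> g x = (LINT y:{0<..}|lebesgue. (u x - u y) * K_kernel lam \<sigma> x y) + u x * B_fun lam \<sigma> x)"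
proof -
  obtain H where H: "H \<ge> 0" "\<And>x y. x > 0 \<Longrightarrow> y > 0 \<Longrightarrow> \<bar>u y - u x\<bar> \<le> H * \<bar>x - y\<bar> powr \<alpha>"
    "\<And>x. x > 0 \<Longrightarrow> \<bar>u x\<bar> \<le> H * x powr \<alpha>"
    using holder_plusE[OF uh] by metis
  have uc: "continuous_on {0<..} u" by (rule holder_plus_continuous[OF uh])
  have um [measurable]: "u \<in> borel_measurable halfline" by (rule continuous_on_imp_measurable_halfline[OF uc])
  have \<alpha>0: "\<alpha> > 0" using \<alpha> \<sigma> by linarith
  note small = holder_small_time[OF _ _ \<alpha>0 \<alpha>(2) um H]
  have Cu: "0 \<le> H * (2 * C * pi + 1)" using H(1) C by (intro mult_nonneg_nonneg) (auto simp: add_nonneg_nonneg)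
  interpret bessel_transposition lam C \<sigma> u "\<alpha> / 2" "H * (2 * C * pi + 1)"
  proof
    show "integrable halfline (\<lambda>x. \<bar>u x\<bar> * wt \<sigma> x)" by (rule L_space_integrable_wt[OF \<sigma> u um])
    fix t x :: real assume t: "0 < t" "t \<le> 1" and x: "0 < x"
    have "H * (2 * C * pi + 1) * 1 \<le> H * (2 * C * pi + 1) * (1 + x powr (- lam))"
      using Cu by (intro mult_left_mono) auto
    then have "H * (2 * C * pi + 1) * t powr (\<alpha> / 2) \<le> H * (2 * C * pi + 1) * (1 + x powr (- lam)) * t powr (\<alpha> / 2)"
      by (intro mult_right_mono) auto
    then show "\<bar>heat_op t u x - u x\<bar> \<le> H * (2 * C * pi + 1) * (1 + x powr (- lam)) * t powr (\<alpha> / 2)"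
      using small(2)[OF t(1) x] by linarith
  qed (use lam1 \<sigma> uc \<alpha> Cu in simp_all)
  have K: "(\<lambda>y. (u x - u y) * K_kernel lam \<sigma> x y) \<in> borel_measurable halfline" for x
    by measurable
  show ?thesis
  proof (intro exI[of _ g] conjI g_continuous frac_bessel_is_function_g allI impI)
    fix x :: real assume x: "x > 0"
    note f = g_formula_holder[OF x small(1)[OF _ x]]
    show "set_integrable lebesgue {0<..} (\<lambda>y. (u x - u y) * K_kernel lam \<sigma> x y)"
      unfolding set_integrable_halfline[OF K] by (rule f(1))
    show "g x = (LINT y:{0<..}|lebesgue. (u x - u y) * K_kernel lam \<sigma> x y) + u x * B_fun lam \<sigma> x"
      unfolding set_lebesgue_integral_halfline[OF K] by (rule f(2))
  qed
qed

lemma frac_bessel_C1_holder: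
  assumes lam2: "2 \<le> lam" and \<sigma>: "1/2 \<le> \<sigma>" "\<sigma> < 1" and u: "u \<in> L_space \<sigma>"
    and \<alpha>: "2 * \<sigma> - 1 < \<alpha>" "\<alpha> \<le> 1" and cont: "continuous_on {0..} u"
    and d: "\<And>x. x > 0 \<Longrightarrow> (u has_real_derivative u' x) (at x)" and uh: "u' \<in> holder_plus \<alpha>"
  shows "\<exists>g. continuous_on {0<..} g \<and> frac_bessel_is_function lam \<sigma> u g \<and>
    (\<forall>x>0. (\<forall>\<epsilon>>0. set_integrable lebesgue {y. 0 < y \<and> \<epsilon> < \<bar>x - y\<bar>} (\<lambda>y. (u x - u y) * K_kernel lam \<sigma> x y))
       \<and> (\<exists>l. ((\<lambda>\<epsilon>. LINT y:{y. 0 < y \<and> \<epsilon> < \<bar>x - y\<bar>}|lebesgue. (u x - u y) * K_kernel lam \<sigma> x y) \<longlongrightarrow> l) (at_right 0)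
          \<and> g x = l + u x * B_fun lam \<sigma> x))"
proof -
  obtain H where H: "H \<ge> 0" "\<And>x y. x > 0 \<Longrightarrow> y > 0 \<Longrightarrow> \<bar>u' y - u' x\<bar> \<le> H * \<bar>x - y\<bar> powr \<alpha>"
    "\<And>x. x > 0 \<Longrightarrow> \<bar>u' x\<bar> \<le> H * x powr \<alpha>"
    using holder_plusE[OF uh] by metis
  have uc: "continuous_on {0<..} u" by (rule continuous_on_subset[OF cont]) auto
  have um [measurable]: "u \<in> borel_measurable halfline" by (rule continuous_on_imp_measurable_halfline[OF uc])
  have \<alpha>0: "\<alpha> > 0" and \<sigma>0: "\<sigma> > 0" using \<alpha> \<sigma> by simp_all
  let ?Cu = "H * (2 * C * pi) + (C * pi + 1) * (\<bar>u 0\<bar> + H)"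
  have Cu: "0 \<le> ?Cu" using H(1) C by (intro add_nonneg_nonneg mult_nonneg_nonneg) (auto simp: add_nonneg_nonneg)
  interpret bessel_transposition lam C \<sigma> u "(1 + \<alpha>) / 2" ?Cu
  proof
    show "integrable halfline (\<lambda>x. \<bar>u x\<bar> * wt \<sigma> x)" by (rule L_space_integrable_wt[OF \<sigma>0 \<sigma>(2) u um])
    fix t x :: real assume t: "0 < t" "t \<le> 1" and x: "0 < x"
    show "\<bar>heat_op t u x - u x\<bar> \<le> ?Cu * (1 + x powr (- lam)) * t powr ((1 + \<alpha>) / 2)"
      by (rule C1_holder_heat_op[OF t(1) x \<alpha>0 \<alpha>(2) lam2 cont d H])
  qed (use lam2 \<sigma> \<sigma>0 uc \<alpha> Cu in simp_all)
  have K: "(\<lambda>y. if \<epsilon> < \<bar>x - y\<bar> then (u x - u y) * K_kernel lam \<sigma> x y else 0) \<in> borel_measurable halfline" for x \<epsilon>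
    by measurable
  have ind: "indicator {y. 0 < y \<and> \<epsilon> < \<bar>x - y\<bar>} y *\<^sub>R ((u x - u y) * K_kernel lam \<sigma> x y)
    = indicator {0<..} y *\<^sub>R (if \<epsilon> < \<bar>x - y\<bar> then (u x - u y) * K_kernel lam \<sigma> x y else 0)" for x y \<epsilon>
    by (simp add: indicator_def)
  show ?thesis
  proof (intro exI[of _ g] conjI g_continuous frac_bessel_is_function_g allI impI)
    fix x :: real assume x: "x > 0"
    show "set_integrable lebesgue {y. 0 < y \<and> \<epsilon> < \<bar>x - y\<bar>} (\<lambda>y. (u x - u y) * K_kernel lam \<sigma> x y)"
      if "\<epsilon> > 0" for \<epsilon>
      unfolding set_integrable_def ind
      unfolding set_integrable_def[symmetric] set_integrable_halfline[OF K] by (rule truncated_Fubini(1)[OF x that])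
    have "((\<lambda>\<epsilon>. LINT y:{y. 0 < y \<and> \<epsilon> < \<bar>x - y\<bar>}|lebesgue. (u x - u y) * K_kernel lam \<sigma> x y)
        \<longlongrightarrow> g x - u x * B_fun lam \<sigma> x) (at_right 0)"
      unfolding set_lebesgue_integral_def ind
      unfolding set_lebesgue_integral_def[symmetric] set_lebesgue_integral_halfline[OF K]
      by (rule g_formula_pv[OF x C1_holder_small_time(2)[OF _ x \<alpha>0 \<alpha>(2) cont d H]])
    then show "\<exists>l. ((\<lambda>\<epsilon>. LINT y:{y. 0 < y \<and> \<epsilon> < \<bar>x - y\<bar>}|lebesgue. (u x - u y) * K_kernel lam \<sigma> x y) \<longlongrightarrow> l) (at_right 0)
          \<and> g x = l + u x * B_fun lam \<sigma> x"
      by (intro exI[of _ "g x - u x * B_fun lam \<sigma> x"] conjI) simp_all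
  qed
qed

end

theorem theorem2p2:
  fixes lam \<sigma> :: real and u :: "real \<Rightarrow> real"
  assumes "0 < lam" and "0 < \<sigma>" and "\<sigma> < 1" and "u \<in> L_space \<sigma>"
  shows "(\<forall>x>0. \<forall>y>0. x \<noteq> y \<longrightarrow> set_integrable lebesgue {0<..} (K_integrand lam \<sigma> x y))
    \<and> (\<forall>x>0. set_integrable lebesgue {0<..} (B_integrand lam \<sigma> x))
    \<and> (\<exists>C. (\<forall>x>0. \<forall>y>0. x \<noteq> y \<longrightarrow>
              0 \<le> K_kernel lam \<sigma> x y \<and> K_kernel lam \<sigma> x y \<le> C / \<bar>x - y\<bar> powr (1 + 2 * \<sigma>))
           \<and> (\<forall>x>0. \<bar>B_fun lam \<sigma> x\<bar> \<le> C / x powr (2 * \<sigma>)))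
    \<and> (\<sigma> < 1/2 \<and> 1 \<le> lam \<longrightarrow>
        (\<forall>\<alpha>. 2 * \<sigma> < \<alpha> \<and> \<alpha> \<le> 1 \<and> u \<in> holder_plus \<alpha> \<longrightarrow>
          (\<exists>g. continuous_on {0<..} g \<and> frac_bessel_is_function lam \<sigma> u g \<and>
            (\<forall>x>0. set_integrable lebesgue {0<..} (\<lambda>y. (u x - u y) * K_kernel lam \<sigma> x y)
               \<and> g x = (LINT y:{0<..}|lebesgue. (u x - u y) * K_kernel lam \<sigma> x y)
                       + u x * B_fun lam \<sigma> x))))
    \<and> (1/2 \<le> \<sigma> \<and> 2 \<le> lam \<longrightarrow>
        (\<forall>\<alpha> u'. 2 * \<sigma> - 1 < \<alpha> \<and> \<alpha> \<le> 1 \<and> continuous_on {0..} u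
            \<and> (\<forall>x>0. (u has_real_derivative u' x) (at x)) \<and> u' \<in> holder_plus \<alpha> \<longrightarrow>
          (\<exists>g. continuous_on {0<..} g \<and> frac_bessel_is_function lam \<sigma> u g \<and>
            (\<forall>x>0. (\<forall>\<epsilon>>0. set_integrable lebesgue {y. 0 < y \<and> \<epsilon> < \<bar>x - y\<bar>}
                               (\<lambda>y. (u x - u y) * K_kernel lam \<sigma> x y))
               \<and> (\<exists>l. ((\<lambda>\<epsilon>. LINT y:{y. 0 < y \<and> \<epsilon> < \<bar>x - y\<bar>}|lebesgue.
                                 (u x - u y) * K_kernel lam \<sigma> x y) \<longlongrightarrow> l) (at_right 0)
                    \<and> g x = l + u x * B_fun lam \<sigma> x)))))"
proof -
  obtain C where "bessel_heat lam C" using bessel_heat_exists[OF assms(1)] by blast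
  then interpret bessel_heat lam C .
  note K = kernel_estimates[OF assms(2,3)]
  show ?thesis
  proof (intro conjI)
    show "\<forall>x>0. \<forall>y>0. x \<noteq> y \<longrightarrow> set_integrable lebesgue {0<..} (K_integrand lam \<sigma> x y)"
      by (rule conjunct1[OF K])
    show "\<forall>x>0. set_integrable lebesgue {0<..} (B_integrand lam \<sigma> x)"
      by (rule conjunct1[OF conjunct2[OF K]])
    show "\<exists>C. (\<forall>x>0. \<forall>y>0. x \<noteq> y \<longrightarrow>
              0 \<le> K_kernel lam \<sigma> x y \<and> K_kernel lam \<sigma> x y \<le> C / \<bar>x - y\<bar> powr (1 + 2 * \<sigma>))
           \<and> (\<forall>x>0. \<bar>B_fun lam \<sigma> x\<bar> \<le> C / x powr (2 * \<sigma>))"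
      by (rule conjunct2[OF conjunct2[OF K]])
  next
    show "\<sigma> < 1/2 \<and> 1 \<le> lam \<longrightarrow>
        (\<forall>\<alpha>. 2 * \<sigma> < \<alpha> \<and> \<alpha> \<le> 1 \<and> u \<in> holder_plus \<alpha> \<longrightarrow>
          (\<exists>g. continuous_on {0<..} g \<and> frac_bessel_is_function lam \<sigma> u g \<and>
            (\<forall>x>0. set_integrable lebesgue {0<..} (\<lambda>y. (u x - u y) * K_kernel lam \<sigma> x y)
               \<and> g x = (LINT y:{0<..}|lebesgue. (u x - u y) * K_kernel lam \<sigma> x y)
                       + u x * B_fun lam \<sigma> x)))"
      by (intro impI allI, elim conjE) (rule frac_bessel_holder[OF _ assms(2-4)])
  next
    show "1/2 \<le> \<sigma> \<and> 2 \<le> lam \<longrightarrow>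
        (\<forall>\<alpha> u'. 2 * \<sigma> - 1 < \<alpha> \<and> \<alpha> \<le> 1 \<and> continuous_on {0..} u
            \<and> (\<forall>x>0. (u has_real_derivative u' x) (at x)) \<and> u' \<in> holder_plus \<alpha> \<longrightarrow>
          (\<exists>g. continuous_on {0<..} g \<and> frac_bessel_is_function lam \<sigma> u g \<and>
            (\<forall>x>0. (\<forall>\<epsilon>>0. set_integrable lebesgue {y. 0 < y \<and> \<epsilon> < \<bar>x - y\<bar>}
                               (\<lambda>y. (u x - u y) * K_kernel lam \<sigma> x y))
               \<and> (\<exists>l. ((\<lambda>\<epsilon>. LINT y:{y. 0 < y \<and> \<epsilon> < \<bar>x - y\<bar>}|lebesgue.
                                 (u x - u y) * K_kernel lam \<sigma> x y) \<longlongrightarrow> l) (at_right 0)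
                    \<and> g x = l + u x * B_fun lam \<sigma> x))))"
    proof (intro impI allI, elim conjE)
      fix \<alpha> u' assume "1/2 \<le> \<sigma>" "2 \<le> lam" "2 * \<sigma> - 1 < \<alpha>" "\<alpha> \<le> 1" "continuous_on {0..} u"
        and d: "\<forall>x>0. (u has_real_derivative u' x) (at x)" and "u' \<in> holder_plus \<alpha>"
      then show "\<exists>g. continuous_on {0<..} g \<and> frac_bessel_is_function lam \<sigma> u g \<and>
            (\<forall>x>0. (\<forall>\<epsilon>>0. set_integrable lebesgue {y. 0 < y \<and> \<epsilon> < \<bar>x - y\<bar>}
                               (\<lambda>y. (u x - u y) * K_kernel lam \<sigma> x y))
               \<and> (\<exists>l. ((\<lambda>\<epsilon>. LINT y:{y. 0 < y \<and> \<epsilon> < \<bar>x - y\<bar>}|lebesgue.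
                                 (u x - u y) * K_kernel lam \<sigma> x y) \<longlongrightarrow> l) (at_right 0)
                    \<and> g x = l + u x * B_fun lam \<sigma> x))"
        by (intro frac_bessel_C1_holder[where u' = u' and \<alpha> = \<alpha>] assms(3,4)) auto
    qed
  qed
qed

end
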